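(* Let $X$ be a Banach space and $p\in(1,\infty)$. Let $(T_1,\ldots,T_d)$ be a $d$-tuple of commuting operators acting on $X$ such that every $T_k$ is an $R$-Ritt operator, $k=1,\ldots,d$. Suppose that there exist a measure space $\Sigma$, a $d$-tuple of commuting isomorphisms $(U_1,\ldots,U_d)$ acting on the Bochner space $L_p(\Sigma;X)$ having a $C(\mathbb{T}^d)$ bounded calculus, and two bounded operators $J:X\to L_p(\Sigma;X)$, $Q:L_p(\Sigma;X)\to X$ such that $$T_1^{n_1}\cdots T_d^{n_d}=Q\,U_1^{n_1}\cdots U_d^{n_d}\,J,\qquad (n_1,\ldots,n_d)\in\mathbb{N}^d.$$ Then there exist $\gamma_1,\ldots,\gamma_d$ in $(0,\frac{\pi}{2})$ such that $(T_1,\ldots,T_d)$ admits an $H^\infty(B_{\gamma_1}\times\cdots\times B_{\gamma_d})$ joint functional calculus.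
   Context: Banach spaces are complex, $d\ge 1$ is an integer, $B(X)$ is the algebra of bounded operators on $X$, $R(\lambda,T)=(\lambda I_X-T)^{-1}$, $\mathbb{T}$ is the unit circle, $\mathbb{N}=\{0,1,2,\ldots\}$. Ritt operators. $T\in B(X)$ is a Ritt operator if there is $C>0$ with $\|T^n\|\le C$ and $\|n(T^n-T^{n-1})\|\le C$ for all $n\ge 1$. For $a\in(0,\frac{\pi}{2})$, the Stolz domain $B_a$ is the interior of the convex hull of $1$ and the disc $D(0,\sin a)$. A Ritt operator $T$ is of type $a\in(0,\frac\pi2)$ if $\sigma(T)\subset\overline{B_a}$ and for every $b\in(a,\frac{\pi}{2})$ there is $K_b>0$ with $\|(\lambda-1)R(\lambda,T)\|\le K_b$ for all $\lambda\in\mathbb{C}\setminus\overline{B_b}$. Every Ritt operator is of type $a$ for some $a\in(0,\frac\pi2)$. $R$-Ritt operators. Let $(r_k)_{k\ge1}$ be independent Rademacher variables on a probability space $\Omega_0$. A set $E\subset B(X)$ is $R$-bounded if there is $C\ge0$ such that $\|\sum_{k=1}^n r_k\otimes S_kx_k\|_{L_2(\Omega_0;X)}\le C\|\sum_{k=1}^n r_k\otimes x_k\|_{L_2(\Omega_0;X)}$ for all $n\ge1$, $S_1,\ldots,S_n\in E$, $x_1,\ldots,x_n\in X$. A Ritt operator $T$ is $R$-Ritt if the sets $\{T^n:n\in\mathbb{N}\}$ and $\{n(T^n-T^{n-1}):n\ge1\}$ are $R$-bounded. Joint functional calculus. Let $\gamma_1,\ldots,\gamma_d\in(0,\frac{\pi}{2})$.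 For $\Lambda\subset\{1,\ldots,d\}$, $H_0^\infty(\prod_{i\in\Lambda}B_{\gamma_i})$ is the algebra of bounded holomorphic functions $f$ on $B_{\gamma_1}\times\cdots\times B_{\gamma_d}$ depending only on the variables $(\lambda_i)_{i\in\Lambda}$ and for which there are positive constants $c,(s_i)_{i\in\Lambda}$ with $|f(\lambda_1,\ldots,\lambda_d)|\le c\prod_{i\in\Lambda}|1-\lambda_i|^{s_i}$ (constant functions if $\Lambda=\emptyset$). Let $(T_1,\ldots,T_d)$ be commuting Ritt operators, $T_k$ of type $a_k\in(0,\gamma_k)$, and let $b_k\in(a_k,\gamma_k)$. For $\Lambda\neq\emptyset$ and $f\in H_0^\infty(\prod_{i\in\Lambda}B_{\gamma_i})$, set $$f(T_1,\ldots,T_d)=\Big(\frac{1}{2\pi i}\Big)^{|\Lambda|}\int_{\prod_{i\in\Lambda}\partial B_{b_i}}f(\lambda_1,\ldots,\lambda_d)\prod_{i\in\Lambda}R(\lambda_i,T_i)\prod_{i\in\Lambda}d\lambda_i$$ (counterclockwise orientation; absolutely convergent and independent of the $b_i$), and $f(T_1,\ldots,T_d)=cI_X$ if $f\equiv c$. Extend linearly to the direct sum $H_{0,1}^\infty(B_{\gamma_1}\times\cdots\times B_{\gamma_d})=\bigoplus_{\Lambda\subset\{1,\ldots,d\}}H_0^\infty(\prod_{i\in\Lambda}B_{\gamma_i})$. The tuple $(T_1,\ldots,T_d)$ (with $T_k$ of some type $a_k<\gamma_k$) admits an $H^\infty(B_{\gamma_1}\times\cdots\times B_{\gamma_d})$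 joint functional calculus if there is $K>0$ with $\|f(T_1,\ldots,T_d)\|\le K\sup_{B_{\gamma_1}\times\cdots\times B_{\gamma_d}}|f|$ for all $f\in H_{0,1}^\infty(B_{\gamma_1}\times\cdots\times B_{\gamma_d})$. $C(\mathbb{T}^d)$ bounded calculus. An isomorphism on a Banach space $Y$ is a bounded invertible operator $Y\to Y$. Commuting isomorphisms $(U_1,\ldots,U_d)$ on $Y$ have a $C(\mathbb{T}^d)$ bounded calculus if there is $C\ge1$ such that for every finite family of complex numbers $(a_{n_1,\ldots,n_d})_{(n_1,\ldots,n_d)\in\mathbb{Z}^d}$, $$\Big\|\sum a_{n_1,\ldots,n_d}U_1^{n_1}\cdots U_d^{n_d}\Big\|\le C\sup_{(s_1,\ldots,s_d)\in\mathbb{R}^d}\Big|\sum a_{n_1,\ldots,n_d}e^{i(n_1s_1+\cdots+n_ds_d)}\Big|.$$ *)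

theory Defs
  imports "HOL-Complex_Analysis.Complex_Analysis" "HOL-Probability.Probability"
begin

section \<open>Complex Banach spaces and bounded operators\<close>

class complex_normed_vector = real_normed_vector +
  fixes scaleC :: "complex \<Rightarrow> 'a \<Rightarrow> 'a" (infixr \<open>*\<^sub>C\<close> 75)
  assumes scaleC_add_right: "c *\<^sub>C (x + y) = c *\<^sub>C x + c *\<^sub>C y"
    and scaleC_add_left: "(c + d) *\<^sub>C x = c *\<^sub>C x + d *\<^sub>C x"
    and scaleC_scaleC: "c *\<^sub>C (d *\<^sub>C x) = (c * d) *\<^sub>C x"
    and scaleC_of_real: "complex_of_real r *\<^sub>C x = r *\<^sub>R x"
    and norm_scaleC: "norm (c *\<^sub>C x) = cmod c * norm x"

class complex_banach = complex_normed_vector + banach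

instantiation complex :: complex_banach
begin
definition scaleC_complex :: "complex \<Rightarrow> complex \<Rightarrow> complex"
  where "scaleC_complex c x = c * x"
instance
  by standard (simp_all add: scaleC_complex_def algebra_simps norm_mult scaleR_conv_of_real)
end

lemma bounded_linear_scaleC: "bounded_linear ((*\<^sub>C) c :: 'a \<Rightarrow> 'a::complex_normed_vector)"
proof (rule bounded_linear_intro[where K = "cmod c"])
  fix x y :: 'a and r :: real
  show "c *\<^sub>C (x + y) = c *\<^sub>C x + c *\<^sub>C y" by (rule scaleC_add_right)
  show "c *\<^sub>C (r *\<^sub>R x) = r *\<^sub>R (c *\<^sub>C x)"
    by (simp flip: scaleC_of_real add: scaleC_scaleC mult.commute)
  show "norm (c *\<^sub>C x) \<le> norm x * cmod c" by (simp add: norm_scaleC)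
qed

instantiation blinfun :: (real_normed_vector, complex_normed_vector) complex_normed_vector
begin
lift_definition scaleC_blinfun :: "complex \<Rightarrow> 'a \<Rightarrow>\<^sub>L 'b \<Rightarrow> 'a \<Rightarrow>\<^sub>L 'b" is "\<lambda>c f x. c *\<^sub>C f x"
  by (rule bounded_linear_compose[OF bounded_linear_scaleC])
instance
proof
  fix c d :: complex and x y :: "'a \<Rightarrow>\<^sub>L 'b" and r :: real
  show "c *\<^sub>C (x + y) = c *\<^sub>C x + c *\<^sub>C y"
    by transfer (simp add: scaleC_add_right)
  show "(c + d) *\<^sub>C x = c *\<^sub>C x + d *\<^sub>C x"
    by transfer (simp add: scaleC_add_left)
  show "c *\<^sub>C (d *\<^sub>C x) = (c * d) *\<^sub>C x"
    by transfer (simp add: scaleC_scaleC)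
  show "complex_of_real r *\<^sub>C x = r *\<^sub>R x"
    by transfer (simp add: scaleC_of_real)
  have le: "norm (c *\<^sub>C x) \<le> cmod c * norm x" for c and x :: "'a \<Rightarrow>\<^sub>L 'b"
  proof (rule norm_blinfun_bound)
    fix v
    have "cmod c * norm (blinfun_apply x v) \<le> cmod c * (norm x * norm v)"
      by (intro mult_left_mono norm_blinfun) simp
    then show "norm (blinfun_apply (c *\<^sub>C x) v) \<le> cmod c * norm x * norm v"
      by (simp add: scaleC_blinfun.rep_eq norm_scaleC mult.assoc)
  qed simp
  show "norm (c *\<^sub>C x) = cmod c * norm x"
  proof (cases "c = 0")
    case True
    with le[of c x] show ?thesis by simp
  next
    case False
    have "inverse c *\<^sub>C c *\<^sub>C x = x"
    proof (rule blinfun_eqI)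
      fix v
      have "1 *\<^sub>C blinfun_apply x v = blinfun_apply x v"
        using scaleC_of_real[of 1 "blinfun_apply x v"] by simp
      with False show "blinfun_apply (inverse c *\<^sub>C c *\<^sub>C x) v = blinfun_apply x v"
        by (simp add: scaleC_blinfun.rep_eq scaleC_scaleC)
    qed
    with le[of "inverse c" "c *\<^sub>C x"] have "norm x \<le> norm (c *\<^sub>C x) / cmod c"
      by (simp add: norm_inverse divide_inverse mult.commute)
    with False le[of c x] show ?thesis by (simp add: field_simps)
  qed
qed
end

instance blinfun :: (real_normed_vector, complex_banach) complex_banach ..

text \<open>The library type \<open>'x \<Rightarrow>\<^sub>L 'x\<close> consists of all real linear bounded maps; the algebra
  \<open>B(X)\<close> is the subset of the complex linear ones (with the same norm).\<close>

definition bounded_operators :: "('x::complex_normed_vector \<Rightarrow>\<^sub>L 'x) set"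
  where "bounded_operators = {T. \<forall>c x. blinfun_apply T (c *\<^sub>C x) = c *\<^sub>C blinfun_apply T x}"

definition op_power :: "('x::complex_normed_vector \<Rightarrow>\<^sub>L 'x) \<Rightarrow> nat \<Rightarrow> 'x \<Rightarrow>\<^sub>L 'x"
  where "op_power T n = ((o\<^sub>L) T ^^ n) id_blinfun"

text \<open>Product \<open>A\<^sub>i\<^sub>1 \<cdots> A\<^sub>i\<^sub>m\<close> over \<open>\<Lambda> = {i\<^sub>1 < \<cdots> < i\<^sub>m}\<close>, in increasing order of the
  indices; it is only used for commuting families.\<close>

definition op_prod :: "'d::linorder set \<Rightarrow> ('d::linorder \<Rightarrow> ('x::complex_normed_vector \<Rightarrow>\<^sub>L 'x)) \<Rightarrow> 'x \<Rightarrow>\<^sub>L 'x"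
  where "op_prod \<Lambda> A = foldr (\<lambda>i S. A i o\<^sub>L S) (sorted_list_of_set \<Lambda>) id_blinfun"

definition is_op_inverse :: "('x::complex_normed_vector \<Rightarrow>\<^sub>L 'x) \<Rightarrow> ('x \<Rightarrow>\<^sub>L 'x) \<Rightarrow> bool"
  where "is_op_inverse A S \<longleftrightarrow>
    S \<in> bounded_operators \<and> A o\<^sub>L S = id_blinfun \<and> S o\<^sub>L A = id_blinfun"

definition op_spectrum :: "('x::complex_normed_vector \<Rightarrow>\<^sub>L 'x) \<Rightarrow> complex set"
  where "op_spectrum T = {\<zeta>. \<nexists>S. is_op_inverse (\<zeta> *\<^sub>C id_blinfun - T) S}"

definition resolvent :: "complex \<Rightarrow> ('x::complex_normed_vector \<Rightarrow>\<^sub>L 'x) \<Rightarrow> 'x \<Rightarrow>\<^sub>L 'x"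
  where "resolvent \<zeta> T = (THE S. is_op_inverse (\<zeta> *\<^sub>C id_blinfun - T) S)"


section \<open>Ritt operators\<close>

definition ritt_operator :: "('x::complex_banach \<Rightarrow>\<^sub>L 'x) \<Rightarrow> bool"
  where "ritt_operator T \<longleftrightarrow> T \<in> bounded_operators \<and>
    (\<exists>C>0. \<forall>n\<ge>1. norm (op_power T n) \<le> C \<and>
                  norm (real n *\<^sub>R (op_power T n - op_power T (n - 1))) \<le> C)"

definition stolz_domain :: "real \<Rightarrow> complex set"
  where "stolz_domain a = interior (convex hull (insert 1 (ball 0 (sin a))))"

definition ritt_operator_of_type :: "real \<Rightarrow> ('x::complex_banach \<Rightarrow>\<^sub>L 'x) \<Rightarrow> bool"
  where "ritt_operator_of_type a T \<longleftrightarrow> 0 < a \<and> a < pi / 2 \<and> ritt_operator T \<and>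
    op_spectrum T \<subseteq> closure (stolz_domain a) \<and>
    (\<forall>b. a < b \<and> b < pi / 2 \<longrightarrow>
      (\<exists>K>0. \<forall>\<zeta>. \<zeta> \<notin> closure (stolz_domain b) \<longrightarrow>
        norm ((\<zeta> - 1) *\<^sub>C resolvent \<zeta> T) \<le> K))"


section \<open>Bochner spaces\<close>

text \<open>The library's Bochner theory needs second countable ranges. Here the range may be a
  nonseparable space, so measurability means strong measurability.\<close>

definition strongly_measurable :: "'s measure \<Rightarrow> ('s \<Rightarrow> 'x::complex_banach) \<Rightarrow> bool"
  where "strongly_measurable M f \<longleftrightarrow>
    (\<exists>s. (\<forall>i::nat. simple_function M (s i)) \<and> (\<forall>\<omega>\<in>space M. (\<lambda>i. s i \<omega>) \<longlonglongrightarrow> f \<omega>))"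

definition Lp_fun :: "'s measure \<Rightarrow> real \<Rightarrow> ('s \<Rightarrow> 'x::complex_banach) set"
  where "Lp_fun M p = {f. strongly_measurable M f \<and> integrable M (\<lambda>\<omega>. norm (f \<omega>) powr p)}"

definition Lp_seminorm :: "'s measure \<Rightarrow> real \<Rightarrow> ('s \<Rightarrow> 'x::complex_banach) \<Rightarrow> real"
  where "Lp_seminorm M p f = (\<integral>\<omega>. norm (f \<omega>) powr p \<partial>M) powr (1 / p)"

definition Lp_rel :: "'s measure \<Rightarrow> real \<Rightarrow> (('s \<Rightarrow> 'x::complex_banach) \<times> ('s \<Rightarrow> 'x)) set"
  where "Lp_rel M p = {(f, g). f \<in> Lp_fun M p \<and> g \<in> Lp_fun M p \<and> (AE \<omega> in M. f \<omega> = g \<omega>)}"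

text \<open>The space \<open>L\<^sub>p(\<Sigma>;X)\<close> depends on the measure, so it is not a type. Normed spaces with an
  explicit carrier are records; spaces that are types are viewed as such records
  through \<open>type_space\<close>.\<close>

record 'v normed_space =
  ns_carrier :: "'v set"
  ns_zero :: 'v
  ns_add :: "'v \<Rightarrow> 'v \<Rightarrow> 'v"
  ns_scale :: "complex \<Rightarrow> 'v \<Rightarrow> 'v"
  ns_norm :: "'v \<Rightarrow> real"

definition type_space :: "'x::complex_banach normed_space"
  where "type_space = \<lparr>ns_carrier = UNIV, ns_zero = 0, ns_add = (+), ns_scale = (*\<^sub>C), ns_norm = norm\<rparr>"

definition Lp_space :: "'s measure \<Rightarrow> real \<Rightarrow> ('s \<Rightarrow> 'x::complex_banach) set normed_space"
  where "Lp_space M p =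
    \<lparr>ns_carrier = Lp_fun M p // Lp_rel M p,
     ns_zero = Lp_rel M p `` {\<lambda>\<omega>. 0},
     ns_add = (\<lambda>F G. \<Union>f\<in>F. \<Union>g\<in>G. Lp_rel M p `` {\<lambda>\<omega>. f \<omega> + g \<omega>}),
     ns_scale = (\<lambda>c F. \<Union>f\<in>F. Lp_rel M p `` {\<lambda>\<omega>. c *\<^sub>C f \<omega>}),
     ns_norm = (\<lambda>F. the_elem (Lp_seminorm M p ` F))\<rparr>"

definition bounded_operator_between ::
    "'v normed_space \<Rightarrow> 'w normed_space \<Rightarrow> ('v \<Rightarrow> 'w) \<Rightarrow> bool"
  where "bounded_operator_between V W A \<longleftrightarrow>
    (\<forall>x\<in>ns_carrier V. A x \<in> ns_carrier W) \<and>
    (\<forall>x\<in>ns_carrier V. \<forall>y\<in>ns_carrier V. A (ns_add V x y) = ns_add W (A x) (A y)) \<and>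
    (\<forall>c. \<forall>x\<in>ns_carrier V. A (ns_scale V c x) = ns_scale W c (A x)) \<and>
    (\<exists>C. \<forall>x\<in>ns_carrier V. ns_norm W (A x) \<le> C * ns_norm V x)"

definition isomorphism_on :: "'v normed_space \<Rightarrow> ('v \<Rightarrow> 'v) \<Rightarrow> bool"
  where "isomorphism_on V U \<longleftrightarrow> bounded_operator_between V V U \<and>
    bij_betw U (ns_carrier V) (ns_carrier V) \<and>
    bounded_operator_between V V (inv_into (ns_carrier V) U)"

definition int_power_on :: "'v normed_space \<Rightarrow> ('v \<Rightarrow> 'v) \<Rightarrow> int \<Rightarrow> 'v \<Rightarrow> 'v"
  where "int_power_on V U n =
    (if n \<ge> 0 then U ^^ nat n else inv_into (ns_carrier V) U ^^ nat (- n))"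

text \<open>\<open>U\<^sub>1\<^bsup>n\<^sub>1\<^esup> \<cdots> U\<^sub>d\<^bsup>n\<^sub>d\<^esup>\<close>; the index set \<open>{1,\<dots>,d}\<close> is rendered by a finite linearly ordered
  type \<open>'d\<close>.\<close>

definition multi_power_on ::
    "'v normed_space \<Rightarrow> ('d::{finite,linorder} \<Rightarrow> 'v \<Rightarrow> 'v) \<Rightarrow> ('d::{finite,linorder} \<Rightarrow> int) \<Rightarrow> 'v \<Rightarrow> 'v"
  where "multi_power_on V U n =
    foldr (\<lambda>k S. int_power_on V (U k) (n k) \<circ> S) (sorted_list_of_set UNIV) id"

definition ns_sum :: "'v normed_space \<Rightarrow> 'i set \<Rightarrow> ('i \<Rightarrow> 'v) \<Rightarrow> 'v"
  where "ns_sum V N f = Finite_Set.fold (\<lambda>n. ns_add V (f n)) (ns_zero V) N"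

definition torus_bounded_calculus ::
    "'v normed_space \<Rightarrow> ('d::{finite,linorder} \<Rightarrow> 'v \<Rightarrow> 'v) \<Rightarrow> bool"
  where "torus_bounded_calculus V U \<longleftrightarrow>
    (\<exists>C\<ge>1. \<forall>(N :: ('d \<Rightarrow> int) set) (a :: ('d \<Rightarrow> int) \<Rightarrow> complex). finite N \<longrightarrow>
      (\<forall>y\<in>ns_carrier V.
        ns_norm V (ns_sum V N (\<lambda>n. ns_scale V (a n) (multi_power_on V U n y)))
          \<le> C * (SUP s::'d \<Rightarrow> real. cmod (\<Sum>n\<in>N. a n * cis (\<Sum>k\<in>UNIV. of_int (n k) * s k)))
              * ns_norm V y))"


section \<open>\<open>R\<close>-Ritt operators\<close>

definition rademacher_sequence :: "'w measure \<Rightarrow> (nat \<Rightarrow> 'w \<Rightarrow> real) \<Rightarrow> bool"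
  where "rademacher_sequence \<Omega> r \<longleftrightarrow> prob_space \<Omega> \<and>
    prob_space.indep_vars \<Omega> (\<lambda>_. borel) r {1..} \<and>
    (\<forall>k\<ge>1. measure \<Omega> {\<omega>\<in>space \<Omega>. r k \<omega> = 1} = 1 / 2 \<and>
           measure \<Omega> {\<omega>\<in>space \<Omega>. r k \<omega> = - 1} = 1 / 2)"

definition R_bounded ::
    "'w measure \<Rightarrow> (nat \<Rightarrow> 'w \<Rightarrow> real) \<Rightarrow> ('x::complex_banach \<Rightarrow>\<^sub>L 'x) set \<Rightarrow> bool"
  where "R_bounded \<Omega> r E \<longleftrightarrow>
    (\<exists>C\<ge>0. \<forall>n\<ge>1. \<forall>S x. (\<forall>k\<in>{1..n}. S k \<in> E) \<longrightarrow>
      Lp_seminorm \<Omega> 2 (\<lambda>\<omega>. \<Sum>k=1..n. r k \<omega> *\<^sub>R blinfun_apply (S k) (x k))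
        \<le> C * Lp_seminorm \<Omega> 2 (\<lambda>\<omega>. \<Sum>k=1..n. r k \<omega> *\<^sub>R x k))"

definition R_ritt_operator ::
    "'w measure \<Rightarrow> (nat \<Rightarrow> 'w \<Rightarrow> real) \<Rightarrow> ('x::complex_banach \<Rightarrow>\<^sub>L 'x) \<Rightarrow> bool"
  where "R_ritt_operator \<Omega> r T \<longleftrightarrow> ritt_operator T \<and>
    R_bounded \<Omega> r (range (op_power T)) \<and>
    R_bounded \<Omega> r {real n *\<^sub>R (op_power T n - op_power T (n - 1)) | n. n \<ge> 1}"


section \<open>Joint functional calculus\<close>

definition stolz_polydomain :: "('d::finite \<Rightarrow> real) \<Rightarrow> (complex ^ 'd::finite) set"
  where "stolz_polydomain \<gamma> = {z. \<forall>i. z $ i \<in> stolz_domain (\<gamma> i)}"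

definition holomorphic_several :: "(complex ^ 'd::finite \<Rightarrow> complex) \<Rightarrow> (complex ^ 'd::finite) set \<Rightarrow> bool"
  where "holomorphic_several f D \<longleftrightarrow>
    (\<forall>z\<in>D. \<exists>f'. (f has_derivative f') (at z) \<and> (\<forall>c v. f' (c *s v) = c * f' v))"

text \<open>For \<open>\<Lambda> = {}\<close> the two last conditions say that \<open>f\<close> is a (bounded) constant on the domain.\<close>

definition H0_infty :: "('d::finite \<Rightarrow> real) \<Rightarrow> 'd::finite set \<Rightarrow> (complex ^ 'd::finite \<Rightarrow> complex) set"
  where "H0_infty \<gamma> \<Lambda> = {f.
    holomorphic_several f (stolz_polydomain \<gamma>) \<and>
    bounded (f ` stolz_polydomain \<gamma>) \<and>
    (\<forall>z\<in>stolz_polydomain \<gamma>. \<forall>w\<in>stolz_polydomain \<gamma>. (\<forall>i\<in>\<Lambda>. z $ i = w $ i) \<longrightarrow> f z = f w) \<and>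
    (\<exists>c>0. \<exists>s. (\<forall>i\<in>\<Lambda>. s i > 0) \<and>
      (\<forall>z\<in>stolz_polydomain \<gamma>. cmod (f z) \<le> c * (\<Prod>i\<in>\<Lambda>. cmod (1 - z $ i) powr s i)))}"

text \<open>The boundary of the Stolz domain, counterclockwise from \<open>1\<close>: the tangents from \<open>1\<close> touch the
  circle of radius \<open>sin b\<close> at the arguments \<open>\<plusminus>(\<pi>/2 - b)\<close>.\<close>

definition stolz_boundary :: "real \<Rightarrow> real \<Rightarrow> complex"
  where "stolz_boundary b =
    linepath 1 (rcis (sin b) (pi / 2 - b)) +++
    part_circlepath 0 (sin b) (pi / 2 - b) (3 * pi / 2 + b) +++
    linepath (rcis (sin b) (- (pi / 2 - b))) 1"

text \<open>The library's \<open>contour_integral\<close>, for functions with values in a Banach space.\<close>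

definition banach_contour_integral ::
    "(real \<Rightarrow> complex) \<Rightarrow> (complex \<Rightarrow> 'b::complex_banach) \<Rightarrow> 'b"
  where "banach_contour_integral g F =
    integral {0..1} (\<lambda>t. vector_derivative g (at t within {0..1}) *\<^sub>C F (g t))"

text \<open>The integral of \<open>F\<close> over \<open>\<Prod>i\<in>is. g i\<close>, as an iterated integral (all integrals below converge
  absolutely); the coordinates of \<open>z\<close> not listed in \<open>is\<close> are kept fixed.\<close>

primrec iterated_contour_integral ::
    "'d::finite list \<Rightarrow> ('d::finite \<Rightarrow> real \<Rightarrow> complex) \<Rightarrow> (complex ^ 'd::finite \<Rightarrow> 'b::complex_banach) \<Rightarrow> complex ^ 'd::finite \<Rightarrow> 'b"
  where
    "iterated_contour_integral [] g F z = F z"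
  | "iterated_contour_integral (i # is) g F z =
      banach_contour_integral (g i)
        (\<lambda>w. iterated_contour_integral is g F (\<chi> j. if j = i then w else z $ j))"

text \<open>\<open>f(T\<^sub>1,\<dots>,T\<^sub>d)\<close> for \<open>f \<in> H0_infty \<gamma> \<Lambda>\<close>. As \<open>f\<close> does not depend on the coordinates outside
  \<open>\<Lambda>\<close>, these are set to \<open>0\<close>, a point of every Stolz domain. For \<open>\<Lambda> = {}\<close> and \<open>f \<equiv> c\<close> the value
  is \<open>c I\<^sub>X\<close>.\<close>

definition H0_calculus ::
    "('d::{finite,linorder} \<Rightarrow> real) \<Rightarrow> ('d::{finite,linorder} \<Rightarrow> ('x::complex_banach \<Rightarrow>\<^sub>L 'x)) \<Rightarrow> 'd::{finite,linorder} set \<Rightarrow>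
      (complex ^ 'd::{finite,linorder} \<Rightarrow> complex) \<Rightarrow> 'x \<Rightarrow>\<^sub>L 'x"
  where "H0_calculus b T \<Lambda> f =
    (1 / (2 * of_real pi * \<i>)) ^ card \<Lambda> *\<^sub>C
      iterated_contour_integral (sorted_list_of_set \<Lambda>) (\<lambda>i. stolz_boundary (b i))
        (\<lambda>z. f z *\<^sub>C op_prod \<Lambda> (\<lambda>i. resolvent (z $ i) (T i))) 0"

text \<open>An element of the direct sum \<open>H\<^sub>0\<^sub>,\<^sub>1\<close> is given by its components \<open>f \<Lambda> \<in> H0_infty \<gamma> \<Lambda>\<close>;
  as a function it is \<open>\<Sum>\<Lambda>. f \<Lambda>\<close>. The value of the calculus does not depend on the choice of the
  contours, that is, of \<open>b\<close>.\<close>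

definition joint_functional_calculus ::
    "('d::{finite,linorder} \<Rightarrow> real) \<Rightarrow> ('d::{finite,linorder} \<Rightarrow> ('x::complex_banach \<Rightarrow>\<^sub>L 'x)) \<Rightarrow> bool"
  where "joint_functional_calculus \<gamma> T \<longleftrightarrow>
    (\<exists>a. (\<forall>k. a k < \<gamma> k \<and> ritt_operator_of_type (a k) (T k)) \<and>
      (\<exists>K>0. \<forall>b f. (\<forall>k. a k < b k \<and> b k < \<gamma> k) \<longrightarrow> (\<forall>\<Lambda>. f \<Lambda> \<in> H0_infty \<gamma> \<Lambda>) \<longrightarrow>
        norm (\<Sum>\<Lambda>\<in>UNIV. H0_calculus b T \<Lambda> (f \<Lambda>))
          \<le> K * (SUP z\<in>stolz_polydomain \<gamma>. cmod (\<Sum>\<Lambda>\<in>UNIV. f \<Lambda> z))))"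

end

theory Submission
  imports Defs
begin

text \<open>The joint functional calculus is given by Cauchy integrals of \<open>f\<close> against products of resolvents. The
  dilation has one consequence that matters: since the isomorphisms have a \<open>C(\<T>\<^sup>d)\<close> calculus and
  \<open>T\<^sub>1\<^bsup>n\<^sub>1\<^esup> \<cdots> T\<^sub>d\<^bsup>n\<^sub>d\<^esup> = Q U\<^sub>1\<^bsup>n\<^sub>1\<^esup> \<cdots> U\<^sub>d\<^bsup>n\<^sub>d\<^esup> J\<close>, a polynomial in \<open>T\<^sub>1, \<dots>, T\<^sub>d\<close> is bounded by its supremum on the
  polydisc (\<open>dilation_polynomial_bound\<close>). The polydisc is larger than a product of Stolz domains, and
  \<open>R\<close>-boundedness is what bridges the difference.

  An \<open>R\<close>-Ritt operator has an \<open>R\<close>-bounded set \<open>{(\<lambda> - 1) R(\<lambda>,T)}\<close>, first for \<open>|\<lambda>| > 1\<close>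
  (\<open>R_ritt_resolvent_exterior\<close>) and then, by Neumann series, outside a Stolz domain \<open>B\<^sub>a\<close>
  (\<open>R_bdd_resolvent_neumann\<close>, \<open>stolz_exterior_near_unit_circle\<close>). This gives the angles \<open>a\<^sub>k\<close>, and any
  \<open>\<gamma>\<^sub>k\<close> between \<open>a\<^sub>k\<close> and \<open>\<pi>/2\<close> will do.

  For \<open>\<lambda>\<close> on a contour between \<open>B\<^sub>a\<close> and \<open>B\<^sub>\<gamma>\<close> put \<open>v = 1 - \<lambda>\<close>, \<open>u = 1 - z\<close> and \<open>\<phi>\<^sub>\<lambda>(z) = 4uv/(u + v)\<^sup>2\<close>. This
  function of \<open>z\<close> is holomorphic near the closed disc and equals \<open>1\<close> at \<open>z = \<lambda>\<close>. Hence the singularity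
  of \<open>(1 - \<phi>\<^sub>\<lambda>(T)\<^sup>2) R(\<lambda>,T)\<close> cancels: it is a polynomial in \<open>R(2 - \<lambda>,T)\<close>, holomorphic in \<open>\<lambda>\<close> on all of \<open>B\<^sub>\<gamma>\<close>, and
  its Cauchy integral against \<open>f\<close> vanishes (\<open>resolvent_minus_kern\<close>, \<open>trunc_integral_kern_defect\<close>). In
  the definition of \<open>f(T\<^sub>1, \<dots>, T\<^sub>d)\<close> each resolvent may therefore be replaced by \<open>\<phi>\<^sub>\<lambda>(T)\<^sup>2 R(\<lambda>,T)\<close>
  (\<open>replace_all\<close>).

  After the replacement, the contours are cut into dyadic pieces \<open>p\<close> accumulating at \<open>1\<close>. Each piece has
  bounded measure for \<open>|d\<lambda>|/|1 - \<lambda>|\<close>, and \<open>\<Sum>\<^sub>p |\<phi>\<^sub>p(z)|\<close> is bounded on the disc (\<open>kern_sum_le\<close>). The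
  integral becomes an average of sums \<open>\<Sum>\<^sub>p c\<^sub>p \<phi>\<^sub>p(T)\<^sup>2 S\<^sub>p\<close> with \<open>S\<^sub>p = (\<lambda>\<^sub>p - 1) R(\<lambda>\<^sub>p,T)\<close> and \<open>|c\<^sub>p|\<close> of the size
  of \<open>sup |f|\<close>. With random signs such a sum is an average of
  \<open>(\<Sum>\<epsilon>\<^sub>p\<phi>\<^sub>p(T)) (\<Sum>\<epsilon>\<^sub>p c\<^sub>p S\<^sub>p\<phi>\<^sub>p(T))\<close>; the polynomial bound controls the first factor, and also the second once
  \<open>R\<close>-boundedness has removed the \<open>S\<^sub>p\<close> (\<open>norm_diagonal_sum_le\<close>, \<open>norm_kernel_sum_le\<close>). This can be done in one
  variable after the other and bounds every component \<open>f\<^sub>\<Lambda>(T\<^sub>1, \<dots>, T\<^sub>d)\<close> by \<open>sup |f\<^sub>\<Lambda>|\<close> (\<open>H0_calculus_bound\<close>).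
  Finally \<open>sup |f\<^sub>\<Lambda>|\<close> is bounded by the supremum of the whole function \<open>\<Sum>\<^sub>\<Lambda> f\<^sub>\<Lambda>\<close>, because components
  vanish when one of their variables tends to \<open>1\<close> (\<open>component_bound\<close>).\<close>


section \<open>Complex scalars\<close>

lemma scaleC_1 [simp]: "1 *\<^sub>C (x::'a::complex_normed_vector) = x"
  using scaleC_of_real[of 1 x] by simp

lemma scaleR_scaleC: "r *\<^sub>R (x::'a::complex_normed_vector) = complex_of_real r *\<^sub>C x"
  by (simp add: scaleC_of_real)

lemma bounded_bilinear_scaleC:
  "bounded_bilinear ((*\<^sub>C) :: complex \<Rightarrow> 'a::complex_normed_vector \<Rightarrow> 'a)"
proof
  fix c d :: complex and x y :: 'a and r :: real
  show "(c + d) *\<^sub>C x = c *\<^sub>C x + d *\<^sub>C x" by (rule scaleC_add_left)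
  show "c *\<^sub>C (x + y) = c *\<^sub>C x + c *\<^sub>C y" by (rule scaleC_add_right)
  show "(r *\<^sub>R c) *\<^sub>C x = r *\<^sub>R (c *\<^sub>C x)"
    by (simp only: scaleR_conv_of_real[of r c] scaleC_scaleC[symmetric] scaleC_of_real)
  show "c *\<^sub>C (r *\<^sub>R x) = r *\<^sub>R (c *\<^sub>C x)"
    by (simp add: scaleR_scaleC scaleC_scaleC mult.commute)
  show "\<exists>K. \<forall>a b. norm (a *\<^sub>C (b::'a)) \<le> norm a * norm b * K"
    by (rule exI[of _ 1]) (simp add: norm_scaleC)
qed

lemmas scaleC_zero_left [simp] = bounded_bilinear.zero_left[OF bounded_bilinear_scaleC]
lemmas scaleC_zero_right [simp] = bounded_bilinear.zero_right[OF bounded_bilinear_scaleC]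
lemmas scaleC_minus_left = bounded_bilinear.minus_left[OF bounded_bilinear_scaleC]
lemmas scaleC_minus_right = bounded_bilinear.minus_right[OF bounded_bilinear_scaleC]
lemmas scaleC_diff_left = bounded_bilinear.diff_left[OF bounded_bilinear_scaleC]
lemmas scaleC_diff_right = bounded_bilinear.diff_right[OF bounded_bilinear_scaleC]
lemmas scaleC_sum_left = bounded_bilinear.sum_left[OF bounded_bilinear_scaleC]
lemmas scaleC_sum_right = bounded_bilinear.sum_right[OF bounded_bilinear_scaleC]
lemmas tendsto_scaleC [tendsto_intros] = bounded_bilinear.tendsto[OF bounded_bilinear_scaleC]
lemmas continuous_on_scaleC [continuous_intros] =
  bounded_bilinear.continuous_on[OF bounded_bilinear_scaleC]


section \<open>The algebra of bounded operators as a type\<close>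

text \<open>As a type, \<open>B(X)\<close> is a Banach algebra, so that the library's powers, products and
  series are available for operators. It is not an instance of \<open>ring_1\<close>, because the zero space
  is not excluded.\<close>

typedef (overloaded) ('x::complex_normed_vector) op = "bounded_operators :: ('x \<Rightarrow>\<^sub>L 'x) set"
  morphisms op_map Op
  by (rule exI[of _ 0]) (simp add: bounded_operators_def)

setup_lifting type_definition_op

instantiation op :: (complex_normed_vector) complex_normed_vector
begin
lift_definition zero_op :: "'a op" is 0 by (simp add: bounded_operators_def)
lift_definition plus_op :: "'a op \<Rightarrow> 'a op \<Rightarrow> 'a op" is "(+)"
  by (simp add: bounded_operators_def blinfun.add_left scaleC_add_right)
lift_definition minus_op :: "'a op \<Rightarrow> 'a op \<Rightarrow> 'a op" is "(-)"
  by (simp add: bounded_operators_def blinfun.diff_left scaleC_diff_right)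
lift_definition uminus_op :: "'a op \<Rightarrow> 'a op" is uminus
  by (simp add: bounded_operators_def blinfun.minus_left scaleC_minus_right)
lift_definition scaleR_op :: "real \<Rightarrow> 'a op \<Rightarrow> 'a op" is scaleR
  by (auto simp: bounded_operators_def blinfun.scaleR_left)
    (simp add: scaleR_scaleC scaleC_scaleC mult.commute)
lift_definition scaleC_op :: "complex \<Rightarrow> 'a op \<Rightarrow> 'a op" is scaleC
  by (simp add: bounded_operators_def scaleC_blinfun.rep_eq scaleC_scaleC mult.commute)
lift_definition norm_op :: "'a op \<Rightarrow> real" is norm .
definition dist_op :: "'a op \<Rightarrow> 'a op \<Rightarrow> real" where "dist_op A B = norm (A - B)"
definition sgn_op :: "'a op \<Rightarrow> 'a op" where "sgn_op A = scaleR (inverse (norm A)) A"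
definition uniformity_op :: "('a op \<times> 'a op) filter"
  where "uniformity_op = (INF e\<in>{0<..}. principal {(A, B). dist A B < e})"
definition open_op :: "'a op set \<Rightarrow> bool"
  where "open_op S \<longleftrightarrow> (\<forall>A\<in>S. \<forall>\<^sub>F (A', B) in uniformity. A' = A \<longrightarrow> B \<in> S)"
instance
proof
  fix A B C :: "'a op" and a b :: real and c d :: complex
  show "A + B + C = A + (B + C)" by transfer simp
  show "A + B = B + A" by transfer simp
  show "0 + A = A" by transfer simp
  show "- A + A = 0" by transfer simp
  show "A - B = A + - B" by transfer simp
  show "a *\<^sub>R (A + B) = a *\<^sub>R A + a *\<^sub>R B" by transfer (simp add: scaleR_add_right)
  show "(a + b) *\<^sub>R A = a *\<^sub>R A + b *\<^sub>R A" by transfer (simp add: scaleR_add_left)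
  show "a *\<^sub>R b *\<^sub>R A = (a * b) *\<^sub>R A" by transfer simp
  show "1 *\<^sub>R A = A" by transfer simp
  show "dist A B = norm (A - B)" by (rule dist_op_def)
  show "sgn A = scaleR (inverse (norm A)) A" by (rule sgn_op_def)
  show "(uniformity :: ('a op \<times> 'a op) filter) = (INF e\<in>{0<..}. principal {(A, B). dist A B < e})"
    by (rule uniformity_op_def)
  show "open S \<longleftrightarrow> (\<forall>A\<in>S. \<forall>\<^sub>F (A', B) in uniformity. A' = A \<longrightarrow> B \<in> S)" for S :: "'a op set"
    by (rule open_op_def)
  show "(norm A = 0) = (A = 0)" by transfer simp
  show "norm (A + B) \<le> norm A + norm B" by transfer (rule norm_triangle_ineq)
  show "norm (a *\<^sub>R A) = \<bar>a\<bar> * norm A" by transfer simp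
  show "c *\<^sub>C (A + B) = c *\<^sub>C A + c *\<^sub>C B" by transfer (rule scaleC_add_right)
  show "(c + d) *\<^sub>C A = c *\<^sub>C A + d *\<^sub>C A" by transfer (rule scaleC_add_left)
  show "c *\<^sub>C d *\<^sub>C A = (c * d) *\<^sub>C A" by transfer (rule scaleC_scaleC)
  show "complex_of_real a *\<^sub>C A = a *\<^sub>R A" by transfer (rule scaleC_of_real)
  show "norm (c *\<^sub>C A) = cmod c * norm A" by transfer (rule norm_scaleC)
qed
end

instantiation op :: (complex_normed_vector) "{real_normed_algebra, monoid_mult}"
begin
lift_definition one_op :: "'a op" is id_blinfun by (simp add: bounded_operators_def)
lift_definition times_op :: "'a op \<Rightarrow> 'a op \<Rightarrow> 'a op" is "(o\<^sub>L)"
  by (simp add: bounded_operators_def)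
instance
proof
  fix A B C :: "'a op" and a :: real
  show "A * B * C = A * (B * C)" by transfer (auto intro: blinfun_eqI)
  show "1 * A = A" by transfer (auto intro: blinfun_eqI)
  show "A * 1 = A" by transfer (auto intro: blinfun_eqI)
  show "(A + B) * C = A * C + B * C" by transfer (auto intro: blinfun_eqI simp: blinfun.bilinear_simps)
  show "A * (B + C) = A * B + A * C" by transfer (auto intro: blinfun_eqI simp: blinfun.bilinear_simps)
  show "a *\<^sub>R A * B = a *\<^sub>R (A * B)" by transfer (auto intro: blinfun_eqI simp: blinfun.bilinear_simps)
  show "A * a *\<^sub>R B = a *\<^sub>R (A * B)" by transfer (auto intro: blinfun_eqI simp: blinfun.bilinear_simps)
  show "norm (A * B) \<le> norm A * norm B" by transfer (rule norm_blinfun_compose)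
qed
end

lemma norm_op_map [simp]: "norm (op_map A) = norm A"
  by transfer simp

lemma norm_one_op_le: "norm (1 :: 'a::complex_normed_vector op) \<le> 1"
  by transfer (rule norm_blinfun_id_le)

instance op :: (complex_banach) complex_banach
proof
  fix X :: "nat \<Rightarrow> 'a op"
  assume X: "Cauchy X"
  have "Cauchy (\<lambda>n. op_map (X n))"
    using X by (simp add: Cauchy_def dist_norm norm_op.rep_eq minus_op.rep_eq)
  then obtain L where L: "(\<lambda>n. op_map (X n)) \<longlonglongrightarrow> L"
    by (auto dest!: Cauchy_convergent simp: convergent_def)
  have "blinfun_apply L (c *\<^sub>C x) = c *\<^sub>C blinfun_apply L x" for c x
  proof (rule LIMSEQ_unique)
    have lim: "(\<lambda>n. blinfun_apply (op_map (X n)) y) \<longlonglongrightarrow> blinfun_apply L y" for y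
      by (intro blinfun.tendsto L tendsto_const)
    show "(\<lambda>n. blinfun_apply (op_map (X n)) (c *\<^sub>C x)) \<longlonglongrightarrow> blinfun_apply L (c *\<^sub>C x)"
      by (rule lim)
    have "blinfun_apply (op_map (X n)) (c *\<^sub>C x) = c *\<^sub>C blinfun_apply (op_map (X n)) x" for n
      using op_map[of "X n"] by (simp add: bounded_operators_def)
    then show "(\<lambda>n. blinfun_apply (op_map (X n)) (c *\<^sub>C x)) \<longlonglongrightarrow> c *\<^sub>C blinfun_apply L x"
      by (simp, intro tendsto_scaleC tendsto_const lim)
  qed
  then have "L \<in> bounded_operators" by (simp add: bounded_operators_def)
  then obtain A where "L = op_map A" by (metis Op_inverse)
  then have "X \<longlonglongrightarrow> A"
    using L by (simp add: tendsto_iff dist_norm norm_op.rep_eq minus_op.rep_eq)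
  then show "convergent X" by (auto simp: convergent_def)
qed

lemma mult_scaleC_left [simp]: "(c *\<^sub>C A) * B = c *\<^sub>C (A * B :: 'a::complex_normed_vector op)"
  by transfer (auto intro: blinfun_eqI simp: scaleC_blinfun.rep_eq)

lemma mult_scaleC_right [simp]: "A * (c *\<^sub>C B) = c *\<^sub>C (A * B :: 'a::complex_normed_vector op)"
  by transfer (auto intro!: blinfun_eqI simp: scaleC_blinfun.rep_eq bounded_operators_def)

lemma op_power_op_map: "op_power (op_map A) n = op_map (A ^ n)"
  unfolding op_power_def by (induction n) (auto simp: one_op.rep_eq times_op.rep_eq)

lemma op_prod_op_map:
  "op_prod \<Lambda> (\<lambda>i. op_map (A i)) = op_map (prod_list (map A (sorted_list_of_set \<Lambda>)))"
proof -
  have "foldr (\<lambda>i S. op_map (A i) o\<^sub>L S) is id_blinfun = op_map (prod_list (map A is))" for "is"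
    by (induction "is") (auto simp: one_op.rep_eq times_op.rep_eq)
  then show ?thesis by (simp add: op_prod_def)
qed

abbreviation op_app :: "'x::complex_normed_vector op \<Rightarrow> 'x \<Rightarrow> 'x" (infixr "\<star>" 75)
  where "A \<star> x \<equiv> blinfun_apply (op_map A) x"

lemma op_app_simps [simp]:
  "0 \<star> x = 0" "1 \<star> x = x" "(A + B) \<star> x = A \<star> x + B \<star> x" "(A - B) \<star> x = A \<star> x - B \<star> x"
  "(- A) \<star> x = - (A \<star> x)" "(r *\<^sub>R A) \<star> x = r *\<^sub>R (A \<star> x)" "(c *\<^sub>C A) \<star> x = c *\<^sub>C (A \<star> x)"
  "(A * B) \<star> x = A \<star> B \<star> x"
  "A \<star> (x + y) = A \<star> x + A \<star> y" "A \<star> (r *\<^sub>R x) = r *\<^sub>R (A \<star> x)" "A \<star> (c *\<^sub>C x) = c *\<^sub>C (A \<star> x)"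
  "A \<star> 0 = 0"
  using op_map[of A]
  by (simp_all add: zero_op.rep_eq one_op.rep_eq plus_op.rep_eq minus_op.rep_eq uminus_op.rep_eq
      scaleR_op.rep_eq scaleC_op.rep_eq times_op.rep_eq blinfun.bilinear_simps
      scaleC_blinfun.rep_eq bounded_operators_def)

lemma op_app_sum: "(\<Sum>i\<in>I. A i) \<star> x = (\<Sum>i\<in>I. A i \<star> x)"
  by (induction I rule: infinite_finite_induct) auto

lemma norm_op_app: "norm (A \<star> x) \<le> norm A * norm x"
  using norm_blinfun[of "op_map A" x] by simp

lemma norm_op_leI:
  "0 \<le> C \<Longrightarrow> (\<And>x. norm (A \<star> x) \<le> C * norm x) \<Longrightarrow> norm A \<le> C"
  by (metis norm_blinfun_bound norm_op_map)

lemma bounded_bilinear_op_app: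
  "bounded_bilinear ((\<star>) :: 'x::complex_normed_vector op \<Rightarrow> 'x \<Rightarrow> 'x)"
proof
  show "\<exists>K. \<forall>(A :: 'x op) x. norm (A \<star> x) \<le> norm A * norm x * K"
    using norm_op_app by (metis mult.right_neutral)
qed simp_all

lemmas tendsto_op_app [tendsto_intros] = bounded_bilinear.tendsto[OF bounded_bilinear_op_app]
lemmas continuous_on_op_app [continuous_intros] =
  bounded_bilinear.continuous_on[OF bounded_bilinear_op_app]

section \<open>\<open>R\<close>-boundedness by averages over signs\<close>

definition choice_sign :: "nat set \<Rightarrow> nat \<Rightarrow> real"
  where "choice_sign A k = (if k \<in> A then 1 else - 1)"

text \<open>For independent signs this is \<open>2\<^bsup>n/2\<^esup>\<close> times the \<open>L\<^sub>2\<close>-norm of the Rademacher sum of \<open>y\<^sub>0, \<dots>, y\<^sub>n\<^sub>-\<^sub>1\<close>: a subset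
  of \<open>{..<n}\<close> is the set of positive signs. Finite averages avoid measurability questions in \<open>X\<close>.\<close>

definition rad :: "nat \<Rightarrow> (nat \<Rightarrow> 'x::real_normed_vector) \<Rightarrow> real"
  where "rad n y = L2_set (\<lambda>A. norm (\<Sum>k<n. choice_sign A k *\<^sub>R y k)) (Pow {..<n})"

lemma rad_nonneg [simp]: "0 \<le> rad n y"
  by (simp add: rad_def)

lemma rad_cong: "(\<And>k. k < n \<Longrightarrow> y k = z k) \<Longrightarrow> rad n y = rad n z"
  by (simp add: rad_def)

lemma rad_add: "rad n (\<lambda>k. y k + z k) \<le> rad n y + rad n z"
proof -
  have "rad n (\<lambda>k. y k + z k) \<le> L2_set (\<lambda>A. norm (\<Sum>k<n. choice_sign A k *\<^sub>R y k)
      + norm (\<Sum>k<n. choice_sign A k *\<^sub>R z k)) (Pow {..<n})"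
    unfolding rad_def
    by (intro L2_set_mono) (simp_all add: scaleR_add_right sum.distrib norm_triangle_ineq)
  also have "\<dots> \<le> rad n y + rad n z"
    unfolding rad_def by (rule L2_set_triangle_ineq)
  finally show ?thesis .
qed

lemma rad_zero [simp]: "rad n (\<lambda>k. 0) = 0"
  by (simp add: rad_def L2_set_def)

lemma rad_scaleR: "rad n (\<lambda>k. c *\<^sub>R y k) = \<bar>c\<bar> * rad n y"
proof -
  have "(\<Sum>k<n. choice_sign A k *\<^sub>R c *\<^sub>R y k) = c *\<^sub>R (\<Sum>k<n. choice_sign A k *\<^sub>R y k)" for A
    by (simp add: scaleR_sum_right mult.commute)
  then show ?thesis by (simp add: rad_def L2_set_right_distrib)
qed

lemma rad_scaleC: "rad n (\<lambda>k. c *\<^sub>C y k) = cmod c * rad n y"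
proof -
  have "norm (\<Sum>k<n. choice_sign A k *\<^sub>R c *\<^sub>C y k) = cmod c * norm (\<Sum>k<n. choice_sign A k *\<^sub>R y k)" for A
    by (simp add: norm_scaleC[symmetric] scaleC_sum_right scaleR_scaleC scaleC_scaleC mult.commute)
  then show ?thesis by (simp add: rad_def L2_set_right_distrib)
qed

lemma rad_sum: "rad n (\<lambda>k. \<Sum>j<m. z j k) \<le> (\<Sum>j<m. rad n (z j))" for m :: nat
proof (induction m)
  case (Suc m)
  then show ?case
    using rad_add[of n "\<lambda>k. \<Sum>j<m. z j k" "z m"] by simp
qed simp

lemma tendsto_rad:
  assumes "\<And>k. k < n \<Longrightarrow> ((\<lambda>i. z i k) \<longlongrightarrow> y k) F"
  shows "((\<lambda>i. rad n (z i)) \<longlongrightarrow> rad n y) F"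
  unfolding rad_def L2_set_def
  by (intro tendsto_intros assms) auto

text \<open>Multiplication by a fixed pattern of signs permutes the patterns.\<close>

lemma rad_flip: "rad n (\<lambda>k. choice_sign B k *\<^sub>R y k) = rad n y"
proof -
  let ?i = "\<lambda>A. {k \<in> {..<n}. (k \<in> A) = (k \<in> B)}"
  have "(\<Sum>A\<in>Pow {..<n}. (norm (\<Sum>k<n. choice_sign A k *\<^sub>R choice_sign B k *\<^sub>R y k))\<^sup>2)
      = (\<Sum>A\<in>Pow {..<n}. (norm (\<Sum>k<n. choice_sign A k *\<^sub>R y k))\<^sup>2)"
  proof (rule sum.reindex_bij_witness[of _ ?i ?i])
    fix A assume "A \<in> Pow {..<n}"
    have "(\<Sum>k<n. choice_sign (?i A) k *\<^sub>R y k) = (\<Sum>k<n. choice_sign A k *\<^sub>R choice_sign B k *\<^sub>R y k)"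
      by (rule sum.cong) (auto simp: choice_sign_def)
    then show "(norm (\<Sum>k<n. choice_sign (?i A) k *\<^sub>R y k))\<^sup>2
      = (norm (\<Sum>k<n. choice_sign A k *\<^sub>R choice_sign B k *\<^sub>R y k))\<^sup>2" by simp
  qed auto
  then show ?thesis by (simp add: rad_def L2_set_def)
qed

text \<open>The contraction principle: a coefficient in \<open>[-1,1]\<close> is an average of the two signs, and
  changing signs leaves the average \<open>rad\<close> unchanged.\<close>

lemma rad_contract:
  assumes c: "\<And>k. k < n \<Longrightarrow> \<bar>c k\<bar> \<le> 1"
  shows "rad n (\<lambda>k. c k *\<^sub>R y k) \<le> rad n y"
proof -
  have "rad n (\<lambda>k. if k < m then c k *\<^sub>R y k else y k) \<le> rad n y" if "m \<le> n" for m
    using that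
  proof (induction m)
    case (Suc m)
    define z where "z k = (if k < m then c k *\<^sub>R y k else y k)" for k
    define z' where "z' k = choice_sign (- {m}) k *\<^sub>R z k" for k
    have z': "rad n z' = rad n z" unfolding z'_def by (rule rad_flip)
    have "(\<lambda>k. if k < Suc m then c k *\<^sub>R y k else y k)
        = (\<lambda>k. ((1 + c m) / 2) *\<^sub>R z k + ((1 - c m) / 2) *\<^sub>R z' k)"
      by (rule ext) (auto simp: z_def z'_def choice_sign_def less_Suc_eq scaleR_left_distrib[symmetric]
          scaleR_left_diff_distrib[symmetric] field_simps)
    then have "rad n (\<lambda>k. if k < Suc m then c k *\<^sub>R y k else y k)
        \<le> \<bar>(1 + c m) / 2\<bar> * rad n z + \<bar>(1 - c m) / 2\<bar> * rad n z'"
      using rad_add[of n "\<lambda>k. ((1 + c m) / 2) *\<^sub>R z k" "\<lambda>k. ((1 - c m) / 2) *\<^sub>R z' k"]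
      by (simp only: rad_scaleR)
    also have "\<dots> = rad n z"
      using c[of m] Suc.prems by (simp add: z' abs_le_iff field_simps)
    also have "rad n z \<le> rad n y" using Suc unfolding z_def by simp
    finally show ?case .
  qed simp
  from this[of n] show ?thesis
    by (simp cong: rad_cong)
qed

text \<open>The factor \<open>2\<close> comes from treating the real and the imaginary parts separately.\<close>

lemma rad_contract_complex:
  fixes y :: "nat \<Rightarrow> 'x::complex_normed_vector"
  assumes c: "\<And>k. k < n \<Longrightarrow> cmod (c k) \<le> b" and "0 \<le> b"
  shows "rad n (\<lambda>k. c k *\<^sub>C y k) \<le> 2 * b * rad n y"
proof (cases "b = 0")
  case True
  with c have "\<And>k. k < n \<Longrightarrow> c k = 0" by auto
  then have "rad n (\<lambda>k. c k *\<^sub>C y k) = rad n (\<lambda>k. 0 :: 'x)" by (intro rad_cong) simp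
  then show ?thesis using True by simp
next
  case False
  with \<open>0 \<le> b\<close> have b: "b > 0" by simp
  have c1: "\<bar>Re (c k) / b\<bar> \<le> 1" "\<bar>Im (c k) / b\<bar> \<le> 1" if "k < n" for k
    using c[OF that] b abs_Re_le_cmod[of "c k"] abs_Im_le_cmod[of "c k"] by simp_all
  have "c k *\<^sub>C y k = b *\<^sub>R ((Re (c k) / b) *\<^sub>R y k) + (of_real b * \<i>) *\<^sub>C ((Im (c k) / b) *\<^sub>R y k)" for k
    using b complex_eq[of "c k"]
    by (simp add: scaleR_scaleC scaleC_scaleC scaleC_add_left[symmetric] mult.commute)
  then have "rad n (\<lambda>k. c k *\<^sub>C y k) \<le> rad n (\<lambda>k. b *\<^sub>R ((Re (c k) / b) *\<^sub>R y k))
      + rad n (\<lambda>k. (of_real b * \<i>) *\<^sub>C ((Im (c k) / b) *\<^sub>R y k))"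
    by (simp only: rad_add)
  also have "\<dots> = b * rad n (\<lambda>k. (Re (c k) / b) *\<^sub>R y k) + b * rad n (\<lambda>k. (Im (c k) / b) *\<^sub>R y k)"
    using b by (simp only: rad_scaleR rad_scaleC norm_mult) simp
  also have "\<dots> \<le> b * rad n y + b * rad n y"
    using b by (intro add_mono mult_left_mono rad_contract c1) auto
  finally show ?thesis by simp
qed

text \<open>The factor \<open>2\<^bsup>n/2\<^esup>\<close> in \<open>rad\<close> appears on both sides, so this is \<open>R\<close>-boundedness with an explicit
  constant.\<close>

definition R_bdd :: "real \<Rightarrow> 'x::complex_normed_vector op set \<Rightarrow> bool"
  where "R_bdd C E \<longleftrightarrow> 0 \<le> C \<and>
    (\<forall>n S y. (\<forall>k<n. S k \<in> E) \<longrightarrow> rad n (\<lambda>k. S k \<star> y k) \<le> C * rad n y)"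

lemma R_bddD: "R_bdd C E \<Longrightarrow> (\<And>k. k < n \<Longrightarrow> S k \<in> E) \<Longrightarrow> rad n (\<lambda>k. S k \<star> y k) \<le> C * rad n y"
  by (simp add: R_bdd_def)

lemma R_bdd_nonneg: "R_bdd C E \<Longrightarrow> 0 \<le> C"
  by (simp add: R_bdd_def)

lemma R_bdd_subset: "R_bdd C E \<Longrightarrow> F \<subseteq> E \<Longrightarrow> R_bdd C F"
  by (auto simp: R_bdd_def subset_eq)

lemma R_bdd_mono:
  assumes "R_bdd C E" "C \<le> D" shows "R_bdd D E"
  unfolding R_bdd_def
proof (intro conjI allI impI)
  show "0 \<le> D" using assms R_bdd_nonneg[of C E] by simp
  fix n :: nat and S :: "nat \<Rightarrow> 'a op" and y :: "nat \<Rightarrow> 'a" assume "\<forall>k<n. S k \<in> E"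
  then show "rad n (\<lambda>k. S k \<star> y k) \<le> D * rad n y"
    using R_bddD[OF assms(1), of n S y] mult_right_mono[OF assms(2) rad_nonneg[of n y]] by simp
qed

lemma R_bdd_norm:
  assumes "R_bdd C E" "A \<in> E" shows "norm A \<le> C"
proof (rule norm_op_leI)
  fix x
  have eq: "rad 1 (\<lambda>k. y) = sqrt 2 * norm y" for y :: 'a
    by (simp add: rad_def L2_set_def Pow_def choice_sign_def lessThan_Suc subset_singleton_iff
        Collect_disj_eq real_sqrt_mult)
  have "rad 1 (\<lambda>k. A \<star> x) \<le> C * rad 1 (\<lambda>k. x)"
    by (rule R_bddD[OF assms(1), of 1 "\<lambda>_. A" "\<lambda>_. x"]) (rule assms(2))
  then have "sqrt 2 * norm (A \<star> x) \<le> sqrt 2 * (C * norm x)"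
    unfolding eq by (simp add: mult.left_commute)
  then show "norm (A \<star> x) \<le> C * norm x" by simp
qed (rule R_bdd_nonneg[OF assms(1)])

lemma R_bdd_one: "R_bdd 1 {1}"
  unfolding R_bdd_def
proof (intro conjI allI impI)
  fix n :: nat and S :: "nat \<Rightarrow> 'a op" and y :: "nat \<Rightarrow> 'a" assume "\<forall>k<n. S k \<in> {1 :: 'a op}"
  then have "rad n (\<lambda>k. S k \<star> y k) = rad n y" by (intro rad_cong) simp
  then show "rad n (\<lambda>k. S k \<star> y k) \<le> 1 * rad n y" by simp
qed simp

lemma R_bdd_add:
  assumes E: "R_bdd C E" and F: "R_bdd D F"
  shows "R_bdd (C + D) {A + B | A B. A \<in> E \<and> B \<in> F}"
  unfolding R_bdd_def
proof (intro conjI allI impI)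
  show "0 \<le> C + D" using R_bdd_nonneg[OF E] R_bdd_nonneg[OF F] by simp
  fix n :: nat and S :: "nat \<Rightarrow> 'a op" and y :: "nat \<Rightarrow> 'a"
  assume "\<forall>k<n. S k \<in> {A + B | A B. A \<in> E \<and> B \<in> F}"
  then obtain A B where AB: "\<And>k. k < n \<Longrightarrow> S k = A k + B k \<and> A k \<in> E \<and> B k \<in> F"
    by simp metis
  then have "rad n (\<lambda>k. S k \<star> y k) = rad n (\<lambda>k. A k \<star> y k + B k \<star> y k)"
    by (intro rad_cong) simp
  also have "\<dots> \<le> rad n (\<lambda>k. A k \<star> y k) + rad n (\<lambda>k. B k \<star> y k)" by (rule rad_add)
  also have "\<dots> \<le> C * rad n y + D * rad n y"
    using AB by (intro add_mono R_bddD[OF E] R_bddD[OF F]) auto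
  finally show "rad n (\<lambda>k. S k \<star> y k) \<le> (C + D) * rad n y" by (simp add: algebra_simps)
qed

lemma R_bdd_mult:
  assumes E: "R_bdd C E" and F: "R_bdd D F"
  shows "R_bdd (C * D) {A * B | A B. A \<in> E \<and> B \<in> F}"
  unfolding R_bdd_def
proof (intro conjI allI impI)
  show "0 \<le> C * D" using R_bdd_nonneg[OF E] R_bdd_nonneg[OF F] by simp
  fix n :: nat and S :: "nat \<Rightarrow> 'a op" and y :: "nat \<Rightarrow> 'a"
  assume "\<forall>k<n. S k \<in> {A * B | A B. A \<in> E \<and> B \<in> F}"
  then obtain A B where AB: "\<And>k. k < n \<Longrightarrow> S k = A k * B k \<and> A k \<in> E \<and> B k \<in> F"
    by simp metis
  then have "rad n (\<lambda>k. S k \<star> y k) = rad n (\<lambda>k. A k \<star> (B k \<star> y k))"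
    by (intro rad_cong) simp
  also have "\<dots> \<le> C * rad n (\<lambda>k. B k \<star> y k)"
    using AB by (intro R_bddD[OF E]) auto
  also have "\<dots> \<le> C * (D * rad n y)"
    using AB R_bdd_nonneg[OF E] by (intro mult_left_mono R_bddD[OF F]) auto
  finally show "rad n (\<lambda>k. S k \<star> y k) \<le> C * D * rad n y" by (simp add: algebra_simps)
qed

lemma R_bdd_power:
  assumes E: "R_bdd C E"
  shows "R_bdd (C ^ j) {A ^ j | A. A \<in> E}"
proof (induction j)
  case 0
  show ?case by (rule R_bdd_subset[OF _ _, of _ "{1}"]) (auto intro: R_bdd_one)
next
  case (Suc j)
  show ?case
    by (rule R_bdd_subset[OF R_bdd_mult[OF E Suc, folded power_Suc]]) auto
qed

lemma R_bdd_scaleC: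
  assumes E: "R_bdd C E" and "0 \<le> b"
  shows "R_bdd (2 * b * C) {c *\<^sub>C A | c A. cmod c \<le> b \<and> A \<in> E}"
  unfolding R_bdd_def
proof (intro conjI allI impI)
  show "0 \<le> 2 * b * C" using R_bdd_nonneg[OF E] \<open>0 \<le> b\<close> by simp
  fix n :: nat and S :: "nat \<Rightarrow> 'a op" and y :: "nat \<Rightarrow> 'a"
  assume "\<forall>k<n. S k \<in> {c *\<^sub>C A | c A. cmod c \<le> b \<and> A \<in> E}"
  then obtain c A where AB: "\<And>k. k < n \<Longrightarrow> S k = c k *\<^sub>C A k \<and> cmod (c k) \<le> b \<and> A k \<in> E"
    by simp metis
  then have "rad n (\<lambda>k. S k \<star> y k) = rad n (\<lambda>k. A k \<star> (c k *\<^sub>C y k))"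
    by (intro rad_cong) simp
  also have "\<dots> \<le> C * rad n (\<lambda>k. c k *\<^sub>C y k)"
    using AB by (intro R_bddD[OF E]) auto
  also have "\<dots> \<le> C * (2 * b * rad n y)"
    using AB R_bdd_nonneg[OF E] \<open>0 \<le> b\<close> by (intro mult_left_mono rad_contract_complex) auto
  finally show "rad n (\<lambda>k. S k \<star> y k) \<le> 2 * b * C * rad n y" by (simp add: algebra_simps)
qed

text \<open>As a function of one of the operators, with the others fixed, the average is convex and
  continuous; so the operators can be moved one after the other into the closed convex hull.\<close>

lemma R_bdd_closure_convex_hull:
  assumes E: "R_bdd C E"
  shows "R_bdd C (closure (convex hull E))"
  unfolding R_bdd_def
proof (intro conjI allI impI)
  show "0 \<le> C" by (rule R_bdd_nonneg[OF E])
  let ?H = "closure (convex hull E)"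
  have EH: "E \<subseteq> ?H" by (meson closure_subset hull_subset order_trans)
  fix n :: nat and S :: "nat \<Rightarrow> 'a op" and y :: "nat \<Rightarrow> 'a"
  assume S: "\<forall>k<n. S k \<in> ?H"
  have "rad n (\<lambda>k. S k \<star> y k) \<le> C * rad n y"
    if "m \<le> n" "\<And>k. k < m \<Longrightarrow> S k \<in> ?H" "\<And>k. m \<le> k \<Longrightarrow> k < n \<Longrightarrow> S k \<in> E" for m S
    using that
  proof (induction m arbitrary: S)
    case 0
    then show ?case by (intro R_bddD[OF E]) simp
  next
    case (Suc m)
    let ?g = "\<lambda>A k. (if k = m then A else S k) \<star> y k"
    define X where "X = {A. rad n (?g A) \<le> C * rad n y}"
    have "A \<in> X" if "A \<in> E" for A
    proof -
      have "rad n (\<lambda>k. (S(m := A)) k \<star> y k) \<le> C * rad n y"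
      proof (rule Suc.IH)
        show "m \<le> n" using Suc.prems(1) by simp
        show "(S(m := A)) k \<in> ?H" if "k < m" for k
          using Suc.prems(2)[of k] that by simp
        show "(S(m := A)) k \<in> E" if "m \<le> k" "k < n" for k
          using Suc.prems(3)[of k] that \<open>A \<in> E\<close> by simp
      qed
      then show ?thesis by (simp add: X_def fun_upd_def)
    qed
    moreover have "convex X"
    proof (rule convexI)
      fix A B and u v :: real
      assume AB: "A \<in> X" "B \<in> X" and uv: "0 \<le> u" "0 \<le> v" "u + v = 1"
      have "?g (u *\<^sub>R A + v *\<^sub>R B) = (\<lambda>k. u *\<^sub>R ?g A k + v *\<^sub>R ?g B k)"
        using uv(3) by (auto simp: scaleR_left_distrib[symmetric])
      then have "rad n (?g (u *\<^sub>R A + v *\<^sub>R B)) \<le> u * rad n (?g A) + v * rad n (?g B)"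
        using rad_add[of n "\<lambda>k. u *\<^sub>R ?g A k" "\<lambda>k. v *\<^sub>R ?g B k"] uv by (simp only: rad_scaleR abs_of_nonneg)
      also have "\<dots> \<le> u * (C * rad n y) + v * (C * rad n y)"
        using AB uv by (intro add_mono mult_left_mono) (simp_all add: X_def)
      also have "\<dots> = C * rad n y" using uv(3) by (simp add: distrib_right[symmetric])
      finally show "u *\<^sub>R A + v *\<^sub>R B \<in> X" by (simp add: X_def)
    qed
    moreover have "closed X"
      unfolding X_def
    proof (rule closed_Collect_le)
      have cont: "continuous_on UNIV (\<lambda>A. ?g A k)" for k
        by (cases "k = m") (simp_all add: continuous_intros)
      then show "continuous_on UNIV (\<lambda>A. rad n (?g A))"
        unfolding rad_def L2_set_def
        by (intro continuous_on_real_sqrt continuous_on_sum continuous_on_power continuous_on_norm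
            continuous_on_scaleR continuous_on_const cont)
    qed simp
    ultimately have "?H \<subseteq> X" by (intro closure_minimal hull_minimal) auto
    moreover have "S m \<in> ?H" using Suc.prems(2) by simp
    ultimately have "rad n (?g (S m)) \<le> C * rad n y" by (auto simp: X_def)
    moreover have "?g (S m) = (\<lambda>k. S k \<star> y k)" by auto
    ultimately show ?case by simp
  qed
  from this[of n S] S show "rad n (\<lambda>k. S k \<star> y k) \<le> C * rad n y" by simp
qed

lemma convex_sum_le_1:
  fixes b :: "'i \<Rightarrow> 'v::real_vector"
  assumes "convex H" "0 \<in> H" "finite I" "\<And>i. i \<in> I \<Longrightarrow> 0 \<le> a i" "\<And>i. i \<in> I \<Longrightarrow> b i \<in> H" "sum a I \<le> 1"
  shows "(\<Sum>i\<in>I. a i *\<^sub>R b i) \<in> H"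
proof (cases "sum a I = 0")
  case True
  then have "\<And>i. i \<in> I \<Longrightarrow> a i = 0" using assms by (simp add: sum_nonneg_eq_0_iff)
  then show ?thesis using \<open>0 \<in> H\<close> by simp
next
  case False
  define s where "s = sum a I"
  have s: "0 < s" "s \<le> 1" using False assms by (auto simp: s_def sum_nonneg order_less_le)
  have "(\<Sum>i\<in>I. (a i / s) *\<^sub>R b i) \<in> H"
    using assms s by (intro convex_sum) (simp_all add: s_def sum_divide_distrib[symmetric])
  then have "s *\<^sub>R (\<Sum>i\<in>I. (a i / s) *\<^sub>R b i) + (1 - s) *\<^sub>R 0 \<in> H"
    using s assms(1,2) by (intro convexD) auto
  moreover have "s *\<^sub>R (\<Sum>i\<in>I. (a i / s) *\<^sub>R b i) = (\<Sum>i\<in>I. a i *\<^sub>R b i)"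
    using s by (simp add: scaleR_sum_right)
  ultimately show ?thesis by simp
qed

text \<open>Series whose coefficients have an absolute sum at most \<open>b\<close> are limits of convex combinations of
  elements \<open>c A\<close> with \<open>|c| \<le> b\<close>, so convexity replaces a summation of constants.\<close>

lemma R_bdd_series:
  assumes E: "R_bdd C E" and "0 < b"
    and F: "\<And>A. A \<in> F \<Longrightarrow> \<exists>c B. (\<forall>n. B n \<in> E) \<and> summable (\<lambda>n. cmod (c n)) \<and>
      (\<Sum>n. cmod (c n)) \<le> b \<and> (\<lambda>n. c n *\<^sub>C B n) sums A"
  shows "R_bdd (2 * b * C) F"
proof (rule R_bdd_subset)
  let ?E = "{c *\<^sub>C A | c A. cmod c \<le> b \<and> A \<in> E}"
  show "R_bdd (2 * b * C) (closure (convex hull ?E))"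
    using E \<open>0 < b\<close> by (intro R_bdd_closure_convex_hull R_bdd_scaleC) auto
  show "F \<subseteq> closure (convex hull ?E)"
  proof
    fix A assume "A \<in> F"
    from F[OF this] obtain c B where B: "\<And>n::nat. B n \<in> E" and c: "summable (\<lambda>n. cmod (c n))"
      and cb: "(\<Sum>n. cmod (c n)) \<le> b" and A: "(\<lambda>n. c n *\<^sub>C B n) sums A" by blast
    have "(\<Sum>n<M. c n *\<^sub>C B n) \<in> convex hull ?E" for M
    proof -
      have "(\<Sum>n<M. (cmod (c n) / b) *\<^sub>R ((of_real b * sgn (c n)) *\<^sub>C B n)) \<in> convex hull ?E"
      proof (rule convex_sum_le_1)
        have "0 *\<^sub>C B 0 \<in> ?E"
          using B[of 0] \<open>0 < b\<close> by (intro CollectI exI[of _ 0] exI[of _ "B 0"]) simp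
        then show "0 \<in> convex hull ?E" by (simp only: scaleC_zero_left hull_inc)
        show "(of_real b * sgn (c n)) *\<^sub>C B n \<in> convex hull ?E" for n
          using B \<open>0 < b\<close> by (intro hull_inc CollectI exI conjI) (auto simp: norm_mult norm_sgn)
        have "(\<Sum>n<M. cmod (c n)) \<le> b"
          using sum_le_suminf[OF c, of "{..<M}"] cb by simp
        then show "(\<Sum>n<M. cmod (c n) / b) \<le> 1"
          using \<open>0 < b\<close> by (simp add: sum_divide_distrib[symmetric])
      qed (use \<open>0 < b\<close> in auto)
      moreover have "of_real (cmod (c n) / b) * (of_real b * sgn (c n)) = c n" for n
        using \<open>0 < b\<close> by (cases "c n = 0") (simp_all add: sgn_eq)
      ultimately show ?thesis by (simp add: scaleR_scaleC scaleC_scaleC)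
    qed
    with A show "A \<in> closure (convex hull ?E)"
      unfolding sums_def closure_sequential by (intro exI[of _ "\<lambda>M. \<Sum>n<M. c n *\<^sub>C B n"]) auto
  qed
qed

text \<open>For series with a different set in each place, the triangle inequality adds the constants.\<close>

lemma R_bdd_suminf:
  assumes E: "\<And>j::nat. R_bdd (C j) (E j)" and C: "summable C"
    and F: "\<And>A. A \<in> F \<Longrightarrow> \<exists>B. (\<forall>j. B j \<in> E j) \<and> B sums A"
  shows "R_bdd (suminf C) F"
  unfolding R_bdd_def
proof (intro conjI allI impI)
  have C0: "0 \<le> C j" for j by (rule R_bdd_nonneg[OF E])
  show "0 \<le> suminf C" by (intro suminf_nonneg C C0)
  fix n :: nat and S :: "nat \<Rightarrow> 'a op" and y :: "nat \<Rightarrow> 'a"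
  assume "\<forall>k<n. S k \<in> F"
  then have "\<forall>k. \<exists>B. k < n \<longrightarrow> (\<forall>j. B j \<in> E j) \<and> B sums S k"
    using F by blast
  from choice[OF this] obtain B where "\<forall>k. k < n \<longrightarrow> (\<forall>j. B k j \<in> E j) \<and> B k sums S k" ..
  then have B: "\<And>k j. k < n \<Longrightarrow> B k j \<in> E j" "\<And>k. k < n \<Longrightarrow> B k sums S k"
    by auto
  have lim: "(\<lambda>M. rad n (\<lambda>k. (\<Sum>j<M. B k j) \<star> y k)) \<longlonglongrightarrow> rad n (\<lambda>k. S k \<star> y k)"
    using B(2) unfolding sums_def by (intro tendsto_rad tendsto_intros) auto
  have "rad n (\<lambda>k. (\<Sum>j<M. B k j) \<star> y k) \<le> suminf C * rad n y" for M
  proof -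
    have "rad n (\<lambda>k. (\<Sum>j<M. B k j) \<star> y k) \<le> (\<Sum>j<M. rad n (\<lambda>k. B k j \<star> y k))"
      by (simp add: op_app_sum rad_sum)
    also have "\<dots> \<le> (\<Sum>j<M. C j * rad n y)"
      using B(1) by (intro sum_mono R_bddD[OF E]) auto
    also have "\<dots> \<le> suminf C * rad n y"
      unfolding sum_distrib_right[symmetric]
      by (intro mult_right_mono sum_le_suminf C) (auto simp: C0)
    finally show ?thesis .
  qed
  with lim show "rad n (\<lambda>k. S k \<star> y k) \<le> suminf C * rad n y"
    by (blast intro: LIMSEQ_le_const2)
qed

text \<open>Independent Rademacher variables take each pattern of \<open>n\<close> signs with probability \<open>2\<^sup>-\<^sup>n\<close>, so the
  \<open>L\<^sub>2\<close>-norm is a normalised average over patterns. The integrand is a continuous function of finitely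
  many random variables, which makes it measurable even if the range is not separable.\<close>

lemma Lp_seminorm_rademacher:
  fixes x :: "nat \<Rightarrow> 'x::complex_banach"
  assumes r: "rademacher_sequence \<Omega> r" and n: "n \<ge> 1"
  shows "Lp_seminorm \<Omega> 2 (\<lambda>\<omega>. \<Sum>k=1..n. r k \<omega> *\<^sub>R x k) = rad n (\<lambda>k. x (Suc k)) / sqrt (2 ^ n)"
proof -
  interpret prob_space \<Omega> using r by (simp add: rademacher_sequence_def)
  have ind: "indep_vars (\<lambda>_. borel) r {1..}"
    and half: "\<And>k. k \<ge> 1 \<Longrightarrow> prob {\<omega>\<in>space \<Omega>. r k \<omega> = 1} = 1 / 2"
      "\<And>k. k \<ge> 1 \<Longrightarrow> prob {\<omega>\<in>space \<Omega>. r k \<omega> = - 1} = 1 / 2"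
    using r by (auto simp: rademacher_sequence_def)
  have rv [measurable]: "r k \<in> borel_measurable \<Omega>" if "k \<ge> 1" for k
    using ind that unfolding indep_vars_def by auto
  have rS [measurable]: "r (Suc k) \<in> borel_measurable \<Omega>" for k
    by (rule rv) simp
  define h where "h \<rho> = norm (\<Sum>k<n. \<rho> k *\<^sub>R x (Suc k)) powr 2" for \<rho> :: "nat \<Rightarrow> real"
  have "continuous_on UNIV (\<lambda>\<rho> :: nat \<Rightarrow> real. norm (\<Sum>k<n. \<rho> k *\<^sub>R x (Suc k)))"
    by (intro continuous_intros continuous_on_product_coordinates)
  then have "continuous_on UNIV h"
    unfolding h_def by (rule continuous_on_powr') auto
  then have hm: "h \<in> borel_measurable borel"
    by (rule borel_measurable_continuous_onI)
  have "(\<lambda>\<omega> k. r (Suc k) \<omega>) \<in> borel_measurable \<Omega>"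
    by (rule measurable_coordinatewise_then_product) simp
  from measurable_compose[OF this hm]
  have meas: "(\<lambda>\<omega>. h (\<lambda>k. r (Suc k) \<omega>)) \<in> borel_measurable \<Omega>" .
  define Ev where "Ev A = {\<omega>\<in>space \<Omega>. \<forall>k<n. r (Suc k) \<omega> = choice_sign A k}" for A
  have Ev_meas [measurable]: "Ev A \<in> events" for A
    unfolding Ev_def by measurable
  have Ev: "prob (Ev A) = (1 / 2) ^ n" for A
  proof -
    let ?J = "Suc ` {..<n}"
    let ?S = "\<lambda>k. {choice_sign A (k - 1)}"
    have "prob (\<Inter>k\<in>?J. r k -` ?S k \<inter> space \<Omega>) = (\<Prod>k\<in>?J. prob (r k -` ?S k \<inter> space \<Omega>))"
      using n by (intro indep_varsD[OF ind]) (auto simp: lessThan_empty_iff)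
    also have "(\<Inter>k\<in>?J. r k -` ?S k \<inter> space \<Omega>) = Ev A"
    proof -
      have "0 \<in> {..<n}" using n by simp
      then have "{..<n} \<noteq> {}" by blast
      then show ?thesis by (auto simp: Ev_def)
    qed
    also have "(\<Prod>k\<in>?J. prob (r k -` ?S k \<inter> space \<Omega>)) = (\<Prod>k\<in>?J. 1 / 2)"
    proof (rule prod.cong)
      fix k assume "k \<in> ?J"
      then have "k \<ge> 1" by auto
      have "r k -` ?S k \<inter> space \<Omega> = {\<omega>\<in>space \<Omega>. r k \<omega> = choice_sign A (k - 1)}" by auto
      then show "prob (r k -` ?S k \<inter> space \<Omega>) = 1 / 2"
        using half[OF \<open>k \<ge> 1\<close>] by (auto simp: choice_sign_def)
    qed simp
    finally show ?thesis by (simp add: card_image)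
  qed
  have sign: "AE \<omega> in \<Omega>. r (Suc k) \<omega> = 1 \<or> r (Suc k) \<omega> = - 1" for k
  proof -
    have "prob ({\<omega>\<in>space \<Omega>. r (Suc k) \<omega> = 1} \<union> {\<omega>\<in>space \<Omega>. r (Suc k) \<omega> = - 1}) = 1"
      by (subst finite_measure_Union) (auto simp: half)
    then have "AE \<omega> in \<Omega>. \<omega> \<in> {\<omega>\<in>space \<Omega>. r (Suc k) \<omega> = 1} \<union> {\<omega>\<in>space \<Omega>. r (Suc k) \<omega> = - 1}"
      by (subst (asm) prob_eq_1) auto
    then show ?thesis by eventually_elim auto
  qed
  have AE: "AE \<omega> in \<Omega>. h (\<lambda>k. r (Suc k) \<omega>) = (\<Sum>A\<in>Pow {..<n}. indicator (Ev A) \<omega> * h (choice_sign A))"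
  proof -
    have "AE \<omega> in \<Omega>. \<forall>k\<in>{..<n}. r (Suc k) \<omega> = 1 \<or> r (Suc k) \<omega> = - 1"
      by (rule AE_finite_allI) (auto intro: sign)
    then show ?thesis using AE_space
    proof eventually_elim
      fix \<omega> assume *: "\<forall>k\<in>{..<n}. r (Suc k) \<omega> = 1 \<or> r (Suc k) \<omega> = - 1" and sp: "\<omega> \<in> space \<Omega>"
      let ?A = "{k\<in>{..<n}. r (Suc k) \<omega> = 1}"
      have in_Ev: "\<omega> \<in> Ev A \<longleftrightarrow> A = ?A" if "A \<in> Pow {..<n}" for A
      proof
        assume "\<omega> \<in> Ev A"
        then have "r (Suc k) \<omega> = choice_sign A k" if "k < n" for k using that by (simp add: Ev_def)
        then have "r (Suc k) \<omega> = 1 \<longleftrightarrow> k \<in> A" if "k < n" for k using that by (simp add: choice_sign_def)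
        then show "A = ?A" using \<open>A \<in> Pow {..<n}\<close> by blast
      next
        assume A: "A = ?A"
        have "r (Suc k) \<omega> = choice_sign A k" if "k < n" for k
          using that * by (subst A) (auto simp: choice_sign_def)
        then show "\<omega> \<in> Ev A" using sp by (simp add: Ev_def)
      qed
      have "(\<Sum>A\<in>Pow {..<n}. indicator (Ev A) \<omega> * h (choice_sign A))
          = (\<Sum>A\<in>Pow {..<n}. if A = ?A then h (choice_sign A) else 0)"
        by (rule sum.cong) (simp_all add: in_Ev indicator_def)
      also have "\<dots> = h (choice_sign ?A)"
        by (subst sum.delta) auto
      also have "\<dots> = h (\<lambda>k. r (Suc k) \<omega>)"
        using * unfolding h_def by (intro arg_cong[where f = "\<lambda>z. norm z powr 2"] sum.cong) (auto simp: choice_sign_def)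
      finally show "h (\<lambda>k. r (Suc k) \<omega>) = (\<Sum>A\<in>Pow {..<n}. indicator (Ev A) \<omega> * h (choice_sign A))" ..
    qed
  qed
  have "(\<integral>\<omega>. h (\<lambda>k. r (Suc k) \<omega>) \<partial>\<Omega>) = (\<integral>\<omega>. (\<Sum>A\<in>Pow {..<n}. indicator (Ev A) \<omega> * h (choice_sign A)) \<partial>\<Omega>)"
    by (intro integral_cong_AE[OF meas _ AE] borel_measurable_sum borel_measurable_times
        borel_measurable_indicator Ev_meas borel_measurable_const)
  also have "\<dots> = (\<Sum>A\<in>Pow {..<n}. h (choice_sign A) / 2 ^ n)"
  proof -
    have EvS: "Ev A \<inter> space \<Omega> = Ev A" for A by (auto simp: Ev_def)
    have int: "integrable \<Omega> (\<lambda>\<omega>. indicator (Ev A) \<omega> * h (choice_sign A))" for A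
      by (intro integrable_mult_left integrable_real_indicator Ev_meas) (simp add: emeasure_eq_measure)
    have "(\<integral>\<omega>. indicator (Ev A) \<omega> * h (choice_sign A) \<partial>\<Omega>) = h (choice_sign A) / 2 ^ n" for A
      by (simp only: integral_mult_left_zero integral_indicator EvS) (simp add: Ev power_one_over)
    then show ?thesis by (simp only: Bochner_Integration.integral_sum[OF int])
  qed
  also have "\<dots> = (\<Sum>A\<in>Pow {..<n}. h (choice_sign A)) / 2 ^ n"
    by (simp add: sum_divide_distrib)
  finally have int: "(\<integral>\<omega>. h (\<lambda>k. r (Suc k) \<omega>) \<partial>\<Omega>) = (\<Sum>A\<in>Pow {..<n}. h (choice_sign A)) / 2 ^ n" .
  have "(\<Sum>k=1..n. r k \<omega> *\<^sub>R x k) = (\<Sum>k<n. r (Suc k) \<omega> *\<^sub>R x (Suc k))" for \<omega>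
    by (simp add: sum.atLeast1_atMost_eq)
  then have "Lp_seminorm \<Omega> 2 (\<lambda>\<omega>. \<Sum>k=1..n. r k \<omega> *\<^sub>R x k) = (\<integral>\<omega>. h (\<lambda>k. r (Suc k) \<omega>) \<partial>\<Omega>) powr (1 / 2)"
    by (simp add: Lp_seminorm_def h_def)
  also have "\<dots> = sqrt ((\<Sum>A\<in>Pow {..<n}. h (choice_sign A)) / 2 ^ n)"
    unfolding int by (intro powr_half_sqrt divide_nonneg_nonneg sum_nonneg) (auto simp: h_def)
  also have "\<dots> = rad n (\<lambda>k. x (Suc k)) / sqrt (2 ^ n)"
    unfolding rad_def L2_set_def real_sqrt_divide by (simp only: h_def powr_numeral norm_ge_zero)
  finally show ?thesis .
qed

lemma R_bounded_imp_R_bdd: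
  assumes r: "rademacher_sequence \<Omega> r" and E: "R_bounded \<Omega> r E"
  shows "\<exists>C. R_bdd C {A. op_map A \<in> E}"
proof -
  obtain C where C: "C \<ge> 0" and le: "\<And>n S x. n \<ge> 1 \<Longrightarrow> (\<forall>k\<in>{1..n}. S k \<in> E) \<Longrightarrow>
      Lp_seminorm \<Omega> 2 (\<lambda>\<omega>. \<Sum>k=1..n. r k \<omega> *\<^sub>R blinfun_apply (S k) (x k))
        \<le> C * Lp_seminorm \<Omega> 2 (\<lambda>\<omega>. \<Sum>k=1..n. r k \<omega> *\<^sub>R x k)"
    using E unfolding R_bounded_def by blast
  have "rad n (\<lambda>k. S k \<star> y k) \<le> C * rad n y" if S: "\<And>k. k < n \<Longrightarrow> op_map (S k) \<in> E" for n S y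
  proof (cases "n = 0")
    case True
    then show ?thesis by (simp add: rad_def L2_set_def)
  next
    case False
    then have n: "n \<ge> 1" by simp
    have SE: "\<forall>k\<in>{1..n}. op_map (S (k - 1)) \<in> E"
      using S by auto
    have "Lp_seminorm \<Omega> 2 (\<lambda>\<omega>. \<Sum>k=1..n. r k \<omega> *\<^sub>R (S (k - 1) \<star> y (k - 1)))
        = rad n (\<lambda>k. S k \<star> y k) / sqrt (2 ^ n)"
      "Lp_seminorm \<Omega> 2 (\<lambda>\<omega>. \<Sum>k=1..n. r k \<omega> *\<^sub>R y (k - 1)) = rad n y / sqrt (2 ^ n)"
      by (simp_all only: Lp_seminorm_rademacher[OF r n] diff_Suc_1)
    with le[OF n SE, of "\<lambda>k. y (k - 1)"]
    have "rad n (\<lambda>k. S k \<star> y k) / sqrt (2 ^ n) \<le> C * (rad n y / sqrt (2 ^ n))"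
      by (simp only:)
    then show ?thesis by (simp add: field_simps)
  qed
  with C show ?thesis unfolding R_bdd_def by blast
qed

section \<open>Resolvents of Ritt operators\<close>

definition is_res :: "complex \<Rightarrow> 'x::complex_normed_vector op \<Rightarrow> 'x op \<Rightarrow> bool"
  where "is_res w T R \<longleftrightarrow> (w *\<^sub>C 1 - T) * R = 1 \<and> R * (w *\<^sub>C 1 - T) = 1"

definition res :: "complex \<Rightarrow> 'x::complex_normed_vector op \<Rightarrow> 'x op"
  where "res w T = (THE R. is_res w T R)"

lemma is_res_unique: "is_res w T R \<Longrightarrow> is_res w T R' \<Longrightarrow> R = R'"
  unfolding is_res_def by (metis mult.assoc mult.left_neutral mult.right_neutral)

lemma res_eq: "is_res w T R \<Longrightarrow> res w T = R"
  unfolding res_def by (blast intro: the_equality is_res_unique)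

lemma is_op_inverse_op_map:
  "is_op_inverse (w *\<^sub>C id_blinfun - op_map T) S \<longleftrightarrow> (\<exists>R. S = op_map R \<and> is_res w T R)"
proof -
  have eq: "w *\<^sub>C id_blinfun - op_map T = op_map (w *\<^sub>C 1 - T)"
    by (simp add: minus_op.rep_eq scaleC_op.rep_eq one_op.rep_eq)
  have 1: "is_op_inverse (w *\<^sub>C id_blinfun - op_map T) (op_map R) \<longleftrightarrow> is_res w T R" for R
    unfolding eq is_op_inverse_def is_res_def
    using op_map[of R] by (simp add: times_op.rep_eq[symmetric] one_op.rep_eq[symmetric] op_map_inject)
  show ?thesis
  proof
    assume *: "is_op_inverse (w *\<^sub>C id_blinfun - op_map T) S"
    then obtain R where "S = op_map R"
      unfolding is_op_inverse_def by (metis Op_inverse)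
    with * 1 show "\<exists>R. S = op_map R \<and> is_res w T R" by blast
  qed (use 1 in blast)
qed

lemma resolvent_op_map:
  assumes "is_res w T R" shows "resolvent w (op_map T) = op_map R"
  unfolding resolvent_def
  by (rule the_equality)
    (use assms is_res_unique in \<open>auto simp: is_op_inverse_op_map\<close>)

lemma res_commute:
  assumes R: "is_res w T R" and A: "A * T = T * A" shows "A * R = R * A"
proof -
  have "A * (w *\<^sub>C 1 - T) = (w *\<^sub>C 1 - T) * A" using A by (simp add: algebra_simps)
  then have "R * (A * (w *\<^sub>C 1 - T)) * R = R * ((w *\<^sub>C 1 - T) * A) * R" by simp
  moreover have "R * (A * (w *\<^sub>C 1 - T)) * R = R * A"
    using R by (simp add: is_res_def mult.assoc)
  moreover have "R * ((w *\<^sub>C 1 - T) * A) * R = A * R"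
    using R by (simp add: is_res_def mult.assoc[symmetric])
  ultimately show ?thesis by simp
qed

lemma norm_op_power_le: "norm (A ^ n :: 'x::complex_normed_vector op) \<le> norm A ^ n"
proof (induction n)
  case (Suc n)
  have "norm (A ^ Suc n) \<le> norm A * norm (A ^ n)" by (simp add: norm_mult_ineq)
  also have "\<dots> \<le> norm A * norm A ^ n" by (intro mult_left_mono Suc) simp
  finally show ?case by simp
qed (simp add: norm_one_op_le)

lemma sums_scaleC: "f sums s \<Longrightarrow> (\<lambda>n. c *\<^sub>C f n) sums (c *\<^sub>C s)"
  unfolding sums_def by (simp add: scaleC_sum_right[symmetric] tendsto_scaleC)

text \<open>With \<open>X = (w - l) R(w,T)\<close> one has \<open>l - T = (1 - X)(w - T)\<close>.\<close>

lemma is_res_neumann: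
  fixes T :: "'x::complex_banach op"
  assumes R: "is_res w T R" and X: "X = (w - l) *\<^sub>C R" "norm X < 1"
    and Y: "(\<lambda>j. X ^ j) sums Y"
  shows "is_res l T (R * Y)"
proof -
  have XY: "X * Y = Y - 1" "Y * X = Y - 1"
  proof -
    have "(\<lambda>j. X ^ Suc j) sums (Y - 1)" using Y by (subst sums_Suc_iff) simp
    moreover have "(\<lambda>j. X ^ Suc j) sums (X * Y)"
      using bounded_linear.sums[OF bounded_linear_mult_right Y, of X] by simp
    moreover have "(\<lambda>j. X ^ Suc j) sums (Y * X)"
      using bounded_linear.sums[OF bounded_linear_mult_left Y, of X] by (simp add: power_commutes)
    ultimately show "X * Y = Y - 1" "Y * X = Y - 1" by (auto dest: sums_unique2)
  qed
  have RX: "R * X = X * R" by (simp add: X)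
  have RY: "R * Y = Y * R"
  proof (rule sums_unique2)
    show "(\<lambda>j. R * X ^ j) sums (R * Y)" by (rule bounded_linear.sums[OF bounded_linear_mult_right Y])
    have "R * X ^ j = X ^ j * R" for j
      using power_commuting_commutes[of X R j] RX by simp
    then show "(\<lambda>j. R * X ^ j) sums (Y * R)"
      using bounded_linear.sums[OF bounded_linear_mult_left Y, of R] by simp
  qed
  have a: "l *\<^sub>C 1 - T = (1 - X) * (w *\<^sub>C 1 - T)" "l *\<^sub>C 1 - T = (w *\<^sub>C 1 - T) * (1 - X)"
  proof -
    have "X * (w *\<^sub>C 1 - T) = (w - l) *\<^sub>C 1" "(w *\<^sub>C 1 - T) * X = (w - l) *\<^sub>C 1"
      unfolding X mult_scaleC_left mult_scaleC_right using R by (auto simp: is_res_def)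
    then show "l *\<^sub>C 1 - T = (1 - X) * (w *\<^sub>C 1 - T)" "l *\<^sub>C 1 - T = (w *\<^sub>C 1 - T) * (1 - X)"
      by (simp_all only: left_diff_distrib[of 1 X] right_diff_distrib[of _ 1 X] mult_1_left mult_1_right)
        (simp_all add: scaleC_diff_left)
  qed
  have "(l *\<^sub>C 1 - T) * (R * Y) = (1 - X) * ((w *\<^sub>C 1 - T) * R) * Y"
    by (simp add: a(1) mult.assoc)
  also have "(w *\<^sub>C 1 - T) * R = 1" using R by (simp add: is_res_def)
  also have "(1 - X) * 1 * Y = 1" using XY by (simp add: left_diff_distrib)
  finally have 1: "(l *\<^sub>C 1 - T) * (R * Y) = 1" .
  have "(R * Y) * (l *\<^sub>C 1 - T) = Y * (R * (w *\<^sub>C 1 - T)) * (1 - X)"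
    by (simp add: a(2) RY mult.assoc)
  also have "R * (w *\<^sub>C 1 - T) = 1" using R by (simp add: is_res_def)
  also have "Y * 1 * (1 - X) = 1" using XY by (simp add: right_diff_distrib)
  finally show ?thesis using 1 by (simp add: is_res_def)
qed

lemma is_res_power_series:
  fixes T :: "'x::complex_banach op"
  assumes T: "\<And>n. norm (T ^ n) \<le> C" and w: "cmod w > 1"
  shows "is_res w T (res w T)" and "(\<lambda>n. (1 / w) ^ Suc n *\<^sub>C T ^ n) sums res w T"
proof -
  define q where "q = 1 / w"
  have q: "cmod q < 1" "q \<noteq> 0" "q * w = 1" using w by (auto simp: q_def norm_divide divide_less_eq)
  have C: "0 \<le> C" using T[of 0] norm_ge_zero order_trans by blast
  have "summable (\<lambda>n. q ^ n *\<^sub>C T ^ n)"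
  proof (rule summable_comparison_test')
    show "summable (\<lambda>n. C * cmod q ^ n)" using q by (intro summable_mult summable_geometric) simp
    show "norm (q ^ n *\<^sub>C T ^ n) \<le> C * cmod q ^ n" if "n \<ge> 0" for n
      using mult_left_mono[OF T[of n], of "cmod q ^ n"] by (simp add: norm_scaleC norm_power mult.commute)
  qed
  then obtain S where S: "(\<lambda>n. q ^ n *\<^sub>C T ^ n) sums S" by (auto simp: summable_def)
  have TS: "q *\<^sub>C (T * S) = S - 1" "q *\<^sub>C (S * T) = S - 1"
  proof -
    have "(\<lambda>n. q ^ Suc n *\<^sub>C T ^ Suc n) sums (S - 1)" using S by (subst sums_Suc_iff) simp
    moreover have "(\<lambda>n. q ^ Suc n *\<^sub>C T ^ Suc n) sums (q *\<^sub>C (T * S))"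
      using sums_scaleC[OF bounded_linear.sums[OF bounded_linear_mult_right S, of T], of q]
      by (simp add: scaleC_scaleC)
    moreover have "(\<lambda>n. q ^ Suc n *\<^sub>C T ^ Suc n) sums (q *\<^sub>C (S * T))"
      using sums_scaleC[OF bounded_linear.sums[OF bounded_linear_mult_left S, of T], of q]
      by (simp add: scaleC_scaleC power_commutes)
    ultimately show "q *\<^sub>C (T * S) = S - 1" "q *\<^sub>C (S * T) = S - 1" by (auto dest: sums_unique2)
  qed
  have "is_res w T (q *\<^sub>C S)"
    unfolding is_res_def using TS q by (simp add: algebra_simps scaleC_diff_right scaleC_scaleC)
  moreover from res_eq[OF this] show "is_res w T (res w T)" using calculation by simp
  ultimately show "(\<lambda>n. (1 / w) ^ Suc n *\<^sub>C T ^ n) sums res w T"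
    using sums_scaleC[OF S, of q] res_eq by (fastforce simp: scaleC_scaleC q_def)
qed

text \<open>One summation by parts gains a factor \<open>1 - q\<close> and turns the coefficients into differences.\<close>

lemma sums_by_parts:
  fixes a :: "nat \<Rightarrow> 'b::complex_normed_vector"
  assumes "(\<lambda>n. q ^ n *\<^sub>C a n) sums S"
  shows "(\<lambda>n. q ^ Suc n *\<^sub>C (a (Suc n) - a n)) sums ((1 - q) *\<^sub>C S - a 0)"
proof -
  have "(\<lambda>n. q ^ Suc n *\<^sub>C a (Suc n)) sums (S - a 0)"
    using assms by (subst sums_Suc_iff) simp
  from sums_diff[OF this sums_scaleC[OF assms, of q]]
  have "(\<lambda>n. q ^ Suc n *\<^sub>C a (Suc n) - q *\<^sub>C q ^ n *\<^sub>C a n) sums (S - a 0 - q *\<^sub>C S)" .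
  moreover have "q ^ Suc n *\<^sub>C a (Suc n) - q *\<^sub>C q ^ n *\<^sub>C a n = q ^ Suc n *\<^sub>C (a (Suc n) - a n)" for n
    by (simp add: scaleC_diff_right scaleC_scaleC)
  moreover have "S - a 0 - q *\<^sub>C S = (1 - q) *\<^sub>C S - a 0"
    by (simp add: scaleC_diff_left)
  ultimately show ?thesis by simp
qed

text \<open>The tail from \<open>N\<close> on is compared with the telescoping series of \<open>1/n - 1/(n + 1)\<close>.\<close>

lemma sum_inverse_squares:
  fixes N :: nat assumes "N \<ge> 1"
  shows "summable (\<lambda>n. 1 / (real (n + N) + 1)\<^sup>2)" "(\<Sum>n. 1 / (real (n + N) + 1)\<^sup>2) \<le> 1 / real N"
proof -
  let ?f = "\<lambda>n. 1 / real (n + N)"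
  have "?f \<longlonglongrightarrow> 0"
    using LIMSEQ_ignore_initial_segment[OF lim_1_over_n, of N] by simp
  from telescope_sums'[OF this] have s: "(\<lambda>n. ?f n - ?f (Suc n)) sums (1 / real N)" by simp
  have le: "1 / (real (n + N) + 1)\<^sup>2 \<le> ?f n - ?f (Suc n)" for n
  proof -
    define x where "x = real (n + N)"
    have x: "x > 0" using assms by (simp add: x_def)
    have "1 / x - 1 / (x + 1) = 1 / (x * (x + 1))" using x by (simp add: field_simps)
    moreover have "1 / (x + 1)\<^sup>2 \<le> 1 / (x * (x + 1))"
      using x by (intro divide_left_mono) (auto simp: power2_eq_square)
    ultimately show ?thesis by (simp add: x_def algebra_simps)
  qed
  show sm: "summable (\<lambda>n. 1 / (real (n + N) + 1)\<^sup>2)"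
    by (rule summable_comparison_test'[OF sums_summable[OF s], of 0]) (use le in auto)
  show "(\<Sum>n. 1 / (real (n + N) + 1)\<^sup>2) \<le> 1 / real N"
    using suminf_le[OF le sm sums_summable[OF s]] sums_unique[OF s] by simp
qed

text \<open>For \<open>q = 1/w\<close> the operator \<open>(w - 1) R(w,T)\<close> is \<open>(1 - q) \<Sum>q\<^sup>nT\<^sup>n\<close>. Up to \<open>N \<approx> 1/|1 - q|\<close> the
  coefficients have a bounded sum. Beyond \<open>N\<close>, two summations by parts turn the powers into second
  differences \<open>T\<^sup>m(T - 1)\<^sup>2\<close>, which are products of two first differences and so of order \<open>1/m\<^sup>2\<close>. All
  operators are thus absolutely convex combinations, with coefficient sums bounded independently of
  \<open>w\<close>.\<close>

lemma R_ritt_resolvent_exterior: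
  fixes T :: "'x::complex_banach op"
  assumes C1: "R_bdd C1 (range ((^) T))"
    and C2: "R_bdd C2 {real n *\<^sub>R (T ^ n - T ^ (n - 1)) | n. n \<ge> 1}"
  shows "R_bdd (8 * C1 + 2 * C2 + 8 * (C2 * C2)) {(w - 1) *\<^sub>C res w T | w. cmod w > 1}"
proof -
  let ?E1 = "range ((^) T)" and ?E2 = "{real n *\<^sub>R (T ^ n - T ^ (n - 1)) | n. n \<ge> 1}"
  let ?E3 = "{A * B | A B. A \<in> ?E2 \<and> B \<in> ?E2}"
  define F where "F b E = {A. \<exists>c B. (\<forall>n. B n \<in> E) \<and> summable (\<lambda>n. cmod (c n)) \<and>
      (\<Sum>n. cmod (c n)) \<le> b \<and> (\<lambda>n. c n *\<^sub>C B n) sums A}" for b and E :: "'x op set"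
  have FI: "A \<in> F b E" if "\<And>n. B n \<in> E" "summable (\<lambda>n. cmod (c n))" "(\<Sum>n. cmod (c n)) \<le> b"
      "(\<lambda>n. c n *\<^sub>C B n) sums A" for A b E and B :: "nat \<Rightarrow> 'x op" and c
    using that unfolding F_def by blast
  have RF: "R_bdd (2 * b * C) (F b E)" if "R_bdd C E" "b > 0" for b C E
    using that by (rule R_bdd_series) (simp add: F_def)
  have E3: "R_bdd (C2 * C2) ?E3" by (rule R_bdd_mult[OF C2 C2])
  have bdd: "norm (T ^ n) \<le> C1" for n by (rule R_bdd_norm[OF C1]) simp
  define D where "D n = T ^ Suc n - T ^ n" for n
  have DE: "real (Suc n) *\<^sub>R D n \<in> ?E2" for n
    by (rule CollectI, rule exI[of _ "Suc n"]) (simp add: D_def)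
  have "(w - 1) *\<^sub>C res w T \<in> {A + B | A B. A \<in> {A + B | A B. A \<in> F 4 ?E1 \<and> B \<in> F 1 ?E2} \<and> B \<in> F 4 ?E3}"
    if w: "cmod w > 1" for w
  proof -
    define q where "q = 1 / w"
    have q: "cmod q < 1" "q \<noteq> 0" "q * w = 1" "w * q = 1" "q \<noteq> 1" using w by (auto simp: q_def norm_divide divide_less_eq)
    define \<delta> where "\<delta> = cmod (1 - q)"
    have \<delta>: "0 < \<delta>" "\<delta> \<le> 2"
      using q norm_triangle_ineq4[of 1 q] by (auto simp: \<delta>_def)
    \<comment> \<open>up to this index the coefficients \<open>(1 - q) q\<^sup>n\<close> are summable by the trivial bound \<open>|1 - q|\<close>\<close>
    define N where "N = nat \<lceil>1 / \<delta>\<rceil>"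
    have N: "1 / \<delta> \<le> real N" "real N \<le> 1 / \<delta> + 1" "N \<ge> 1"
    proof -
      have pos: "0 < 1 / \<delta>" using \<delta> by simp
      then have "real N = of_int \<lceil>1 / \<delta>\<rceil>" by (simp add: N_def)
      then show "1 / \<delta> \<le> real N" "real N \<le> 1 / \<delta> + 1" by linarith+
      with pos show "N \<ge> 1" by linarith
    qed
    have N\<delta>: "real N * \<delta> \<le> 3" "1 \<le> real N * \<delta>"
      using N \<delta> by (auto simp: field_simps)
    define S where "S = w *\<^sub>C res w T"
    have "(\<lambda>n. w *\<^sub>C (1 / w) ^ Suc n *\<^sub>C T ^ n) sums S"
      unfolding S_def by (rule sums_scaleC[OF is_res_power_series(2)[OF bdd w]])
    then have S: "(\<lambda>n. q ^ n *\<^sub>C T ^ n) sums S"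
      using q by (simp add: scaleC_scaleC q_def[symmetric] mult.assoc[symmetric])
    have goal: "(w - 1) *\<^sub>C res w T = (1 - q) *\<^sub>C S"
      using q by (simp add: S_def scaleC_scaleC algebra_simps)
    define P where "P = (\<Sum>n<N. q ^ n *\<^sub>C T ^ n)"
    define S' where "S' = (1 / q ^ N) *\<^sub>C (S - P)"
    have S': "(\<lambda>n. q ^ n *\<^sub>C T ^ (n + N)) sums S'"
    proof -
      have "(\<lambda>n. q ^ (n + N) *\<^sub>C T ^ (n + N)) sums (S - P)"
        unfolding P_def by (rule sums_split_initial_segment[OF S])
      from sums_scaleC[OF this, of "1 / q ^ N"] show ?thesis
        using q by (simp add: S'_def scaleC_scaleC power_add)
    qed
    have SP: "S = P + q ^ N *\<^sub>C S'" using q by (simp add: S'_def scaleC_scaleC)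
    define U where "U = (1 / q) *\<^sub>C ((1 - q) *\<^sub>C S' - T ^ N)"
    have U: "(\<lambda>n. q ^ n *\<^sub>C D (n + N)) sums U"
      using sums_scaleC[OF sums_by_parts[OF S'], of "1 / q"] q by (simp add: U_def scaleC_scaleC D_def)
    have S'U: "(1 - q) *\<^sub>C S' = T ^ N + q *\<^sub>C U" using q by (simp add: U_def scaleC_scaleC)
    define V where "V = (1 - q) *\<^sub>C U - D N"
    have V: "(\<lambda>n. q ^ Suc n *\<^sub>C (D (Suc n + N) - D (n + N))) sums V"
      using sums_by_parts[OF U] by (simp add: V_def)
    have UV: "U = (1 / (1 - q)) *\<^sub>C (D N + V)" using q by (simp add: V_def scaleC_scaleC)
    define g where "g = q ^ Suc N / (1 - q)"
    have g: "cmod g \<le> 1 / \<delta>"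
      using q \<delta> power_le_one[of "cmod q" "Suc N"]
      by (auto simp: g_def norm_divide norm_mult norm_power \<delta>_def[symmetric] intro!: divide_right_mono)
    have decomp: "(1 - q) *\<^sub>C S = ((1 - q) *\<^sub>C P + q ^ N *\<^sub>C T ^ N) + g *\<^sub>C D N + g *\<^sub>C V"
    proof -
      have "(1 - q) *\<^sub>C S = (1 - q) *\<^sub>C P + q ^ N *\<^sub>C ((1 - q) *\<^sub>C S')"
        by (simp add: SP scaleC_add_right scaleC_scaleC mult.commute)
      also have "\<dots> = (1 - q) *\<^sub>C P + q ^ N *\<^sub>C T ^ N + g *\<^sub>C (D N + V)"
        unfolding S'U by (subst UV) (simp add: scaleC_add_right scaleC_scaleC g_def mult.commute add.assoc)
      finally show ?thesis by (simp add: scaleC_add_right add.assoc)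
    qed
    have P1: "(1 - q) *\<^sub>C P + q ^ N *\<^sub>C T ^ N \<in> F 4 ?E1"
    proof (rule FI)
      let ?c = "\<lambda>n. if n < N then (1 - q) * q ^ n else if n = N then q ^ N else 0"
      have fin: "?c n = 0" if "n \<notin> {..N}" for n using that by auto
      show "summable (\<lambda>n. cmod (?c n))" by (rule summable_finite[of "{..N}"]) (use fin in auto)
      have "(\<Sum>n. cmod (?c n)) = (\<Sum>n\<le>N. cmod (?c n))"
        by (rule suminf_finite) (use fin in auto)
      also have "\<dots> = (\<Sum>n<N. cmod (?c n)) + cmod q ^ N"
        by (simp add: lessThan_Suc_atMost[symmetric] norm_power)
      also have "(\<Sum>n<N. cmod (?c n)) \<le> (\<Sum>n<N. \<delta>)"
        using q by (intro sum_mono) (auto simp: norm_mult norm_power \<delta>_def power_le_one mult_left_le)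
      also have "(\<Sum>n<N. \<delta>) + cmod q ^ N \<le> 4"
        using N\<delta> q power_le_one[of "cmod q" N] by simp
      finally show "(\<Sum>n. cmod (?c n)) \<le> 4" by simp
      have "(\<lambda>n. ?c n *\<^sub>C T ^ n) sums (\<Sum>n\<le>N. ?c n *\<^sub>C T ^ n)"
        by (rule sums_finite) (use fin in auto)
      also have "(\<Sum>n\<le>N. ?c n *\<^sub>C T ^ n) = (1 - q) *\<^sub>C P + q ^ N *\<^sub>C T ^ N"
        by (simp add: lessThan_Suc_atMost[symmetric] P_def scaleC_sum_right scaleC_scaleC)
      finally show "(\<lambda>n. ?c n *\<^sub>C T ^ n) sums ((1 - q) *\<^sub>C P + q ^ N *\<^sub>C T ^ N)" .
    qed simp
    have P2: "g *\<^sub>C D N \<in> F 1 ?E2"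
    proof (rule FI)
      let ?c = "\<lambda>n::nat. if n = 0 then g / of_nat (Suc N) else 0"
      have fin: "?c n = 0" if "n \<notin> {0}" for n using that by auto
      show "summable (\<lambda>n. cmod (?c n))" by (rule summable_finite[of "{0}"]) (use fin in auto)
      have "(\<Sum>n. cmod (?c n)) = (\<Sum>n\<in>{0}. cmod (?c n))"
        by (rule suminf_finite) (use fin in auto)
      also have "\<dots> = cmod g / real (Suc N)" by (simp add: norm_divide del: of_nat_Suc)
      also have "\<dots> \<le> (1 / \<delta>) / real (Suc N)" using g by (intro divide_right_mono) auto
      also have "\<dots> \<le> 1" using N \<delta> by (simp add: field_simps)
      finally show "(\<Sum>n. cmod (?c n)) \<le> 1" .
      have "(\<lambda>n. ?c n *\<^sub>C (real (Suc N) *\<^sub>R D N)) sums (\<Sum>n\<in>{0}. ?c n *\<^sub>C (real (Suc N) *\<^sub>R D N))"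
        by (rule sums_finite) (use fin in auto)
      also have "(\<Sum>n\<in>{0}. ?c n *\<^sub>C (real (Suc N) *\<^sub>R D N)) = g *\<^sub>C D N"
        by (simp add: scaleR_scaleC scaleC_scaleC del: of_nat_Suc)
      finally show "(\<lambda>n. ?c n *\<^sub>C (real (Suc N) *\<^sub>R D N)) sums (g *\<^sub>C D N)" .
    qed (rule DE)
    have P3: "g *\<^sub>C V \<in> F 4 ?E3"
    proof (rule FI)
      \<comment> \<open>the second difference at \<open>n + N\<close> is the product of first differences at the two halves\<close>
      let ?p = "\<lambda>n. (n + N) div 2" and ?p' = "\<lambda>n. n + N - (n + N) div 2"
      let ?k = "\<lambda>n. real (Suc (?p n)) * real (Suc (?p' n))"
      let ?c = "\<lambda>n. g * q ^ Suc n / of_real (?k n)"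
      let ?B = "\<lambda>n. (real (Suc (?p n)) *\<^sub>R D (?p n)) * (real (Suc (?p' n)) *\<^sub>R D (?p' n))"
      show "?B n \<in> ?E3" for n using DE by blast
      have k: "(real (n + N) + 1)\<^sup>2 / 4 \<le> ?k n" for n
      proof -
        have "(real (n + N) + 1) / 2 * ((real (n + N) + 1) / 2) \<le> ?k n"
        proof -
          define m where "m = (n + N) div 2"
          define m' where "m' = n + N - m"
          have "n + N \<le> 2 * m + 1" "2 * m \<le> n + N" "m' + m = n + N" by (auto simp: m_def m'_def)
          then have "real (n + N) \<le> real (2 * m + 1)" "real (2 * m) \<le> real (n + N)" "real (m' + m) = real (n + N)"
            by (simp_all only: of_nat_le_iff)
          then have "(real (n + N) + 1) / 2 \<le> real (Suc m)" "(real (n + N) + 1) / 2 \<le> real (Suc m')"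
            by simp_all
          then have "(real (n + N) + 1) / 2 * ((real (n + N) + 1) / 2) \<le> real (Suc m) * real (Suc m')"
            by (rule mult_mono) auto
          then show ?thesis by (simp only: m_def m'_def)
        qed
        then show ?thesis by (simp add: power2_eq_square)
      qed
      have le: "cmod (?c n) \<le> 4 / \<delta> * (1 / (real (n + N) + 1)\<^sup>2)" for n
      proof -
        have "cmod (?c n) = cmod g * cmod q ^ Suc n / ?k n"
          by (simp only: norm_divide norm_mult norm_power norm_of_real) (simp del: of_nat_Suc)
        also have "\<dots> \<le> (1 / \<delta>) * 1 / ((real (n + N) + 1)\<^sup>2 / 4)"
          using g q \<delta> by (intro frac_le mult_mono k power_le_one) auto
        finally show ?thesis by simp
      qed
      show sm: "summable (\<lambda>n. cmod (?c n))"
        by (rule summable_comparison_test'[OF summable_mult[OF sum_inverse_squares(1)[OF N(3)], of "4 / \<delta>"], of 0])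
          (use le in simp)
      have "(\<Sum>n. cmod (?c n)) \<le> (\<Sum>n. 4 / \<delta> * (1 / (real (n + N) + 1)\<^sup>2))"
        by (rule suminf_le[OF le sm summable_mult[OF sum_inverse_squares(1)[OF N(3)]]])
      also have "\<dots> = 4 / \<delta> * (\<Sum>n. 1 / (real (n + N) + 1)\<^sup>2)"
        by (rule suminf_mult[OF sum_inverse_squares(1)[OF N(3)]])
      also have "\<dots> \<le> 4 / \<delta> * (1 / real N)"
        using \<delta> by (intro mult_left_mono sum_inverse_squares(2)[OF N(3)]) simp
      also have "\<dots> \<le> 4" using N\<delta> \<delta> N(3) by (simp add: field_simps)
      finally show "(\<Sum>n. cmod (?c n)) \<le> 4" .
      have D2: "D (Suc n + N) - D (n + N) = D (?p n) * D (?p' n)" for n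
      proof -
        have DT: "D m = T ^ m * (T - 1)" for m
          by (simp add: D_def right_diff_distrib power_commutes)
        have DT': "D m = (T - 1) * T ^ m" for m
          by (simp add: D_def left_diff_distrib)
        have "D (?p n) * D (?p' n) = (T - 1) * (T ^ ?p n * T ^ ?p' n) * (T - 1)"
          by (subst DT', subst DT) (simp only: mult.assoc)
        also have "T ^ ?p n * T ^ ?p' n = T ^ (n + N)" by (simp add: power_add[symmetric])
        also have "(T - 1) * T ^ (n + N) * (T - 1) = D (n + N) * T - D (n + N)"
          by (simp add: DT'[symmetric] right_diff_distrib)
        also have "D (n + N) * T = D (Suc n + N)"
          by (simp add: D_def left_diff_distrib power_commutes mult.assoc)
        finally show ?thesis ..
      qed
      have "?c n *\<^sub>C ?B n = g *\<^sub>C q ^ Suc n *\<^sub>C (D (Suc n + N) - D (n + N))" for n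
      proof -
        define \<kappa> where "\<kappa> = ?k n"
        have \<kappa>: "\<kappa> \<noteq> 0" unfolding \<kappa>_def by (simp del: of_nat_Suc)
        have "?B n = of_real \<kappa> *\<^sub>C (D (?p n) * D (?p' n))"
          unfolding \<kappa>_def
          by (simp only: scaleR_scaleC mult_scaleC_left mult_scaleC_right scaleC_scaleC of_real_mult mult.commute)
        then show ?thesis
          unfolding \<kappa>_def[symmetric] D2 using \<kappa> by (simp only: scaleC_scaleC) simp
      qed
      then show "(\<lambda>n. ?c n *\<^sub>C ?B n) sums (g *\<^sub>C V)"
        using sums_scaleC[OF V, of g] by (simp only:)
    qed
    show ?thesis unfolding goal decomp using P1 P2 P3 by blast
  qed
  then have "{(w - 1) *\<^sub>C res w T | w. cmod w > 1}
      \<subseteq> {A + B | A B. A \<in> {A + B | A B. A \<in> F 4 ?E1 \<and> B \<in> F 1 ?E2} \<and> B \<in> F 4 ?E3}"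
    by blast
  with R_bdd_add[OF R_bdd_add[OF RF[OF C1, of 4] RF[OF C2, of 1]] RF[OF E3, of 4]] show ?thesis
    by (auto intro: R_bdd_subset)
qed

text \<open>The Neumann series around an exterior point \<open>w\<close>, in terms of \<open>S = (w - 1) R(w,T)\<close>: it reaches
  all points whose distance from \<open>w\<close> is a small fraction of \<open>|w - 1|\<close>.\<close>

lemma R_bdd_resolvent_neumann:
  fixes T :: "'x::complex_banach op"
  assumes R: "\<And>w. cmod w > 1 \<Longrightarrow> is_res w T (res w T)"
    and K: "R_bdd K {(w - 1) *\<^sub>C res w T | w. cmod w > 1}" "K \<ge> 1"
  defines "G \<equiv> {l. \<exists>w. cmod w > 1 \<and> cmod (l - w) \<le> cmod (w - 1) / (4 * K)}"
  shows "\<forall>l\<in>G. is_res l T (res l T)" and "\<exists>K'. R_bdd K' {(l - 1) *\<^sub>C res l T | l. l \<in> G}"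
proof -
  let ?E = "{(w - 1) *\<^sub>C res w T | w. cmod w > 1}"
  let ?E' = "\<lambda>j. {c *\<^sub>C A | c A. cmod c \<le> 2 * (1 / (4 * K)) ^ j \<and> A \<in> {A ^ Suc j | A. A \<in> ?E}}"
  have main: "is_res l T (res l T) \<and> (\<exists>B. (\<forall>j. B j \<in> ?E' j) \<and> B sums ((l - 1) *\<^sub>C res l T))" if lG: "l \<in> G" for l
  proof -
    obtain w where w: "cmod w > 1" and lw: "cmod (l - w) \<le> cmod (w - 1) / (4 * K)"
      using lG by (auto simp: G_def)
    have w1: "w - 1 \<noteq> 0" using w by auto
    define S where "S = (w - 1) *\<^sub>C res w T"
    \<comment> \<open>\<open>(w - l) R(w,T) = k S\<close>, where \<open>|k| K \<le> 1/4\<close> makes the series of powers converge geometrically\<close>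
    define k where "k = (w - l) / (w - 1)"
    have SE: "S \<in> ?E" using w by (auto simp: S_def)
    have S: "norm S \<le> K" by (rule R_bdd_norm[OF K(1) SE])
    have k: "cmod k \<le> 1 / (4 * K)"
      using lw w1 K(2) by (simp add: k_def norm_divide norm_minus_commute field_simps)
    have "1 / (4 * K) \<le> 1" using K(2) by simp
    then have k1: "cmod k \<le> 1" using k by linarith
    define X where "X = k *\<^sub>C S"
    have X: "norm X \<le> 1 / 4"
    proof -
      have "norm X \<le> 1 / (4 * K) * K"
        unfolding X_def norm_scaleC using k S K(2) by (intro mult_mono) auto
      then show ?thesis using K(2) by simp
    qed
    have Xw: "X = (w - l) *\<^sub>C res w T" using w1 by (simp add: X_def k_def S_def scaleC_scaleC)
    have "summable (\<lambda>j. X ^ j)"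
    proof (rule summable_comparison_test')
      show "summable (\<lambda>j. (1 / 4 :: real) ^ j)" by (rule summable_geometric) simp
      show "norm (X ^ j) \<le> (1 / 4) ^ j" if "j \<ge> 0" for j
        using norm_op_power_le[of X j] power_mono[OF X, of j] by simp
    qed
    then obtain Y where Y: "(\<lambda>j. X ^ j) sums Y" by (auto simp: summable_def)
    have l: "is_res l T (res w T * Y)"
      using X by (intro is_res_neumann[OF R[OF w] Xw _ Y]) simp
    have eq: "res l T = res w T * Y" by (rule res_eq[OF l])
    have Sj: "X ^ j = k ^ j *\<^sub>C S ^ j" for j
      by (induction j) (auto simp: X_def scaleC_scaleC mult.commute)
    define B where "B j = ((1 - k) * k ^ j) *\<^sub>C S ^ Suc j" for j
    have "(\<lambda>j. (l - 1) *\<^sub>C (res w T * X ^ j)) sums ((l - 1) *\<^sub>C (res w T * Y))"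
      by (rule sums_scaleC[OF bounded_linear.sums[OF bounded_linear_mult_right Y]])
    moreover have "(l - 1) *\<^sub>C (res w T * X ^ j) = B j" for j
    proof -
      have "l - 1 = (1 - k) * (w - 1)" using w1 by (simp add: k_def field_simps)
      then show ?thesis
        by (simp add: B_def Sj scaleC_scaleC mult_ac) (simp add: S_def scaleC_scaleC mult_ac)
    qed
    ultimately have sums: "B sums ((l - 1) *\<^sub>C res l T)" by (simp add: eq)
    have "B j \<in> ?E' j" for j
    proof -
      have "cmod ((1 - k) * k ^ j) \<le> 2 * (1 / (4 * K)) ^ j"
        unfolding norm_mult norm_power
        using k k1 norm_triangle_ineq4[of 1 k] by (intro mult_mono power_mono) auto
      then show ?thesis unfolding B_def using SE by blast
    qed
    with l eq sums show ?thesis by auto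
  qed
  then show "\<forall>l\<in>G. is_res l T (res l T)" by blast
  have E': "R_bdd (4 * K * (1 / 4) ^ j) (?E' j)" for j
  proof -
    have "R_bdd (2 * (2 * (1 / (4 * K)) ^ j) * K ^ Suc j) (?E' j)"
      using K(2) by (intro R_bdd_scaleC R_bdd_power K(1)) auto
    moreover have "2 * (2 * (1 / (4 * K)) ^ j) * K ^ Suc j = 4 * K * (1 / 4) ^ j"
      using K(2) by (simp add: power_mult_distrib power_divide)
    ultimately show ?thesis by (simp only:)
  qed
  have "R_bdd (\<Sum>j. 4 * K * (1 / 4) ^ j) {(l - 1) *\<^sub>C res l T | l. l \<in> G}"
    using main by (intro R_bdd_suminf[OF E'] summable_mult summable_geometric) auto
  then show "\<exists>K'. R_bdd K' {(l - 1) *\<^sub>C res l T | l. l \<in> G}" by blast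
qed

section \<open>Geometry of Stolz domains\<close>

text \<open>The Stolz domain is a union of discs \<open>D(1 - s, s sin a)\<close> with \<open>0 < s \<le> 1\<close>, the images of \<open>D(0, sin a)\<close> under
  the contractions towards \<open>1\<close>. In this form, membership becomes an inequality.\<close>

lemma stolz_domainI:
  assumes "0 < s" "s \<le> 1" "cmod (z - (1 - of_real s)) < s * sin a"
  shows "z \<in> stolz_domain a"
proof -
  have "ball (1 - complex_of_real s) (s * sin a) \<subseteq> convex hull (insert 1 (ball 0 (sin a)))"
  proof
    fix y :: complex assume y: "y \<in> ball (1 - of_real s) (s * sin a)"
    define w where "w = (y - (1 - of_real s)) / of_real s"
    have "w \<in> ball 0 (sin a)"
      using y \<open>0 < s\<close> by (simp add: w_def norm_divide dist_norm norm_minus_commute field_simps)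
    then have "(1 - s) *\<^sub>R 1 + s *\<^sub>R w \<in> convex hull (insert 1 (ball 0 (sin a)))"
      using assms(1,2) by (intro convexD[OF convex_convex_hull] hull_inc) auto
    moreover have "(1 - s) *\<^sub>R 1 + s *\<^sub>R w = y"
      using \<open>0 < s\<close> by (simp add: w_def scaleR_conv_of_real)
    ultimately show "y \<in> convex hull (insert 1 (ball 0 (sin a)))" by simp
  qed
  then have "ball (1 - of_real s) (s * sin a) \<subseteq> stolz_domain a"
    unfolding stolz_domain_def by (rule interior_maximal) simp
  with assms(3) show ?thesis by (auto simp: dist_norm norm_minus_commute)
qed

lemma closure_stolz_domainD:
  assumes "z \<in> closure (stolz_domain a)" "0 \<le> sin a"
  shows "\<exists>s. 0 \<le> s \<and> s \<le> 1 \<and> cmod (z - (1 - of_real s)) \<le> s * sin a"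
proof -
  define f where "f = (\<lambda>(s, w). 1 - complex_of_real s + of_real s * w)"
  let ?K = "f ` ({0..1} \<times> cball 0 (sin a))"
  have hull: "convex hull (insert 1 (ball 0 (sin a))) \<subseteq> ?K"
  proof (cases "sin a = 0")
    case True
    then show ?thesis by (auto simp: f_def intro!: image_eqI[of _ _ "(0, 0)"])
  next
    case False
    then have "ball (0 :: complex) (sin a) \<noteq> {}" using assms(2) by simp
    show ?thesis
    proof
      fix y :: complex assume "y \<in> convex hull (insert 1 (ball 0 (sin a)))"
      then obtain u v w where uv: "0 \<le> u" "0 \<le> v" "u + v = 1" and w: "w \<in> ball 0 (sin a)"
        and y: "y = u *\<^sub>R 1 + v *\<^sub>R w"
        unfolding convex_hull_insert[OF \<open>ball 0 (sin a) \<noteq> {}\<close>] hull_same[of convex, OF convex_ball] by auto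
      have u: "u = 1 - v" using uv by simp
      have "y = f (v, w)" by (simp add: f_def y u scaleR_conv_of_real)
      moreover have "(v, w) \<in> {0..1} \<times> cball 0 (sin a)" using uv w by auto
      ultimately show "y \<in> ?K" by blast
    qed
  qed
  have "compact ?K"
    by (rule compact_continuous_image)
      (auto simp: f_def split_def intro!: continuous_intros compact_Times)
  then have "closed ?K" by (rule compact_imp_closed)
  have "closure (stolz_domain a) \<subseteq> ?K"
    unfolding stolz_domain_def
    by (rule closure_minimal[OF order_trans[OF interior_subset hull] \<open>closed ?K\<close>])
  with assms(1) obtain y where "y \<in> {0..1} \<times> cball 0 (sin a)" "z = f y" by blast
  then obtain s w where "0 \<le> s" "s \<le> 1" "cmod w \<le> sin a" "z = f (s, w)" by (cases y) auto
  then show ?thesis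
    by (intro exI[of _ s]) (auto simp: f_def norm_mult intro!: mult_left_mono)
qed

lemma convex_stolz_domain: "convex (stolz_domain a)"
  unfolding stolz_domain_def by (intro convex_interior convex_convex_hull)

lemma open_stolz_domain: "open (stolz_domain a)"
  by (simp add: stolz_domain_def)

lemma stolz_domain_mono: "sin a \<le> sin b \<Longrightarrow> stolz_domain a \<subseteq> stolz_domain b"
  unfolding stolz_domain_def by (intro interior_mono hull_mono) auto

lemma zero_in_stolz_domain: "0 < sin a \<Longrightarrow> 0 \<in> stolz_domain a"
  by (rule stolz_domainI[of 1]) auto

lemma one_minus_in_stolz_domain: "0 < sin a \<Longrightarrow> 0 < s \<Longrightarrow> s \<le> 1 \<Longrightarrow> 1 - of_real s \<in> stolz_domain a"
  by (rule stolz_domainI[of s]) auto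

lemma one_in_closure_stolz_domain:
  assumes "0 < sin a" shows "1 \<in> closure (stolz_domain a)"
  unfolding closure_approachable
proof (intro allI impI)
  fix e :: real assume "e > 0"
  then show "\<exists>y\<in>stolz_domain a. dist y 1 < e"
    using assms by (intro bexI[of _ "1 - of_real (min 1 (e / 2))"] one_minus_in_stolz_domain)
      (auto simp: dist_norm norm_minus_commute min_def)
qed

lemma sin_bounds: "0 < b \<Longrightarrow> b < pi / 2 \<Longrightarrow> 0 < sin b \<and> sin b < 1 \<and> 0 < cos b \<and> cos b < 1"
  using sin_gt_zero[of b] sin_monotone_2pi[of b "pi / 2"] cos_gt_zero[of b] cos_monotone_0_pi[of 0 b]
  by auto

lemma stolz_domainD:
  assumes z: "z \<in> stolz_domain b" and b: "0 < b" "b < pi / 2"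
  shows "0 < Re (1 - z)" "cmod (1 - z) \<le> 2"
proof -
  note sb = sin_bounds[OF b]
  have z1: "z \<noteq> 1"
  proof
    assume "z = 1"
    with z obtain e where e: "e > 0" "ball 1 e \<subseteq> stolz_domain b"
      using open_stolz_domain[of b] by (auto simp: open_contains_ball)
    then have "1 + of_real (e / 2) \<in> stolz_domain b" by (auto simp: dist_norm)
    then have "1 + of_real (e / 2) \<in> closure (stolz_domain b)" using closure_subset by blast
    from closure_stolz_domainD[OF this] sb obtain s where s: "0 \<le> s" "s \<le> 1"
        "cmod (of_real (e / 2 + s)) \<le> s * sin b" by auto
    have "e / 2 + s = cmod (of_real (e / 2 + s))" using s(1) \<open>e > 0\<close> by (subst norm_of_real) simp
    also have "\<dots> \<le> s * sin b" by (rule s(3))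
    also have "\<dots> \<le> s" using s sb by (simp add: mult_left_le)
    finally show False using \<open>e > 0\<close> by simp
  qed
  have "z \<in> closure (stolz_domain b)" using z closure_subset by blast
  from closure_stolz_domainD[OF this] sb obtain s where s: "0 \<le> s" "s \<le> 1"
      "cmod (z - (1 - of_real s)) \<le> s * sin b" by auto
  have "s \<noteq> 0" using s z1 by auto
  then have "0 < s * (1 - sin b)" using s sb by simp
  also have "\<dots> \<le> Re (1 - z)"
    using s(3) complex_Re_le_cmod[of "z - (1 - of_real s)"] by (simp add: algebra_simps)
  finally show "0 < Re (1 - z)" .
  have "cmod (1 - z) \<le> cmod (of_real s) + cmod (z - (1 - of_real s))"
    using norm_triangle_ineq4[of "of_real s" "z - (1 - of_real s)"] by (simp add: algebra_simps)
  also have "\<dots> \<le> 1 + 1 * 1"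
    using s sb by (intro add_mono order_trans[OF s(3)] mult_mono) auto
  finally show "cmod (1 - z) \<le> 2" by simp
qed

text \<open>A point of the closed disc outside a large Stolz domain is much closer to the unit circle than
  to \<open>1\<close>. Conversely, a point \<open>l\<close> that is far from the circle lies in one of the discs of radius \<open>s sin a\<close>
  around \<open>1 - s\<close>: with \<open>u = 1 - l\<close>, the choice \<open>s = |u|/c\<close> is optimal in the extreme case \<open>Re u = c|u|\<close>.\<close>

lemma in_stolz_domain_if_away:
  assumes c: "0 < c" "c \<le> 1" and a: "1 - c\<^sup>2 < (sin a)\<^sup>2" "0 < sin a"
    and l: "c * cmod (1 - l) \<le> 1 - cmod l" "l \<noteq> 1"
  shows "l \<in> stolz_domain a"
proof -
  define u where "u = 1 - l"
  define x where "x = cmod u"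
  have x: "x > 0" "c * x \<le> 1 - cmod l" using l by (auto simp: x_def u_def)
  show ?thesis
  proof (cases "x \<le> c")
    case True
    define s where "s = x / c"
    have s: "0 < s" "s \<le> 1" "x = c * s" using True c x by (auto simp: s_def)
    have "(cmod l)\<^sup>2 \<le> (1 - c * x)\<^sup>2" using x by (intro power_mono) auto
    moreover have "(cmod l)\<^sup>2 = 1 - 2 * Re u + x\<^sup>2"
      unfolding x_def u_def cmod_power2 by (simp add: power2_eq_square algebra_simps)
    moreover have "c\<^sup>2 * x\<^sup>2 \<le> x\<^sup>2" using c by (simp add: mult_left_le_one_le power_le_one)
    ultimately have Re: "2 * c * x \<le> 2 * Re u" by (simp add: power2_eq_square algebra_simps)
    have "(cmod (l - (1 - of_real s)))\<^sup>2 = s\<^sup>2 - s * (2 * Re u) + x\<^sup>2"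
      unfolding x_def u_def cmod_power2 by (simp add: power2_eq_square algebra_simps)
    also have "\<dots> \<le> s\<^sup>2 - s * (2 * c * x) + x\<^sup>2" using Re s by (simp add: mult_left_mono)
    also have "\<dots> = s\<^sup>2 * (1 - c\<^sup>2)" by (simp add: s(3) power2_eq_square algebra_simps)
    also have "\<dots> < s\<^sup>2 * (sin a)\<^sup>2" using a s by (intro mult_strict_left_mono) auto
    finally have "(cmod (l - (1 - of_real s)))\<^sup>2 < (s * sin a)\<^sup>2" by (simp add: power_mult_distrib)
    then have "cmod (l - (1 - of_real s)) < s * sin a"
      by (rule power2_less_imp_less) (use s a in auto)
    then show ?thesis by (rule stolz_domainI[OF s(1,2)])
  next
    case False
    have "cmod l \<le> 1 - c * x" using x by simp
    also have "\<dots> \<le> 1 - c\<^sup>2" using False c by (simp add: power2_eq_square)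
    finally have l1: "cmod l \<le> 1 - c\<^sup>2" .
    have "(cmod l)\<^sup>2 \<le> (1 - c\<^sup>2)\<^sup>2" using l1 by (intro power_mono) auto
    also have "\<dots> \<le> 1 - c\<^sup>2"
      using c by (auto simp: power2_eq_square[of "1 - c\<^sup>2"] mult_left_le power_le_one)
    also have "\<dots> < (sin a)\<^sup>2" by (rule a)
    finally have "cmod l < sin a" by (rule power2_less_imp_less) (use a in auto)
    then show ?thesis using stolz_domainI[of 1 l a] by simp
  qed
qed

text \<open>A point \<open>l\<close> of the disc outside the Stolz domain is moved radially to a point \<open>w\<close> just beyond the unit
  circle; the distance is small compared with \<open>|1 - l|\<close>, hence with \<open>|1 - w|\<close>.\<close>

lemma stolz_exterior_near_unit_circle:
  assumes K: "K \<ge> 1"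
  obtains a where "0 < a" "a < pi / 2"
    "\<And>l. l \<notin> closure (stolz_domain a) \<Longrightarrow> \<exists>w. cmod w > 1 \<and> cmod (l - w) \<le> cmod (w - 1) / (4 * K)"
proof -
  define c where "c = 1 / (8 * K)"
  have c: "0 < c" "c \<le> 1 / 8" using K by (auto simp: c_def field_simps)
  \<comment> \<open>any angle with \<open>cos a < c\<close> works\<close>
  define a where "a = arccos (c / 2)"
  have a: "0 < a" "a < pi / 2"
    using c arccos_lt_bounded[of "c / 2"] arccos_less_arccos[of 0 "c / 2"] by (auto simp: a_def)
  have sa: "0 < sin a" using sin_bounds[OF a] by simp
  have "(sin a)\<^sup>2 = 1 - (c / 2)\<^sup>2"
    using c unfolding sin_squared_eq a_def by simp
  then have a2: "1 - c\<^sup>2 < (sin a)\<^sup>2" using c by (simp add: power2_eq_square)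
  show ?thesis
  proof (rule that[OF a])
    fix l assume l: "l \<notin> closure (stolz_domain a)"
    have l1: "l \<noteq> 1" using l one_in_closure_stolz_domain[OF sa] by auto
    show "\<exists>w. cmod w > 1 \<and> cmod (l - w) \<le> cmod (w - 1) / (4 * K)"
    proof (cases "cmod l > 1")
      case True
      then show ?thesis using K by (intro exI[of _ l]) auto
    next
      case False
      have "\<not> c * cmod (1 - l) \<le> 1 - cmod l"
        using in_stolz_domain_if_away[of c a l] c a2 sa l1 l closure_subset by auto
      then have lc: "1 - cmod l < c * cmod (1 - l)" by simp
      have "cmod (1 - l) \<le> 2" using norm_triangle_ineq4[of 1 l] False by simp
      then have "c * cmod (1 - l) \<le> 1 / 8 * 2" using c by (intro mult_mono) auto
      then have l0: "l \<noteq> 0" using lc by auto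
      define \<eta> where "\<eta> = (c * cmod (1 - l) - (1 - cmod l)) / 2"
      have \<eta>: "\<eta> > 0" "1 + \<eta> - cmod l \<le> c * cmod (1 - l)" using lc by (auto simp: \<eta>_def field_simps)
      define w where "w = of_real (1 + \<eta>) * sgn l"
      have w: "cmod w = 1 + \<eta>" using l0 \<eta> by (simp only: w_def norm_mult norm_of_real norm_sgn) simp
      have "l - w = of_real (cmod l - (1 + \<eta>)) * sgn l"
        using l0 by (simp add: w_def sgn_eq field_simps)
      then have "cmod (l - w) = 1 + \<eta> - cmod l"
        using l0 False \<eta>(1) by (simp only: norm_mult norm_of_real norm_sgn) simp
      then have lw: "cmod (l - w) \<le> c * cmod (1 - l)" using \<eta> by simp
      have "cmod (1 - l) \<le> cmod (w - 1) + cmod (l - w)"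
        using norm_triangle_ineq[of "l - w" "w - 1"] by (simp add: norm_minus_commute)
      also have "\<dots> \<le> cmod (w - 1) + 1 / 2 * cmod (1 - l)"
        using lw c mult_right_mono[of c "1 / 2" "cmod (1 - l)"] by simp
      finally have "cmod (1 - l) \<le> 2 * cmod (w - 1)" by simp
      then have "c * cmod (1 - l) \<le> c * (2 * cmod (w - 1))" using c by (intro mult_left_mono) auto
      with lw have "cmod (l - w) \<le> c * (2 * cmod (w - 1))" by simp
      also have "\<dots> = cmod (w - 1) / (4 * K)" by (simp add: c_def)
      finally show ?thesis using w \<eta> by (intro exI[of _ w]) auto
    qed
  qed
qed

section \<open>The boundary of a Stolz domain\<close>

text \<open>The two tangents from \<open>1\<close>: with \<open>v = 1 - \<lambda>\<close> they are the rays \<open>arg v = \<mp>b\<close>.\<close>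

definition tangent_pt :: "real \<Rightarrow> real \<Rightarrow> real \<Rightarrow> complex"
  where "tangent_pt b \<sigma> \<tau> = 1 - of_real \<tau> * (of_real (cos b) * cis (- \<sigma> * b))"

lemma tangent_pt_1:
  "tangent_pt b 1 1 = rcis (sin b) (pi / 2 - b)" "tangent_pt b (- 1) 1 = rcis (sin b) (- (pi / 2 - b))"
proof -
  have "1 - cos b * cos b = sin b * sin b"
    using sin_cos_squared_add[of b] by (simp add: power2_eq_square)
  then show "tangent_pt b 1 1 = rcis (sin b) (pi / 2 - b)" "tangent_pt b (- 1) 1 = rcis (sin b) (- (pi / 2 - b))"
    by (auto simp: tangent_pt_def complex_eq_iff rcis_def cos_diff sin_diff)
qed

text \<open>The boundary of the Stolz domain without the point \<open>1\<close>, at which the resolvents are singular.\<close>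

definition stolz_curve :: "real \<Rightarrow> complex set"
  where "stolz_curve b = {l. (\<exists>\<tau> \<sigma>. 0 < \<tau> \<and> \<tau> \<le> 1 \<and> (\<sigma> = 1 \<or> \<sigma> = - 1) \<and> l = tangent_pt b \<sigma> \<tau>) \<or>
    (cmod l = sin b \<and> Re l \<le> (sin b)\<^sup>2)}"

lemma stolz_curve_cases:
  assumes "l \<in> stolz_curve b"
  obtains (tangent) \<tau> \<sigma> where "0 < \<tau>" "\<tau> \<le> 1" "\<sigma> = 1 \<or> \<sigma> = - 1" "l = tangent_pt b \<sigma> \<tau>"
    | (arc) "cmod l = sin b" "Re l \<le> (sin b)\<^sup>2"
  using assms unfolding stolz_curve_def by blast

text \<open>The distances from a point of the tangent to the centres \<open>1 - s\<close>: the foot of the perpendicular is at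
  \<open>\<tau> = s\<close>, at distance \<open>s sin b\<close>.\<close>

lemma cmod_tangent_pt:
  assumes "\<sigma> = 1 \<or> \<sigma> = - 1"
  shows "(cmod (of_real s - (1 - tangent_pt b \<sigma> \<tau>)))\<^sup>2 = (s * sin b)\<^sup>2 + (s * cos b - \<tau> * cos b)\<^sup>2"
proof -
  have 1: "(sin b)\<^sup>2 + (cos b)\<^sup>2 = 1" by simp
  have "(cmod (of_real s - (1 - tangent_pt b \<sigma> \<tau>)))\<^sup>2
      = (s - \<tau> * (cos b * cos b))\<^sup>2 + (\<tau> * (cos b * sin b))\<^sup>2"
    unfolding cmod_power2 using assms by (auto simp: tangent_pt_def)
  also have "\<dots> = (s * sin b)\<^sup>2 + (s * cos b - \<tau> * cos b)\<^sup>2" using 1 by algebra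
  finally show ?thesis .
qed

lemma cmod_tangent_pt_self:
  assumes "\<sigma> = 1 \<or> \<sigma> = - 1" "0 \<le> \<tau>" "0 \<le> cos b"
  shows "cmod (1 - tangent_pt b \<sigma> \<tau>) = \<tau> * cos b"
  using assms by (simp add: tangent_pt_def norm_mult)

lemma stolz_curve_subset:
  assumes l: "l \<in> stolz_curve b" and b: "0 < b" "b < g" "g < pi / 2"
  shows "l \<in> stolz_domain g"
proof -
  have sb: "0 < sin b" "sin b < sin g"
    using b sin_bounds[of b] sin_monotone_2pi[of b g] by auto
  from l show ?thesis
  proof (cases rule: stolz_curve_cases)
    case (tangent \<tau> \<sigma>)
    have "(cmod (of_real \<tau> - (1 - l)))\<^sup>2 = (\<tau> * sin b)\<^sup>2"
      by (simp add: tangent(4) cmod_tangent_pt[OF tangent(3)])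
    then have "cmod (of_real \<tau> - (1 - l)) = \<tau> * sin b"
      using tangent(1) sb by (simp add: power2_eq_iff_nonneg)
    also have "of_real \<tau> - (1 - l) = l - (1 - of_real \<tau>)" by simp
    finally show ?thesis using tangent sb by (intro stolz_domainI[of \<tau>]) auto
  next
    case arc
    then show ?thesis using sb by (intro stolz_domainI[of 1]) auto
  qed
qed

text \<open>A point of the curve has at least the distance \<open>s sin b\<close> from \<open>1 - s\<close>, so none of the smaller discs
  \<open>D(1 - s, s sin a)\<close> contains it.\<close>

lemma stolz_curve_exterior:
  assumes l: "l \<in> stolz_curve b" and ab: "0 < a" "a < b" "b < pi / 2"
  shows "l \<notin> closure (stolz_domain a)"
proof
  have sb: "0 < sin a" "sin a < sin b" "sin b < 1" "0 < cos b"
    using ab sin_bounds[of a] sin_bounds[of b] sin_monotone_2pi[of a b] by auto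
  assume "l \<in> closure (stolz_domain a)"
  from closure_stolz_domainD[OF this] sb obtain s where s: "0 \<le> s" "s \<le> 1"
      and le: "cmod (l - (1 - of_real s)) \<le> s * sin a" by auto
  have "(s * sin b)\<^sup>2 \<le> (cmod (l - (1 - of_real s)))\<^sup>2"
    using l
  proof (cases rule: stolz_curve_cases)
    case (tangent \<tau> \<sigma>)
    have "l - (1 - of_real s) = of_real s - (1 - l)" by simp
    then have "(cmod (l - (1 - of_real s)))\<^sup>2 = (s * sin b)\<^sup>2 + (s * cos b - \<tau> * cos b)\<^sup>2"
      using cmod_tangent_pt[OF tangent(3), of s b \<tau>] by (simp only: tangent(4))
    then show ?thesis by simp
  next
    case arc
    have "(cmod (l - (1 - of_real s)))\<^sup>2 = (cmod l)\<^sup>2 - 2 * (1 - s) * Re l + (1 - s)\<^sup>2"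
      unfolding cmod_power2 by (simp add: power2_eq_square algebra_simps)
    also have "\<dots> \<ge> (sin b)\<^sup>2 - 2 * (1 - s) * (sin b)\<^sup>2 + (1 - s)\<^sup>2"
      using arc s by (simp add: mult_left_mono)
    also have "(sin b)\<^sup>2 - 2 * (1 - s) * (sin b)\<^sup>2 + (1 - s)\<^sup>2
        = (s * sin b)\<^sup>2 + (1 - s)\<^sup>2 * (1 - (sin b)\<^sup>2)"
      by (simp add: power2_eq_square algebra_simps)
    also have "\<dots> \<ge> (s * sin b)\<^sup>2" using sb by (simp add: power_le_one)
    finally show ?thesis by simp
  qed
  then have "s * sin b \<le> cmod (l - (1 - of_real s))"
    by (rule power2_le_imp_le) simp
  with le have "s * sin b \<le> s * sin a" by linarith
  then have "s = 0" using s sb by (simp add: mult_le_cancel_left)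
  then have "l = 1" using le by simp
  with l show False
  proof (cases rule: stolz_curve_cases)
    case (tangent \<tau> \<sigma>)
    then show ?thesis
      using cmod_tangent_pt_self[OF tangent(3), of \<tau> b] sb \<open>l = 1\<close> by auto
  next
    case arc
    then show ?thesis using \<open>l = 1\<close> sb by simp
  qed
qed

section \<open>Sums in Bochner spaces and the polynomial inequality\<close>

lemma strongly_measurable_norm:
  assumes "strongly_measurable M f" shows "(\<lambda>\<omega>. norm (f \<omega>)) \<in> borel_measurable M"
proof -
  obtain s where s: "\<And>i::nat. simple_function M (s i)" "\<And>\<omega>. \<omega> \<in> space M \<Longrightarrow> (\<lambda>i. s i \<omega>) \<longlonglongrightarrow> f \<omega>"
    using assms unfolding strongly_measurable_def by blast
  show ?thesis
  proof (rule borel_measurable_LIMSEQ_real)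
    show "(\<lambda>i. norm (s i \<omega>)) \<longlonglongrightarrow> norm (f \<omega>)" if "\<omega> \<in> space M" for \<omega>
      by (intro tendsto_norm s that)
    show "(\<lambda>\<omega>. norm (s i \<omega>)) \<in> borel_measurable M" for i
      by (rule borel_measurable_simple_function[OF simple_function_compose1[OF s(1)]])
  qed
qed

lemma strongly_measurable_add:
  assumes "strongly_measurable M f" "strongly_measurable M g"
  shows "strongly_measurable M (\<lambda>\<omega>. f \<omega> + g \<omega>)"
proof -
  obtain s where s: "\<And>i::nat. simple_function M (s i)" "\<And>\<omega>. \<omega> \<in> space M \<Longrightarrow> (\<lambda>i. s i \<omega>) \<longlonglongrightarrow> f \<omega>"
    using assms(1) unfolding strongly_measurable_def by blast
  obtain t where t: "\<And>i::nat. simple_function M (t i)" "\<And>\<omega>. \<omega> \<in> space M \<Longrightarrow> (\<lambda>i. t i \<omega>) \<longlonglongrightarrow> g \<omega>"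
    using assms(2) unfolding strongly_measurable_def by blast
  show ?thesis unfolding strongly_measurable_def
    by (rule exI[of _ "\<lambda>i \<omega>. s i \<omega> + t i \<omega>"])
      (use simple_function_compose2[OF s(1) t(1), of "(+)"] in \<open>auto intro!: tendsto_add s(2) t(2)\<close>)
qed

lemma strongly_measurable_scaleC:
  assumes "strongly_measurable M f"
  shows "strongly_measurable M (\<lambda>\<omega>. c *\<^sub>C f \<omega>)"
proof -
  obtain s where s: "\<And>i::nat. simple_function M (s i)" "\<And>\<omega>. \<omega> \<in> space M \<Longrightarrow> (\<lambda>i. s i \<omega>) \<longlonglongrightarrow> f \<omega>"
    using assms unfolding strongly_measurable_def by blast
  show ?thesis unfolding strongly_measurable_def
    by (rule exI[of _ "\<lambda>i \<omega>. c *\<^sub>C s i \<omega>"])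
      (use simple_function_compose1[OF s(1), of "(*\<^sub>C) c"] in \<open>auto intro!: tendsto_scaleC s(2)\<close>)
qed

lemma Lp_fun_add:
  assumes f: "f \<in> Lp_fun M p" and g: "g \<in> Lp_fun M p" and p: "1 < p"
  shows "(\<lambda>\<omega>. f \<omega> + g \<omega>) \<in> Lp_fun M p"
proof -
  have sm: "strongly_measurable M (\<lambda>\<omega>. f \<omega> + g \<omega>)"
    using f g by (intro strongly_measurable_add) (auto simp: Lp_fun_def)
  have "integrable M (\<lambda>\<omega>. norm (f \<omega> + g \<omega>) powr p)"
  proof (rule Bochner_Integration.integrable_bound)
    show "integrable M (\<lambda>\<omega>. 2 powr p * (norm (f \<omega>) powr p + norm (g \<omega>) powr p))"
      using f g by (auto simp: Lp_fun_def)
    show "(\<lambda>\<omega>. norm (f \<omega> + g \<omega>) powr p) \<in> borel_measurable M"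
      using measurable_compose[OF strongly_measurable_norm[OF sm], of "\<lambda>x. x powr p" borel] by simp
    have "norm (x + y) powr p \<le> 2 powr p * (norm x powr p + norm y powr p)" for x y :: 'b
    proof -
      have "norm (x + y) \<le> 2 * max (norm x) (norm y)"
        using norm_triangle_ineq[of x y] by simp
      then have "norm (x + y) powr p \<le> (2 * max (norm x) (norm y)) powr p"
        using p by (intro powr_mono2) auto
      also have "\<dots> = 2 powr p * max (norm x) (norm y) powr p"
        by (intro powr_mult)
      also have "\<dots> \<le> 2 powr p * (norm x powr p + norm y powr p)"
        by (intro mult_left_mono) (auto simp: max_def)
      finally show ?thesis .
    qed
    then show "AE \<omega> in M. norm (norm (f \<omega> + g \<omega>) powr p) \<le> norm (2 powr p * (norm (f \<omega>) powr p + norm (g \<omega>) powr p))"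
      by (intro AE_I2) simp
  qed
  with sm show ?thesis by (simp add: Lp_fun_def)
qed

lemma Lp_fun_scaleC:
  assumes f: "f \<in> Lp_fun M p" and p: "1 < p"
  shows "(\<lambda>\<omega>. c *\<^sub>C f \<omega>) \<in> Lp_fun M p"
proof -
  have "strongly_measurable M f" "integrable M (\<lambda>\<omega>. norm (f \<omega>) powr p)" using f by (auto simp: Lp_fun_def)
  moreover have "norm (c *\<^sub>C f \<omega>) powr p = cmod c powr p * norm (f \<omega>) powr p" for \<omega>
    unfolding norm_scaleC by (rule powr_mult)
  ultimately show ?thesis
    unfolding Lp_fun_def using strongly_measurable_scaleC[of M f c] by simp
qed

lemma Lp_fun_zero: "(\<lambda>\<omega>. 0) \<in> Lp_fun M p"
proof -
  have "\<forall>\<omega>\<in>space M. (\<lambda>i. 0) \<longlonglongrightarrow> (0 :: 'b)" by simp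
  moreover have "\<forall>i::nat. simple_function M (\<lambda>\<omega>. 0 :: 'b)" by simp
  ultimately have "strongly_measurable M (\<lambda>\<omega>. 0 :: 'b)"
    unfolding strongly_measurable_def by (intro exI[of _ "\<lambda>i \<omega>. 0"] conjI)
  then show ?thesis by (simp add: Lp_fun_def)
qed

lemma equiv_Lp_rel: "equiv (Lp_fun M p) (Lp_rel M p)"
proof (rule equivI)
  show "Lp_rel M p \<subseteq> Lp_fun M p \<times> Lp_fun M p" by (auto simp: Lp_rel_def)
  show "refl_on (Lp_fun M p) (Lp_rel M p)" by (auto simp: refl_on_def Lp_rel_def)
  show "sym (Lp_rel M p)" by (auto simp: sym_def Lp_rel_def)
  show "trans (Lp_rel M p)"
  proof (rule transI)
    fix f g h assume fg: "(f, g) \<in> Lp_rel M p" and gh: "(g, h) \<in> Lp_rel M p"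
    then have "AE \<omega> in M. f \<omega> = g \<omega>" "AE \<omega> in M. g \<omega> = h \<omega>" by (auto simp: Lp_rel_def)
    then have "AE \<omega> in M. f \<omega> = h \<omega>" by eventually_elim simp
    then show "(f, h) \<in> Lp_rel M p" using fg gh by (auto simp: Lp_rel_def)
  qed
qed

abbreviation Lp_class :: "'s measure \<Rightarrow> real \<Rightarrow> ('s \<Rightarrow> 'x::complex_banach) \<Rightarrow> ('s \<Rightarrow> 'x) set"
  where "Lp_class M p f \<equiv> Lp_rel M p `` {f}"

lemma Lp_classD:
  assumes "g \<in> Lp_class M p f"
  shows "g \<in> Lp_fun M p" "AE \<omega> in M. f \<omega> = g \<omega>"
  using assms unfolding Lp_rel_def by simp_all

lemma Lp_carrierE:
  assumes "F \<in> ns_carrier (Lp_space M p)"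
  obtains f where "f \<in> Lp_fun M p" "F = Lp_class M p f"
proof -
  have "F \<in> Lp_fun M p // Lp_rel M p" using assms by (simp add: Lp_space_def)
  then show thesis by (rule quotientE) (rule that)
qed

lemma Lp_class_in_carrier: "f \<in> Lp_fun M p \<Longrightarrow> Lp_class M p f \<in> ns_carrier (Lp_space M p)"
  by (simp add: Lp_space_def quotientI)

lemma Lp_class_eqI:
  assumes "f \<in> Lp_fun M p" "g \<in> Lp_fun M p" "AE \<omega> in M. f \<omega> = g \<omega>"
  shows "Lp_class M p f = Lp_class M p g"
proof (rule equiv_class_eq[OF equiv_Lp_rel])
  show "(f, g) \<in> Lp_rel M p" unfolding Lp_rel_def using assms by simp
qed

lemma Lp_class_self: "f \<in> Lp_fun M p \<Longrightarrow> f \<in> Lp_class M p f"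
  by (rule equiv_class_self[OF equiv_Lp_rel])

lemma Lp_class_nonempty: "f \<in> Lp_fun M p \<Longrightarrow> (Lp_class M p f = {}) = False"
  by (metis Lp_class_self empty_iff)

text \<open>The unions over representatives that define the operations collapse, because all representatives give
  the same class.\<close>

lemma Lp_add_class:
  assumes p: "1 < p" and f: "f \<in> Lp_fun M p" and g: "g \<in> Lp_fun M p"
  shows "ns_add (Lp_space M p) (Lp_class M p f) (Lp_class M p g) = Lp_class M p (\<lambda>\<omega>. f \<omega> + g \<omega>)"
proof -
  have eq: "Lp_class M p (\<lambda>\<omega>. f' \<omega> + g' \<omega>) = Lp_class M p (\<lambda>\<omega>. f \<omega> + g \<omega>)"
    if "f' \<in> Lp_class M p f" "g' \<in> Lp_class M p g" for f' g'
  proof (rule Lp_class_eqI)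
    have "AE \<omega> in M. f \<omega> = f' \<omega>" "AE \<omega> in M. g \<omega> = g' \<omega>" by (rule Lp_classD(2)[OF that(1)], rule Lp_classD(2)[OF that(2)])
    then show "AE \<omega> in M. f' \<omega> + g' \<omega> = f \<omega> + g \<omega>" by eventually_elim simp
    show "(\<lambda>\<omega>. f' \<omega> + g' \<omega>) \<in> Lp_fun M p" by (rule Lp_fun_add[OF Lp_classD(1)[OF that(1)] Lp_classD(1)[OF that(2)] p])
    show "(\<lambda>\<omega>. f \<omega> + g \<omega>) \<in> Lp_fun M p" by (rule Lp_fun_add[OF f g p])
  qed
  have "ns_add (Lp_space M p) (Lp_class M p f) (Lp_class M p g)
      = (\<Union>f'\<in>Lp_class M p f. \<Union>g'\<in>Lp_class M p g. Lp_class M p (\<lambda>\<omega>. f' \<omega> + g' \<omega>))"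
    by (simp only: Lp_space_def normed_space.simps)
  also have "\<dots> = (\<Union>f'\<in>Lp_class M p f. \<Union>g'\<in>Lp_class M p g. Lp_class M p (\<lambda>\<omega>. f \<omega> + g \<omega>))"
    by (intro SUP_cong refl eq)
  also have "\<dots> = Lp_class M p (\<lambda>\<omega>. f \<omega> + g \<omega>)"
    by (simp only: UN_constant Lp_class_nonempty[OF f] Lp_class_nonempty[OF g] if_False)
  finally show ?thesis .
qed

lemma Lp_scale_class:
  assumes p: "1 < p" and f: "f \<in> Lp_fun M p"
  shows "ns_scale (Lp_space M p) c (Lp_class M p f) = Lp_class M p (\<lambda>\<omega>. c *\<^sub>C f \<omega>)"
proof -
  have eq: "Lp_class M p (\<lambda>\<omega>. c *\<^sub>C f' \<omega>) = Lp_class M p (\<lambda>\<omega>. c *\<^sub>C f \<omega>)"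
    if "f' \<in> Lp_class M p f" for f'
  proof (rule Lp_class_eqI)
    have "AE \<omega> in M. f \<omega> = f' \<omega>" by (rule Lp_classD(2)[OF that])
    then show "AE \<omega> in M. c *\<^sub>C f' \<omega> = c *\<^sub>C f \<omega>" by eventually_elim simp
    show "(\<lambda>\<omega>. c *\<^sub>C f' \<omega>) \<in> Lp_fun M p" by (rule Lp_fun_scaleC[OF Lp_classD(1)[OF that] p])
    show "(\<lambda>\<omega>. c *\<^sub>C f \<omega>) \<in> Lp_fun M p" by (rule Lp_fun_scaleC[OF f p])
  qed
  have "ns_scale (Lp_space M p) c (Lp_class M p f) = (\<Union>f'\<in>Lp_class M p f. Lp_class M p (\<lambda>\<omega>. c *\<^sub>C f' \<omega>))"
    by (simp only: Lp_space_def normed_space.simps)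
  also have "\<dots> = (\<Union>f'\<in>Lp_class M p f. Lp_class M p (\<lambda>\<omega>. c *\<^sub>C f \<omega>))"
    by (intro SUP_cong refl eq)
  also have "\<dots> = Lp_class M p (\<lambda>\<omega>. c *\<^sub>C f \<omega>)"
    by (simp only: UN_constant Lp_class_nonempty[OF f] if_False)
  finally show ?thesis .
qed

lemma Lp_norm_nonneg:
  assumes "F \<in> ns_carrier (Lp_space M p)" shows "0 \<le> ns_norm (Lp_space M p) F"
proof -
  obtain f where f: "f \<in> Lp_fun M p" and F: "F = Lp_class M p f" by (rule Lp_carrierE[OF assms])
  have "Lp_seminorm M p g = Lp_seminorm M p f" if "g \<in> F" for g
  proof -
    have fg: "g \<in> Lp_fun M p" "AE \<omega> in M. f \<omega> = g \<omega>"
      by (rule Lp_classD(1)[OF that[unfolded F]], rule Lp_classD(2)[OF that[unfolded F]])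
    have "(\<integral>\<omega>. norm (g \<omega>) powr p \<partial>M) = (\<integral>\<omega>. norm (f \<omega>) powr p \<partial>M)"
    proof (rule integral_cong_AE)
      show "AE \<omega> in M. norm (g \<omega>) powr p = norm (f \<omega>) powr p"
        using fg(2) by eventually_elim simp
      show "(\<lambda>\<omega>. norm (g \<omega>) powr p) \<in> borel_measurable M" "(\<lambda>\<omega>. norm (f \<omega>) powr p) \<in> borel_measurable M"
        using f fg(1) unfolding Lp_fun_def by (simp_all add: borel_measurable_integrable)
    qed
    then show ?thesis by (simp add: Lp_seminorm_def)
  qed
  moreover have "f \<in> F" using Lp_class_self[OF f] by (simp add: F)
  ultimately have "Lp_seminorm M p ` F = {Lp_seminorm M p f}" by blast
  then have "ns_norm (Lp_space M p) F = Lp_seminorm M p f"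
    by (simp only: Lp_space_def normed_space.simps the_elem_eq)
  then show ?thesis by (simp only: Lp_seminorm_def powr_ge_zero)
qed

text \<open>The folds that define finite sums depend only on values in the carrier, on which
  addition is commutative and associative.\<close>

lemma additive_ns_sum:
  fixes M :: "'s measure" and f :: "'i \<Rightarrow> ('s \<Rightarrow> 'x::complex_banach) set"
  assumes p: "1 < p" and N: "finite N"
    and f: "\<And>n. n \<in> N \<Longrightarrow> f n \<in> ns_carrier (Lp_space M p)"
    and Q: "bounded_operator_between (Lp_space M p) type_space Q"
  shows "ns_sum (Lp_space M p) N f \<in> ns_carrier (Lp_space M p)
    \<and> Q (ns_sum (Lp_space M p) N f) = (\<Sum>n\<in>N. Q (f n))"
proof -
  let ?V = "Lp_space M p :: ('s \<Rightarrow> 'x) set normed_space"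
  let ?B = "ns_carrier ?V"
  have Qadd: "Q (ns_add ?V F G) = Q F + Q G" if "F \<in> ?B" "G \<in> ?B" for F G
    using Q that by (simp add: bounded_operator_between_def type_space_def)
  have zero: "ns_zero ?V = Lp_class M p (\<lambda>\<omega>. 0)" by (simp only: Lp_space_def normed_space.simps)
  have zB: "ns_zero ?V \<in> ?B" unfolding zero by (rule Lp_class_in_carrier[OF Lp_fun_zero])
  have zz: "ns_add ?V (ns_zero ?V) (ns_zero ?V) = ns_zero ?V"
    unfolding zero by (subst Lp_add_class[OF p Lp_fun_zero Lp_fun_zero]) simp
  have "Q (ns_zero ?V) = Q (ns_zero ?V) + Q (ns_zero ?V)"
    using Qadd[OF zB zB] by (simp only: zz)
  then have Q0: "Q (ns_zero ?V) = 0" by (simp only: add_cancel_right_right)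
  have closed: "ns_add ?V F G \<in> ?B" if FG: "F \<in> ?B" "G \<in> ?B" for F G
  proof -
    obtain f where f: "f \<in> Lp_fun M p" "F = Lp_class M p f" by (rule Lp_carrierE[OF FG(1)])
    obtain g where g: "g \<in> Lp_fun M p" "G = Lp_class M p g" by (rule Lp_carrierE[OF FG(2)])
    show ?thesis
      unfolding f(2) g(2) Lp_add_class[OF p f(1) g(1)]
      by (rule Lp_class_in_carrier[OF Lp_fun_add[OF f(1) g(1) p]])
  qed
  have left_comm: "ns_add ?V F (ns_add ?V G H) = ns_add ?V G (ns_add ?V F H)"
    if FGH: "F \<in> ?B" "G \<in> ?B" "H \<in> ?B" for F G H
  proof -
    obtain f where f: "f \<in> Lp_fun M p" "F = Lp_class M p f" by (rule Lp_carrierE[OF FGH(1)])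
    obtain g where g: "g \<in> Lp_fun M p" "G = Lp_class M p g" by (rule Lp_carrierE[OF FGH(2)])
    obtain h where h: "h \<in> Lp_fun M p" "H = Lp_class M p h" by (rule Lp_carrierE[OF FGH(3)])
    have "(\<lambda>\<omega>. f \<omega> + (g \<omega> + h \<omega>)) = (\<lambda>\<omega>. g \<omega> + (f \<omega> + h \<omega>))"
      by (rule ext) (rule add.left_commute)
    then show ?thesis
      unfolding f(2) g(2) h(2) Lp_add_class[OF p g(1) h(1)] Lp_add_class[OF p f(1) h(1)]
        Lp_add_class[OF p f(1) Lp_fun_add[OF g(1) h(1) p]] Lp_add_class[OF p g(1) Lp_fun_add[OF f(1) h(1) p]]
      by (rule arg_cong)
  qed
  define A where "A n G = (if G \<in> ?B then ns_add ?V (f n) G else G)" for n G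
  have Ain: "A n G = ns_add ?V (f n) G" if "G \<in> ?B" for n G by (simp only: A_def that if_True)
  have Aout: "A n G = G" if "G \<notin> ?B" for n G by (simp only: A_def that if_False)
  have AB: "A n G \<in> ?B" if "n \<in> N" "G \<in> ?B" for n G
    unfolding Ain[OF that(2)] by (rule closed[OF f[OF that(1)] that(2)])
  have comm: "A n (A m G) = A m (A n G)" if mn: "m \<in> N" "n \<in> N" for m n G
  proof (cases "G \<in> ?B")
    case True
    then show ?thesis
      by (simp only: Ain AB[OF mn(1)] AB[OF mn(2)] closed f[OF mn(1)] f[OF mn(2)])
        (rule left_comm[OF f[OF mn(2)] f[OF mn(1)] True])
  qed (simp only: Aout not_False_eq_True)
  interpret comp_fun_commute_on N A
    by unfold_locales (rule ext, simp only: o_apply comm)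
  have fold_eq: "ns_sum ?V N f = Finite_Set.fold A (ns_zero ?V) N"
    unfolding ns_sum_def
  proof (rule fold_closed_eq[of N ?B])
    fix n G assume "n \<in> N" "G \<in> ?B"
    then show "ns_add ?V (f n) G = A n G" "A n G \<in> ?B" by (simp only: Ain, intro AB)
  qed (rule zB)
  have "Finite_Set.fold A (ns_zero ?V) N' \<in> ?B
      \<and> Q (Finite_Set.fold A (ns_zero ?V) N') = (\<Sum>n\<in>N'. Q (f n))" if "N' \<subseteq> N" for N'
    using finite_subset[OF that N] that
  proof (induction N' rule: finite_induct)
    case empty
    then show ?case using zB Q0 by simp
  next
    case (insert n N')
    then have n: "n \<in> N" and IH: "Finite_Set.fold A (ns_zero ?V) N' \<in> ?B"
      "Q (Finite_Set.fold A (ns_zero ?V) N') = (\<Sum>n\<in>N'. Q (f n))" by auto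
    have "Finite_Set.fold A (ns_zero ?V) (insert n N') = A n (Finite_Set.fold A (ns_zero ?V) N')"
      using insert by (intro fold_insert) auto
    then show ?case
      using Qadd[OF f[OF n] IH(1)] AB[OF n IH(1)] Ain[OF IH(1)] IH(2) insert(1,2) by simp
  qed
  from this[OF order_refl] show ?thesis by (simp only: fold_eq)
qed

definition op_monomial :: "('d::{finite,linorder} \<Rightarrow> 'x::complex_banach op) \<Rightarrow> ('d \<Rightarrow> nat) \<Rightarrow> 'x op"
  where "op_monomial A n = prod_list (map (\<lambda>k. A k ^ n k) (sorted_list_of_set UNIV))"

text \<open>The dilation turns a polynomial in the operators into \<open>Q\<close> and \<open>J\<close> around the same polynomial in
  the isomorphisms.\<close>

lemma dilation_polynomial_bound:
  fixes A :: "'d::{finite,linorder} \<Rightarrow> 'x::complex_banach op"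
    and M :: "'s measure" and J :: "'x \<Rightarrow> ('s \<Rightarrow> 'x) set"
  assumes p: "1 < p"
    and U: "\<And>k. isomorphism_on (Lp_space M p) (U k)"
    and tc: "torus_bounded_calculus (Lp_space M p) U"
    and J: "bounded_operator_between type_space (Lp_space M p) J"
    and Q: "bounded_operator_between (Lp_space M p) type_space Q"
    and dil: "\<And>n x. op_monomial A n \<star> x = Q (multi_power_on (Lp_space M p) U (\<lambda>k. int (n k)) (J x))"
  shows "\<exists>C\<ge>0. \<forall>N a B. finite N \<longrightarrow> (\<forall>z. (\<forall>k. cmod (z k) \<le> 1) \<longrightarrow>
      cmod (\<Sum>n\<in>N. a n * (\<Prod>k\<in>UNIV. z k ^ n k)) \<le> B)
      \<longrightarrow> norm (\<Sum>n\<in>N. a n *\<^sub>C op_monomial A n) \<le> C * B"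
proof -
  let ?V = "Lp_space M p :: ('s \<Rightarrow> 'x) set normed_space"
  let ?B = "ns_carrier ?V"
  have "\<exists>CQ. \<forall>F\<in>?B. norm (Q F) \<le> CQ * ns_norm ?V F"
    using Q unfolding bounded_operator_between_def type_space_def by simp
  then obtain CQ where CQ: "\<And>F. F \<in> ?B \<Longrightarrow> norm (Q F) \<le> CQ * ns_norm ?V F" by blast
  have "\<exists>CJ. \<forall>x. ns_norm ?V (J x) \<le> CJ * norm x"
    using J unfolding bounded_operator_between_def type_space_def by simp
  then obtain CJ where CJ: "\<And>x. ns_norm ?V (J x) \<le> CJ * norm x" by blast
  obtain C where C: "C \<ge> 1" and tcC: "\<forall>(N :: ('d \<Rightarrow> int) set) a. finite N \<longrightarrow> (\<forall>y\<in>?B.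
        ns_norm ?V (ns_sum ?V N (\<lambda>n. ns_scale ?V (a n) (multi_power_on ?V U n y)))
          \<le> C * (SUP s::'d \<Rightarrow> real. cmod (\<Sum>n\<in>N. a n * cis (\<Sum>k\<in>UNIV. of_int (n k) * s k)))
              * ns_norm ?V y)"
    using tc unfolding torus_bounded_calculus_def by (elim exE conjE) (rule that)
  note tc' = tcC[rule_format]
  have JB: "J x \<in> ?B" for x using J by (simp add: bounded_operator_between_def type_space_def)
  have UB: "U k F \<in> ?B" if "F \<in> ?B" for k F
    using U[of k] that by (simp add: isomorphism_on_def bounded_operator_between_def)
  have scB: "ns_scale ?V c F \<in> ?B" if F: "F \<in> ?B" for c F
  proof -
    obtain f where f: "f \<in> Lp_fun M p" "F = Lp_class M p f" by (rule Lp_carrierE[OF F])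
    show ?thesis
      unfolding f(2) Lp_scale_class[OF p f(1)] by (intro Lp_class_in_carrier Lp_fun_scaleC f(1) p)
  qed
  have mB: "multi_power_on ?V U (\<lambda>k. int (n k)) F \<in> ?B" if F: "F \<in> ?B" for n F
  proof -
    have pow: "(U k ^^ m) G \<in> ?B" if "G \<in> ?B" for k m G
      using that by (induction m) (auto intro: UB)
    have "foldr (\<lambda>k S. int_power_on ?V (U k) (int (n k)) \<circ> S) ks id F \<in> ?B" for ks
      by (induction ks) (auto simp: F int_power_on_def pow)
    then show ?thesis by (simp add: multi_power_on_def)
  qed
  have "norm (\<Sum>n\<in>N. a n *\<^sub>C op_monomial A n) \<le> \<bar>CQ\<bar> * C * \<bar>CJ\<bar> * B"
    if N: "finite N" and B: "\<And>z. (\<And>k. cmod (z k) \<le> 1) \<Longrightarrow> cmod (\<Sum>n\<in>N. a n * (\<Prod>k\<in>UNIV. z k ^ n k)) \<le> B"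
    for N a B
  proof (rule norm_op_leI)
    have B0: "0 \<le> B" by (rule order_trans[OF norm_ge_zero B[of "\<lambda>_. 0"]]) simp
    then show "0 \<le> \<bar>CQ\<bar> * C * \<bar>CJ\<bar> * B" using C by simp
    fix x
    let ?i = "\<lambda>(n :: 'd \<Rightarrow> nat) k. int (n k)"
    define N' where "N' = ?i ` N"
    define a' where "a' m = a (\<lambda>k. nat (m k))" for m :: "'d \<Rightarrow> int"
    have inj: "inj_on ?i N" by (auto simp: inj_on_def fun_eq_iff)
    have N': "finite N'" using N by (simp add: N'_def)
    define g where "g m = ns_scale ?V (a' m) (multi_power_on ?V U m (J x))" for m
    have gB: "g m \<in> ?B" if "m \<in> N'" for m
      using that by (auto simp: N'_def g_def intro!: scB mB JB)
    have S: "ns_sum ?V N' g \<in> ?B \<and> Q (ns_sum ?V N' g) = (\<Sum>m\<in>N'. Q (g m))"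
      by (rule additive_ns_sum[OF p N' gB Q])
    have "(\<Sum>n\<in>N. a n *\<^sub>C op_monomial A n) \<star> x = (\<Sum>n\<in>N. a n *\<^sub>C Q (multi_power_on ?V U (?i n) (J x)))"
      by (simp add: op_app_sum dil)
    also have "\<dots> = (\<Sum>n\<in>N. Q (g (?i n)))"
    proof (intro sum.cong refl)
      fix n
      have "Q (ns_scale ?V (a n) F) = a n *\<^sub>C Q F" if "F \<in> ?B" for F
        using Q that by (simp add: bounded_operator_between_def type_space_def)
      then show "a n *\<^sub>C Q (multi_power_on ?V U (?i n) (J x)) = Q (g (?i n))"
        using mB[OF JB] by (simp add: g_def a'_def)
    qed
    also have "\<dots> = (\<Sum>m\<in>N'. Q (g m))"
      unfolding N'_def by (simp add: sum.reindex[OF inj])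
    also have "\<dots> = Q (ns_sum ?V N' g)" by (rule S[THEN conjunct2, symmetric])
    finally have "norm ((\<Sum>n\<in>N. a n *\<^sub>C op_monomial A n) \<star> x) \<le> CQ * ns_norm ?V (ns_sum ?V N' g)"
      using CQ[OF S[THEN conjunct1]] by simp
    also have "\<dots> \<le> \<bar>CQ\<bar> * ns_norm ?V (ns_sum ?V N' g)"
      using Lp_norm_nonneg[OF S[THEN conjunct1]] by (intro mult_right_mono) auto
    finally have N1: "norm ((\<Sum>n\<in>N. a n *\<^sub>C op_monomial A n) \<star> x) \<le> \<bar>CQ\<bar> * ns_norm ?V (ns_sum ?V N' g)" .
    have N2: "ns_norm ?V (ns_sum ?V N' g) \<le> C * B * (\<bar>CJ\<bar> * norm x)"
    proof -
      have "ns_norm ?V (ns_sum ?V N' g)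
          \<le> C * (SUP s::'d \<Rightarrow> real. cmod (\<Sum>n\<in>N'. a' n * cis (\<Sum>k\<in>UNIV. of_int (n k) * s k))) * ns_norm ?V (J x)"
        unfolding g_def by (rule tc'[OF N' JB])
      also have "\<dots> \<le> C * B * (\<bar>CJ\<bar> * norm x)"
      proof (rule mult_mono)
       have "(SUP s::'d \<Rightarrow> real. cmod (\<Sum>n\<in>N'. a' n * cis (\<Sum>k\<in>UNIV. of_int (n k) * s k))) \<le> B"
       proof (rule cSUP_least)
        fix s :: "'d \<Rightarrow> real"
        have "(\<Sum>n\<in>N'. a' n * cis (\<Sum>k\<in>UNIV. of_int (n k) * s k)) = (\<Sum>n\<in>N. a n * (\<Prod>k\<in>UNIV. cis (s k) ^ n k))"
        proof -
          have "cis (\<Sum>k\<in>K. r k) = (\<Prod>k\<in>K. cis (r k))" if "finite K" for K :: "'d set" and r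
            using that by (induction K) (simp_all add: cis_mult[symmetric])
          from this[OF finite_class.finite_UNIV]
          have "cis (\<Sum>k\<in>UNIV. of_int (int (n k)) * s k) = (\<Prod>k\<in>UNIV. cis (s k) ^ n k)" for n
            by (simp only: Complex.DeMoivre of_int_of_nat_eq)
          then show ?thesis
            unfolding N'_def sum.reindex[OF inj] o_apply a'_def by simp
        qed
        then show "cmod (\<Sum>n\<in>N'. a' n * cis (\<Sum>k\<in>UNIV. of_int (n k) * s k)) \<le> B"
          using B[of "\<lambda>k. cis (s k)"] by simp
       qed simp
       then show "C * (SUP s::'d \<Rightarrow> real. cmod (\<Sum>n\<in>N'. a' n * cis (\<Sum>k\<in>UNIV. of_int (n k) * s k))) \<le> C * B"
         using C by (intro mult_left_mono) auto
        show "ns_norm ?V (J x) \<le> \<bar>CJ\<bar> * norm x"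
          by (rule order_trans[OF CJ mult_right_mono[OF abs_ge_self norm_ge_zero]])
      qed (use C B0 in \<open>auto intro: Lp_norm_nonneg[OF JB]\<close>)
      finally show ?thesis .
    qed
    show "norm ((\<Sum>n\<in>N. a n *\<^sub>C op_monomial A n) \<star> x) \<le> \<bar>CQ\<bar> * C * \<bar>CJ\<bar> * B * norm x"
      using order_trans[OF N1 mult_left_mono[OF N2 abs_ge_zero]] by (simp only: mult_ac)
  qed
  then show ?thesis using C by (intro exI[of _ "\<bar>CQ\<bar> * C * \<bar>CJ\<bar>"]) auto
qed

section \<open>Functions on the polydisc applied to commuting operators\<close>

lemma commute_prod_list:
  fixes X :: "'a::monoid_mult"
  assumes "\<And>i. i \<in> set is \<Longrightarrow> X * F i = F i * X"
  shows "X * prod_list (map F is) = prod_list (map F is) * X"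
  using assms by (induction "is") (simp_all add: mult.assoc[symmetric], simp add: mult.assoc)

lemma prod_list_mult_commuting:
  fixes F G :: "'i \<Rightarrow> 'a::monoid_mult"
  assumes "\<And>i j. G i * F j = F j * G i"
  shows "prod_list (map (\<lambda>i. F i * G i) is) = prod_list (map F is) * prod_list (map G is)"
proof (induction "is")
  case (Cons i "is")
  have "prod_list (map (\<lambda>i. F i * G i) (i # is)) = F i * (G i * prod_list (map F is)) * prod_list (map G is)"
    by (simp add: Cons mult.assoc)
  also have "G i * prod_list (map F is) = prod_list (map F is) * G i"
    by (rule commute_prod_list) (rule assms)
  finally show ?case by (simp add: mult.assoc)
qed simp

lemma power_commute_power: "x * y = y * x \<Longrightarrow> x ^ m * y ^ n = y ^ n * (x :: 'a::monoid_mult) ^ m"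
  by (metis power_commuting_commutes)

locale commuting_operators =
  fixes A :: "'d::{finite,linorder} \<Rightarrow> 'x::complex_banach op"
  assumes A_commute: "A i * A j = A j * A i"
begin

lemma op_monomial_add: "op_monomial A (\<lambda>k. m k + n k) = op_monomial A m * op_monomial A n"
  unfolding op_monomial_def power_add
  by (rule prod_list_mult_commuting) (intro power_commute_power A_commute)

text \<open>A pair of a polynomial and its value at the operators, written with arbitrary, possibly
  repeated, exponents; repetitions make products of such pairs easy to form.\<close>

definition poly_pair :: "(('d \<Rightarrow> complex) \<Rightarrow> complex) \<Rightarrow> 'x op \<Rightarrow> bool"
  where "poly_pair g B \<longleftrightarrow> (\<exists>I c e. finite (I :: nat set) \<and>
    g = (\<lambda>z. \<Sum>i\<in>I. c i * (\<Prod>k\<in>UNIV. z k ^ e i k)) \<and> B = (\<Sum>i\<in>I. c i *\<^sub>C op_monomial A (e i)))"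

lemma poly_pairI:
  fixes I :: "'i::countable set"
  assumes "finite I" "\<And>z. g z = (\<Sum>i\<in>I. c i * (\<Prod>k\<in>UNIV. z k ^ e i k))"
    and "B = (\<Sum>i\<in>I. c i *\<^sub>C op_monomial A (e i))"
  shows "poly_pair g B"
  unfolding poly_pair_def
proof (intro exI conjI)
  show "finite (to_nat ` I)" using assms(1) by simp
  show "g = (\<lambda>z. \<Sum>i\<in>to_nat ` I. c (from_nat i) * (\<Prod>k\<in>UNIV. z k ^ e (from_nat i) k))"
    by (rule ext) (simp add: assms(2) sum.reindex)
  show "B = (\<Sum>i\<in>to_nat ` I. c (from_nat i) *\<^sub>C op_monomial A (e (from_nat i)))"
    by (simp add: assms(3) sum.reindex)
qed

lemma poly_pair_const: "poly_pair (\<lambda>z. c) (c *\<^sub>C 1)"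
proof (rule poly_pairI[of "{0::nat}"])
  have "prod_list (map (\<lambda>k. A k ^ 0) ks) = 1" for ks by (induction ks) auto
  then have "op_monomial A (\<lambda>k. 0) = 1" by (simp only: op_monomial_def)
  then show "c *\<^sub>C 1 = (\<Sum>i\<in>{0::nat}. c *\<^sub>C op_monomial A (\<lambda>k. 0))" by simp
qed simp_all

lemma poly_pair_var: "poly_pair (\<lambda>z. z k) (A k)"
proof (rule poly_pairI[of "{0::nat}" _ "\<lambda>_. 1" "\<lambda>_ j. if j = k then 1 else 0"])
  have "prod_list (map (\<lambda>j. A j ^ (if j = k then 1 else 0)) ks) = (if k \<in> set ks then A k else 1)"
    if "distinct ks" for ks
    using that by (induction ks) auto
  from this[of "sorted_list_of_set UNIV"]
  have "op_monomial A (\<lambda>j. if j = k then 1 else 0) = A k" by (simp add: op_monomial_def)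
  then show "A k = (\<Sum>i\<in>{0::nat}. 1 *\<^sub>C op_monomial A (\<lambda>j. if j = k then 1 else 0))" by simp
  show "z k = (\<Sum>i\<in>{0::nat}. 1 * (\<Prod>j\<in>UNIV. z j ^ (if j = k then 1 else 0)))" for z
  proof -
    have "z j ^ (if j = k then 1 else 0) = (if j = k then z j else 1)" for j by simp
    then show ?thesis by (simp add: prod.delta)
  qed
qed simp

lemma poly_pair_add:
  assumes "poly_pair g B" "poly_pair h C" shows "poly_pair (\<lambda>z. g z + h z) (B + C)"
proof -
  obtain I c e where 1: "finite (I :: nat set)" "g = (\<lambda>z. \<Sum>i\<in>I. c i * (\<Prod>k\<in>UNIV. z k ^ e i k))"
    "B = (\<Sum>i\<in>I. c i *\<^sub>C op_monomial A (e i))" using assms(1) unfolding poly_pair_def by blast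
  obtain J c' e' where 2: "finite (J :: nat set)" "h = (\<lambda>z. \<Sum>i\<in>J. c' i * (\<Prod>k\<in>UNIV. z k ^ e' i k))"
    "C = (\<Sum>i\<in>J. c' i *\<^sub>C op_monomial A (e' i))" using assms(2) unfolding poly_pair_def by blast
  show ?thesis
    by (rule poly_pairI[of "I <+> J" _ "case_sum c c'" "case_sum e e'"])
      (simp_all add: 1 2 sum.Plus)
qed

lemma poly_pair_mult:
  assumes "poly_pair g B" "poly_pair h C" shows "poly_pair (\<lambda>z. g z * h z) (B * C)"
proof -
  obtain I c e where 1: "finite (I :: nat set)" "g = (\<lambda>z. \<Sum>i\<in>I. c i * (\<Prod>k\<in>UNIV. z k ^ e i k))"
    "B = (\<Sum>i\<in>I. c i *\<^sub>C op_monomial A (e i))" using assms(1) unfolding poly_pair_def by blast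
  obtain J c' e' where 2: "finite (J :: nat set)" "h = (\<lambda>z. \<Sum>i\<in>J. c' i * (\<Prod>k\<in>UNIV. z k ^ e' i k))"
    "C = (\<Sum>i\<in>J. c' i *\<^sub>C op_monomial A (e' i))" using assms(2) unfolding poly_pair_def by blast
  show ?thesis
  proof (rule poly_pairI[of "I \<times> J" _ "\<lambda>(i, j). c i * c' j" "\<lambda>(i, j) k. e i k + e' j k"])
    show "g z * h z = (\<Sum>x\<in>I \<times> J. (case x of (i, j) \<Rightarrow> c i * c' j) *
        (\<Prod>k\<in>UNIV. z k ^ (case x of (i, j) \<Rightarrow> \<lambda>k. e i k + e' j k) k))" for z
      unfolding 1(2) 2(2) sum_product sum.cartesian_product
      by (intro sum.cong refl) (auto simp: power_add prod.distrib mult_ac)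
    show "B * C = (\<Sum>x\<in>I \<times> J. (case x of (i, j) \<Rightarrow> c i * c' j) *\<^sub>C
        op_monomial A (case x of (i, j) \<Rightarrow> \<lambda>k. e i k + e' j k))"
      unfolding 1(3) 2(3) sum_product sum.cartesian_product
      by (intro sum.cong refl) (auto simp: op_monomial_add scaleC_scaleC mult.commute)
  qed (use 1 2 in simp)
qed

lemma poly_pair_bounded:
  assumes "poly_pair g B" shows "\<exists>b. \<forall>z. (\<forall>k. cmod (z k) \<le> 1) \<longrightarrow> cmod (g z) \<le> b"
proof -
  obtain I c e where 1: "finite (I :: nat set)" "g = (\<lambda>z. \<Sum>i\<in>I. c i * (\<Prod>k\<in>UNIV. z k ^ e i k))"
    using assms(1) unfolding poly_pair_def by blast
  have "cmod (g z) \<le> (\<Sum>i\<in>I. cmod (c i))" if "\<forall>k. cmod (z k) \<le> 1" for z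
    unfolding 1
    by (intro sum_norm_le)
      (use that in \<open>auto simp: norm_mult norm_power prod_norm[symmetric] intro!: mult_left_le prod_le_1 power_le_one\<close>)
  then show ?thesis by blast
qed

text \<open>The values of uniform limits of polynomials on the closed polydisc, if the operators
  converge as well.\<close>

definition disc_pair :: "(('d \<Rightarrow> complex) \<Rightarrow> complex) \<Rightarrow> 'x op \<Rightarrow> bool"
  where "disc_pair g B \<longleftrightarrow> (\<forall>e>0. \<exists>g' B'. poly_pair g' B' \<and>
    (\<forall>z. (\<forall>k. cmod (z k) \<le> 1) \<longrightarrow> cmod (g z - g' z) \<le> e) \<and> norm (B - B') \<le> e)"

lemma poly_pair_imp_disc_pair: "poly_pair g B \<Longrightarrow> disc_pair g B"
  unfolding disc_pair_def by (metis cancel_comm_monoid_add_class.diff_cancel less_imp_le norm_zero)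

lemma disc_pair_limit:
  assumes "\<And>e. e > 0 \<Longrightarrow> \<exists>g' B'. disc_pair g' B' \<and>
    (\<forall>z. (\<forall>k. cmod (z k) \<le> 1) \<longrightarrow> cmod (g z - g' z) \<le> e) \<and> norm (B - B') \<le> e"
  shows "disc_pair g B"
  unfolding disc_pair_def
proof (intro allI impI)
  fix e :: real assume "e > 0"
  then have e: "e / 2 > 0" by simp
  from assms[OF e] obtain g1 B1 where 1: "disc_pair g1 B1"
    "\<And>z. (\<And>k. cmod (z k) \<le> 1) \<Longrightarrow> cmod (g z - g1 z) \<le> e / 2" "norm (B - B1) \<le> e / 2" by blast
  from 1(1) e obtain g2 B2 where 2: "poly_pair g2 B2"
    "\<And>z. (\<And>k. cmod (z k) \<le> 1) \<Longrightarrow> cmod (g1 z - g2 z) \<le> e / 2" "norm (B1 - B2) \<le> e / 2"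
    unfolding disc_pair_def by blast
  have "cmod (g z - g2 z) \<le> e" if "\<forall>k. cmod (z k) \<le> 1" for z
    using norm_triangle_ineq[of "g z - g1 z" "g1 z - g2 z"] 1(2)[of z] 2(2)[of z] that by simp
  moreover have "norm (B - B2) \<le> e"
    using norm_triangle_ineq[of "B - B1" "B1 - B2"] 1(3) 2(3) by simp
  ultimately show "\<exists>g' B'. poly_pair g' B' \<and>
    (\<forall>z. (\<forall>k. cmod (z k) \<le> 1) \<longrightarrow> cmod (g z - g' z) \<le> e) \<and> norm (B - B') \<le> e" using 2(1) by blast
qed

lemma disc_pair_add:
  assumes "disc_pair g B" "disc_pair h C" shows "disc_pair (\<lambda>z. g z + h z) (B + C)"
  unfolding disc_pair_def
proof (intro allI impI)
  fix e :: real assume "e > 0"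
  then have e: "e / 2 > 0" by simp
  from assms(1) e obtain g1 B1 where 1: "poly_pair g1 B1"
    "\<And>z. (\<And>k. cmod (z k) \<le> 1) \<Longrightarrow> cmod (g z - g1 z) \<le> e / 2" "norm (B - B1) \<le> e / 2"
    unfolding disc_pair_def by blast
  from assms(2) e obtain g2 B2 where 2: "poly_pair g2 B2"
    "\<And>z. (\<And>k. cmod (z k) \<le> 1) \<Longrightarrow> cmod (h z - g2 z) \<le> e / 2" "norm (C - B2) \<le> e / 2"
    unfolding disc_pair_def by blast
  have "cmod (g z + h z - (g1 z + g2 z)) \<le> e" if "\<forall>k. cmod (z k) \<le> 1" for z
    using norm_triangle_ineq[of "g z - g1 z" "h z - g2 z"] 1(2)[of z] 2(2)[of z] that
    by (simp add: algebra_simps)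
  moreover have "norm (B + C - (B1 + B2)) \<le> e"
    using norm_triangle_ineq[of "B - B1" "C - B2"] 1(3) 2(3) by (simp add: algebra_simps)
  ultimately show "\<exists>g' B'. poly_pair g' B' \<and>
    (\<forall>z. (\<forall>k. cmod (z k) \<le> 1) \<longrightarrow> cmod (g z + h z - g' z) \<le> e) \<and> norm (B + C - B') \<le> e"
    using poly_pair_add[OF 1(1) 2(1)] by (intro exI[of _ "\<lambda>z. g1 z + g2 z"] exI[of _ "B1 + B2"]) auto
qed

lemma disc_pair_mult:
  assumes "disc_pair g B" "disc_pair h C" shows "disc_pair (\<lambda>z. g z * h z) (B * C)"
  unfolding disc_pair_def
proof (intro allI impI)
  fix e :: real assume "e > 0"
  have bdd: "\<exists>b\<ge>0. \<forall>z. (\<forall>k. cmod (z k) \<le> 1) \<longrightarrow> cmod (g z) \<le> b" if "disc_pair g B" for g B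
  proof -
    from that obtain g1 B1 where 1: "poly_pair g1 B1"
      "\<And>z. (\<And>k. cmod (z k) \<le> 1) \<Longrightarrow> cmod (g z - g1 z) \<le> 1"
      unfolding disc_pair_def by (meson zero_less_one)
    from poly_pair_bounded[OF 1(1)] obtain b where b: "\<And>z. (\<And>k. cmod (z k) \<le> 1) \<Longrightarrow> cmod (g1 z) \<le> b"
      by blast
    have "cmod (g z) \<le> \<bar>b\<bar> + 1" if "\<forall>k. cmod (z k) \<le> 1" for z
      using norm_triangle_ineq[of "g z - g1 z" "g1 z"] 1(2)[of z] b[of z] that by simp
    then show ?thesis by (intro exI[of _ "\<bar>b\<bar> + 1"]) auto
  qed
  obtain bg where bg: "bg \<ge> 0" "\<And>z. (\<And>k. cmod (z k) \<le> 1) \<Longrightarrow> cmod (g z) \<le> bg"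
    using bdd[OF assms(1)] by blast
  obtain bh where bh: "bh \<ge> 0" "\<And>z. (\<And>k. cmod (z k) \<le> 1) \<Longrightarrow> cmod (h z) \<le> bh"
    using bdd[OF assms(2)] by blast
  define m where "m = bg + bh + norm B + norm C + 1"
  have m: "m > 0" using bg(1) bh(1) by (simp add: m_def add_nonneg_pos)
  define e' where "e' = min 1 (e / m)"
  have e': "e' > 0" "e' \<le> 1" "e' * m \<le> e"
    using m \<open>e > 0\<close> by (auto simp: e'_def min_def field_simps)
  from assms(1) e'(1) obtain g1 B1 where 1: "poly_pair g1 B1"
    "\<And>z. (\<And>k. cmod (z k) \<le> 1) \<Longrightarrow> cmod (g z - g1 z) \<le> e'" "norm (B - B1) \<le> e'"
    unfolding disc_pair_def by blast
  from assms(2) e'(1) obtain g2 B2 where 2: "poly_pair g2 B2"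
    "\<And>z. (\<And>k. cmod (z k) \<le> 1) \<Longrightarrow> cmod (h z - g2 z) \<le> e'" "norm (C - B2) \<le> e'"
    unfolding disc_pair_def by blast
  have "cmod (g z * h z - g1 z * g2 z) \<le> e" if z: "\<forall>k. cmod (z k) \<le> 1" for z
  proof -
    have a: "cmod (g z - g1 z) \<le> e'" "cmod (h z - g2 z) \<le> e'" "cmod (g z) \<le> bg" "cmod (h z) \<le> bh"
      using z by (auto intro: 1(2) 2(2) bg(2) bh(2))
    have "g z * h z - g1 z * g2 z = (g z - g1 z) * h z + (g z - (g z - g1 z)) * (h z - g2 z)"
      by (simp add: algebra_simps)
    also have "cmod \<dots> \<le> e' * bh + (bg + e') * e'"
      unfolding norm_mult
    proof (intro norm_triangle_le add_mono)
      show "cmod ((g z - g1 z) * h z) \<le> e' * bh"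
        unfolding norm_mult using a e'(1) by (intro mult_mono) auto
      have "cmod (g z - (g z - g1 z)) \<le> bg + e'"
        using norm_triangle_ineq4[of "g z" "g z - g1 z"] a by linarith
      then show "cmod ((g z - (g z - g1 z)) * (h z - g2 z)) \<le> (bg + e') * e'"
        unfolding norm_mult using a e'(1) bg(1) by (intro mult_mono) auto
    qed
    also have "\<dots> \<le> e' * m"
    proof -
      have "e' * e' \<le> e'" "0 \<le> e' * norm B" "0 \<le> e' * norm C" using e' by (auto intro: mult_left_le)
      then show ?thesis by (simp add: m_def algebra_simps)
    qed
    finally show ?thesis using e'(3) by simp
  qed
  moreover have "norm (B * C - B1 * B2) \<le> e"
  proof -
    have "B * C - B1 * B2 = (B - B1) * C + (B - (B - B1)) * (C - B2)"
      by (simp add: algebra_simps)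
    also have "norm \<dots> \<le> e' * norm C + (norm B + e') * e'"
    proof (intro norm_triangle_le add_mono)
      show "norm ((B - B1) * C) \<le> e' * norm C"
        using 1(3) by (intro order_trans[OF norm_mult_ineq] mult_right_mono) auto
      have "norm (B - (B - B1)) \<le> norm B + e'"
        using norm_triangle_ineq4[of B "B - B1"] 1(3) by simp
      then show "norm ((B - (B - B1)) * (C - B2)) \<le> (norm B + e') * e'"
        using 2(3) e'(1) by (intro order_trans[OF norm_mult_ineq] mult_mono) auto
    qed
    also have "\<dots> \<le> e' * m"
    proof -
      have "e' * e' \<le> e'" "0 \<le> e' * bg" "0 \<le> e' * bh" using e' bg(1) bh(1) by (auto intro: mult_left_le)
      then show ?thesis by (simp add: m_def algebra_simps)
    qed
    finally show ?thesis using e'(3) by simp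
  qed
  ultimately show "\<exists>g' B'. poly_pair g' B' \<and>
    (\<forall>z. (\<forall>k. cmod (z k) \<le> 1) \<longrightarrow> cmod (g z * h z - g' z) \<le> e) \<and> norm (B * C - B') \<le> e"
    using poly_pair_mult[OF 1(1) 2(1)] by (intro exI[of _ "\<lambda>z. g1 z * g2 z"] exI[of _ "B1 * B2"]) auto
qed

lemma disc_pair_const: "disc_pair (\<lambda>z. c) (c *\<^sub>C 1)"
  by (rule poly_pair_imp_disc_pair[OF poly_pair_const])

lemma disc_pair_scale: "disc_pair g B \<Longrightarrow> disc_pair (\<lambda>z. c * g z) (c *\<^sub>C B)"
  using disc_pair_mult[OF disc_pair_const[of c]] by fastforce

lemma disc_pair_sum:
  "(\<And>i. i \<in> I \<Longrightarrow> disc_pair (g i) (B i)) \<Longrightarrow> disc_pair (\<lambda>z. \<Sum>i\<in>I. g i z) (\<Sum>i\<in>I. B i)"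
proof (induction I rule: infinite_finite_induct)
  case (insert i I)
  then show ?case by (simp add: disc_pair_add)
qed (use disc_pair_const[of 0] in simp_all)

lemma disc_pair_power: "disc_pair g B \<Longrightarrow> disc_pair (\<lambda>z. g z ^ n) (B ^ n)"
  using disc_pair_const[of 1] by (induction n) (auto intro: disc_pair_mult)

lemma disc_pair_prod_list:
  "(\<And>i. i \<in> set is \<Longrightarrow> disc_pair (g i) (B i)) \<Longrightarrow>
    disc_pair (\<lambda>z. prod_list (map (\<lambda>i. g i z) is)) (prod_list (map B is))"
  using disc_pair_const[of 1] by (induction "is") (auto intro: disc_pair_mult)

text \<open>For \<open>|w| > 1\<close> the power series \<open>\<Sum>z\<^sup>n/w\<^sup>n\<^sup>+\<^sup>1\<close> converges uniformly on the closed disc, and so does the series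
  of the operators, as their powers are bounded.\<close>

lemma disc_pair_resolvent:
  assumes T: "\<And>n. norm (A k ^ n) \<le> C" and w: "cmod w > 1"
  shows "disc_pair (\<lambda>z. 1 / (w - z k)) (res w (A k))"
proof (rule disc_pair_limit)
  fix e :: real assume e: "e > 0"
  define q where "q = 1 / w"
  have q: "cmod q < 1" "w \<noteq> 0" using w by (auto simp: q_def norm_divide divide_less_eq)
  have "(\<lambda>M. norm (res w (A k) - (\<Sum>n<M. q ^ Suc n *\<^sub>C A k ^ n))) \<longlonglongrightarrow> norm (res w (A k) - res w (A k))"
    using is_res_power_series(2)[OF T w] unfolding sums_def q_def by (intro tendsto_intros)
  then have "\<forall>\<^sub>F M in sequentially. norm (res w (A k) - (\<Sum>n<M. q ^ Suc n *\<^sub>C A k ^ n)) < e"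
    using e by (intro order_tendstoD(2)) auto
  moreover have "(\<lambda>M. cmod q ^ M / (cmod w - 1)) \<longlonglongrightarrow> 0 / (cmod w - 1)"
    using q w by (intro tendsto_intros LIMSEQ_power_zero) auto
  then have "\<forall>\<^sub>F M in sequentially. cmod q ^ M / (cmod w - 1) < e"
    using e by (intro order_tendstoD(2)) auto
  ultimately have "\<forall>\<^sub>F M in sequentially. norm (res w (A k) - (\<Sum>n<M. q ^ Suc n *\<^sub>C A k ^ n)) < e
      \<and> cmod q ^ M / (cmod w - 1) < e" by eventually_elim simp
  then obtain M where M: "norm (res w (A k) - (\<Sum>n<M. q ^ Suc n *\<^sub>C A k ^ n)) < e" "cmod q ^ M / (cmod w - 1) < e"
    by (auto simp: eventually_sequentially)
  have "cmod (1 / (w - z k) - (\<Sum>n<M. q ^ Suc n * z k ^ n)) \<le> e" if "\<forall>k. cmod (z k) \<le> 1" for z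
  proof -
    define \<zeta> where "\<zeta> = z k"
    have z: "cmod \<zeta> \<le> 1" using that by (simp add: \<zeta>_def)
    have ne: "w - \<zeta> \<noteq> 0" using z w by auto
    have wz: "cmod w - 1 \<le> cmod (w - \<zeta>)" using norm_triangle_ineq2[of w \<zeta>] z by simp
    have "(w - \<zeta>) * (\<Sum>n<M. q ^ Suc n * \<zeta> ^ n) = 1 - (q * \<zeta>) ^ M"
    proof (induction M)
      case (Suc M)
      have "(w - \<zeta>) * (q ^ Suc M * \<zeta> ^ M) = (q * \<zeta>) ^ M - (q * \<zeta>) ^ Suc M"
        using q(2) by (simp add: q_def power_mult_distrib field_simps)
      with Suc show ?case by (simp add: distrib_left)
    qed simp
    then have "1 / (w - \<zeta>) - (\<Sum>n<M. q ^ Suc n * \<zeta> ^ n) = (q * \<zeta>) ^ M / (w - \<zeta>)"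
      using ne by (simp add: field_simps)
    also have "cmod \<dots> \<le> cmod q ^ M * 1 / (cmod w - 1)"
      unfolding norm_divide norm_power norm_mult power_mult_distrib
      using w z wz by (intro frac_le mult_left_mono power_le_one) auto
    finally show ?thesis using M(2) by (simp add: \<zeta>_def)
  qed
  moreover have "disc_pair (\<lambda>z. \<Sum>n<M. q ^ Suc n * z k ^ n) (\<Sum>n<M. q ^ Suc n *\<^sub>C A k ^ n)"
    by (intro disc_pair_sum disc_pair_scale disc_pair_power poly_pair_imp_disc_pair poly_pair_var)
  ultimately show "\<exists>g' B'. disc_pair g' B' \<and>
    (\<forall>z. (\<forall>k. cmod (z k) \<le> 1) \<longrightarrow> cmod (1 / (w - z k) - g' z) \<le> e) \<and> norm (res w (A k) - B') \<le> e"
    using M(1) by (intro exI[of _ "\<lambda>z. \<Sum>n<M. q ^ Suc n * z k ^ n"] exI[of _ "\<Sum>n<M. q ^ Suc n *\<^sub>C A k ^ n"]) auto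
qed

end

locale polynomially_bounded = commuting_operators +
  fixes C :: real
  assumes C_nonneg: "0 \<le> C"
    and polynomial_bound: "\<And>N a B. finite N \<Longrightarrow> (\<And>z. (\<And>k. cmod (z k) \<le> 1) \<Longrightarrow>
        cmod (\<Sum>n\<in>N. a n * (\<Prod>k\<in>UNIV. z k ^ n k)) \<le> B)
      \<Longrightarrow> norm (\<Sum>n\<in>N. a n *\<^sub>C op_monomial A n) \<le> C * B"
begin

text \<open>Monomials with equal exponents have to be collected before the bound applies.\<close>

lemma poly_pair_norm:
  assumes "poly_pair g B" and g: "\<And>z. (\<And>k. cmod (z k) \<le> 1) \<Longrightarrow> cmod (g z) \<le> b"
  shows "norm B \<le> C * b"
proof -
  obtain I c e where 1: "finite (I :: nat set)" "g = (\<lambda>z. \<Sum>i\<in>I. c i * (\<Prod>k\<in>UNIV. z k ^ e i k))"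
    "B = (\<Sum>i\<in>I. c i *\<^sub>C op_monomial A (e i))" using assms(1) unfolding poly_pair_def by blast
  define a where "a n = (\<Sum>i\<in>{i\<in>I. e i = n}. c i)" for n
  have "g z = (\<Sum>n\<in>e ` I. a n * (\<Prod>k\<in>UNIV. z k ^ n k))" for z
  proof -
    have "g z = (\<Sum>n\<in>e ` I. \<Sum>i\<in>{i\<in>I. e i = n}. c i * (\<Prod>k\<in>UNIV. z k ^ e i k))"
      using 1(1) by (subst sum.group) (auto simp: 1(2))
    also have "\<dots> = (\<Sum>n\<in>e ` I. a n * (\<Prod>k\<in>UNIV. z k ^ n k))"
      by (simp add: a_def sum_distrib_right)
    finally show ?thesis .
  qed
  moreover have "B = (\<Sum>n\<in>e ` I. a n *\<^sub>C op_monomial A n)"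
  proof -
    have "B = (\<Sum>n\<in>e ` I. \<Sum>i\<in>{i\<in>I. e i = n}. c i *\<^sub>C op_monomial A (e i))"
      using 1(1) by (subst sum.group) (auto simp: 1(3))
    also have "\<dots> = (\<Sum>n\<in>e ` I. a n *\<^sub>C op_monomial A n)"
      by (simp add: a_def scaleC_sum_left)
    finally show ?thesis .
  qed
  ultimately show ?thesis using polynomial_bound[of "e ` I" a b] 1(1) g by simp
qed

text \<open>The polynomial inequality survives uniform limits. Only the supremum on the polydisc enters, not the
  decomposition into monomials.\<close>

lemma disc_pair_norm:
  assumes "disc_pair g B" and g: "\<And>z. (\<And>k. cmod (z k) \<le> 1) \<Longrightarrow> cmod (g z) \<le> b"
  shows "norm B \<le> C * b"
proof (rule field_le_epsilon)
  fix e :: real assume "e > 0"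
  define e' where "e' = e / (C + 1)"
  have e': "e' > 0" "e' * (C + 1) = e" using \<open>e > 0\<close> C_nonneg by (auto simp: e'_def)
  from assms(1) e'(1) obtain g1 B1 where 1: "poly_pair g1 B1"
    "\<And>z. (\<And>k. cmod (z k) \<le> 1) \<Longrightarrow> cmod (g z - g1 z) \<le> e'" "norm (B - B1) \<le> e'"
    unfolding disc_pair_def by blast
  have "norm B1 \<le> C * (b + e')"
  proof (rule poly_pair_norm[OF 1(1)])
    fix z :: "'a \<Rightarrow> complex" assume z: "\<And>k. cmod (z k) \<le> 1"
    have "cmod (g1 z) \<le> cmod (g z) + cmod (g z - g1 z)"
      using norm_triangle_ineq4[of "g z" "g z - g1 z"] by simp
    then show "cmod (g1 z) \<le> b + e'" using g[of z] 1(2)[of z] z by fastforce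
  qed
  then have "norm B \<le> C * b + e' * (C + 1)"
    using norm_triangle_ineq[of "B - B1" B1] 1(3) by (simp add: algebra_simps)
  then show "norm B \<le> C * b + e" by (simp only: e'(2))
qed

end

section \<open>Nested sums and randomisation\<close>

primrec nsum :: "'d list \<Rightarrow> nat \<Rightarrow> (('d \<Rightarrow> nat) \<Rightarrow> 'v::comm_monoid_add) \<Rightarrow> ('d \<Rightarrow> nat) \<Rightarrow> 'v" where
  "nsum [] N F P = F P"
| "nsum (i # is) N F P = (\<Sum>p<N. nsum is N F (P(i := p)))"

lemma nsum_upd: "i \<notin> set is \<Longrightarrow> nsum is N F (P(i := p)) = nsum is N (\<lambda>Q. F (Q(i := p))) P"
proof (induction "is" arbitrary: P)
  case (Cons j "is")
  have "nsum is N F (P(i := p, j := q)) = nsum is N (\<lambda>Q. F (Q(i := p))) (P(j := q))" for q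
  proof -
    have ij: "i \<noteq> j" and i: "i \<notin> set is" using Cons.prems by auto
    show ?thesis unfolding fun_upd_twist[OF ij] by (rule Cons.IH[OF i])
  qed
  then show ?case by (simp only: nsum.simps)
qed simp

lemma nsum_sum: "nsum is N (\<lambda>P. \<Sum>j\<in>J. F j P) P = (\<Sum>j\<in>J. nsum is N (F j) P)"
proof (induction "is" arbitrary: P)
  case (Cons i "is")
  show ?case unfolding nsum.simps Cons.IH by (rule sum.swap)
qed simp

lemma nsum_linear:
  assumes "h 0 = 0" "\<And>x y. h (x + y) = h x + h y"
  shows "h (nsum is N F P) = nsum is N (\<lambda>P. h (F P)) P"
proof (induction "is" arbitrary: P)
  case (Cons i "is")
  have "h (\<Sum>p<M. g p) = (\<Sum>p<M. h (g p))" for M :: nat and g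
    using assms by (induction M) auto
  then show ?case unfolding nsum.simps by (simp only: Cons)
qed simp

text \<open>The sum over one index is moved inside the sums over the other indices.\<close>

lemma nsum_Cons_scaled:
  assumes "i \<notin> set is"
  shows "nsum (i # is) N (\<lambda>P. a (P i) *\<^sub>R F P) P = nsum is N (\<lambda>P. \<Sum>p<N. a p *\<^sub>R F (P(i := p))) P"
  by (simp add: nsum_upd[OF assms] nsum_sum)

text \<open>For a product of functions of one index each, the nested sum of absolute values factorises.\<close>

lemma nsum_prod_le:
  fixes c :: "('d \<Rightarrow> nat) \<Rightarrow> complex" and a :: "'d \<Rightarrow> nat \<Rightarrow> complex"
  assumes "distinct is" "\<And>P. (\<And>j. j \<in> set is \<Longrightarrow> P j < N) \<Longrightarrow> cmod (c P) \<le> b" "0 \<le> b"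
    and "\<And>i. i \<in> set is \<Longrightarrow> (\<Sum>p<N. cmod (a i p)) \<le> H" "0 \<le> H"
  shows "cmod (nsum is N (\<lambda>P. c P * prod_list (map (\<lambda>i. a i (P i)) is)) P) \<le> b * H ^ length is"
  using assms(1,2,4)
proof (induction "is" arbitrary: P c)
  case (Cons i "is")
  have "nsum is N (\<lambda>P. c P * prod_list (map (\<lambda>i. a i (P i)) (i # is))) (P(i := p))
      = a i p * nsum is N (\<lambda>P. c (P(i := p)) * prod_list (map (\<lambda>i. a i (P i)) is)) P" for p
  proof -
    have *: "map (\<lambda>ia. a ia (if ia = i then p else Q ia)) is = map (\<lambda>i. a i (Q i)) is" for Q
      using Cons.prems(1) by (intro map_cong) auto
    have "nsum is N (\<lambda>P. c P * prod_list (map (\<lambda>i. a i (P i)) (i # is))) (P(i := p))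
        = nsum is N (\<lambda>P. a i p * (c (P(i := p)) * prod_list (map (\<lambda>i. a i (P i)) is))) P"
      using Cons.prems(1) by (subst nsum_upd) (simp_all add: * mult_ac)
    also have "\<dots> = a i p * nsum is N (\<lambda>P. c (P(i := p)) * prod_list (map (\<lambda>i. a i (P i)) is)) P"
      by (rule nsum_linear[symmetric]) (simp_all add: distrib_left)
    finally show ?thesis .
  qed
  then have "cmod (nsum (i # is) N (\<lambda>P. c P * prod_list (map (\<lambda>i. a i (P i)) (i # is))) P)
      \<le> (\<Sum>p<N. cmod (a i p) * cmod (nsum is N (\<lambda>P. c (P(i := p)) * prod_list (map (\<lambda>i. a i (P i)) is)) P))"
    by (simp add: norm_mult[symmetric] norm_sum del: norm_mult)
  also have "\<dots> \<le> (\<Sum>p<N. cmod (a i p) * (b * H ^ length is))"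
  proof (intro sum_mono mult_left_mono Cons.IH)
    fix p P assume p: "p \<in> {..<N}" and P: "\<And>j. j \<in> set is \<Longrightarrow> P j < N"
    show "cmod (c (P(i := p))) \<le> b" using p P by (intro Cons.prems(2)) auto
  qed (use Cons.prems in auto)
  also have "\<dots> = (\<Sum>p<N. cmod (a i p)) * (b * H ^ length is)" by (simp add: sum_distrib_right)
  also have "\<dots> \<le> H * (b * H ^ length is)"
    using Cons.prems(3)[of i] assms(3,5) by (intro mult_right_mono) auto
  finally show ?case by (simp add: mult.left_commute)
qed (simp add: assms)

lemma (in commuting_operators) disc_pair_nsum:
  "(\<And>P. disc_pair (g P) (B P)) \<Longrightarrow> disc_pair (\<lambda>z. nsum is N (\<lambda>P. g P z) P) (nsum is N B P)"
  by (induction "is" arbitrary: P) (auto intro: disc_pair_sum)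

text \<open>Orthogonality of the Rademacher functions; exchanging the sign at one index pairs off the patterns.\<close>

lemma sum_choice_sign:
  assumes "j < n" "k < n"
  shows "(\<Sum>A\<in>Pow {..<n}. choice_sign A j * choice_sign A k) = (if j = k then 2 ^ n else 0)"
proof (cases "j = k")
  case True
  have "choice_sign A k * choice_sign A k = 1" for A by (simp add: choice_sign_def)
  then show ?thesis using True by (simp add: card_Pow)
next
  case False
  let ?i = "\<lambda>A. if j \<in> A then A - {j} else insert j A"
  have "(\<Sum>A\<in>Pow {..<n}. choice_sign A j * choice_sign A k)
      = (\<Sum>A\<in>Pow {..<n}. - (choice_sign A j * choice_sign A k))"
    by (rule sum.reindex_bij_witness[of _ ?i ?i])
      (use assms False in \<open>auto simp: choice_sign_def split: if_splits\<close>)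
  then show ?thesis using False by (simp add: sum_negf)
qed

lemma rad_le:
  assumes "\<And>A. norm (\<Sum>k<n. choice_sign A k *\<^sub>R y k) \<le> M"
  shows "rad n y \<le> sqrt (2 ^ n) * M"
proof -
  have M: "0 \<le> M" using assms[of "{}"] norm_ge_zero order_trans by blast
  have "rad n y \<le> L2_set (\<lambda>A. M) (Pow {..<n})"
    unfolding rad_def by (intro L2_set_mono assms) auto
  also have "\<dots> = sqrt (2 ^ n) * M"
    using M by (simp add: L2_set_def card_Pow real_sqrt_mult)
  finally show ?thesis .
qed

text \<open>A diagonal sum \<open>\<Sum> \<Phi>\<^sub>p S\<^sub>p y\<^sub>p\<close> is the average of the products of two randomised sums; the first
  factor is bounded for all signs, and \<open>R\<close>-boundedness removes the \<open>S\<^sub>p\<close> from the second.\<close>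

lemma norm_diagonal_sum_le:
  fixes \<Phi> S :: "nat \<Rightarrow> 'x::complex_normed_vector op"
  assumes \<Phi>: "\<And>A. norm (\<Sum>p<n. choice_sign A p *\<^sub>R \<Phi> p) \<le> C"
    and S: "R_bdd K E" "\<And>p. p < n \<Longrightarrow> S p \<in> E"
    and y: "\<And>A. norm (\<Sum>p<n. choice_sign A p *\<^sub>R y p) \<le> M"
  shows "norm (\<Sum>p<n. \<Phi> p \<star> S p \<star> y p) \<le> C * K * M"
proof -
  have C: "0 \<le> C" using \<Phi>[of "{}"] norm_ge_zero order_trans by blast
  let ?a = "\<lambda>A. \<Sum>p<n. choice_sign A p *\<^sub>R \<Phi> p"
  let ?b = "\<lambda>A. \<Sum>p<n. choice_sign A p *\<^sub>R (S p \<star> y p)"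
  have "(\<Sum>A\<in>Pow {..<n}. ?a A \<star> ?b A)
      = (\<Sum>A\<in>Pow {..<n}. \<Sum>j<n. \<Sum>k<n. (choice_sign A j * choice_sign A k) *\<^sub>R (\<Phi> j \<star> S k \<star> y k))"
  proof (rule sum.cong[OF refl])
    fix A
    have "?a A \<star> ?b A = (\<Sum>j<n. (choice_sign A j *\<^sub>R \<Phi> j) \<star> ?b A)"
      by (rule op_app_sum)
    also have "\<dots> = (\<Sum>j<n. \<Sum>k<n. (choice_sign A j *\<^sub>R \<Phi> j) \<star> choice_sign A k *\<^sub>R (S k \<star> y k))"
      by (intro sum.cong refl) (rule blinfun.sum_right)
    finally show "?a A \<star> ?b A = (\<Sum>j<n. \<Sum>k<n. (choice_sign A j * choice_sign A k) *\<^sub>R (\<Phi> j \<star> S k \<star> y k))"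
      by (simp add: mult.commute)
  qed
  also have "\<dots> = (\<Sum>j<n. \<Sum>k<n. (\<Sum>A\<in>Pow {..<n}. choice_sign A j * choice_sign A k) *\<^sub>R (\<Phi> j \<star> S k \<star> y k))"
    unfolding scaleR_left.sum
    by (subst sum.swap) (intro sum.cong refl sum.swap)
  also have "\<dots> = (\<Sum>j<n. \<Sum>k<n. if j = k then 2 ^ n *\<^sub>R (\<Phi> j \<star> S k \<star> y k) else 0)"
    by (intro sum.cong refl) (simp add: sum_choice_sign)
  also have "\<dots> = 2 ^ n *\<^sub>R (\<Sum>p<n. \<Phi> p \<star> S p \<star> y p)"
    by (simp add: scaleR_sum_right)
  finally have "2 ^ n * norm (\<Sum>p<n. \<Phi> p \<star> S p \<star> y p) = norm (\<Sum>A\<in>Pow {..<n}. ?a A \<star> ?b A)"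
    by simp
  also have "\<dots> \<le> (\<Sum>A\<in>Pow {..<n}. \<bar>C\<bar> * norm (?b A))"
    using C by (intro sum_norm_le order_trans[OF norm_op_app] mult_right_mono) (auto intro: \<Phi>)
  also have "\<dots> = (\<Sum>A\<in>Pow {..<n}. \<bar>C\<bar> * \<bar>norm (?b A)\<bar>)" by simp
  also have "\<dots> \<le> L2_set (\<lambda>A. C) (Pow {..<n}) * rad n (\<lambda>p. S p \<star> y p)"
    unfolding rad_def by (rule L2_set_mult_ineq)
  also have "\<dots> \<le> (sqrt (2 ^ n) * C) * (K * (sqrt (2 ^ n) * M))"
  proof (intro mult_mono)
    show "L2_set (\<lambda>A. C) (Pow {..<n}) \<le> sqrt (2 ^ n) * C"
      using C by (simp add: L2_set_def card_Pow real_sqrt_mult)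
    have "rad n (\<lambda>p. S p \<star> y p) \<le> K * rad n y" by (rule R_bddD[OF S])
    also have "\<dots> \<le> K * (sqrt (2 ^ n) * M)"
      using R_bdd_nonneg[OF S(1)] rad_le[OF y] by (rule mult_left_mono[rotated])
    finally show "rad n (\<lambda>p. S p \<star> y p) \<le> K * (sqrt (2 ^ n) * M)" .
  qed (use C in auto)
  also have "\<dots> = 2 ^ n * (C * K * M)"
    using real_sqrt_mult_self[of "2 ^ n"] by (simp add: mult_ac)
  finally show ?thesis by simp
qed

text \<open>Randomisation in one variable after the other. The randomised sum over the first index, with the signs
  absorbed into \<open>V\<close>, is again of the same form in the remaining indices; this is why the hypothesis on
  \<open>V\<close> admits arbitrary signs \<open>\<epsilon>\<close>.\<close>

lemma norm_nsum_diagonal_le: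
  fixes \<Phi> S :: "'d \<Rightarrow> nat \<Rightarrow> 'x::complex_normed_vector op"
  assumes "distinct is"
    and \<Phi>: "\<And>i A. i \<in> set is \<Longrightarrow> norm (\<Sum>p<N. choice_sign A p *\<^sub>R \<Phi> i p) \<le> C"
    and S: "\<And>i. i \<in> set is \<Longrightarrow> R_bdd K (S i ` {..<N})"
    and V: "\<And>\<epsilon>. norm (nsum is N (\<lambda>P. prod_list (map (\<lambda>i. choice_sign (\<epsilon> i) (P i)) is) *\<^sub>R V P) P) \<le> M"
  shows "norm (nsum is N (\<lambda>P. prod_list (map (\<lambda>i. \<Phi> i (P i) * S i (P i)) is) \<star> V P) P) \<le> (C * K) ^ length is * M"
  using assms
proof (induction "is" arbitrary: V P M)
  case Nil
  then show ?case by simp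
next
  case (Cons i "is")
  have i: "i \<notin> set is" using Cons.prems(1) by simp
  have map_upd: "map (\<lambda>j. f j (if j = i then p else Q j)) is = map (\<lambda>j. f j (Q j)) is" for f p and Q :: "'d \<Rightarrow> nat"
    using i by (intro map_cong) auto
  define G where "G P = prod_list (map (\<lambda>i. \<Phi> i (P i) * S i (P i)) is)" for P
  have G_upd: "G (P(i := p)) = G P" for P p 
    unfolding G_def by (intro arg_cong[where f = prod_list] map_cong) (use i in auto)
  define y where "y p = nsum is N (\<lambda>P. G P \<star> V (P(i := p))) P" for p
  have "nsum is N (\<lambda>P. prod_list (map (\<lambda>i. \<Phi> i (P i) * S i (P i)) (i # is)) \<star> V P) (P(i := p))
      = \<Phi> i p \<star> S i p \<star> y p" for p
  proof -
    have "nsum is N (\<lambda>P. prod_list (map (\<lambda>i. \<Phi> i (P i) * S i (P i)) (i # is)) \<star> V P) (P(i := p))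
        = nsum is N (\<lambda>P. (\<Phi> i (P i) * S i (P i) * G P) \<star> V P) (P(i := p))"
      by (simp add: G_def mult.assoc)
    also have "\<dots> = nsum is N (\<lambda>P. (\<Phi> i p * S i p) \<star> (G P \<star> V (P(i := p)))) P"
      by (simp add: nsum_upd[OF i] G_upd)
    also have "\<dots> = (\<Phi> i p * S i p) \<star> y p"
      unfolding y_def by (rule nsum_linear[symmetric]) simp_all
    finally show ?thesis by simp
  qed
  then have eq: "nsum (i # is) N (\<lambda>P. prod_list (map (\<lambda>i. \<Phi> i (P i) * S i (P i)) (i # is)) \<star> V P) P
      = (\<Sum>p<N. \<Phi> i p \<star> S i p \<star> y p)" by simp
  have y: "norm (\<Sum>p<N. choice_sign A p *\<^sub>R y p) \<le> (C * K) ^ length is * M" for A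
  proof -
    define V' where "V' P = (\<Sum>p<N. choice_sign A p *\<^sub>R V (P(i := p)))" for P
    have "(\<Sum>p<N. choice_sign A p *\<^sub>R y p) = nsum is N (\<lambda>P. \<Sum>p<N. choice_sign A p *\<^sub>R (G P \<star> V (P(i := p)))) P"
      by (simp add: y_def nsum_sum nsum_linear[of "scaleR _"] scaleR_add_right)
    also have "\<dots> = nsum is N (\<lambda>P. G P \<star> V' P) P"
      by (simp add: V'_def blinfun.sum_right)
    finally have eq: "(\<Sum>p<N. choice_sign A p *\<^sub>R y p)
      = nsum is N (\<lambda>P. prod_list (map (\<lambda>i. \<Phi> i (P i) * S i (P i)) is) \<star> V' P) P" by (simp add: G_def)
    show ?thesis
      unfolding eq
    proof (rule Cons.IH)
      fix \<epsilon>
      let ?e = "\<epsilon>(i := A)"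
      have "nsum (i # is) N (\<lambda>P. prod_list (map (\<lambda>i. choice_sign (?e i) (P i)) (i # is)) *\<^sub>R V P) P
          = nsum (i # is) N (\<lambda>P. choice_sign A (P i) *\<^sub>R (prod_list (map (\<lambda>i. choice_sign (?e i) (P i)) is) *\<^sub>R V P)) P"
        by (simp del: nsum.simps)
      also have "\<dots> = nsum is N (\<lambda>P. \<Sum>p<N. choice_sign A p *\<^sub>R
          (prod_list (map (\<lambda>j. choice_sign (?e j) ((P(i := p)) j)) is) *\<^sub>R V (P(i := p)))) P"
        by (rule nsum_Cons_scaled[OF i])
      also have "\<dots> = nsum is N (\<lambda>P. prod_list (map (\<lambda>i. choice_sign (\<epsilon> i) (P i)) is) *\<^sub>R V' P) P"
      proof -
        have "map (\<lambda>j. choice_sign (?e j) ((P(i := p)) j)) is = map (\<lambda>j. choice_sign (\<epsilon> j) (P j)) is" for P p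
          using i by (intro map_cong) auto
        then show ?thesis
          unfolding V'_def scaleR_sum_right by (simp only: scaleR_scaleR mult.commute)
      qed
      finally show "norm (nsum is N (\<lambda>P. prod_list (map (\<lambda>i. choice_sign (\<epsilon> i) (P i)) is) *\<^sub>R V' P) P) \<le> M"
        using Cons.prems(4)[of ?e] by simp
    qed (use Cons.prems in auto)
  qed
  have "norm (\<Sum>p<N. \<Phi> i p \<star> S i p \<star> y p) \<le> C * K * ((C * K) ^ length is * M)"
    by (rule norm_diagonal_sum_le[OF _ Cons.prems(3) _ y])
      (use Cons.prems(2)[of i] in auto)
  then show ?case unfolding eq by (simp add: mult_ac)
qed

text \<open>The discrete form of the functional calculus estimate: coefficients \<open>c\<close> against kernels
  \<open>\<Phi>\<^sup>2S\<close>, where the \<open>\<Phi>\<close> have absolutely summable symbols on the disc.\<close>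

lemma (in polynomially_bounded) norm_kernel_sum_le:
  assumes "distinct is"
    and \<Phi>: "\<And>i p. disc_pair (\<lambda>z. h i p (z i)) (\<Phi> i p)"
    and h: "\<And>i \<zeta>. i \<in> set is \<Longrightarrow> cmod \<zeta> \<le> 1 \<Longrightarrow> (\<Sum>p<N. cmod (h i p \<zeta>)) \<le> H"
    and S: "\<And>i. i \<in> set is \<Longrightarrow> R_bdd K (S i ` {..<N})"
    and comm: "\<And>i j p q. \<Phi> i p * \<Phi> j q = \<Phi> j q * \<Phi> i p" "\<And>i j p q. \<Phi> i p * S j q = S j q * \<Phi> i p"
    and c: "\<And>P. (\<And>j. j \<in> set is \<Longrightarrow> P j < N) \<Longrightarrow> cmod (c P) \<le> b" and b: "0 \<le> b" and H: "0 \<le> H"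
  shows "norm (nsum is N (\<lambda>P. c P *\<^sub>C prod_list (map (\<lambda>i. \<Phi> i (P i) * \<Phi> i (P i) * S i (P i)) is)) P)
    \<le> (C * H * K) ^ length is * (C * (b * H ^ length is))"
    (is "norm ?X \<le> ?c")
proof (rule norm_op_leI)
  have K: "0 \<le> K ^ length is"
    using R_bdd_nonneg[OF S, of "hd is"] by (cases "is") auto
  show "0 \<le> ?c"
    using C_nonneg b H K by (simp add: power_mult_distrib mult_nonneg_nonneg)
  fix x
  define V where "V P = (c P *\<^sub>C prod_list (map (\<lambda>i. \<Phi> i (P i)) is)) \<star> x" for P
  have factor: "prod_list (map (\<lambda>i. \<Phi> i (P i) * \<Phi> i (P i) * S i (P i)) is)
      = prod_list (map (\<lambda>i. \<Phi> i (P i) * S i (P i)) is) * prod_list (map (\<lambda>i. \<Phi> i (P i)) is)" for P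
  proof -
    have "\<Phi> i (P i) * \<Phi> i (P i) * S i (P i) = (\<Phi> i (P i) * S i (P i)) * \<Phi> i (P i)" for i
      by (metis mult.assoc comm(2))
    moreover have "\<Phi> i (P i) * (\<Phi> j (P j) * S j (P j)) = (\<Phi> j (P j) * S j (P j)) * \<Phi> i (P i)" for i j
      by (metis comm mult.assoc)
    ultimately show ?thesis
      by (simp only: prod_list_mult_commuting[of "\<lambda>i. \<Phi> i (P i)" "\<lambda>i. \<Phi> i (P i) * S i (P i)" "is"])
  qed
  have "?X \<star> x = nsum is N (\<lambda>P. (c P *\<^sub>C prod_list (map (\<lambda>i. \<Phi> i (P i) * \<Phi> i (P i) * S i (P i)) is)) \<star> x) P"
    by (rule nsum_linear) simp_all
  also have "\<dots> = nsum is N (\<lambda>P. prod_list (map (\<lambda>i. \<Phi> i (P i) * S i (P i)) is) \<star> V P) P"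
    by (simp add: V_def factor)
  also have "norm \<dots> \<le> (C * H * K) ^ length is * (C * (b * H ^ length is) * norm x)"
  proof (rule norm_nsum_diagonal_le[OF assms(1) _ S])
    show "norm (\<Sum>p<N. choice_sign A p *\<^sub>R \<Phi> i p) \<le> C * H" if i: "i \<in> set is" for i A
    proof (rule disc_pair_norm)
      show "disc_pair (\<lambda>z. \<Sum>p<N. of_real (choice_sign A p) * h i p (z i)) (\<Sum>p<N. choice_sign A p *\<^sub>R \<Phi> i p)"
        unfolding scaleR_scaleC by (intro disc_pair_sum disc_pair_scale \<Phi>)
      fix z :: "'a \<Rightarrow> complex" assume z: "\<And>k. cmod (z k) \<le> 1"
      have "cmod (\<Sum>p<N. of_real (choice_sign A p) * h i p (z i)) \<le> (\<Sum>p<N. cmod (h i p (z i)))"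
        by (intro sum_norm_le) (simp add: norm_mult choice_sign_def)
      then show "cmod (\<Sum>p<N. of_real (choice_sign A p) * h i p (z i)) \<le> H"
        using h[OF i z[of i]] by linarith
    qed
    fix \<epsilon>
    let ?c = "\<lambda>P. of_real (prod_list (map (\<lambda>i. choice_sign (\<epsilon> i) (P i)) is)) * c P"
    have "nsum is N (\<lambda>P. prod_list (map (\<lambda>i. choice_sign (\<epsilon> i) (P i)) is) *\<^sub>R V P) P
        = nsum is N (\<lambda>P. (?c P *\<^sub>C prod_list (map (\<lambda>i. \<Phi> i (P i)) is)) \<star> x) P"
      by (simp add: V_def scaleR_scaleC scaleC_scaleC)
    also have "\<dots> = nsum is N (\<lambda>P. ?c P *\<^sub>C prod_list (map (\<lambda>i. \<Phi> i (P i)) is)) P \<star> x"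
      by (rule nsum_linear[symmetric]) simp_all
    also have "norm \<dots> \<le> norm (nsum is N (\<lambda>P. ?c P *\<^sub>C prod_list (map (\<lambda>i. \<Phi> i (P i)) is)) P) * norm x"
      by (rule norm_op_app)
    also have "\<dots> \<le> C * (b * H ^ length is) * norm x"
    proof (intro mult_right_mono disc_pair_norm)
      show "disc_pair (\<lambda>z. nsum is N (\<lambda>P. ?c P * prod_list (map (\<lambda>i. h i (P i) (z i)) is)) P)
          (nsum is N (\<lambda>P. ?c P *\<^sub>C prod_list (map (\<lambda>i. \<Phi> i (P i)) is)) P)"
        by (intro disc_pair_nsum disc_pair_scale disc_pair_prod_list \<Phi>)
      fix z :: "'a \<Rightarrow> complex" assume z: "\<And>k. cmod (z k) \<le> 1"
      have one: "\<bar>prod_list (map (\<lambda>i. choice_sign (\<epsilon> i) (P i)) js)\<bar> = 1" for P js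
        by (induction js) (auto simp: abs_mult choice_sign_def)
      show "cmod (nsum is N (\<lambda>P. ?c P * prod_list (map (\<lambda>i. h i (P i) (z i)) is)) P) \<le> b * H ^ length is"
        by (rule nsum_prod_le[OF assms(1)])
          (use c b H h z in \<open>simp_all add: norm_mult one del: of_real_mult\<close>)
    qed simp
    finally show "norm (nsum is N (\<lambda>P. prod_list (map (\<lambda>i. choice_sign (\<epsilon> i) (P i)) is) *\<^sub>R V P) P)
        \<le> C * (b * H ^ length is) * norm x" .
  qed
  finally show "norm (?X \<star> x) \<le> ?c * norm x" by (simp add: mult_ac)
qed

section \<open>The truncated contour\<close>

text \<open>The boundary of the Stolz domain without small neighbourhoods of \<open>1\<close> is cut into pieces
  parametrised by \<open>[0,1]\<close>: the dyadic blocks of the two tangents and the arc. The weights are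
  the derivatives, up to the orientation.\<close>

definition piece :: "real \<Rightarrow> nat \<Rightarrow> nat \<Rightarrow> real \<Rightarrow> complex"
  where "piece b n p t =
    (if p < n then tangent_pt b 1 ((1 + t) / 2 ^ Suc p)
     else if p < 2 * n then tangent_pt b (- 1) ((1 + t) / 2 ^ Suc (p - n))
     else part_circlepath 0 (sin b) (pi / 2 - b) (3 * pi / 2 + b) t)"

definition wt :: "real \<Rightarrow> nat \<Rightarrow> nat \<Rightarrow> real \<Rightarrow> complex"
  where "wt b n p t =
    (if p < n then of_real (1 / 2 ^ Suc p) * (tangent_pt b 1 1 - 1)
     else if p < 2 * n then - of_real (1 / 2 ^ Suc (p - n)) * (tangent_pt b (- 1) 1 - 1)
     else \<i> * of_real (sin b) * of_real (pi + 2 * b) * exp (\<i> * of_real (pi / 2 - b + t * (pi + 2 * b))))"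

lemma sum_pieces:
  fixes f :: "nat \<Rightarrow> 'a::comm_monoid_add"
  shows "(\<Sum>p<2 * n + 1. f p) = (\<Sum>p<n. f p) + (\<Sum>k<n. f (n + k)) + f (2 * n)"
proof -
  have "(\<Sum>p<n + m. f p) = (\<Sum>p<n. f p) + (\<Sum>k<m. f (n + k))" for m
    by (induction m) (auto simp: add_ac)
  from this[of n] show ?thesis by (simp add: mult_2)
qed

text \<open>The tangents are affine in the parameter, so dyadic blocks are rescaled copies of one segment.\<close>

lemma tangent_pt_affine: "tangent_pt b \<sigma> \<tau> = 1 + of_real \<tau> * (tangent_pt b \<sigma> 1 - 1)"
  by (simp add: tangent_pt_def algebra_simps)

lemma arc_eq:
  "part_circlepath 0 (sin b) (pi / 2 - b) (3 * pi / 2 + b) t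
    = of_real (sin b) * exp (\<i> * of_real (pi / 2 - b + t * (pi + 2 * b)))"
proof -
  have "linepath (pi / 2 - b) (3 * pi / 2 + b) t = pi / 2 - b + t * (pi + 2 * b)"
    by (simp add: linepath_def field_simps)
  then show ?thesis by (simp add: part_circlepath_def)
qed

lemma dyadic_block_bounds:
  assumes "0 \<le> t" "t \<le> 1" shows "0 < (1 + t) / 2 ^ Suc k" "(1 + t) / (2 :: real) ^ Suc k \<le> 1"
proof -
  have "1 + t \<le> 2 * 2 ^ k" using assms one_le_power[of "2 :: real" k] by linarith
  then show "0 < (1 + t) / 2 ^ Suc k" "(1 + t) / (2 :: real) ^ Suc k \<le> 1"
    using assms by auto
qed

lemma tangent_in_stolz_curve:
  "0 < \<tau> \<Longrightarrow> \<tau> \<le> 1 \<Longrightarrow> \<sigma> = 1 \<or> \<sigma> = - 1 \<Longrightarrow> tangent_pt b \<sigma> \<tau> \<in> stolz_curve b"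
  by (auto simp: stolz_curve_def)

lemma arc_in_stolz_curve:
  assumes b: "0 < b" "b < pi / 2" and t: "0 \<le> t" "t \<le> 1"
  shows "part_circlepath 0 (sin b) (pi / 2 - b) (3 * pi / 2 + b) t \<in> stolz_curve b"
proof -
  define \<theta> where "\<theta> = pi / 2 - b + t * (pi + 2 * b)"
  have sb: "0 < sin b" using sin_bounds[OF b] by simp
  have "t * (pi + 2 * b) \<le> 1 * (pi + 2 * b)" using t b by (intro mult_right_mono) auto
  moreover have "0 \<le> t * (pi + 2 * b)" using t b by (intro mult_nonneg_nonneg) auto
  ultimately have \<theta>: "\<bar>\<theta> - pi\<bar> \<le> pi / 2 + b" unfolding \<theta>_def by (auto simp: abs_le_iff)
  have "cos \<theta> = - cos \<bar>\<theta> - pi\<bar>" by (simp add: cos_abs_real cos_diff)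
  also have "\<dots> \<le> - cos (pi / 2 + b)"
    by (rule le_imp_neg_le, rule cos_monotone_0_pi_le) (use \<theta> b in auto)
  also have "\<dots> = sin b" by (simp add: cos_add)
  finally have "sin b * cos \<theta> \<le> sin b * sin b" using sb by (intro mult_left_mono) auto
  then show ?thesis
    unfolding stolz_curve_def arc_eq \<theta>_def[symmetric] cis_conv_exp[symmetric]
    using sb by (simp add: norm_mult power2_eq_square)
qed

lemma piece_in_stolz_curve:
  assumes "0 < b" "b < pi / 2" "0 \<le> t" "t \<le> 1"
  shows "piece b n p t \<in> stolz_curve b"
  using assms dyadic_block_bounds[OF assms(3,4)]
  by (auto simp: piece_def simp del: power_Suc intro: tangent_in_stolz_curve arc_in_stolz_curve)

lemma continuous_on_piece: "continuous_on {0..1} (piece b n p)"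
proof -
  have "continuous_on {0..1} (\<lambda>t. tangent_pt b \<sigma> ((1 + t) / 2 ^ Suc k))" for \<sigma> k
    unfolding tangent_pt_def by (intro continuous_intros) auto
  moreover have "continuous_on {0..1} (part_circlepath 0 (sin b) (pi / 2 - b) (3 * pi / 2 + b))"
    unfolding arc_eq[abs_def] by (intro continuous_intros)
  ultimately show ?thesis
    unfolding piece_def[abs_def]
    by (cases "p < n"; cases "p < 2 * n") (simp_all del: power_Suc)
qed

lemma continuous_on_wt: "continuous_on {0..1} (wt b n p)"
  unfolding wt_def[abs_def]
  by (cases "p < n"; cases "p < 2 * n") (simp_all add: continuous_intros)

lemma has_derivative_tangent:
  "((\<lambda>t. tangent_pt b \<sigma> ((1 + t) / 2 ^ Suc k)) has_vector_derivative
    of_real (1 / 2 ^ Suc k) * (tangent_pt b \<sigma> 1 - 1)) (at t within S)"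
  unfolding tangent_pt_affine[of b \<sigma> "_ / _"]
  by (auto intro!: derivative_eq_intros simp: has_vector_derivative_def scaleR_conv_of_real field_simps)

lemma has_derivative_arc:
  "(part_circlepath 0 (sin b) (pi / 2 - b) (3 * pi / 2 + b) has_vector_derivative
    \<i> * of_real (sin b) * of_real (pi + 2 * b) * exp (\<i> * of_real (pi / 2 - b + t * (pi + 2 * b)))) (at t within S)"
proof -
  have "linepath (pi / 2 - b) (3 * pi / 2 + b) t = pi / 2 - b + t * (pi + 2 * b)"
    by (simp add: linepath_def field_simps)
  moreover have "3 * pi / 2 + b - (pi / 2 - b) = pi + 2 * b" by simp
  ultimately show ?thesis
    using has_vector_derivative_part_circlepath[of 0 "sin b" "pi / 2 - b" "3 * pi / 2 + b" t S]
    by (simp only: of_real_diff[symmetric])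
qed

lemma stolz_curve_re:
  assumes "l \<in> stolz_curve b" "0 < b" "b < pi / 2"
  shows "0 < Re (1 - l)" "cmod (1 - l) \<le> 2"
proof -
  have "l \<in> stolz_domain ((b + pi / 2) / 2)"
    using assms by (intro stolz_curve_subset[OF assms(1,2)]) (simp_all add: field_simps)
  from stolz_domainD[OF this] assms show "0 < Re (1 - l)" "cmod (1 - l) \<le> 2" by (simp_all add: field_simps)
qed

lemma arc_away_from_1:
  assumes "cmod l = sin b" shows "1 - sin b \<le> Re (1 - l)" "1 - sin b \<le> cmod (1 - l)"
  using assms complex_Re_le_cmod[of l] complex_Re_le_cmod[of "1 - l"] by auto

lemma cmod_arc: "0 < sin b \<Longrightarrow> cmod (part_circlepath 0 (sin b) (pi / 2 - b) (3 * pi / 2 + b) t) = sin b"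
  by (simp add: arc_eq norm_mult)

text \<open>The length of a dyadic block is at most its distance from \<open>1\<close>, and the arc keeps a positive distance from
  \<open>1\<close>. So the measure \<open>|d\<lambda>| / |1 - \<lambda>|\<close> of each piece is bounded; a bound in terms of \<open>g\<close> is uniform in the contours.\<close>

lemma wt_le:
  assumes b: "0 < b" "b \<le> g" "g < pi / 2" and t: "0 \<le> t" "t \<le> 1"
  shows "cmod (wt b n p t) \<le> 2 * pi / (1 - sin g) * cmod (1 - piece b n p t)"
proof -
  have bs: "0 < sin b" "sin b \<le> sin g" "sin g < 1" "0 < cos b"
    using b sin_bounds[of b] sin_bounds[of g] sin_monotone_2pi_le[of b g] by auto
  have one: "1 \<le> 2 * pi / (1 - sin g)"
    using bs pi_gt3 by (simp add: field_simps)
  have tan: "cmod (of_real (1 / 2 ^ Suc k) * (tangent_pt b \<sigma> 1 - 1))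
      \<le> 2 * pi / (1 - sin g) * cmod (1 - tangent_pt b \<sigma> ((1 + t) / 2 ^ Suc k))"
    if \<sigma>: "\<sigma> = 1 \<or> \<sigma> = - 1" for \<sigma> k
  proof -
    have "cmod (of_real (1 / 2 ^ Suc k) * (tangent_pt b \<sigma> 1 - 1)) = 1 / 2 ^ Suc k * cos b"
      using cmod_tangent_pt_self[OF \<sigma>, of 1 b] bs
      by (simp only: norm_mult norm_of_real norm_minus_commute[of _ 1]) simp
    also have "\<dots> \<le> (1 + t) / 2 ^ Suc k * cos b"
      using t bs by (intro mult_right_mono divide_right_mono) auto
    also have "\<dots> = cmod (1 - tangent_pt b \<sigma> ((1 + t) / 2 ^ Suc k))"
      using dyadic_block_bounds[OF t, of k] bs by (intro cmod_tangent_pt_self[OF \<sigma>, symmetric]) auto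
    also have "1 * \<dots> \<le> 2 * pi / (1 - sin g) * \<dots>"
      by (intro mult_right_mono one) simp
    finally show ?thesis by simp
  qed
  have arc: "cmod (\<i> * of_real (sin b) * of_real (pi + 2 * b) * exp (\<i> * of_real (pi / 2 - b + t * (pi + 2 * b))))
      \<le> 2 * pi / (1 - sin g) * cmod (1 - part_circlepath 0 (sin b) (pi / 2 - b) (3 * pi / 2 + b) t)"
    (is "_ \<le> _ * cmod (1 - ?a)")
  proof -
    have "cmod (\<i> * of_real (sin b) * of_real (pi + 2 * b) * exp (\<i> * of_real (pi / 2 - b + t * (pi + 2 * b))))
        = sin b * (pi + 2 * b)"
      using bs b by (simp only: norm_mult norm_of_real norm_exp_i_times) simp
    also have "\<dots> \<le> 1 * (2 * pi)" using bs b by (intro mult_mono) auto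
    also have "\<dots> = 2 * pi / (1 - sin g) * (1 - sin g)" using bs by simp
    also have "\<dots> \<le> 2 * pi / (1 - sin g) * cmod (1 - ?a)"
      using bs arc_away_from_1(2)[OF cmod_arc[OF bs(1), of t]] by (intro mult_left_mono) auto
    finally show ?thesis .
  qed
  show ?thesis
    using tan[of 1 p] tan[of "- 1" "p - n"] arc
    by (simp add: wt_def piece_def del: power_Suc)
qed

section \<open>The scalar kernel\<close>

text \<open>With \<open>v = 1 - \<lambda>\<close> and \<open>u = 1 - z\<close> this is \<open>4uv / (u + v)\<^sup>2\<close>. It is analytic for \<open>z\<close> in the closed
  disc, because \<open>|1 + v| > 1\<close>, and it is small unless \<open>|u|\<close> and \<open>|v|\<close> are of the same size.\<close>

definition kern :: "complex \<Rightarrow> complex \<Rightarrow> complex"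
  where "kern v z = 4 * (v * (1 / (1 + v - z))) * (1 - v * (1 / (1 + v - z)))"

lemma kern_eq:
  assumes "0 < Re v" "cmod z \<le> 1"
  shows "kern v z = 4 * (1 - z) * v / ((1 - z) + v)\<^sup>2" and "(1 - z) + v \<noteq> 0"
proof -
  have "Re z \<le> 1" using complex_Re_le_cmod[of z] assms by linarith
  then have "Re ((1 - z) + v) > 0" using assms by simp
  then show ne: "(1 - z) + v \<noteq> 0" by (metis less_irrefl zero_complex.sel(1))
  define u where "u = 1 - z"
  have d: "1 + v - z = u + v" by (simp add: u_def)
  have ne': "u + v \<noteq> 0" unfolding u_def by (rule ne)
  have "1 - v * (1 / (u + v)) = u / (u + v)" using ne' by (simp add: field_simps)
  then have "kern v z = 4 * u * v / (u + v)\<^sup>2"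
    unfolding kern_def d by (simp only:) (simp add: power2_eq_square)
  then show "kern v z = 4 * (1 - z) * v / ((1 - z) + v)\<^sup>2" by (simp only: u_def)
qed

text \<open>Here \<open>u\<close> lies in the right half plane and \<open>v\<close> on a ray at the angle \<open>b < \<pi>/2\<close> from the real axis. The two
  cannot cancel: \<open>|u + v|\<^sup>2\<close> is at least a multiple of \<open>(|u| + |v|)\<^sup>2\<close>.\<close>

lemma kern_tangent_le:
  assumes b: "0 < b" "b < pi / 2" and \<sigma>: "\<sigma> = 1 \<or> \<sigma> = - 1" and \<tau>: "0 < \<tau>" and z: "cmod z \<le> 1"
  shows "cmod (kern (1 - tangent_pt b \<sigma> \<tau>) z)
    \<le> 8 / (1 - sin b) * (cmod (1 - z) * (\<tau> * cos b) / (cmod (1 - z) + \<tau> * cos b)\<^sup>2)"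
proof -
  note sb = sin_bounds[OF b]
  define u where "u = 1 - z"
  define y where "y = \<tau> * cos b"
  define v where "v = 1 - tangent_pt b \<sigma> \<tau>"
  have y: "0 < y" using \<tau> sb by (simp add: y_def)
  have u: "0 \<le> Re u" using complex_Re_le_cmod[of z] z by (simp add: u_def)
  have v: "v = of_real y * cis (- \<sigma> * b)" by (simp add: v_def tangent_pt_def y_def)
  have cv: "cmod v = y" using y by (simp add: v norm_mult)
  have Re: "0 < Re v" and Im: "\<bar>Im v\<bar> = y * sin b"
    using \<sigma> y sb by (auto simp: v abs_mult)
  have "\<bar>Im u * Im v\<bar> \<le> cmod u * (y * sin b)"
    unfolding abs_mult Im using y sb by (intro mult_right_mono abs_Im_le_cmod) auto
  moreover have "0 \<le> Re u * Re v" using u Re by (intro mult_nonneg_nonneg) auto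
  ultimately have "- (cmod u * y * sin b) \<le> Re u * Re v + Im u * Im v"
    unfolding mult.assoc by linarith
  moreover have "(cmod (u + v))\<^sup>2 = (cmod u)\<^sup>2 + (cmod v)\<^sup>2 + 2 * (Re u * Re v + Im u * Im v)"
    unfolding cmod_power2 by (simp add: power2_eq_square algebra_simps)
  ultimately have 1: "(cmod u)\<^sup>2 + y\<^sup>2 - 2 * (cmod u * y * sin b) \<le> (cmod (u + v))\<^sup>2"
    by (simp add: cv)
  have "(1 - sin b) / 2 * (cmod u + y)\<^sup>2 \<le> (cmod u)\<^sup>2 + y\<^sup>2 - 2 * (cmod u * y * sin b)"
  proof -
    have "0 \<le> (1 + sin b) / 2 * (cmod u - y)\<^sup>2" using sb by simp
    then show ?thesis by (simp add: power2_eq_square field_simps)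
  qed
  with 1 have 2: "(1 - sin b) / 2 * (cmod u + y)\<^sup>2 \<le> (cmod (u + v))\<^sup>2" by linarith
  have pos: "0 < (1 - sin b) / 2 * (cmod u + y)\<^sup>2"
    using sb y by (intro mult_pos_pos zero_less_power add_nonneg_pos) auto
  have "cmod (kern v z) = 4 * (cmod u * y) / (cmod (u + v))\<^sup>2"
    by (simp only: kern_eq(1)[OF Re z] u_def[symmetric] norm_divide norm_mult norm_power norm_numeral mult.assoc cv)
  also have "\<dots> \<le> 4 * (cmod u * y) / ((1 - sin b) / 2 * (cmod u + y)\<^sup>2)"
    using y by (intro frac_le order_refl 2 pos) simp
  also have "\<dots> = 8 / (1 - sin b) * (cmod u * y / (cmod u + y)\<^sup>2)"
    using sb by (simp add: field_simps)
  finally show ?thesis by (simp add: v_def u_def y_def)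
qed

text \<open>The terms are dominated by the differences of \<open>y \<mapsto> y/(x + y)\<close> at consecutive dyadic points.\<close>

lemma dyadic_kernel_sum:
  fixes x y :: real
  assumes "0 \<le> x" "0 < y"
  shows "(\<Sum>k<n. x * (y / 2 ^ k) / (x + y / 2 ^ k)\<^sup>2) \<le> 2"
proof -
  define f where "f k = (y / 2 ^ k) / (x + y / 2 ^ k)" for k :: nat
  have "x * (y / 2 ^ k) / (x + y / 2 ^ k)\<^sup>2 \<le> 2 * (f k - f (Suc k))" for k
  proof -
    define a where "a = y / 2 ^ Suc k"
    have a: "a > 0" "y / 2 ^ k = 2 * a" using assms by (auto simp: a_def)
    have "x * (y / 2 ^ k) / (x + y / 2 ^ k)\<^sup>2 = 2 * (x * a / ((x + 2 * a) * (x + 2 * a)))"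
      unfolding a(2) by (simp add: power2_eq_square)
    also have "\<dots> \<le> 2 * (x * a / ((x + 2 * a) * (x + a)))"
      using a(1) assms(1) by (intro mult_left_mono divide_left_mono mult_pos_pos) auto
    also have "x * a / ((x + 2 * a) * (x + a)) = f k - f (Suc k)"
      unfolding f_def a(2) a_def[symmetric] using a(1) assms(1)
      by (simp add: divide_simps add_nonneg_pos) (simp add: algebra_simps)
    finally show ?thesis .
  qed
  then have "(\<Sum>k<n. x * (y / 2 ^ k) / (x + y / 2 ^ k)\<^sup>2) \<le> (\<Sum>k<n. 2 * (f k - f (Suc k)))"
    by (intro sum_mono)
  also have "\<dots> = 2 * (f 0 - f n)"
    by (simp only: sum_distrib_left[symmetric] sum_lessThan_telescope')
  also have "\<dots> \<le> 2 * 1"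
  proof -
    have "0 \<le> f n" using assms by (simp add: f_def)
    moreover have "f 0 \<le> 1" using assms by (simp add: f_def)
    ultimately show ?thesis by (intro mult_left_mono) auto
  qed
  finally show ?thesis by simp
qed

text \<open>On each tangent \<open>|v|\<close> runs through a dyadic sequence, and only the scales near \<open>|u|\<close> contribute to the sum. The
  bound is uniform in \<open>z\<close>, in the number of pieces and in the position \<open>t\<close> inside the pieces.\<close>

lemma kern_sum_le:
  assumes b: "0 < b" "b \<le> g" "g < pi / 2" and t: "0 \<le> t" "t \<le> 1" and z: "cmod z \<le> 1"
  shows "(\<Sum>p<2 * n + 1. cmod (kern (1 - piece b n p t) z)) \<le> 32 / (1 - sin g) + 16 / (1 - sin g)\<^sup>2"
proof -
  have bs: "0 < sin b" "sin b \<le> sin g" "sin g < 1" "0 < cos b"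
    using b sin_bounds[of b] sin_bounds[of g] sin_monotone_2pi_le[of b g] by auto
  have tan: "(\<Sum>k<n. cmod (kern (1 - tangent_pt b \<sigma> ((1 + t) / 2 ^ Suc k)) z)) \<le> 16 / (1 - sin g)"
    if \<sigma>: "\<sigma> = 1 \<or> \<sigma> = - 1" for \<sigma>
  proof -
    define x y where "x = cmod (1 - z)" and "y = (1 + t) / 2 * cos b"
    have y: "0 < y" using t bs by (simp add: y_def)
    have yk: "(1 + t) / 2 ^ Suc k * cos b = y / 2 ^ k" for k by (simp add: y_def)
    have "(\<Sum>k<n. cmod (kern (1 - tangent_pt b \<sigma> ((1 + t) / 2 ^ Suc k)) z))
        \<le> (\<Sum>k<n. 8 / (1 - sin b) * (x * (y / 2 ^ k) / (x + y / 2 ^ k)\<^sup>2))"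
      using kern_tangent_le[OF b(1) _ \<sigma> dyadic_block_bounds(1)[OF t] z] b
      unfolding yk x_def by (intro sum_mono) auto
    also have "\<dots> = 8 / (1 - sin b) * (\<Sum>k<n. x * (y / 2 ^ k) / (x + y / 2 ^ k)\<^sup>2)"
      by (rule sum_distrib_left[symmetric])
    also have "\<dots> \<le> 8 / (1 - sin g) * 2"
      using bs y by (intro mult_mono frac_le dyadic_kernel_sum sum_nonneg) (auto simp: x_def)
    finally show ?thesis by simp
  qed
  define l where "l = part_circlepath 0 (sin b) (pi / 2 - b) (3 * pi / 2 + b) t"
  have arc: "cmod (kern (1 - l) z) \<le> 16 / (1 - sin g)\<^sup>2"
  proof -
    note aw = arc_away_from_1[OF cmod_arc[OF bs(1), of t], folded l_def]
    have Re: "0 < Re (1 - l)" using aw bs by linarith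
    have "1 - sin g \<le> Re ((1 - z) + (1 - l))"
      using aw bs complex_Re_le_cmod[of z] z by simp
    also have "\<dots> \<le> cmod ((1 - z) + (1 - l))" by (rule complex_Re_le_cmod)
    finally have 1: "(1 - sin g)\<^sup>2 \<le> (cmod ((1 - z) + (1 - l)))\<^sup>2"
      using bs by (intro power_mono) auto
    have 2: "cmod (1 - z) \<le> 2" "cmod (1 - l) \<le> 2"
      using norm_triangle_ineq4[of 1 z] norm_triangle_ineq4[of 1 l] z
        cmod_arc[OF bs(1), of t, folded l_def] bs by auto
    have "cmod (kern (1 - l) z) = 4 * (cmod (1 - z) * cmod (1 - l)) / (cmod ((1 - z) + (1 - l)))\<^sup>2"
      by (simp only: kern_eq(1)[OF Re z] norm_divide norm_mult norm_power norm_numeral mult.assoc)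
    also have "\<dots> \<le> 4 * (2 * 2) / (1 - sin g)\<^sup>2"
      using 1 2 bs by (intro frac_le mult_left_mono mult_mono) auto
    finally show ?thesis by simp
  qed
  let ?K = "\<lambda>p. cmod (kern (1 - piece b n p t) z)"
  have "(\<Sum>p<2 * n + 1. ?K p) = (\<Sum>p<n. ?K p) + (\<Sum>k<n. ?K (n + k)) + ?K (2 * n)"
    by (rule sum_pieces)
  also have "(\<Sum>p<n. ?K p) = (\<Sum>k<n. cmod (kern (1 - tangent_pt b 1 ((1 + t) / 2 ^ Suc k)) z))"
    by (intro sum.cong refl) (simp add: piece_def)
  also have "(\<Sum>k<n. ?K (n + k)) = (\<Sum>k<n. cmod (kern (1 - tangent_pt b (- 1) ((1 + t) / 2 ^ Suc k)) z))"
    by (intro sum.cong refl) (simp add: piece_def)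
  also have "?K (2 * n) = cmod (kern (1 - l) z)" by (simp add: piece_def l_def)
  finally show ?thesis using tan[of 1] tan[of "- 1"] arc by simp
qed

section \<open>Improper contour integrals\<close>

lemma has_integral_powr:
  fixes s :: real
  assumes "0 < d" "d \<le> e" "s > 0"
  shows "((\<lambda>t. c * t powr (s - 1)) has_integral c * (e powr s - d powr s) / s) {d..e}"
proof -
  have "((\<lambda>t. c * t powr (s - 1)) has_integral c * e powr s / s - c * d powr s / s) {d..e}"
  proof (rule fundamental_theorem_of_calculus[OF assms(2)])
    fix x assume "x \<in> {d..e}"
    then have "x > 0" using assms by simp
    then show "((\<lambda>x. c * x powr s / s) has_vector_derivative c * x powr (s - 1)) (at x within {d..e})"
      unfolding has_real_derivative_iff_has_vector_derivative[symmetric]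
      using assms by (auto intro!: derivative_eq_intros)
  qed
  then show ?thesis by (simp add: right_diff_distrib diff_divide_distrib)
qed

text \<open>The integral over \<open>[0,1]\<close> of a function that is continuous on \<open>(0,1]\<close> with an integrable power
  singularity at \<open>0\<close>; its primitive extends continuously to \<open>0\<close>.\<close>

lemma improper_integral:
  fixes k :: "real \<Rightarrow> 'b::banach"
  assumes cont: "continuous_on {0<..1} k"
    and le: "\<And>t. 0 < t \<Longrightarrow> t \<le> 1 \<Longrightarrow> norm (k t) \<le> c * t powr (s - 1)" and s: "s > 0"
  shows "k integrable_on {0..1}"
    and "\<And>d. 0 < d \<Longrightarrow> d \<le> 1 \<Longrightarrow> norm (integral {0..1} k - integral {d..1} k) \<le> c * d powr s / s"
    and "\<And>d. 0 < d \<Longrightarrow> d \<le> 1 \<Longrightarrow> norm (integral {d..1} k) \<le> c / s"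
proof -
  have c: "0 \<le> c" using order_trans[OF norm_ge_zero le[of 1]] by simp
  define H where "H d = integral {d..1} k" for d
  have int: "k integrable_on {d..e}" if "0 < d" "e \<le> 1" for d e
    using that by (intro integrable_continuous_real continuous_on_subset[OF cont]) auto
  have H_diff: "norm (H d - H e) \<le> c * (e powr s - d powr s) / s" if de: "0 < d" "d \<le> e" "e \<le> 1" for d e
  proof -
    have "H d - H e = integral {d..e} k"
      using Henstock_Kurzweil_Integration.integral_combine[OF de(2,3) int[OF de(1) order_refl]] by (simp add: H_def algebra_simps)
    also have "norm \<dots> \<le> integral {d..e} (\<lambda>t. c * t powr (s - 1))"
      by (rule Henstock_Kurzweil_Integration.integral_norm_bound_integral)
        (use de int le has_integral_powr[OF de(1,2) s, of c] in auto)
    also have "\<dots> = c * (e powr s - d powr s) / s"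
      by (rule integral_unique[OF has_integral_powr[OF de(1,2) s]])
    finally show ?thesis .
  qed
  show H_le: "norm (integral {d..1} k) \<le> c / s" if d: "0 < d" "d \<le> 1" for d
  proof -
    have "norm (H d - H 1) \<le> c * (1 powr s - d powr s) / s" by (rule H_diff) (use d in auto)
    also have "\<dots> \<le> c * 1 / s" using c s by (intro divide_right_mono mult_left_mono) auto
    finally show ?thesis by (simp add: H_def)
  qed
  define x where "x n = (1 / 2 :: real) ^ n" for n
  have x: "0 < x n" "x n \<le> 1" for n by (auto simp: x_def power_le_one)
  have x_mono: "x m \<le> x n" if "n \<le> m" for m n using that by (auto simp: x_def intro: power_decreasing)
  have x0: "x \<longlonglongrightarrow> 0" unfolding x_def by (intro LIMSEQ_power_zero) simp
  have xs0: "(\<lambda>n. c * x n powr s / s) \<longlonglongrightarrow> c * 0 / s"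
    by (intro tendsto_intros tendsto_zero_powrI[OF x0 tendsto_const _ s]) (use s x in \<open>auto simp: less_imp_le\<close>)
  have "Cauchy (\<lambda>n. H (x n))"
  proof (rule metric_CauchyI)
    fix e :: real assume "e > 0"
    with xs0 have "\<forall>\<^sub>F n in sequentially. c * x n powr s / s < e" by (intro order_tendstoD(2)) auto
    then obtain N where N: "\<And>n. n \<ge> N \<Longrightarrow> c * x n powr s / s < e" by (auto simp: eventually_sequentially)
    have "norm (H (x m) - H (x n)) < e" if "N \<le> n" "n \<le> m" for m n
    proof -
      have "norm (H (x m) - H (x n)) \<le> c * (x n powr s - x m powr s) / s"
        using x x_mono[OF that(2)] by (intro H_diff)
      also have "\<dots> \<le> c * x n powr s / s"
        using c s by (intro divide_right_mono mult_left_mono) auto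
      also have "\<dots> < e" by (rule N[OF that(1)])
      finally show ?thesis .
    qed
    note D = this
    have "dist (H (x m)) (H (x n)) < e" if "m \<ge> N" "n \<ge> N" for m n
      using that D[of n m] D[of m n] by (cases "n \<le> m") (simp_all add: dist_norm norm_minus_commute)
    then show "\<exists>M. \<forall>m\<ge>M. \<forall>n\<ge>M. dist (H (x m)) (H (x n)) < e" by blast
  qed
  then obtain L where L: "(\<lambda>n. H (x n)) \<longlonglongrightarrow> L" 
    using Cauchy_convergent[of "\<lambda>n. H (x n)"] unfolding convergent_def by blast
  have HL: "norm (L - H d) \<le> c * d powr s / s" if d: "0 < d" "d \<le> 1" for d
  proof (rule LIMSEQ_le_const2)
    show "(\<lambda>n. norm (H (x n) - H d)) \<longlonglongrightarrow> norm (L - H d)" by (intro tendsto_intros L)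
    have "\<forall>\<^sub>F n in sequentially. x n < d" using x0 d by (intro order_tendstoD(2))
    then obtain N where N: "\<And>n. n \<ge> N \<Longrightarrow> x n < d" by (auto simp: eventually_sequentially)
    have "norm (H (x n) - H d) \<le> c * d powr s / s" if "n \<ge> N" for n
    proof -
      have "norm (H (x n) - H d) \<le> c * (d powr s - x n powr s) / s"
        using x N[OF that] d by (intro H_diff) auto
      also have "\<dots> \<le> c * d powr s / s" using c s by (intro divide_right_mono mult_left_mono) auto
      finally show ?thesis .
    qed
    then show "\<exists>N. \<forall>n\<ge>N. norm (H (x n) - H d) \<le> c * d powr s / s" by blast
  qed
  define G where "G t = (if t = 0 then L else H t)" for t
  have der: "(H has_vector_derivative - k t) (at t)" if t: "0 < t" "t < 1" for t
  proof -
    have "((\<lambda>u. integral {u..1} k) has_vector_derivative - k t) (at t within {t / 2..1})"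
      by (rule integral_has_vector_derivative'[OF continuous_on_subset[OF cont]]) (use t in auto)
    moreover have "at t within {t / 2..1} = at t"
      using t by (intro at_within_interior) (auto simp: interior_atLeastAtMost_real)
    ultimately show ?thesis by (simp add: H_def[abs_def])
  qed
  have contG: "continuous_on {0..1} G"
    unfolding continuous_on_eq_continuous_within
  proof
    fix t :: real assume t: "t \<in> {0..1}"
    show "continuous (at t within {0..1}) G"
    proof (cases "t = 0")
      case True
      have "((\<lambda>d. c * d powr s / s) \<longlongrightarrow> c * 0 / s) (at 0 within {0..1})"
        by (intro tendsto_intros tendsto_zero_powrI[OF tendsto_ident_at tendsto_const _ s])
          (use s in \<open>auto simp: eventually_at_filter\<close>)
      then have lim: "((\<lambda>d. c * d powr s / s) \<longlongrightarrow> 0) (at 0 within {0..1})" by simp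
      have "((\<lambda>d. G d - L) \<longlongrightarrow> 0) (at 0 within {0..1})"
      proof (rule Lim_null_comparison[OF _ lim])
        show "\<forall>\<^sub>F d in at 0 within {0..1}. norm (G d - L) \<le> c * d powr s / s"
          unfolding eventually_at_filter
          by (rule always_eventually) (use HL in \<open>auto simp: G_def norm_minus_commute\<close>)
      qed
      then have "(G \<longlongrightarrow> L) (at 0 within {0..1})" by (simp add: LIM_zero_iff)
      then show ?thesis using True by (simp add: continuous_within G_def)
    next
      case False
      then have t0: "0 < t" "t \<le> 1" using t by auto
      have "continuous_on {t / 2..1} H"
        unfolding H_def[abs_def] by (rule indefinite_integral_continuous_1') (use t0 int in auto)
      then have "continuous_on {t / 2..1} G"
        by (rule continuous_on_eq) (use t0 in \<open>auto simp: G_def\<close>)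
      then have "continuous (at t within {t / 2..1}) G"
        using t0 by (simp add: continuous_on_eq_continuous_within)
      moreover have "at t within {0..1} = at t within {t / 2..1}"
        by (rule at_within_nhd[of _ "{t / 2<..}"]) (use t0 in auto)
      ultimately show ?thesis by simp
    qed
  qed
  have "(k has_integral - G 1 - - G 0) {0..1}"
  proof (rule fundamental_theorem_of_calculus_interior)
    show "continuous_on {0..1} (\<lambda>t. - G t)" by (intro continuous_intros contG)
    fix t :: real assume t: "t \<in> {0<..<1}"
    have "(G has_vector_derivative - k t) (at t)"
      by (rule has_vector_derivative_transform_within_open[OF der, of t "{0<..<1}"])
        (use t in \<open>auto simp: G_def\<close>)
    then show "((\<lambda>t. - G t) has_vector_derivative k t) (at t)"
      using has_vector_derivative_minus by fastforce
  qed simp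
  then have k: "(k has_integral L) {0..1}" by (simp add: G_def H_def)
  then show "k integrable_on {0..1}" by blast
  show "norm (integral {0..1} k - integral {d..1} k) \<le> c * d powr s / s" if "0 < d" "d \<le> 1" for d
    using HL[OF that] integral_unique[OF k] by (simp add: H_def)
qed

text \<open>The dyadic blocks exhaust the interval up to \<open>2\<^sup>-\<^sup>n\<close>; each is rescaled to \<open>[0,1]\<close>.\<close>

lemma integral_dyadic_blocks:
  fixes k :: "real \<Rightarrow> 'b::banach"
  assumes cont: "continuous_on {0<..1} k"
  shows "(\<Sum>j<n. integral {0..1} (\<lambda>t. (1 / 2 ^ Suc j) *\<^sub>R k ((1 + t) / 2 ^ Suc j))) = integral {1 / 2 ^ n..1} k"
proof (induction n)
  case (Suc n)
  define m where "m = (1 / 2 ^ Suc n :: real)"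
  have m: "0 < m" "m \<le> 1 / 2" "2 * m = 1 / 2 ^ n"
    by (auto simp: m_def field_simps)
  have int: "k integrable_on {d..e}" if "0 < d" "e \<le> 1" for d e
    using that by (intro integrable_continuous_real continuous_on_subset[OF cont]) auto
  have "(k has_integral integral {m..2 * m} k) (cbox m (2 * m))"
    using int m by auto
  from has_integral_affinity'[OF this m(1), of m]
  have "((\<lambda>t. k (m * t + m)) has_integral integral {m..2 * m} k /\<^sub>R m) {0..1}"
    using m(1) by simp
  from has_integral_cmul[OF this, of m] have "((\<lambda>t. m *\<^sub>R k (m * t + m)) has_integral integral {m..2 * m} k) {0..1}"
    using m(1) by simp
  then have "integral {0..1} (\<lambda>t. m *\<^sub>R k (m * t + m)) = integral {m..2 * m} k" by (rule integral_unique)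
  moreover have "m * t + m = (1 + t) / 2 ^ Suc n" for t by (simp add: m_def field_simps)
  ultimately have "integral {0..1} (\<lambda>t. (1 / 2 ^ Suc n) *\<^sub>R k ((1 + t) / 2 ^ Suc n)) = integral {m..2 * m} k"
    by (simp add: m_def)
  moreover have "integral {m..2 * m} k + integral {2 * m..1} k = integral {m..1} k"
    using m int by (intro Henstock_Kurzweil_Integration.integral_combine) auto
  ultimately show ?case using Suc by (simp add: m(3) m_def add.commute)
qed simp

definition trunc_integral :: "real \<Rightarrow> nat \<Rightarrow> (complex \<Rightarrow> 'b::complex_banach) \<Rightarrow> 'b"
  where "trunc_integral b n F = (\<Sum>p<2 * n + 1. integral {0..1} (\<lambda>t. wt b n p t *\<^sub>C F (piece b n p t)))"

lemma stolz_boundary_simps: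
  "0 \<le> t \<Longrightarrow> t \<le> 1 / 2 \<Longrightarrow> stolz_boundary b t = tangent_pt b 1 (2 * t)"
  "1 / 2 < t \<Longrightarrow> t \<le> 3 / 4 \<Longrightarrow> stolz_boundary b t = part_circlepath 0 (sin b) (pi / 2 - b) (3 * pi / 2 + b) (4 * t - 2)"
  "3 / 4 < t \<Longrightarrow> t \<le> 1 \<Longrightarrow> stolz_boundary b t = tangent_pt b (- 1) (4 - 4 * t)"
proof -
  have lp: "linepath 1 (tangent_pt b \<sigma> 1) u = tangent_pt b \<sigma> u"
    "linepath (tangent_pt b \<sigma> 1) 1 u = tangent_pt b \<sigma> (1 - u)" for \<sigma> u
    unfolding linepath_def tangent_pt_affine[of b \<sigma> u] tangent_pt_affine[of b \<sigma> "1 - u"]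
    by (simp_all add: scaleR_conv_of_real algebra_simps)
  have p: "rcis (sin b) (pi / 2 - b) = tangent_pt b 1 1" "rcis (sin b) (b - pi / 2) = tangent_pt b (- 1) 1"
    by (simp_all add: tangent_pt_1)
  show "0 \<le> t \<Longrightarrow> t \<le> 1 / 2 \<Longrightarrow> stolz_boundary b t = tangent_pt b 1 (2 * t)"
    by (simp add: stolz_boundary_def joinpaths_def p lp)
  show "1 / 2 < t \<Longrightarrow> t \<le> 3 / 4 \<Longrightarrow> stolz_boundary b t
      = part_circlepath 0 (sin b) (pi / 2 - b) (3 * pi / 2 + b) (4 * t - 2)"
    by (simp add: stolz_boundary_def joinpaths_def algebra_simps)
  assume t: "3 / 4 < t" "t \<le> 1"
  then have "stolz_boundary b t = linepath (tangent_pt b (- 1) 1) 1 (4 * t - 3)"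
    by (simp add: stolz_boundary_def joinpaths_def p)
  then show "stolz_boundary b t = tangent_pt b (- 1) (4 - 4 * t)" by (simp add: lp)
qed

lemma has_integral_scaleC: "(f has_integral i) S \<Longrightarrow> ((\<lambda>x. c *\<^sub>C f x) has_integral c *\<^sub>C i) S"
  using has_integral_linear[OF _ bounded_linear_scaleC, of f i S c] by (simp add: o_def)

text \<open>The contour integral converges absolutely for integrable power singularities at \<open>1\<close>, with a
  rate that is uniform in the function.\<close>

lemma contour_vs_trunc_integral:
  fixes F :: "complex \<Rightarrow> 'b::complex_banach"
  assumes b: "0 < b" "b < pi / 2" and cont: "continuous_on (stolz_curve b) F"
    and le: "\<And>l. l \<in> stolz_curve b \<Longrightarrow> norm (F l) \<le> c * cmod (1 - l) powr (s - 1)" and s: "s > 0"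
  shows "norm (banach_contour_integral (stolz_boundary b) F - trunc_integral b n F) \<le> c * (2 * (1 / 2 ^ n) powr s / s)"
    and "norm (trunc_integral b n F) \<le> c * (2 / s + 2 * pi / (1 - sin b) * 2 powr s)"
proof -
  note sb = sin_bounds[OF b]
  have c: "0 \<le> c"
  proof -
    have t: "tangent_pt b 1 1 \<in> stolz_curve b" by (rule tangent_in_stolz_curve) auto
    have "0 < cmod (1 - tangent_pt b 1 1)" using cmod_tangent_pt_self[of 1 1 b] sb by auto
    then have "0 < cmod (1 - tangent_pt b 1 1) powr (s - 1)" by simp
    moreover have "0 \<le> c * cmod (1 - tangent_pt b 1 1) powr (s - 1)"
      using le[OF t] norm_ge_zero order_trans by blast
    ultimately show ?thesis by (simp add: zero_le_mult_iff)
  qed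
  define K where "K \<sigma> \<tau> = F (tangent_pt b \<sigma> \<tau>)" for \<sigma> \<tau>
  define e where "e \<sigma> = tangent_pt b \<sigma> 1 - 1" for \<sigma>
  define I where "I \<sigma> = integral {0..1} (K \<sigma>)" for \<sigma>
  define In where "In \<sigma> = integral {1 / 2 ^ n..1} (K \<sigma>)" for \<sigma>
  let ?arc = "part_circlepath 0 (sin b) (pi / 2 - b) (3 * pi / 2 + b)"
  let ?arc' = "\<lambda>t. \<i> * of_real (sin b) * of_real (pi + 2 * b) * exp (\<i> * of_real (pi / 2 - b + t * (pi + 2 * b)))"
  define A where "A = integral {0..1} (\<lambda>t. ?arc' t *\<^sub>C F (?arc t))"
  have Kcont: "continuous_on {0<..1} (K \<sigma>)" if "\<sigma> = 1 \<or> \<sigma> = - 1" for \<sigma>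
    unfolding K_def
  proof (rule continuous_on_compose2[OF cont])
    show "continuous_on {0<..1} (tangent_pt b \<sigma>)" unfolding tangent_pt_def[abs_def] by (intro continuous_intros)
    show "tangent_pt b \<sigma> ` {0<..1} \<subseteq> stolz_curve b" using that by (auto intro!: tangent_in_stolz_curve)
  qed
  have Kle: "norm (K \<sigma> t) \<le> c * cos b powr (s - 1) * t powr (s - 1)"
    if "\<sigma> = 1 \<or> \<sigma> = - 1" "0 < t" "t \<le> 1" for \<sigma> t
    using le[OF tangent_in_stolz_curve[OF that(2,3,1), of b]] cmod_tangent_pt_self[OF that(1), of t b] that sb
    by (simp add: K_def powr_mult mult_ac)
  note imp = improper_integral[OF Kcont Kle s]
  have e: "cmod (e \<sigma>) = cos b" if "\<sigma> = 1 \<or> \<sigma> = - 1" for \<sigma>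
    using cmod_tangent_pt_self[OF that, of 1 b] sb by (simp add: e_def norm_minus_commute)
  have cos_s: "cos b * cos b powr (s - 1) \<le> 1"
  proof -
    have "cos b * cos b powr (s - 1) = cos b powr s" using sb by (simp add: powr_mult_base)
    also have "\<dots> \<le> 1 powr s" using sb s by (intro powr_mono2) auto
    finally show ?thesis by simp
  qed
  have d: "0 < (1 / 2 ^ n :: real)" "(1 / 2 ^ n :: real) \<le> 1" by auto
  have diff: "norm (e \<sigma> *\<^sub>C I \<sigma> - e \<sigma> *\<^sub>C In \<sigma>) \<le> c * ((1 / 2 ^ n) powr s / s)"
    if "\<sigma> = 1 \<or> \<sigma> = - 1" for \<sigma>
  proof -
    have "norm (e \<sigma> *\<^sub>C I \<sigma> - e \<sigma> *\<^sub>C In \<sigma>) \<le> cos b * (c * cos b powr (s - 1) * (1 / 2 ^ n) powr s / s)"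
      unfolding scaleC_diff_right[symmetric] norm_scaleC e[OF that] I_def In_def
      using imp(2)[OF that that _ _ d] sb by (intro mult_left_mono) auto
    also have "\<dots> = (cos b * cos b powr (s - 1)) * (c * ((1 / 2 ^ n) powr s / s))" by simp
    also have "\<dots> \<le> 1 * (c * ((1 / 2 ^ n) powr s / s))"
      using c s by (intro mult_right_mono cos_s) auto
    finally show ?thesis by simp
  qed
  have seg: "norm (e \<sigma> *\<^sub>C In \<sigma>) \<le> c / s" if "\<sigma> = 1 \<or> \<sigma> = - 1" for \<sigma>
  proof -
    have "norm (e \<sigma> *\<^sub>C In \<sigma>) \<le> cos b * (c * cos b powr (s - 1) / s)"
      unfolding norm_scaleC e[OF that] In_def
      using imp(3)[OF that that _ _ d] sb by (intro mult_left_mono) auto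
    also have "\<dots> = (cos b * cos b powr (s - 1)) * (c / s)" by simp
    also have "\<dots> \<le> 1 * (c / s)" using c s by (intro mult_right_mono cos_s) auto
    finally show ?thesis by simp
  qed
  have arcC: "?arc t \<in> stolz_curve b" if "t \<in> {0..1}" for t
    using that by (intro arc_in_stolz_curve[OF b]) auto
  have arc_cont: "continuous_on {0..1} (\<lambda>t. ?arc' t *\<^sub>C F (?arc t))"
  proof (intro continuous_intros continuous_on_compose2[OF cont])
    show "continuous_on {0..1} ?arc" unfolding arc_eq[abs_def] by (intro continuous_intros)
  qed (use arcC in auto)
  have A: "norm A \<le> c * (2 * pi / (1 - sin b) * 2 powr s)"
  proof -
   have "norm A \<le> c * (2 * pi / (1 - sin b) * 2 powr s) * (1 - 0)"
    unfolding A_def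
   proof (rule integral_bound)
    show "continuous_on {0..1} (\<lambda>t. ?arc' t *\<^sub>C F (?arc t))" by (rule arc_cont)
    fix t :: real assume t: "t \<in> {0..1}"
    have l: "?arc t \<in> stolz_curve b" using t by (intro arcC) auto
    have w: "cmod (?arc' t) \<le> 2 * pi / (1 - sin b) * cmod (1 - ?arc t)"
      using wt_le[OF b(1) order_refl b(2), of t 0 0] t by (simp add: wt_def piece_def)
    have x: "0 < cmod (1 - ?arc t)" using stolz_curve_re(1)[OF l b] by auto
    have "norm (?arc' t *\<^sub>C F (?arc t))
        \<le> (2 * pi / (1 - sin b) * cmod (1 - ?arc t)) * (c * cmod (1 - ?arc t) powr (s - 1))"
      unfolding norm_scaleC using sb by (intro mult_mono w le[OF l]) auto
    also have "\<dots> = c * (2 * pi / (1 - sin b) * cmod (1 - ?arc t) powr s)"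
      using x by (simp add: powr_mult_base[symmetric] powr_diff)
    also have "\<dots> \<le> c * (2 * pi / (1 - sin b) * 2 powr s)"
      using stolz_curve_re(2)[OF l b] x s c sb by (intro mult_left_mono powr_mono2) auto
    finally show "norm (?arc' t *\<^sub>C F (?arc t)) \<le> c * (2 * pi / (1 - sin b) * 2 powr s)" .
   qed simp
   then show ?thesis by simp
  qed
  have trunc: "trunc_integral b n F = e 1 *\<^sub>C In 1 - e (- 1) *\<^sub>C In (- 1) + A"
  proof -
    have blocks: "(\<Sum>j<n. integral {0..1} (\<lambda>t. (of_real (1 / 2 ^ Suc j) * z) *\<^sub>C K \<sigma> ((1 + t) / 2 ^ Suc j))) = z *\<^sub>C In \<sigma>"
      if "\<sigma> = 1 \<or> \<sigma> = - 1" for \<sigma> z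
    proof -
      have "integral {0..1} (\<lambda>t. (of_real (1 / 2 ^ Suc j) * z) *\<^sub>C K \<sigma> ((1 + t) / 2 ^ Suc j))
          = z *\<^sub>C integral {0..1} (\<lambda>t. (1 / 2 ^ Suc j) *\<^sub>R K \<sigma> ((1 + t) / 2 ^ Suc j))" for j
      proof -
        have "(\<lambda>t. (1 / 2 ^ Suc j) *\<^sub>R K \<sigma> ((1 + t) / 2 ^ Suc j)) integrable_on {0..1}"
        proof (intro integrable_continuous_real continuous_intros continuous_on_compose2[OF Kcont[OF that]])
          show "(\<lambda>t. (1 + t) / 2 ^ Suc j) ` {0..1} \<subseteq> {0<..1 :: real}"
            using dyadic_block_bounds by fastforce
        qed auto
        from integral_linear[OF this bounded_linear_scaleC[of z]]
        have "integral {0..1} (\<lambda>t. z *\<^sub>C (1 / 2 ^ Suc j) *\<^sub>R K \<sigma> ((1 + t) / 2 ^ Suc j))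
          = z *\<^sub>C integral {0..1} (\<lambda>t. (1 / 2 ^ Suc j) *\<^sub>R K \<sigma> ((1 + t) / 2 ^ Suc j))" by (simp add: o_def)
        moreover have "(of_real (1 / 2 ^ Suc j) * z) *\<^sub>C x = z *\<^sub>C (1 / 2 ^ Suc j) *\<^sub>R x" for x :: 'b
          by (simp only: scaleR_scaleC scaleC_scaleC mult.commute)
        ultimately show ?thesis by (simp only:)
      qed
      then show ?thesis
        by (simp only: scaleC_sum_right[symmetric] integral_dyadic_blocks[OF Kcont[OF that]] In_def)
    qed
    have "trunc_integral b n F = (\<Sum>j<n. integral {0..1} (\<lambda>t. (of_real (1 / 2 ^ Suc j) * e 1) *\<^sub>C K 1 ((1 + t) / 2 ^ Suc j)))
        + (\<Sum>j<n. integral {0..1} (\<lambda>t. (of_real (1 / 2 ^ Suc j) * - e (- 1)) *\<^sub>C K (- 1) ((1 + t) / 2 ^ Suc j))) + A"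
      unfolding trunc_integral_def sum_pieces
      by (intro arg_cong2[of _ _ _ _ "(+)"] sum.cong refl)
        (simp_all add: wt_def piece_def K_def e_def A_def del: power_Suc minus_diff_eq)
    also have "\<dots> = e 1 *\<^sub>C In 1 + (- e (- 1)) *\<^sub>C In (- 1) + A"
      by (simp only: blocks[of 1] blocks[of "- 1"] simp_thms)
    finally show ?thesis by (simp add: scaleC_minus_left)
  qed
  show "norm (trunc_integral b n F) \<le> c * (2 / s + 2 * pi / (1 - sin b) * 2 powr s)"
  proof -
    have "norm (trunc_integral b n F) \<le> norm (e 1 *\<^sub>C In 1) + norm (e (- 1) *\<^sub>C In (- 1)) + norm A"
      unfolding trunc by (intro norm_triangle_le add_mono order_refl norm_triangle_ineq4)
    also have "\<dots> \<le> c / s + c / s + c * (2 * pi / (1 - sin b) * 2 powr s)"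
      by (intro add_mono seg A) auto
    finally show ?thesis by (simp add: distrib_left mult.commute[of c 2])
  qed
  have full: "banach_contour_integral (stolz_boundary b) F = e 1 *\<^sub>C I 1 - e (- 1) *\<^sub>C I (- 1) + A"
  proof -
    let ?h = "\<lambda>t. vector_derivative (stolz_boundary b) (at t within {0..1}) *\<^sub>C F (stolz_boundary b t)"
    have KI: "(K \<sigma> has_integral I \<sigma>) (cbox 0 1)" if "\<sigma> = 1 \<or> \<sigma> = - 1" for \<sigma>
      using imp(1)[OF that that] by (simp add: I_def integrable_integral)
    have vd: "vector_derivative (stolz_boundary b) (at t within {0..1}) = d"
      if "(g has_vector_derivative d) (at t)" "open S" "t \<in> S" "S \<subseteq> {0..1}" "\<And>x. x \<in> S \<Longrightarrow> g x = stolz_boundary b x"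
      for g d t S
      using has_vector_derivative_transform_within_open[OF that(1,2,3,5)] that(3,4)
      by (intro vector_derivative_at_within_ivl) auto
    have tan': "((\<lambda>t. tangent_pt b \<sigma> (m * t + q)) has_vector_derivative of_real m * e \<sigma>) (at t)" for \<sigma> m q t
      unfolding tangent_pt_affine[of b \<sigma> "_ + _"] e_def
      by (auto intro!: derivative_eq_intros simp: has_vector_derivative_def scaleR_conv_of_real)
    have h1: "(?h has_integral e 1 *\<^sub>C I 1) {0..1 / 2}"
    proof (rule has_integral_spike_finite[of "{0, 1 / 2}"])
      have "((\<lambda>t. K 1 (2 * t)) has_integral I 1 /\<^sub>R 2) {0..1 / 2}"
        using has_integral_affinity'[OF KI[of 1], of 2 0] by simp
      from has_integral_scaleC[OF this, of "2 * e 1"]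
      show "((\<lambda>t. (2 * e 1) *\<^sub>C K 1 (2 * t)) has_integral e 1 *\<^sub>C I 1) {0..1 / 2}"
        by (simp add: scaleR_scaleC scaleC_scaleC)
      fix t :: real assume "t \<in> {0..1 / 2} - {0, 1 / 2}"
      then have t: "t \<in> {0<..<1 / 2}" by auto
      have "vector_derivative (stolz_boundary b) (at t within {0..1}) = of_real 2 * e 1"
        by (rule vd[OF tan'[of 1 2 0] _ t]) (auto simp: stolz_boundary_simps)
      then show "?h t = (2 * e 1) *\<^sub>C K 1 (2 * t)"
        using t by (simp add: stolz_boundary_simps K_def)
    qed simp
    have h2: "(?h has_integral A) {1 / 2..3 / 4}"
    proof (rule has_integral_spike_finite[of "{1 / 2, 3 / 4}"])
      have "((\<lambda>t. ?arc' t *\<^sub>C F (?arc t)) has_integral A) (cbox 0 1)"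
        unfolding A_def using integrable_continuous_real[OF arc_cont] by auto
      from has_integral_affinity'[OF this, of 4 "- 2"]
      have "((\<lambda>t. ?arc' (4 * t - 2) *\<^sub>C F (?arc (4 * t - 2))) has_integral A /\<^sub>R 4) {1 / 2..3 / 4}" by simp
      from has_integral_scaleC[OF this, of 4]
      show "((\<lambda>t. 4 *\<^sub>C (?arc' (4 * t - 2) *\<^sub>C F (?arc (4 * t - 2)))) has_integral A) {1 / 2..3 / 4}"
        by (simp add: scaleR_scaleC scaleC_scaleC)
      fix t :: real assume "t \<in> {1 / 2..3 / 4} - {1 / 2, 3 / 4}"
      then have t: "t \<in> {1 / 2<..<3 / 4}" by auto
      have g: "((\<lambda>t. ?arc (4 * t - 2)) has_vector_derivative 4 * ?arc' (4 * t - 2)) (at t)"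
      proof -
        have "((\<lambda>t. 4 * t - 2) has_vector_derivative 4) (at t)"
          unfolding has_real_derivative_iff_has_vector_derivative[symmetric]
          by (auto intro!: derivative_eq_intros)
        from vector_diff_chain_at[OF this has_derivative_arc[of b "4 * t - 2" UNIV]]
        show ?thesis by (simp add: o_def scaleR_conv_of_real)
      qed
      have "vector_derivative (stolz_boundary b) (at t within {0..1}) = 4 * ?arc' (4 * t - 2)"
        by (rule vd[OF g _ t]) (auto simp: stolz_boundary_simps)
      then show "?h t = 4 *\<^sub>C (?arc' (4 * t - 2) *\<^sub>C F (?arc (4 * t - 2)))"
        using t by (simp only: scaleC_scaleC) (simp add: stolz_boundary_simps)
    qed simp
    have h3: "(?h has_integral - (e (- 1) *\<^sub>C I (- 1))) {3 / 4..1}"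
    proof (rule has_integral_spike_finite[of "{3 / 4, 1}"])
      have "((\<lambda>t. K (- 1) (- 4 * t + 4)) has_integral (1 / 4) *\<^sub>R I (- 1)) ((\<lambda>x. (- 1 / 4) * x + 1) ` {0..1})"
        using has_integral_affinity[OF KI[of "- 1"], of "- 4" 4] by simp
      moreover have "(\<lambda>x::real. (- 1 / 4) * x + 1) ` {0..1} = {3 / 4..1}"
        by (subst image_affinity_atLeastAtMost) simp
      ultimately have "((\<lambda>t. K (- 1) (- 4 * t + 4)) has_integral (1 / 4) *\<^sub>R I (- 1)) {3 / 4..1}" by simp
      from has_integral_scaleC[OF this, of "- 4 * e (- 1)"]
      show "((\<lambda>t. (- 4 * e (- 1)) *\<^sub>C K (- 1) (- 4 * t + 4)) has_integral - (e (- 1) *\<^sub>C I (- 1))) {3 / 4..1}"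
        by (simp add: scaleR_scaleC scaleC_scaleC scaleC_minus_left)
      fix t :: real assume "t \<in> {3 / 4..1} - {3 / 4, 1}"
      then have t: "t \<in> {3 / 4<..<1}" by auto
      have "vector_derivative (stolz_boundary b) (at t within {0..1}) = of_real (- 4) * e (- 1)"
        by (rule vd[OF tan'[of "- 1" "- 4" 4] _ t]) (auto simp: stolz_boundary_simps)
      then show "?h t = (- 4 * e (- 1)) *\<^sub>C K (- 1) (- 4 * t + 4)"
        using t by (simp add: stolz_boundary_simps K_def)
    qed simp
    have "(?h has_integral e 1 *\<^sub>C I 1 + A + - (e (- 1) *\<^sub>C I (- 1))) {0..1}"
      by (rule has_integral_combine[of 0 "3 / 4" 1, OF _ _ has_integral_combine[of 0 "1 / 2" "3 / 4", OF _ _ h1 h2] h3]) auto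
    then show ?thesis
      unfolding banach_contour_integral_def by (simp add: integral_unique)
  qed
  show "norm (banach_contour_integral (stolz_boundary b) F - trunc_integral b n F) \<le> c * (2 * (1 / 2 ^ n) powr s / s)"
  proof -
    have "banach_contour_integral (stolz_boundary b) F - trunc_integral b n F
        = (e 1 *\<^sub>C I 1 - e 1 *\<^sub>C In 1) - (e (- 1) *\<^sub>C I (- 1) - e (- 1) *\<^sub>C In (- 1))"
      unfolding full trunc by simp
    also have "norm \<dots> \<le> norm (e 1 *\<^sub>C I 1 - e 1 *\<^sub>C In 1) + norm (e (- 1) *\<^sub>C I (- 1) - e (- 1) *\<^sub>C In (- 1))"
      by (rule norm_triangle_ineq4)
    also have "\<dots> \<le> c * ((1 / 2 ^ n) powr s / s) + c * ((1 / 2 ^ n) powr s / s)"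
      by (intro add_mono diff) auto
    finally show ?thesis by (simp add: mult_ac)
  qed
qed

section \<open>The operator kernel and the Cauchy theorem\<close>

definition op_rho :: "complex \<Rightarrow> 'x::complex_normed_vector op \<Rightarrow> 'x op"
  where "op_rho v T = v *\<^sub>C res (1 + v) T"

text \<open>The kernel \<open>kern v\<close> applied to \<open>T\<close>; \<open>op_rho v T\<close> corresponds to the factor \<open>v/(1 + v - z)\<close>.\<close>

definition op_kern :: "complex \<Rightarrow> 'x::complex_normed_vector op \<Rightarrow> 'x op"
  where "op_kern v T = 4 *\<^sub>C (op_rho v T * (1 - op_rho v T))"

lemma cmod_1_plus: "0 < Re v \<Longrightarrow> 1 < cmod (1 + v)"
  using complex_Re_le_cmod[of "1 + v"] by simp

text \<open>The difference \<open>(1 - \<phi>\<^sup>2) R(\<lambda>,T)\<close> for \<open>\<phi> = op_kern (1 - \<lambda>) T\<close>, after cancellation. Only resolvents outside the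
  closed unit disc are left.\<close>

definition kern_defect :: "'x::complex_normed_vector op \<Rightarrow> complex \<Rightarrow> 'x op"
  where "kern_defect T l = (1 - 2 *\<^sub>C op_rho (1 - l) T) * (1 + op_kern (1 - l) T) * res (2 - l) T"

text \<open>With \<open>\<rho> = v R(1 + v,T)\<close> and \<open>\<phi> = 4\<rho>(1 - \<rho>)\<close> one has \<open>1 - \<phi> = (1 - 2\<rho>)\<^sup>2\<close> and
  \<open>1 - 2\<rho> = (\<lambda> - T) R(1 + v,T)\<close>. So in \<open>(1 - \<phi>\<^sup>2) R(\<lambda>,T)\<close> the resolvent at \<open>\<lambda>\<close>, which restricts
  \<open>\<lambda>\<close> to the exterior of the Stolz domain, cancels.\<close>

lemma resolvent_minus_kern:
  fixes T :: "'x::complex_banach op"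
  assumes R: "is_res l T (res l T)" and w: "is_res (2 - l) T (res (2 - l) T)"
  shows "res l T - op_kern (1 - l) T * op_kern (1 - l) T * res l T = kern_defect T l"
proof -
  define v where "v = 1 - l"
  have l: "l = 1 - v" "1 + v = 2 - l" by (auto simp: v_def)
  define W where "W = res (2 - l) T"
  define \<rho> where "\<rho> = op_rho v T"
  have \<rho>: "\<rho> = v *\<^sub>C W" by (simp add: \<rho>_def op_rho_def W_def l(2))
  define \<phi> where "\<phi> = op_kern v T"
  have \<phi>: "\<phi> = 4 *\<^sub>C (\<rho> * (1 - \<rho>))" by (simp add: \<phi>_def op_kern_def \<rho>_def)
  define s where "s = 1 - 2 *\<^sub>C \<rho>"
  have s2: "1 - \<phi> = s * s"
    by (simp add: s_def \<phi> algebra_simps scaleC_diff_right scaleC_scaleC)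
      (simp add: scaleC_add_left[symmetric] algebra_simps)
  have WT: "((2 - l) *\<^sub>C 1 - T) * W = 1" using w by (simp add: is_res_def W_def)
  have "l *\<^sub>C 1 - T = ((2 - l) *\<^sub>C 1 - T) - (2 * v) *\<^sub>C 1"
  proof -
    have "((2 - l) *\<^sub>C 1 - T) - (2 * v) *\<^sub>C 1 = ((2 - l) - 2 * v) *\<^sub>C 1 - T"
      by (simp only: scaleC_diff_left) simp
    moreover have "(2 - l) - 2 * v = l" by (simp add: v_def)
    ultimately show ?thesis by simp
  qed
  then have lTW: "(l *\<^sub>C 1 - T) * W = s"
    by (simp add: left_diff_distrib WT s_def \<rho> scaleC_scaleC)
      (use WT in \<open>simp add: left_diff_distrib\<close>)
  have Rs: "res l T * s = W"
    using R by (simp add: lTW[symmetric] is_res_def mult.assoc[symmetric])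
  have RW: "W * res l T = res l T * W"
    unfolding W_def
    by (rule res_commute[OF R]) (rule res_commute[OF w, symmetric], simp)
  have R\<rho>: "\<rho> * res l T = res l T * \<rho>" by (simp add: \<rho> RW)
  have Rsc: "s * res l T = res l T * s" by (simp add: s_def R\<rho> algebra_simps)
  have R\<phi>: "\<phi> * res l T = res l T * \<phi>"
  proof -
    have "\<rho> * (1 - \<rho>) * res l T = res l T * (\<rho> * (1 - \<rho>))"
      by (simp add: right_diff_distrib left_diff_distrib R\<rho> mult.assoc)
        (simp add: mult.assoc[symmetric] R\<rho>)
    then show ?thesis by (simp add: \<phi>)
  qed
  have s\<phi>: "s * \<phi> = \<phi> * s"
  proof -
    define X where "X = \<rho> * (1 - \<rho>)"
    have "\<rho> * X = X * \<rho>" by (simp add: X_def algebra_simps)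
    then show ?thesis
      unfolding \<phi> s_def X_def[symmetric]
      by (simp add: left_diff_distrib right_diff_distrib scaleC_scaleC scaleC_diff_right)
  qed
  have "res l T - \<phi> * \<phi> * res l T = (1 + \<phi>) * (1 - \<phi>) * res l T"
    by (simp add: algebra_simps)
  also have "\<dots> = (1 + \<phi>) * s * (s * res l T)" by (simp add: s2 mult.assoc)
  also have "s * res l T = W" by (simp add: Rsc Rs)
  also have "(1 + \<phi>) * s = s * (1 + \<phi>)" by (simp add: s\<phi> algebra_simps)
  finally show ?thesis by (simp add: kern_defect_def v_def[symmetric] \<phi>_def s_def \<rho>_def W_def)
qed

lemma resolvent_identity:
  assumes "is_res w T R" "is_res z T S" shows "R - S = (z - w) *\<^sub>C (R * S)"
proof -
  have "R - S = R * ((z *\<^sub>C 1 - T) * S) - (R * (w *\<^sub>C 1 - T)) * S"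
    using assms by (simp add: is_res_def)
  also have "\<dots> = R * ((z *\<^sub>C 1 - T) - (w *\<^sub>C 1 - T)) * S"
    by (simp add: mult.assoc left_diff_distrib right_diff_distrib)
  also have "(z *\<^sub>C 1 - T) - (w *\<^sub>C 1 - T) = (z - w) *\<^sub>C 1" by (simp add: scaleC_diff_left)
  finally show ?thesis by simp
qed

text \<open>By the resolvent identity and a local bound for the resolvents.\<close>

lemma continuous_on_res:
  fixes T :: "'x::complex_banach op"
  assumes R: "\<And>w. w \<in> S \<Longrightarrow> is_res w T (res w T)" and K: "\<And>w. w \<in> S \<Longrightarrow> norm ((w - 1) *\<^sub>C res w T) \<le> K"
    and S: "1 \<notin> S"
  shows "continuous_on S (\<lambda>w. res w T)"
  unfolding continuous_on_def
proof
  fix w assume w: "w \<in> S"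
  have w1: "w \<noteq> 1" using w S by auto
  have le: "norm (res z T - res w T) \<le> cmod (w - z) * (K / cmod (z - 1) * norm (res w T))" if z: "z \<in> S" for z
  proof -
    have z1: "z \<noteq> 1" using z S by auto
    have "norm (res z T) \<le> K / cmod (z - 1)"
      using K[OF z] z1 by (simp add: norm_scaleC field_simps)
    then show ?thesis
      unfolding resolvent_identity[OF R[OF z] R[OF w]] norm_scaleC
      by (intro mult_left_mono order_trans[OF norm_mult_ineq] mult_right_mono) auto
  qed
  have "((\<lambda>z. cmod (w - z) * (K / cmod (z - 1) * norm (res w T))) \<longlongrightarrow> cmod (w - w) * (K / cmod (w - 1) * norm (res w T))) (at w within S)"
    using w1 by (intro tendsto_intros) auto
  then have lim: "((\<lambda>z. cmod (w - z) * (K / cmod (z - 1) * norm (res w T))) \<longlongrightarrow> 0) (at w within S)" by simp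
  have "((\<lambda>z. res z T - res w T) \<longlongrightarrow> 0) (at w within S)"
  proof (rule Lim_null_comparison[OF _ lim])
    show "\<forall>\<^sub>F z in at w within S. norm (res z T - res w T) \<le> cmod (w - z) * (K / cmod (z - 1) * norm (res w T))"
      unfolding eventually_at_filter by (rule always_eventually) (intro allI impI le)
  qed
  then show "((\<lambda>w. res w T) \<longlongrightarrow> res w T) (at w within S)" by (simp add: LIM_zero_iff)
qed

text \<open>The truncated contour is closed by the chord between its end points.\<close>

definition chord :: "real \<Rightarrow> nat \<Rightarrow> real \<Rightarrow> complex"
  where "chord b n = linepath (tangent_pt b 1 (1 / 2 ^ n)) (tangent_pt b (- 1) (1 / 2 ^ n))"

definition chord_vec :: "real \<Rightarrow> nat \<Rightarrow> complex"
  where "chord_vec b n = tangent_pt b (- 1) (1 / 2 ^ n) - tangent_pt b 1 (1 / 2 ^ n)"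

definition closed_integral :: "real \<Rightarrow> nat \<Rightarrow> (complex \<Rightarrow> 'b::complex_banach) \<Rightarrow> 'b"
  where "closed_integral b n F = trunc_integral b n F - integral {0..1} (\<lambda>t. chord_vec b n *\<^sub>C F (chord b n t))"

lemma chord_eq:
  "chord b n t = 1 - of_real (1 / 2 ^ n) * of_real (cos b) * (of_real (cos b) + \<i> * of_real ((2 * t - 1) * sin b))"
  "chord_vec b n = - of_real (1 / 2 ^ n) * of_real (cos b) * (\<i> * of_real (2 * sin b))"
proof -
  have c: "cis b = of_real (cos b) + \<i> * of_real (sin b)" "cis (- b) = of_real (cos b) - \<i> * of_real (sin b)"
    by (auto simp: complex_eq_iff)
  show "chord b n t = 1 - of_real (1 / 2 ^ n) * of_real (cos b) * (of_real (cos b) + \<i> * of_real ((2 * t - 1) * sin b))"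
    "chord_vec b n = - of_real (1 / 2 ^ n) * of_real (cos b) * (\<i> * of_real (2 * sin b))"
    by (simp_all add: c chord_def chord_vec_def linepath_def tangent_pt_def scaleR_conv_of_real algebra_simps
        add_divide_distrib diff_divide_distrib)
qed

context
  fixes b g :: real
  assumes b: "0 < b" "b < g" "g < pi / 2"
begin

lemma bpi: "b < pi / 2" using b by simp

lemma piece_in_domain: "t \<in> {0..1} \<Longrightarrow> piece b n p t \<in> stolz_domain g"
  by (rule stolz_curve_subset[OF piece_in_stolz_curve b]) (use b in auto)

lemma chord_in_domain: "t \<in> {0..1} \<Longrightarrow> chord b n t \<in> stolz_domain g"
proof -
  assume t: "t \<in> {0..1}"
  have pos: "0 < (1 / 2 ^ n :: real)" "(1 / 2 ^ n :: real) \<le> 1" by auto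
  have "tangent_pt b \<sigma> (1 / 2 ^ n) \<in> stolz_domain g" if "\<sigma> = 1 \<or> \<sigma> = - 1" for \<sigma>
    by (rule stolz_curve_subset[OF tangent_in_stolz_curve[OF pos that] b])
  then have "closed_segment (tangent_pt b 1 (1 / 2 ^ n)) (tangent_pt b (- 1) (1 / 2 ^ n)) \<subseteq> stolz_domain g"
    by (intro closed_segment_subset convex_stolz_domain) auto
  then show ?thesis
    using linepath_in_path[OF t] unfolding chord_def by blast
qed

lemma integrable_piece:
  fixes F :: "complex \<Rightarrow> 'b::complex_banach"
  assumes "continuous_on (stolz_domain g) F"
  shows "(\<lambda>t. wt b n p t *\<^sub>C F (piece b n p t)) integrable_on {0..1}"
    and "(\<lambda>t. chord_vec b n *\<^sub>C F (chord b n t)) integrable_on {0..1}"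
proof -
  show "(\<lambda>t. wt b n p t *\<^sub>C F (piece b n p t)) integrable_on {0..1}"
    by (intro integrable_continuous_real continuous_intros continuous_on_wt
        continuous_on_compose2[OF assms] continuous_on_piece) (auto intro: piece_in_domain)
  show "(\<lambda>t. chord_vec b n *\<^sub>C F (chord b n t)) integrable_on {0..1}"
    unfolding chord_def
    by (intro integrable_continuous_real continuous_intros continuous_on_compose2[OF assms])
      (auto intro: chord_in_domain[unfolded chord_def])
qed

lemma closed_integral_add:
  fixes F G :: "complex \<Rightarrow> 'b::complex_banach"
  assumes "continuous_on (stolz_domain g) F" "continuous_on (stolz_domain g) G"
  shows "closed_integral b n (\<lambda>l. F l + G l) = closed_integral b n F + closed_integral b n G"
  using assms
  by (simp add: closed_integral_def trunc_integral_def scaleC_add_right integrable_piece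
      Henstock_Kurzweil_Integration.integral_add sum.distrib)

lemma closed_integral_linear:
  fixes F :: "complex \<Rightarrow> 'b::complex_banach" and h :: "'b \<Rightarrow> 'c::complex_banach"
  assumes F: "continuous_on (stolz_domain g) F" and h: "bounded_linear h" "\<And>c x. h (c *\<^sub>C x) = c *\<^sub>C h x"
  shows "closed_integral b n (\<lambda>l. h (F l)) = h (closed_integral b n F)"
proof -
  note lin = bounded_linear.linear[OF h(1)]
  have "integral {0..1} (\<lambda>t. wt b n p t *\<^sub>C h (F (piece b n p t)))
      = h (integral {0..1} (\<lambda>t. wt b n p t *\<^sub>C F (piece b n p t)))" for p
    using integral_linear[OF integrable_piece(1)[OF F] h(1)] by (simp add: o_def h(2))
  moreover have "integral {0..1} (\<lambda>t. chord_vec b n *\<^sub>C h (F (chord b n t)))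
      = h (integral {0..1} (\<lambda>t. chord_vec b n *\<^sub>C F (chord b n t)))"
    using integral_linear[OF integrable_piece(2)[OF F] h(1)] by (simp add: o_def h(2))
  ultimately show ?thesis
    by (simp only: closed_integral_def trunc_integral_def linear_diff[OF lin] linear_sum[OF lin])
qed

text \<open>A scalar holomorphic function has a primitive on the convex domain, and the differences of its values at the
  end points of the pieces telescope around the closed contour.\<close>

lemma closed_integral_holomorphic:
  assumes f: "f holomorphic_on stolz_domain g"
  shows "closed_integral b n f = 0"
proof -
  obtain F where F: "\<And>x. x \<in> stolz_domain g \<Longrightarrow> (F has_field_derivative f x) (at x within stolz_domain g)"
    using holomorphic_convex_primitive'[OF convex_stolz_domain open_stolz_domain f] by blast
  have path: "integral {0..1} (\<lambda>t. d t *\<^sub>C f (\<gamma> t)) = F (\<gamma> 1) - F (\<gamma> 0)"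
    if \<gamma>: "\<And>t. t \<in> {0..1} \<Longrightarrow> \<gamma> t \<in> stolz_domain g"
      "\<And>t. t \<in> {0..1} \<Longrightarrow> (\<gamma> has_vector_derivative d t) (at t within {0..1})" for \<gamma> d
  proof -
    have "((\<lambda>t. d t * f (\<gamma> t)) has_integral (F \<circ> \<gamma>) 1 - (F \<circ> \<gamma>) 0) {0..1}"
    proof (rule fundamental_theorem_of_calculus)
      fix t :: real assume t: "t \<in> {0..1}"
      show "(F \<circ> \<gamma> has_vector_derivative d t * f (\<gamma> t)) (at t within {0..1})"
        by (rule field_vector_diff_chain_within[OF \<gamma>(2)[OF t] DERIV_subset[OF F[OF \<gamma>(1)[OF t]]]])
          (use \<gamma>(1) in auto)
    qed simp
    then show ?thesis by (simp add: integral_unique scaleC_complex_def)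
  qed
  define a where "a \<sigma> k = F (tangent_pt b \<sigma> (1 / 2 ^ k))" for \<sigma> and k :: nat
  have tan: "integral {0..1} (\<lambda>t. (of_real (1 / 2 ^ Suc k) * (tangent_pt b \<sigma> 1 - 1)) *\<^sub>C
      f (tangent_pt b \<sigma> ((1 + t) / 2 ^ Suc k))) = a \<sigma> k - a \<sigma> (Suc k)" if "\<sigma> = 1 \<or> \<sigma> = - 1" for \<sigma> k
  proof -
    have "tangent_pt b \<sigma> ((1 + t) / 2 ^ Suc k) \<in> stolz_domain g" if "t \<in> {0..1}" for t
      using that dyadic_block_bounds[of t k] \<open>\<sigma> = 1 \<or> \<sigma> = - 1\<close>
      by (intro stolz_curve_subset[OF tangent_in_stolz_curve b]) auto
    from path[OF this has_derivative_tangent] show ?thesis by (simp add: a_def)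
  qed
  have arc01: "part_circlepath 0 (sin b) (pi / 2 - b) (3 * pi / 2 + b) 0 = tangent_pt b 1 1"
    "part_circlepath 0 (sin b) (pi / 2 - b) (3 * pi / 2 + b) 1 = tangent_pt b (- 1) 1"
  proof -
    show "part_circlepath 0 (sin b) (pi / 2 - b) (3 * pi / 2 + b) 0 = tangent_pt b 1 1"
      by (simp add: arc_eq tangent_pt_1 rcis_def cis_conv_exp)
    have "exp (\<i> * of_real (pi / 2 - b + 1 * (pi + 2 * b))) = cis (- (pi / 2 - b) + 2 * pi)"
      by (simp add: cis_conv_exp algebra_simps)
    also have "\<dots> = cis (- (pi / 2 - b))" by (simp only: cis_mult[symmetric] cis_2pi mult_1_right)
    finally show "part_circlepath 0 (sin b) (pi / 2 - b) (3 * pi / 2 + b) 1 = tangent_pt b (- 1) 1"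
      by (simp only: arc_eq tangent_pt_1 rcis_def)
  qed
  have arc: "integral {0..1} (\<lambda>t. wt b n (2 * n) t *\<^sub>C f (piece b n (2 * n) t)) = a (- 1) 0 - a 1 0"
  proof -
    have "part_circlepath 0 (sin b) (pi / 2 - b) (3 * pi / 2 + b) t \<in> stolz_domain g" if "t \<in> {0..1}" for t
      using piece_in_domain[OF that, of 0 0] by (simp add: piece_def)
    from path[OF this has_derivative_arc] show ?thesis by (simp add: a_def arc01 wt_def piece_def)
  qed
  have ch: "integral {0..1} (\<lambda>t. chord_vec b n *\<^sub>C f (chord b n t)) = a (- 1) n - a 1 n"
  proof -
    have d: "(chord b n has_vector_derivative chord_vec b n) (at t within {0..1})" for t
      unfolding chord_def chord_vec_def by (rule has_vector_derivative_linepath_within)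
    have "chord b n 0 = tangent_pt b 1 (1 / 2 ^ n)" "chord b n 1 = tangent_pt b (- 1) (1 / 2 ^ n)"
      by (simp_all add: chord_def linepath_0' linepath_1')
    with path[OF chord_in_domain d] show ?thesis by (simp only: a_def)
  qed
  have neg: "integral {0..1} (\<lambda>t. - c *\<^sub>C h t) = - integral {0..1} (\<lambda>t. c *\<^sub>C h t)"
    for c and h :: "real \<Rightarrow> complex"
    by (simp add: scaleC_minus_left)
  have "trunc_integral b n f = (\<Sum>k<n. a 1 k - a 1 (Suc k)) + (\<Sum>k<n. - (a (- 1) k - a (- 1) (Suc k)))
      + (a (- 1) 0 - a 1 0)"
    unfolding trunc_integral_def sum_pieces arc
  proof (intro arg_cong2[of _ _ _ _ "(+)"] sum.cong refl)
    fix k assume k: "k \<in> {..<n}"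
    show "integral {0..1} (\<lambda>t. wt b n k t *\<^sub>C f (piece b n k t)) = a 1 k - a 1 (Suc k)"
      using k tan[of 1 k] by (simp add: wt_def piece_def)
    show "integral {0..1} (\<lambda>t. wt b n (n + k) t *\<^sub>C f (piece b n (n + k) t)) = - (a (- 1) k - a (- 1) (Suc k))"
      using k tan[of "- 1" k] neg[of "of_real (1 / 2 ^ Suc k) * (tangent_pt b (- 1) 1 - 1)"]
      by (simp add: wt_def piece_def)
  qed
  also have "\<dots> = (a 1 0 - a 1 n) - (a (- 1) 0 - a (- 1) n) + (a (- 1) 0 - a 1 0)"
    unfolding sum_negf sum_lessThan_telescope' by simp
  finally show ?thesis by (simp add: closed_integral_def ch)
qed

lemma closed_integral_bound:
  fixes F :: "complex \<Rightarrow> 'b::complex_banach"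
  shows "\<exists>B\<ge>0. \<forall>(F :: complex \<Rightarrow> 'b) M. continuous_on (stolz_domain g) F \<longrightarrow>
    (\<forall>t\<in>{0..1}. \<forall>p. norm (F (piece b n p t)) \<le> M) \<longrightarrow> (\<forall>t\<in>{0..1}. norm (F (chord b n t)) \<le> M)
    \<longrightarrow> norm (closed_integral b n F) \<le> B * M"
proof -
  have "\<exists>B\<ge>0. \<forall>t\<in>{0..1}. cmod (wt b n p t) \<le> B" for p
  proof -
    have "bounded (wt b n p ` {0..1})"
      by (intro compact_imp_bounded compact_continuous_image continuous_on_wt) simp
    then show ?thesis unfolding bounded_iff
      by (metis abs_ge_self abs_ge_zero image_eqI order_trans)
  qed
  then obtain W where W: "\<And>p. 0 \<le> W p" "\<And>p t. t \<in> {0..1} \<Longrightarrow> cmod (wt b n p t) \<le> W p" by metis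
  have "norm (closed_integral b n F) \<le> ((\<Sum>p<2 * n + 1. W p) + cmod (chord_vec b n)) * M"
    if F: "continuous_on (stolz_domain g) F" and M: "\<And>t p. t \<in> {0..1} \<Longrightarrow> norm (F (piece b n p t)) \<le> M"
      "\<And>t. t \<in> {0..1} \<Longrightarrow> norm (F (chord b n t)) \<le> M" for F :: "complex \<Rightarrow> 'b" and M
  proof -
    have bnd: "norm (integral {0..1} h) \<le> B" if "h integrable_on {0..1}" "\<And>t. t \<in> {0..1} \<Longrightarrow> norm (h t) \<le> B"
      for h :: "real \<Rightarrow> 'b" and B
      using Henstock_Kurzweil_Integration.integral_norm_bound_integral[OF that(1) integrable_const_ivl that(2)] by simp
    have "norm (closed_integral b n F) \<le> norm (trunc_integral b n F) + norm (integral {0..1} (\<lambda>t. chord_vec b n *\<^sub>C F (chord b n t)))"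
      unfolding closed_integral_def by (rule norm_triangle_ineq4)
    also have "\<dots> \<le> (\<Sum>p<2 * n + 1. W p * M) + cmod (chord_vec b n) * M"
      unfolding trunc_integral_def
      by (intro add_mono sum_norm_le bnd integrable_piece F)
        (auto simp: norm_scaleC intro!: mult_mono mult_left_mono M W norm_ge_zero)
    finally show ?thesis by (simp add: distrib_right sum_distrib_right)
  qed
  moreover have "0 \<le> (\<Sum>p<2 * n + 1. W p) + cmod (chord_vec b n)"
    using W(1) by (intro add_nonneg_nonneg sum_nonneg) auto
  ultimately show ?thesis by blast
qed

text \<open>The operator functions for which the Cauchy theorem holds, with arbitrary scalar holomorphic
  factors.\<close>

definition cauchy_fun :: "nat \<Rightarrow> (complex \<Rightarrow> 'x::complex_banach op) \<Rightarrow> bool"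
  where "cauchy_fun n F \<longleftrightarrow> continuous_on (stolz_domain g) F \<and>
    (\<forall>f. f holomorphic_on stolz_domain g \<longrightarrow> closed_integral b n (\<lambda>l. f l *\<^sub>C F l) = 0)"

lemma cauchy_funD:
  "cauchy_fun n F \<Longrightarrow> continuous_on (stolz_domain g) F"
  "cauchy_fun n F \<Longrightarrow> f holomorphic_on stolz_domain g \<Longrightarrow> closed_integral b n (\<lambda>l. f l *\<^sub>C F l) = 0"
  by (auto simp: cauchy_fun_def)

lemma cauchy_fun_const: "cauchy_fun n (\<lambda>l. A)"
  unfolding cauchy_fun_def
proof (intro conjI allI impI)
  fix f assume f: "f holomorphic_on stolz_domain g"
  have "bounded_linear (\<lambda>c. c *\<^sub>C A)"
    by (rule bounded_bilinear.bounded_linear_left[OF bounded_bilinear_scaleC])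
  from closed_integral_linear[OF holomorphic_on_imp_continuous_on[OF f] this]
  show "closed_integral b n (\<lambda>l. f l *\<^sub>C A) = 0"
    by (simp add: closed_integral_holomorphic[OF f] scaleC_scaleC scaleC_complex_def)
qed simp

lemma cauchy_fun_add: "cauchy_fun n F \<Longrightarrow> cauchy_fun n G \<Longrightarrow> cauchy_fun n (\<lambda>l. F l + G l)"
  unfolding cauchy_fun_def
  by (auto simp: scaleC_add_right closed_integral_add continuous_intros holomorphic_on_imp_continuous_on)

lemma cauchy_fun_scale:
  "cauchy_fun n F \<Longrightarrow> h holomorphic_on stolz_domain g \<Longrightarrow> cauchy_fun n (\<lambda>l. h l *\<^sub>C F l)"
  unfolding cauchy_fun_def
  by (auto simp: scaleC_scaleC continuous_intros holomorphic_on_imp_continuous_on holomorphic_on_mult)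

lemma cauchy_fun_linear:
  assumes F: "cauchy_fun n F" and h: "bounded_linear h" "\<And>c x. h (c *\<^sub>C x) = c *\<^sub>C h x"
  shows "cauchy_fun n (\<lambda>l. h (F l))"
  unfolding cauchy_fun_def
proof (intro conjI allI impI)
  show "continuous_on (stolz_domain g) (\<lambda>l. h (F l))"
    by (rule bounded_linear.continuous_on[OF h(1) cauchy_funD(1)[OF F]])
  fix f assume f: "f holomorphic_on stolz_domain g"
  have "closed_integral b n (\<lambda>l. h (f l *\<^sub>C F l)) = h (closed_integral b n (\<lambda>l. f l *\<^sub>C F l))"
    by (intro closed_integral_linear h continuous_intros holomorphic_on_imp_continuous_on[OF f] cauchy_funD(1)[OF F])
  then show "closed_integral b n (\<lambda>l. f l *\<^sub>C h (F l)) = 0"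
    using cauchy_funD(2)[OF F f] by (simp add: h linear_0[OF bounded_linear.linear[OF h(1)]])
qed

text \<open>The resolvent at \<open>2 - \<lambda>\<close> is, uniformly on the compact contour, a limit of polynomials in \<open>T\<close> whose coefficients
  are scalar holomorphic functions of \<open>\<lambda>\<close>. For these the scalar Cauchy theorem applies, so no theory of
  Banach-valued holomorphic functions is involved.\<close>

lemma cauchy_fun_resolvent:
  fixes T :: "'x::complex_banach op"
  assumes F: "cauchy_fun n F" and T: "\<And>m. norm (T ^ m) \<le> C"
    and K: "\<And>w. cmod w > 1 \<Longrightarrow> norm ((w - 1) *\<^sub>C res w T) \<le> K"
  shows "cauchy_fun n (\<lambda>l. res (2 - l) T * F l)"
proof -
  let ?Y = "stolz_domain g"
  have g0: "0 < g" using b by simp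
  have w1: "cmod (2 - l) > 1" if "l \<in> ?Y" for l
    using cmod_1_plus[OF stolz_domainD(1)[OF that g0 b(3)]] by simp
  have R: "is_res w T (res w T)" if "cmod w > 1" for w by (rule is_res_power_series(1)[OF T that])
  have cR: "continuous_on ?Y (\<lambda>l. res (2 - l) T)"
    by (rule continuous_on_compose2[OF continuous_on_res[of "{w. cmod w > 1}" T K]])
      (auto intro!: continuous_intros R K w1)
  have cF: "continuous_on ?Y F" by (rule cauchy_funD(1)[OF F])
  have cRF: "continuous_on ?Y (\<lambda>l. res (2 - l) T * F l)" by (intro continuous_intros cR cF)
  show ?thesis
    unfolding cauchy_fun_def
  proof (intro conjI allI impI cRF)
    fix f assume f: "f holomorphic_on ?Y"
    have cf: "continuous_on ?Y f" by (rule holomorphic_on_imp_continuous_on[OF f])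
    obtain B where B: "B \<ge> 0" "\<And>(H :: complex \<Rightarrow> 'x op) M. continuous_on ?Y H \<Longrightarrow>
      (\<And>t p. t \<in> {0..1} \<Longrightarrow> norm (H (piece b n p t)) \<le> M) \<Longrightarrow> (\<And>t. t \<in> {0..1} \<Longrightarrow> norm (H (chord b n t)) \<le> M)
      \<Longrightarrow> norm (closed_integral b n H) \<le> B * M"
      using closed_integral_bound[of n] by blast
    define X where "X = (\<Union>p\<le>2 * n. piece b n p ` {0..1}) \<union> chord b n ` {0..1}"
    have cch: "continuous_on {0..1} (chord b n)" unfolding chord_def by (intro continuous_intros)
    have X: "compact X" "X \<subseteq> ?Y" "chord b n 0 \<in> X"
      unfolding X_def using piece_in_domain chord_in_domain
      by (auto intro!: compact_Un compact_UN compact_continuous_image continuous_on_piece cch)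
    have piece_X: "piece b n p t \<in> X" if "t \<in> {0..1}" for p t
    proof -
      have "piece b n p t = piece b n (min p (2 * n)) t" by (auto simp: piece_def min_def)
      then show ?thesis using that unfolding X_def by fastforce
    qed
    have chord_X: "chord b n t \<in> X" if "t \<in> {0..1}" for t using that unfolding X_def by blast
    have bX: "\<exists>M>0. \<forall>l\<in>X. norm (H l) \<le> M" if "continuous_on ?Y H" for H :: "complex \<Rightarrow> 'x op"
    proof -
      have "bounded (H ` X)"
        by (intro compact_imp_bounded compact_continuous_image X continuous_on_subset[OF that])
      then show ?thesis unfolding bounded_pos by auto
    qed
    obtain M where M: "M > 0" "\<And>l. l \<in> X \<Longrightarrow> norm (f l *\<^sub>C F l) \<le> M"
      using bX[of "\<lambda>l. f l *\<^sub>C F l"] cf cF by (auto simp: continuous_intros)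
    obtain MR where MR: "MR > 0" "\<And>l. l \<in> X \<Longrightarrow> norm (res (2 - l) T) \<le> MR"
      using bX[OF cR] by blast
    have C0: "0 \<le> C" using T[of 0] norm_ge_zero order_trans by blast
    have "\<exists>q. 0 \<le> q \<and> q < 1 \<and> (\<forall>l\<in>X. cmod (1 / (2 - l)) \<le> q)"
    proof -
      have "continuous_on X (\<lambda>l. cmod (1 / (2 - l)))"
        using w1 X(2) by (intro continuous_intros) fastforce
      from continuous_attains_sup[OF X(1) _ this] X(3) obtain l0 where
        l0: "l0 \<in> X" "\<And>l. l \<in> X \<Longrightarrow> cmod (1 / (2 - l)) \<le> cmod (1 / (2 - l0))" by blast
      moreover have "cmod (1 / (2 - l0)) < 1"
        using w1[of l0] l0(1) X(2) by (auto simp: norm_divide divide_less_eq)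
      ultimately show ?thesis by (intro exI[of _ "cmod (1 / (2 - l0))"]) auto
    qed
    then obtain q where q: "0 \<le> q" "q < 1" "\<And>l. l \<in> X \<Longrightarrow> cmod (1 / (2 - l)) \<le> q" by blast
    define P where "P m l = (\<Sum>j<m. (1 / (2 - l)) ^ Suc j *\<^sub>C T ^ j)" for m l
    have cP: "continuous_on ?Y (P m)" for m
      unfolding P_def[abs_def] using w1 by (intro continuous_intros) fastforce
    have P0: "closed_integral b n (\<lambda>l. f l *\<^sub>C (P m l * F l)) = 0" for m
    proof -
      have "cauchy_fun n (\<lambda>l. P m l * F l)"
      proof (induction m)
        case 0
        then show ?case using cauchy_fun_const[of n 0] by (simp add: P_def)
      next
        case (Suc m)
        have hol: "(\<lambda>l. (1 / (2 - l)) ^ Suc m) holomorphic_on ?Y"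
          using w1 by (intro holomorphic_intros) fastforce
        have "cauchy_fun n (\<lambda>l. T ^ m * F l)"
          by (rule cauchy_fun_linear[OF F bounded_linear_mult_right]) simp
        from cauchy_fun_add[OF Suc cauchy_fun_scale[OF this hol]]
        show ?case by (simp add: P_def distrib_right)
      qed
      from cauchy_funD(2)[OF this f] show ?thesis .
    qed
    have approx: "norm (res (2 - l) T - P m l) \<le> q ^ m * (C * MR)" if l: "l \<in> X" for l m
    proof -
      define w where "w = 2 - l"
      have w: "cmod w > 1" using w1[of l] l X(2) by (auto simp: w_def)
      then have w0: "w \<noteq> 0" by auto
      have 1: "P m l * (w *\<^sub>C 1 - T) = 1 - (1 / w) ^ m *\<^sub>C T ^ m"
      proof (induction m)
        case (Suc m)
        have "((1 / w) ^ Suc m *\<^sub>C T ^ m) * (w *\<^sub>C 1 - T) = (1 / w) ^ m *\<^sub>C T ^ m - (1 / w) ^ Suc m *\<^sub>C T ^ Suc m"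
          using w0 by (simp add: right_diff_distrib scaleC_diff_right scaleC_scaleC power_commutes)
        with Suc show ?case by (simp add: P_def w_def distrib_right)
      qed (simp add: P_def)
      have "P m l = P m l * ((w *\<^sub>C 1 - T) * res w T)" using R[OF w] by (simp add: is_res_def)
      also have "\<dots> = res w T - (1 / w) ^ m *\<^sub>C (T ^ m * res w T)"
        by (simp add: mult.assoc[symmetric] 1) (simp add: left_diff_distrib)
      finally have "res w T - P m l = (1 / w) ^ m *\<^sub>C (T ^ m * res w T)" by simp
      also have "norm \<dots> \<le> q ^ m * (C * MR)"
        unfolding norm_scaleC norm_power
        using q(1) q(3)[OF l] MR T C0 l
        by (intro mult_mono power_mono order_trans[OF norm_mult_ineq]) (auto simp: w_def)
      finally show ?thesis by (simp add: w_def)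
    qed
    have "norm (closed_integral b n (\<lambda>l. f l *\<^sub>C (res (2 - l) T * F l))) \<le> B * (q ^ m * (C * MR) * M)" for m
    proof -
      let ?D = "\<lambda>l. f l *\<^sub>C ((res (2 - l) T - P m l) * F l)"
      have cD: "continuous_on ?Y ?D" by (intro continuous_intros cf cR cP cF)
      have cPF: "continuous_on ?Y (\<lambda>l. f l *\<^sub>C (P m l * F l))" by (intro continuous_intros cf cP cF)
      have "(\<lambda>l. f l *\<^sub>C (res (2 - l) T * F l)) = (\<lambda>l. ?D l + f l *\<^sub>C (P m l * F l))"
        by (auto simp: left_diff_distrib scaleC_diff_right)
      then have "closed_integral b n (\<lambda>l. f l *\<^sub>C (res (2 - l) T * F l)) = closed_integral b n ?D"
        using closed_integral_add[OF cD cPF, of n] P0 by simp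
      moreover have "norm (?D l) \<le> q ^ m * (C * MR) * M" if l: "l \<in> X" for l
      proof -
        have "?D l = (res (2 - l) T - P m l) * (f l *\<^sub>C F l)" by simp
        also have "norm \<dots> \<le> q ^ m * (C * MR) * M"
          using approx[OF l, of m] M(2)[OF l] q(1) C0 MR(1)
          by (intro order_trans[OF norm_mult_ineq] mult_mono) auto
        finally show ?thesis .
      qed
      ultimately show ?thesis using B(2)[OF cD] piece_X chord_X by simp
    qed
    moreover have "(\<lambda>m. B * (q ^ m * (C * MR) * M)) \<longlonglongrightarrow> B * (0 * (C * MR) * M)"
      using q by (intro tendsto_intros LIMSEQ_power_zero) auto
    ultimately have "norm (closed_integral b n (\<lambda>l. f l *\<^sub>C (res (2 - l) T * F l))) \<le> B * (0 * (C * MR) * M)"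
      by (intro LIMSEQ_le_const) auto
    then show "closed_integral b n (\<lambda>l. f l *\<^sub>C (res (2 - l) T * F l)) = 0" by simp
  qed
qed

text \<open>A polynomial of degree four in \<open>R(2 - \<lambda>,T)\<close>, with coefficients that are polynomials in \<open>\<lambda>\<close>.\<close>

lemma cauchy_fun_kern_defect:
  fixes T :: "'x::complex_banach op"
  assumes T: "\<And>m. norm (T ^ m) \<le> C" and K: "\<And>w. cmod w > 1 \<Longrightarrow> norm ((w - 1) *\<^sub>C res w T) \<le> K"
  shows "cauchy_fun n (kern_defect T)"
proof -
  have pow: "cauchy_fun n (\<lambda>l. res (2 - l) T ^ j)" for j
  proof (induction j)
    case (Suc j)
    show ?case using cauchy_fun_resolvent[OF Suc T K] by simp
  qed (simp add: cauchy_fun_const)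
  let ?R = "\<lambda>l j. res (2 - l) T ^ j"
  have "cauchy_fun n (\<lambda>l. 1 *\<^sub>C ?R l 1 + (2 * (1 - l)) *\<^sub>C ?R l 2 + (- 12 * (1 - l) ^ 2) *\<^sub>C ?R l 3
      + (8 * (1 - l) ^ 3) *\<^sub>C ?R l 4)"
    by (intro cauchy_fun_add cauchy_fun_scale pow) (intro holomorphic_intros)+
  moreover have "(\<lambda>l. 1 *\<^sub>C ?R l 1 + (2 * (1 - l)) *\<^sub>C ?R l 2 + (- 12 * (1 - l) ^ 2) *\<^sub>C ?R l 3
      + (8 * (1 - l) ^ 3) *\<^sub>C ?R l 4) = kern_defect T"
  proof
    fix l :: complex
    define v where "v = 1 - l"
    have l: "1 + v = 2 - l" by (simp add: v_def)
    define W where "W = res (2 - l) T"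
    have rho: "op_rho v T = v *\<^sub>C W" by (simp add: op_rho_def l W_def)
    have "kern_defect T l = (1 - 2 *\<^sub>C v *\<^sub>C W) * (1 + 4 *\<^sub>C (v *\<^sub>C W * (1 - v *\<^sub>C W))) * W"
      by (simp only: kern_defect_def op_kern_def v_def[symmetric] rho W_def[symmetric])
    also have "\<dots> = 1 *\<^sub>C W ^ 1 + (2 * v) *\<^sub>C W ^ 2 + (- 12 * v ^ 2) *\<^sub>C W ^ 3 + (8 * v ^ 3) *\<^sub>C W ^ 4"
    proof -
      have p: "W ^ 1 = W" "W ^ 2 = W * W" "W ^ 3 = W * (W * W)" "W ^ 4 = W * (W * (W * W))"
        by (simp_all add: numeral_eq_Suc)
      have c: "(2 * v) *\<^sub>C x = 4 *\<^sub>C v *\<^sub>C x - 2 *\<^sub>C v *\<^sub>C x"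
        "(- 12 * v ^ 2) *\<^sub>C x = - (4 *\<^sub>C v *\<^sub>C v *\<^sub>C x) - 8 *\<^sub>C v *\<^sub>C v *\<^sub>C x"
        "(8 * v ^ 3) *\<^sub>C x = 8 *\<^sub>C v *\<^sub>C v *\<^sub>C v *\<^sub>C x" for x :: "'x op"
        by (simp_all add: scaleC_scaleC scaleC_diff_left[symmetric] scaleC_minus_left[symmetric]
            power2_eq_square power3_eq_cube algebra_simps)
      show ?thesis
        unfolding p c
        by (simp add: algebra_simps scaleC_diff_right scaleC_add_right scaleC_scaleC)
    qed
    finally show "1 *\<^sub>C ?R l 1 + (2 * (1 - l)) *\<^sub>C ?R l 2 + (- 12 * (1 - l) ^ 2) *\<^sub>C ?R l 3
      + (8 * (1 - l) ^ 3) *\<^sub>C ?R l 4 = kern_defect T l"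
      by (simp only: v_def W_def)
  qed
  ultimately show ?thesis by simp
qed

lemma norm_op_kern_le:
  fixes T :: "'x::complex_banach op"
  assumes K: "\<And>w. cmod w > 1 \<Longrightarrow> norm ((w - 1) *\<^sub>C res w T) \<le> K" and v: "0 < Re v"
  shows "norm (op_rho v T) \<le> K" "norm (op_kern v T) \<le> 4 * (K * (1 + K))"
proof -
  show 1: "norm (op_rho v T) \<le> K" using K[OF cmod_1_plus[OF v]] by (simp add: op_rho_def)
  then have K0: "0 \<le> K" using norm_ge_zero order_trans by blast
  have "norm (1 - op_rho v T) \<le> 1 + K"
    using norm_triangle_ineq4[of 1 "op_rho v T"] 1 norm_one_op_le[where 'a = 'x] by linarith
  then have "norm (op_rho v T * (1 - op_rho v T)) \<le> K * (1 + K)"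
    using 1 K0 by (intro order_trans[OF norm_mult_ineq] mult_mono) auto
  then show "norm (op_kern v T) \<le> 4 * (K * (1 + K))"
    by (simp add: op_kern_def norm_scaleC)
qed

lemma norm_kern_defect_le:
  fixes T :: "'x::complex_banach op"
  assumes K: "\<And>w. cmod w > 1 \<Longrightarrow> norm ((w - 1) *\<^sub>C res w T) \<le> K" and l: "0 < Re (1 - l)"
  shows "norm (kern_defect T l) \<le> (1 + 2 * K) * (1 + 4 * (K * (1 + K))) * (K / cmod (1 - l))"
proof -
  note k = norm_op_kern_le[OF K l]
  have K0: "0 \<le> K" using k(1) norm_ge_zero order_trans by blast
  have l0: "0 < cmod (1 - l)" using l by auto
  have "norm (res (2 - l) T) \<le> K / cmod (1 - l)"
    using K[OF cmod_1_plus[OF l]] l0 by (simp add: norm_scaleC field_simps norm_minus_commute)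
  moreover have "norm (1 - 2 *\<^sub>C op_rho (1 - l) T) \<le> 1 + 2 * K"
    using norm_triangle_ineq4[of 1 "2 *\<^sub>C op_rho (1 - l) T"] k(1) norm_one_op_le[where 'a = 'x]
    by (simp add: norm_scaleC)
  moreover have "norm (1 + op_kern (1 - l) T) \<le> 1 + 4 * (K * (1 + K))"
    using norm_triangle_ineq[of 1 "op_kern (1 - l) T"] k(2) norm_one_op_le[where 'a = 'x] by linarith
  ultimately show ?thesis
    unfolding kern_defect_def using K0
    by (intro order_trans[OF norm_mult_ineq] mult_mono) auto
qed

text \<open>Replacing the resolvent by the kernel changes the truncated integral only by an integral over the
  chord, which is short and on which the resolvent at \<open>2 - \<lambda>\<close> is of order \<open>1/|1 - \<lambda>|\<close>.\<close>

lemma trunc_integral_kern_defect: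
  fixes T A B :: "'x::complex_banach op"
  assumes T: "\<And>m. norm (T ^ m) \<le> C" and K: "\<And>w. cmod w > 1 \<Longrightarrow> norm ((w - 1) *\<^sub>C res w T) \<le> K"
    and f: "f holomorphic_on stolz_domain g" and s: "s > 0"
    and fc: "\<And>l. l \<in> stolz_domain g \<Longrightarrow> cmod (f l) \<le> c * cmod (1 - l) powr s"
  shows "norm (trunc_integral b n (\<lambda>l. f l *\<^sub>C (A * kern_defect T l * B)))
    \<le> c * (norm A * norm B) * ((1 + 2 * K) * (1 + 4 * (K * (1 + K))) * (2 * K / (cos b)\<^sup>2) * (1 / 2 ^ n) powr s)"
proof -
  note sb = sin_bounds[OF b(1) bpi]
  define \<delta> where "\<delta> = (1 / 2 ^ n :: real)"
  have \<delta>: "0 < \<delta>" by (simp add: \<delta>_def)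
  define KG where "KG = (1 + 2 * K) * (1 + 4 * (K * (1 + K)))"
  have K0: "0 \<le> K"
    using K[of 2] norm_ge_zero order_trans by (metis norm_numeral one_less_numeral_iff semiring_norm(76))
  have KG: "0 \<le> KG" using K0 by (simp add: KG_def)
  have "cauchy_fun n (\<lambda>l. A * kern_defect T l)"
    by (rule cauchy_fun_linear[OF cauchy_fun_kern_defect[OF T K] bounded_linear_mult_right]) auto
  from cauchy_fun_linear[OF this bounded_linear_mult_left, of B]
  have cf: "cauchy_fun n (\<lambda>l. A * kern_defect T l * B)" by simp
  have 0: "trunc_integral b n (\<lambda>l. f l *\<^sub>C (A * kern_defect T l * B))
      = integral {0..1} (\<lambda>t. chord_vec b n *\<^sub>C (f (chord b n t) *\<^sub>C (A * kern_defect T (chord b n t) * B)))"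
    using cauchy_funD(2)[OF cf f] by (simp add: closed_integral_def)
  have c0: "0 \<le> c"
  proof -
    have "0 \<le> c * cmod (1 - 0) powr s"
      using fc[OF zero_in_stolz_domain] sin_bounds[of g] b norm_ge_zero order_trans
      by (metis order_less_trans)
    then show ?thesis by simp
  qed
  define M where "M = c * (norm A * norm B) * (KG * (2 * K / (cos b)\<^sup>2) * \<delta> powr s)"
  have int: "(\<lambda>t. chord_vec b n *\<^sub>C (f (chord b n t) *\<^sub>C (A * kern_defect T (chord b n t) * B))) integrable_on {0..1}"
    by (rule integrable_piece(2)) (intro continuous_intros holomorphic_on_imp_continuous_on[OF f] cauchy_funD(1)[OF cf])
  have "norm (chord_vec b n *\<^sub>C (f (chord b n t) *\<^sub>C (A * kern_defect T (chord b n t) * B))) \<le> M" if t: "t \<in> {0..1}" for t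
  proof -
    define l where "l = chord b n t"
    have lY: "l \<in> stolz_domain g" unfolding l_def by (rule chord_in_domain[OF t])
    have Rel: "Re (1 - l) = \<delta> * (cos b)\<^sup>2"
      by (simp add: l_def chord_eq \<delta>_def power2_eq_square)
    have Re0: "0 < Re (1 - l)" unfolding Rel using \<delta> sb by simp
    have low: "\<delta> * (cos b)\<^sup>2 \<le> cmod (1 - l)" using complex_Re_le_cmod[of "1 - l"] Rel by simp
    have up: "cmod (1 - l) \<le> \<delta>"
    proof -
      have "1 - l = of_real (\<delta> * cos b) * (of_real (cos b) + \<i> * of_real ((2 * t - 1) * sin b))"
        by (simp add: l_def chord_eq \<delta>_def)
      also have "cmod \<dots> \<le> \<delta> * 1"
      proof -
        have "(cmod (of_real (cos b) + \<i> * of_real ((2 * t - 1) * sin b)))\<^sup>2 = (cos b)\<^sup>2 + (2 * t - 1)\<^sup>2 * (sin b)\<^sup>2"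
          unfolding cmod_power2 by (simp add: power_mult_distrib)
        also have "\<dots> \<le> (cos b)\<^sup>2 + 1 * (sin b)\<^sup>2"
          using t by (intro add_left_mono mult_right_mono) (auto simp: abs_square_le_1 abs_le_iff)
        also have "\<dots> = 1\<^sup>2" by simp
        finally have "cmod (of_real (cos b) + \<i> * of_real ((2 * t - 1) * sin b)) \<le> 1"
          by (rule power2_le_imp_le) simp
        then have "cos b * cmod (of_real (cos b) + \<i> * of_real ((2 * t - 1) * sin b)) \<le> 1 * 1"
          using sb by (intro mult_mono) auto
        then show ?thesis using \<delta> sb unfolding norm_mult norm_of_real
          by (simp add: mult.assoc)
      qed
      finally show ?thesis by simp
    qed
    have pos: "0 < cmod (1 - l)" using Re0 by auto
    have vec: "cmod (chord_vec b n) \<le> 2 * \<delta>"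
    proof -
      have "cmod (chord_vec b n) = \<delta> * (cos b * (2 * sin b))"
        using sb by (simp add: chord_eq \<delta>_def norm_mult norm_divide norm_power)
      also have "\<dots> \<le> \<delta> * (1 * (2 * 1))"
        using sb \<delta> by (intro mult_left_mono mult_mono) auto
      finally show ?thesis by simp
    qed
    have kd: "norm (kern_defect T l) \<le> KG * (K / (\<delta> * (cos b)\<^sup>2))"
    proof -
      have "norm (kern_defect T l) \<le> KG * (K / cmod (1 - l))"
        unfolding KG_def by (rule norm_kern_defect_le[OF K Re0])
      also have "\<dots> \<le> KG * (K / (\<delta> * (cos b)\<^sup>2))"
        using KG K0 low \<delta> sb pos by (intro mult_left_mono divide_left_mono mult_pos_pos) auto
      finally show ?thesis .
    qed
    have fl: "cmod (f l) \<le> c * \<delta> powr s"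
      using fc[OF lY] up c0 s pos by (meson less_imp_le mult_left_mono norm_ge_zero order_trans powr_mono2)
    have "norm (chord_vec b n *\<^sub>C (f l *\<^sub>C (A * kern_defect T l * B)))
        \<le> (2 * \<delta>) * ((c * \<delta> powr s) * (norm A * (KG * (K / (\<delta> * (cos b)\<^sup>2))) * norm B))"
      unfolding norm_scaleC using \<delta> c0 KG K0
      by (intro mult_mono vec fl order_trans[OF norm_mult_ineq] kd) auto
    also have "\<dots> = M" using \<delta> by (simp add: M_def)
    finally show ?thesis by (simp add: l_def)
  qed
  from Henstock_Kurzweil_Integration.integral_norm_bound_integral[OF int integrable_const_ivl this]
  show ?thesis unfolding 0 by (simp add: M_def KG_def \<delta>_def)
qed

end

section \<open>Iterated contour integrals\<close>

lemma trunc_integral_cong: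
  assumes "0 < b" "b < pi / 2" "\<And>l. l \<in> stolz_curve b \<Longrightarrow> F l = G l"
  shows "trunc_integral b n F = trunc_integral b n G"
  unfolding trunc_integral_def
proof (intro sum.cong refl Henstock_Kurzweil_Integration.integral_cong)
  fix p t assume "t \<in> {0..1::real}"
  then show "wt b n p t *\<^sub>C F (piece b n p t) = wt b n p t *\<^sub>C G (piece b n p t)"
    using assms(3)[OF piece_in_stolz_curve[OF assms(1,2)], of t n p] by simp
qed

lemma trunc_integrable:
  fixes F :: "complex \<Rightarrow> 'b::complex_banach"
  assumes "0 < b" "b < pi / 2" "continuous_on (stolz_curve b) F"
  shows "(\<lambda>t. wt b n p t *\<^sub>C F (piece b n p t)) integrable_on {0..1}"
  by (intro integrable_continuous_real continuous_intros continuous_on_wt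
      continuous_on_compose2[OF assms(3)] continuous_on_piece)
    (auto intro: piece_in_stolz_curve assms)

lemma trunc_integral_diff:
  assumes "0 < b" "b < pi / 2" "continuous_on (stolz_curve b) F" "continuous_on (stolz_curve b) G"
  shows "trunc_integral b n (\<lambda>l. F l - G l) = trunc_integral b n F - trunc_integral b n G"
  using trunc_integrable[OF assms(1,2,3)] trunc_integrable[OF assms(1,2,4)]
  by (simp add: trunc_integral_def scaleC_diff_right Henstock_Kurzweil_Integration.integral_diff sum_subtractf)

lemma trunc_integral_linear:
  assumes "0 < b" "b < pi / 2" "continuous_on (stolz_curve b) F"
    and h: "bounded_linear h" "\<And>c x. h (c *\<^sub>C x) = c *\<^sub>C h x"
  shows "trunc_integral b n (\<lambda>l. h (F l)) = h (trunc_integral b n F)"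
proof -
  note lin = bounded_linear.linear[OF h(1)]
  have "integral {0..1} (\<lambda>t. wt b n p t *\<^sub>C h (F (piece b n p t)))
      = h (integral {0..1} (\<lambda>t. wt b n p t *\<^sub>C F (piece b n p t)))" for p
    using integral_linear[OF trunc_integrable[OF assms(1-3)] h(1)] by (simp add: o_def h(2))
  then show ?thesis by (simp only: trunc_integral_def linear_sum[OF lin])
qed

lemma trunc_integral_sum:
  assumes "0 < b" "b < pi / 2" "\<And>j. j \<in> J \<Longrightarrow> continuous_on (stolz_curve b) (F j)"
  shows "trunc_integral b n (\<lambda>l. \<Sum>j\<in>J. F j l) = (\<Sum>j\<in>J. trunc_integral b n (F j))"
proof (cases "finite J")
  case True
  have "integral {0..1} (\<lambda>t. \<Sum>j\<in>J. wt b n p t *\<^sub>C F j (piece b n p t))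
      = (\<Sum>j\<in>J. integral {0..1} (\<lambda>t. wt b n p t *\<^sub>C F j (piece b n p t)))" for p
    by (intro Henstock_Kurzweil_Integration.integral_sum True trunc_integrable assms)
  then show ?thesis
    unfolding trunc_integral_def scaleC_sum_right by (simp only: sum.swap[of _ J])
qed (simp add: trunc_integral_def)

definition upd :: "complex ^ 'd::finite \<Rightarrow> 'd \<Rightarrow> complex \<Rightarrow> complex ^ 'd"
  where "upd z i w = (\<chi> j. if j = i then w else z $ j)"

lemma upd_nth [simp]: "upd z i w $ j = (if j = i then w else z $ j)"
  by (simp add: upd_def)

lemma upd_twist: "i \<noteq> j \<Longrightarrow> upd (upd z i v) j w = upd (upd z j w) i v"
  by (simp add: vec_eq_iff)

lemma continuous_on_upd [continuous_intros]:
  assumes "continuous_on S f" "continuous_on S h"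
  shows "continuous_on S (\<lambda>x. upd (f x) i (h x))"
  unfolding upd_def
proof (rule continuous_on_vec_lambda)
  show "continuous_on S (\<lambda>x. if j = i then h x else f x $ j)" for j
    using assms by (cases "j = i") (auto intro: continuous_intros)
qed

text \<open>The truncations of the iterated contour integral, with the same \<open>n\<close> in all variables.\<close>

primrec trunc_iterated :: "('d \<Rightarrow> real) \<Rightarrow> 'd::finite list \<Rightarrow> nat \<Rightarrow> (complex ^ 'd \<Rightarrow> 'b::complex_banach) \<Rightarrow> complex ^ 'd \<Rightarrow> 'b"
  where
    "trunc_iterated b [] n F z = F z"
  | "trunc_iterated b (i # is) n F z = trunc_integral (b i) n (\<lambda>w. trunc_iterated b is n F (upd z i w))"

lemma trunc_iterated_append:
  "trunc_iterated b (xs @ ys) n F z = trunc_iterated b xs n (trunc_iterated b ys n F) z"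
  by (induction xs arbitrary: z) auto

lemma iterated_Cons_upd:
  "iterated_contour_integral (i # is) g F z
    = banach_contour_integral (g i) (\<lambda>w. iterated_contour_integral is g F (upd z i w))"
  by (simp add: upd_def)

locale contours =
  fixes b s :: "'d::finite \<Rightarrow> real"
  assumes b: "\<And>i. 0 < b i" "\<And>i. b i < pi / 2" and s: "\<And>i. 0 < s i"
begin

text \<open>The variables outside \<open>\<Lambda>\<close> are set to \<open>0\<close>, as in the definition of the calculus.\<close>

definition curves :: "'d set \<Rightarrow> (complex ^ 'd) set"
  where "curves \<Lambda> = {z. (\<forall>i\<in>\<Lambda>. z $ i \<in> stolz_curve (b i)) \<and> (\<forall>i. i \<notin> \<Lambda> \<longrightarrow> z $ i = 0)}"

text \<open>The singularity of the integrands: a decay \<open>|1 - \<lambda>\<^sub>i|\<^bsup>s\<^sub>i\<^esup>\<close> of \<open>f\<close> times the size \<open>1/|1 - \<lambda>\<^sub>i|\<close> of a resolvent. It is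
  integrable in each variable.\<close>

definition wd :: "'d set \<Rightarrow> complex ^ 'd \<Rightarrow> real"
  where "wd \<Lambda> z = (\<Prod>i\<in>\<Lambda>. cmod (1 - z $ i) powr (s i - 1))"

definition dominated :: "'d set \<Rightarrow> real \<Rightarrow> (complex ^ 'd \<Rightarrow> 'b::complex_banach) \<Rightarrow> bool"
  where "dominated \<Lambda> c F \<longleftrightarrow> continuous_on (curves \<Lambda>) F \<and> (\<forall>z\<in>curves \<Lambda>. norm (F z) \<le> c * wd \<Lambda> z)"

lemma upd_in_curves:
  "z \<in> curves \<Lambda> \<Longrightarrow> w \<in> stolz_curve (b i) \<Longrightarrow> upd z i w \<in> curves (insert i \<Lambda>)"
  by (auto simp: curves_def)

lemma wd_insert:
  assumes "i \<notin> \<Lambda>"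
  shows "wd (insert i \<Lambda>) (upd z i w) = cmod (1 - w) powr (s i - 1) * wd \<Lambda> z"
proof -
  have "(\<Prod>j\<in>\<Lambda>. cmod (1 - upd z i w $ j) powr (s j - 1)) = wd \<Lambda> z"
    unfolding wd_def using assms by (intro prod.cong) auto
  then show ?thesis using assms by (simp add: wd_def)
qed

lemma one_not_in_stolz_curve: "1 \<notin> stolz_curve (b i)"
  using stolz_curve_re(1)[OF _ b, of 1 i] by auto

lemma wd_pos: "z \<in> curves \<Lambda> \<Longrightarrow> 0 < wd \<Lambda> z"
  unfolding wd_def
proof (rule prod_pos)
  fix i assume "z \<in> curves \<Lambda>" "i \<in> \<Lambda>"
  then have "z $ i \<noteq> 1" using one_not_in_stolz_curve[of i] by (auto simp: curves_def)
  then show "0 < cmod (1 - z $ i) powr (s i - 1)" by simp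
qed

lemma continuous_on_wd: "continuous_on (curves \<Lambda>) (wd \<Lambda>)"
  unfolding wd_def[abs_def]
proof (intro continuous_intros ballI)
  fix i z assume "i \<in> \<Lambda>" "z \<in> curves \<Lambda>"
  then show "cmod (1 - z $ i) \<noteq> 0" using one_not_in_stolz_curve[of i] by (auto simp: curves_def)
qed

lemma section_continuous:
  assumes "continuous_on (curves (insert i \<Lambda>)) F" "z \<in> curves \<Lambda>"
  shows "continuous_on (stolz_curve (b i)) (\<lambda>w. F (upd z i w))"
  by (rule continuous_on_compose2[OF assms(1)]) (auto intro!: continuous_intros upd_in_curves assms(2))

lemma section_dominated:
  assumes "dominated (insert i \<Lambda>) c F" "i \<notin> \<Lambda>" "z \<in> curves \<Lambda>" "w \<in> stolz_curve (b i)"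
  shows "norm (F (upd z i w)) \<le> c * wd \<Lambda> z * cmod (1 - w) powr (s i - 1)"
  using assms(1) upd_in_curves[OF assms(3,4)] unfolding dominated_def
  by (auto simp: wd_insert[OF assms(2)] mult_ac)

lemma continuous_on_trunc:
  assumes F: "continuous_on (curves (insert i \<Lambda>)) F"
  shows "continuous_on (curves \<Lambda>) (\<lambda>z. trunc_integral (b i) n (\<lambda>w. F (upd z i w)))"
  unfolding trunc_integral_def
proof (rule continuous_on_sum)
  fix p
  have "continuous_on (curves \<Lambda> \<times> cbox 0 1) (\<lambda>(z, t). wt (b i) n p t *\<^sub>C F (upd z i (piece (b i) n p t)))"
    unfolding split_def
  proof (intro continuous_intros continuous_on_compose2[OF F]
      continuous_on_compose2[OF continuous_on_wt] continuous_on_compose2[OF continuous_on_piece])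
    show "(\<lambda>x. upd (fst x) i (piece (b i) n p (snd x))) ` (curves \<Lambda> \<times> cbox 0 1) \<subseteq> curves (insert i \<Lambda>)"
      by (auto intro!: upd_in_curves piece_in_stolz_curve b)
  qed auto
  from integral_continuous_on_param[OF this]
  show "continuous_on (curves \<Lambda>) (\<lambda>z. integral {0..1} (\<lambda>t. wt (b i) n p t *\<^sub>C F (upd z i (piece (b i) n p t))))"
    by simp
qed

lemma continuous_on_trunc_iterated:
  "continuous_on (curves (set is \<union> \<Lambda>)) F \<Longrightarrow> continuous_on (curves \<Lambda>) (trunc_iterated b is n F)"
proof (induction "is" arbitrary: \<Lambda>)
  case (Cons i "is")
  have "continuous_on (curves (set is \<union> insert i \<Lambda>)) F" using Cons.prems by simp
  from continuous_on_trunc[OF Cons.IH[OF this]] show ?case by simp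
qed simp

text \<open>Constants from \<open>contour_vs_trunc_integral\<close>: \<open>\<kappa>\<close> bounds an integral of the singularity in one variable, and
  \<open>\<eta>\<close> the part near \<open>1\<close> that is cut off.\<close>

definition \<kappa> :: "'d \<Rightarrow> real"
  where "\<kappa> i = 2 / s i + 2 * pi / (1 - sin (b i)) * 2 powr s i"

definition \<eta> :: "'d \<Rightarrow> nat \<Rightarrow> real"
  where "\<eta> i n = 2 * (1 / 2 ^ n) powr s i / s i"

lemma half_power_tendsto: "0 < r \<Longrightarrow> (\<lambda>n. (1 / 2 ^ n :: real) powr r) \<longlonglongrightarrow> 0"
proof -
  assume r: "0 < r"
  have "(\<lambda>n. (1 / 2 :: real) ^ n) \<longlonglongrightarrow> 0" by (intro LIMSEQ_power_zero) simp
  then have "(\<lambda>n. 1 / 2 ^ n :: real) \<longlonglongrightarrow> 0" by (simp add: power_one_over)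
  then show ?thesis by (rule tendsto_zero_powrI[OF _ tendsto_const _ r]) auto
qed

lemma \<eta>_tendsto: "\<eta> i \<longlonglongrightarrow> 0"
proof -
  have "(\<lambda>n. 2 * (1 / 2 ^ n) powr s i / s i) \<longlonglongrightarrow> 2 * 0 / s i"
    using s[of i] by (intro tendsto_intros half_power_tendsto) auto
  then show ?thesis by (simp add: \<eta>_def[abs_def])
qed

lemma dominated_trunc:
  assumes "dominated (insert i \<Lambda>) c F" "i \<notin> \<Lambda>"
  shows "dominated \<Lambda> (c * \<kappa> i) (\<lambda>z. trunc_integral (b i) n (\<lambda>w. F (upd z i w)))"
  unfolding dominated_def
proof (intro conjI ballI)
  have F: "continuous_on (curves (insert i \<Lambda>)) F" using assms(1) by (simp add: dominated_def)
  show "continuous_on (curves \<Lambda>) (\<lambda>z. trunc_integral (b i) n (\<lambda>w. F (upd z i w)))"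
    by (rule continuous_on_trunc[OF F])
  fix z assume z: "z \<in> curves \<Lambda>"
  show "norm (trunc_integral (b i) n (\<lambda>w. F (upd z i w))) \<le> c * \<kappa> i * wd \<Lambda> z"
    using contour_vs_trunc_integral(2)[OF b section_continuous[OF F z] section_dominated[OF assms z] s[of i], of n]
    by (simp add: \<kappa>_def mult_ac)
qed

lemma full_vs_trunc:
  assumes "dominated (insert i \<Lambda>) c F" "i \<notin> \<Lambda>" "z \<in> curves \<Lambda>"
  shows "norm (banach_contour_integral (stolz_boundary (b i)) (\<lambda>w. F (upd z i w))
    - trunc_integral (b i) n (\<lambda>w. F (upd z i w))) \<le> c * \<eta> i n * wd \<Lambda> z"
proof -
  have F: "continuous_on (curves (insert i \<Lambda>)) F" using assms(1) by (simp add: dominated_def)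
  show ?thesis
    using contour_vs_trunc_integral(1)[OF b section_continuous[OF F assms(3)] section_dominated[OF assms] s[of i], of n]
    by (simp add: \<eta>_def mult_ac)
qed

text \<open>Continuity of the full integral in the remaining variables: divided by the weight, it is a
  uniform limit of truncated integrals.\<close>

lemma dominated_full:
  assumes F: "dominated (insert i \<Lambda>) c F" "i \<notin> \<Lambda>"
  shows "dominated \<Lambda> (c * \<kappa> i) (\<lambda>z. banach_contour_integral (stolz_boundary (b i)) (\<lambda>w. F (upd z i w)))"
    (is "dominated \<Lambda> _ ?B")
proof -
  let ?T = "\<lambda>n z. trunc_integral (b i) n (\<lambda>w. F (upd z i w))"
  have lim: "(\<lambda>n. c * \<eta> i n) \<longlonglongrightarrow> 0"
    using tendsto_mult[OF tendsto_const \<eta>_tendsto, of c i] by simp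
  have "uniform_limit (curves \<Lambda>) (\<lambda>n z. (1 / wd \<Lambda> z) *\<^sub>R ?T n z) (\<lambda>z. (1 / wd \<Lambda> z) *\<^sub>R ?B z) sequentially"
    unfolding uniform_limit_iff
  proof (intro allI impI)
    fix e :: real assume "e > 0"
    with lim have "\<forall>\<^sub>F n in sequentially. c * \<eta> i n < e" by (intro order_tendstoD(2))
    then show "\<forall>\<^sub>F n in sequentially. \<forall>z\<in>curves \<Lambda>. dist ((1 / wd \<Lambda> z) *\<^sub>R ?T n z) ((1 / wd \<Lambda> z) *\<^sub>R ?B z) < e"
    proof eventually_elim
      case (elim n)
      show ?case
      proof
        fix z assume z: "z \<in> curves \<Lambda>"
        have "dist ((1 / wd \<Lambda> z) *\<^sub>R ?T n z) ((1 / wd \<Lambda> z) *\<^sub>R ?B z) = norm (?B z - ?T n z) / wd \<Lambda> z"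
          using wd_pos[OF z] by (simp add: dist_norm scaleR_diff_right[symmetric] norm_minus_commute)
        also have "\<dots> \<le> c * \<eta> i n"
          using full_vs_trunc[OF F z, of n] wd_pos[OF z] by (simp add: divide_le_eq)
        finally show "dist ((1 / wd \<Lambda> z) *\<^sub>R ?T n z) ((1 / wd \<Lambda> z) *\<^sub>R ?B z) < e" using elim by simp
      qed
    qed
  qed
  moreover have "continuous_on (curves \<Lambda>) (\<lambda>z. (1 / wd \<Lambda> z) *\<^sub>R ?T n z)" for n
  proof (intro continuous_intros continuous_on_wd continuous_on_trunc ballI)
    show "continuous_on (curves (insert i \<Lambda>)) F" using F by (simp add: dominated_def)
    show "wd \<Lambda> z \<noteq> 0" if "z \<in> curves \<Lambda>" for z using wd_pos[OF that] by simp
  qed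
  ultimately have "continuous_on (curves \<Lambda>) (\<lambda>z. (1 / wd \<Lambda> z) *\<^sub>R ?B z)"
    by (intro uniform_limit_theorem[OF always_eventually]) auto
  then have "continuous_on (curves \<Lambda>) (\<lambda>z. wd \<Lambda> z *\<^sub>R (1 / wd \<Lambda> z) *\<^sub>R ?B z)"
    by (rule continuous_on_scaleR[OF continuous_on_wd])
  moreover have "wd \<Lambda> z *\<^sub>R (1 / wd \<Lambda> z) *\<^sub>R ?B z = ?B z" if "z \<in> curves \<Lambda>" for z
    using wd_pos[OF that] by simp
  ultimately have "continuous_on (curves \<Lambda>) ?B" by (rule continuous_on_eq)
  moreover have "norm (?B z) \<le> c * \<kappa> i * wd \<Lambda> z" if z: "z \<in> curves \<Lambda>" for z
  proof (rule LIMSEQ_le_const)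
    have "(\<lambda>n. c * \<kappa> i * wd \<Lambda> z + c * \<eta> i n * wd \<Lambda> z) \<longlonglongrightarrow> c * \<kappa> i * wd \<Lambda> z + 0 * wd \<Lambda> z"
      by (intro tendsto_intros lim)
    then show "(\<lambda>n. c * \<kappa> i * wd \<Lambda> z + c * \<eta> i n * wd \<Lambda> z) \<longlonglongrightarrow> c * \<kappa> i * wd \<Lambda> z" by simp
    have "norm (?B z) \<le> c * \<kappa> i * wd \<Lambda> z + c * \<eta> i n * wd \<Lambda> z" for n
    proof -
      have "norm (?T n z) \<le> c * \<kappa> i * wd \<Lambda> z"
        using dominated_trunc[OF F, of n] z by (simp add: dominated_def)
      then show ?thesis
        using full_vs_trunc[OF F z, of n] norm_triangle_ineq[of "?T n z" "?B z - ?T n z"] by simp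
    qed
    then show "\<exists>N. \<forall>n\<ge>N. norm (?B z) \<le> c * \<kappa> i * wd \<Lambda> z + c * \<eta> i n * wd \<Lambda> z" by blast
  qed
  ultimately show ?thesis by (simp add: dominated_def)
qed

lemma dominated_trunc_iterated:
  "distinct is \<Longrightarrow> set is \<inter> \<Lambda> = {} \<Longrightarrow> dominated (set is \<union> \<Lambda>) c F
    \<Longrightarrow> dominated \<Lambda> (c * prod_list (map \<kappa> is)) (trunc_iterated b is n F)"
proof (induction "is" arbitrary: \<Lambda>)
  case (Cons i "is")
  have "dominated (insert i \<Lambda>) (c * prod_list (map \<kappa> is)) (trunc_iterated b is n F)"
    using Cons.prems by (intro Cons.IH) auto
  from dominated_trunc[OF this, of n] Cons.prems show ?case by (simp add: mult_ac)
next
  case Nil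
  have "trunc_iterated b [] n F = F" by (rule ext) simp
  with Nil show ?case by simp
qed

text \<open>By induction over the variables: the innermost integrals are replaced by their truncations with an error
  that is dominated by the same weight, and then integrated over the outer variables.\<close>

lemma iterated_vs_trunc:
  assumes "distinct is" "set is \<inter> \<Lambda> = {}" "dominated (set is \<union> \<Lambda>) c F"
  shows "\<exists>c' e. dominated \<Lambda> c' (iterated_contour_integral is (\<lambda>i. stolz_boundary (b i)) F) \<and> e \<longlonglongrightarrow> 0 \<and>
    (\<forall>n. \<forall>z\<in>curves \<Lambda>. norm (iterated_contour_integral is (\<lambda>i. stolz_boundary (b i)) F z
      - trunc_iterated b is n F z) \<le> e n * wd \<Lambda> z)"
  using assms
proof (induction "is" arbitrary: \<Lambda>)
  case Nil
  then show ?case by (intro exI[of _ c] exI[of _ "\<lambda>n. 0"]) auto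
next
  case (Cons i "is")
  let ?I = "iterated_contour_integral is (\<lambda>i. stolz_boundary (b i)) F"
  let ?T = "\<lambda>n. trunc_iterated b is n F"
  have i: "i \<notin> \<Lambda>" using Cons.prems by auto
  have F: "continuous_on (curves (set is \<union> insert i \<Lambda>)) F" using Cons.prems by (simp add: dominated_def)
  have "\<exists>c' e. dominated (insert i \<Lambda>) c' ?I \<and> e \<longlonglongrightarrow> 0 \<and>
    (\<forall>n. \<forall>z\<in>curves (insert i \<Lambda>). norm (?I z - ?T n z) \<le> e n * wd (insert i \<Lambda>) z)"
    using Cons.prems by (intro Cons.IH) auto
  then obtain c' e where I: "dominated (insert i \<Lambda>) c' ?I" and e: "e \<longlonglongrightarrow> 0"
    and diff: "\<And>n z. z \<in> curves (insert i \<Lambda>) \<Longrightarrow> norm (?I z - ?T n z) \<le> e n * wd (insert i \<Lambda>) z" by blast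
  have Ic: "continuous_on (curves (insert i \<Lambda>)) ?I" using I by (simp add: dominated_def)
  have Tc: "continuous_on (curves (insert i \<Lambda>)) (?T n)" for n by (rule continuous_on_trunc_iterated[OF F])
  define e' where "e' n = c' * \<eta> i n + e n * \<kappa> i" for n
  have "e' \<longlonglongrightarrow> c' * 0 + 0 * \<kappa> i"
    unfolding e'_def[abs_def] by (intro tendsto_intros \<eta>_tendsto e)
  moreover have "norm (iterated_contour_integral (i # is) (\<lambda>i. stolz_boundary (b i)) F z
      - trunc_iterated b (i # is) n F z) \<le> e' n * wd \<Lambda> z" if z: "z \<in> curves \<Lambda>" for n z
  proof -
    have d: "dominated (insert i \<Lambda>) (e n) (\<lambda>z. ?I z - ?T n z)"
      using diff Ic Tc by (auto simp: dominated_def intro: continuous_intros)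
    have "norm (trunc_integral (b i) n (\<lambda>w. ?I (upd z i w)) - trunc_integral (b i) n (\<lambda>w. ?T n (upd z i w)))
        \<le> e n * \<kappa> i * wd \<Lambda> z"
      unfolding trunc_integral_diff[OF b section_continuous[OF Ic z] section_continuous[OF Tc z], symmetric]
      using dominated_trunc[OF d i, of n] z by (simp add: dominated_def)
    from norm_triangle_mono[OF full_vs_trunc[OF I i z, of n] this] show ?thesis
      unfolding iterated_Cons_upd trunc_iterated.simps e'_def distrib_right by simp
  qed
  ultimately show ?case
    using dominated_full[OF I i] unfolding iterated_Cons_upd[abs_def]
    by (intro exI[of _ "c' * \<kappa> i"] exI[of _ e']) auto
qed

lemma trunc_iterated_cong:
  "z \<in> curves \<Lambda> \<Longrightarrow> (\<And>z. z \<in> curves (set is \<union> \<Lambda>) \<Longrightarrow> F z = G z)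
    \<Longrightarrow> trunc_iterated b is n F z = trunc_iterated b is n G z"
proof (induction "is" arbitrary: z \<Lambda>)
  case (Cons i "is")
  have E: "trunc_iterated b is n F (upd z i w) = trunc_iterated b is n G (upd z i w)" if "w \<in> stolz_curve (b i)" for w
    using Cons.prems by (intro Cons.IH[OF upd_in_curves[OF Cons.prems(1) that]]) auto
  show ?case unfolding trunc_iterated.simps by (rule trunc_integral_cong[OF b E])
qed simp

lemma trunc_iterated_linear:
  assumes h: "bounded_linear h" "\<And>c x. h (c *\<^sub>C x) = c *\<^sub>C h x"
  shows "z \<in> curves \<Lambda> \<Longrightarrow> continuous_on (curves (set is \<union> \<Lambda>)) F
    \<Longrightarrow> trunc_iterated b is n (\<lambda>z. h (F z)) z = h (trunc_iterated b is n F z)"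
proof (induction "is" arbitrary: z \<Lambda>)
  case (Cons i "is")
  have F: "continuous_on (curves (set is \<union> insert i \<Lambda>)) F" using Cons.prems by simp
  have E: "trunc_iterated b is n (\<lambda>z. h (F z)) (upd z i w) = h (trunc_iterated b is n F (upd z i w))"
    if "w \<in> stolz_curve (b i)" for w
    by (rule Cons.IH[OF upd_in_curves[OF Cons.prems(1) that] F])
  have "trunc_iterated b (i # is) n (\<lambda>z. h (F z)) z
      = trunc_integral (b i) n (\<lambda>w. h (trunc_iterated b is n F (upd z i w)))"
    unfolding trunc_iterated.simps by (rule trunc_integral_cong[OF b E])
  also have "\<dots> = h (trunc_integral (b i) n (\<lambda>w. trunc_iterated b is n F (upd z i w)))"
    by (rule trunc_integral_linear[OF b section_continuous[OF continuous_on_trunc_iterated[OF F] Cons.prems(1)] h])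
  finally show ?case by simp
qed simp

lemma trunc_iterated_sum:
  assumes "\<And>j. j \<in> J \<Longrightarrow> continuous_on (curves (set is \<union> \<Lambda>)) (F j)"
  shows "z \<in> curves \<Lambda> \<Longrightarrow> trunc_iterated b is n (\<lambda>z. \<Sum>j\<in>J. F j z) z = (\<Sum>j\<in>J. trunc_iterated b is n (F j) z)"
  using assms
proof (induction "is" arbitrary: z \<Lambda>)
  case (Cons i "is")
  have F: "continuous_on (curves (set is \<union> insert i \<Lambda>)) (F j)" if "j \<in> J" for j using Cons.prems that by simp
  have E: "trunc_iterated b is n (\<lambda>z. \<Sum>j\<in>J. F j z) (upd z i w) = (\<Sum>j\<in>J. trunc_iterated b is n (F j) (upd z i w))"
    if "w \<in> stolz_curve (b i)" for w
    by (rule Cons.IH[OF upd_in_curves[OF Cons.prems(1) that] F])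
  have "trunc_iterated b (i # is) n (\<lambda>z. \<Sum>j\<in>J. F j z) z
      = trunc_integral (b i) n (\<lambda>w. \<Sum>j\<in>J. trunc_iterated b is n (F j) (upd z i w))"
    unfolding trunc_iterated.simps by (rule trunc_integral_cong[OF b E])
  also have "\<dots> = (\<Sum>j\<in>J. trunc_integral (b i) n (\<lambda>w. trunc_iterated b is n (F j) (upd z i w)))"
    by (intro trunc_integral_sum b section_continuous[OF continuous_on_trunc_iterated[OF F] Cons.prems(1)])
  finally show ?case by simp
qed simp

text \<open>Fubini for continuous functions on the unit square, for each pair of pieces.\<close>

lemma trunc_integral_swap:
  fixes F :: "(complex, 'd) vec \<Rightarrow> 'b::complex_banach"
  assumes ij: "i \<noteq> j" and z: "z \<in> curves \<Lambda>" and F: "continuous_on (curves (insert i (insert j \<Lambda>))) F"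
  shows "trunc_integral (b i) n (\<lambda>v. trunc_integral (b j) n (\<lambda>w. F (upd (upd z i v) j w)))
    = trunc_integral (b j) n (\<lambda>w. trunc_integral (b i) n (\<lambda>v. F (upd (upd z i v) j w)))"
proof -
  define h where "h p q t u = wt (b i) n p t *\<^sub>C wt (b j) n q u *\<^sub>C
    F (upd (upd z i (piece (b i) n p t)) j (piece (b j) n q u))" for p q t u
  have in_c: "upd (upd z i v) j w \<in> curves (insert i (insert j \<Lambda>))"
    if "v \<in> stolz_curve (b i)" "w \<in> stolz_curve (b j)" for v w
    using upd_in_curves[OF upd_in_curves[OF z that(1)] that(2)] by (simp add: insert_commute)
  have cont2: "continuous_on (cbox (0, 0) (1, 1)) (\<lambda>(t, u). h p q t u)" for p q
    unfolding h_def split_def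
  proof (intro continuous_intros continuous_on_compose2[OF F]
      continuous_on_compose2[OF continuous_on_wt] continuous_on_compose2[OF continuous_on_piece])
    show "(\<lambda>x. upd (upd z i (piece (b i) n p (fst x))) j (piece (b j) n q (snd x))) ` cbox (0, 0) (1, 1)
        \<subseteq> curves (insert i (insert j \<Lambda>))"
      by (auto simp: cbox_Pair_eq intro!: in_c piece_in_stolz_curve b)
  qed (auto simp: cbox_Pair_eq)
  have cont_sec: "continuous_on {0..1} (\<lambda>u. h p q t u)" "continuous_on {0..1} (\<lambda>t. h p q t u)"
    "continuous_on {0..1} (\<lambda>t. integral {0..1} (h p q t))" "continuous_on {0..1} (\<lambda>u. integral {0..1} (\<lambda>t. h p q t u))"
    if "t \<in> {0..1}" "u \<in> {0..1}" for p q t u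
  proof -
    have c: "continuous_on ({0..1} \<times> {0..1}) (\<lambda>x. h p q (fst x) (snd x))"
      using cont2[of p q] by (simp add: cbox_Pair_eq split_def)
    have "continuous_on {0..1} (\<lambda>u::real. (t, u))" "continuous_on {0..1} (\<lambda>t::real. (t, u))"
      by (intro continuous_intros)+
    note p = continuous_on_compose2[OF c this(1)] continuous_on_compose2[OF c this(2)]
    show "continuous_on {0..1} (\<lambda>u. h p q t u)" using p(1) that(1) by (simp add: image_subset_iff)
    show "continuous_on {0..1} (\<lambda>t. h p q t u)" using p(2) that(2) by (simp add: image_subset_iff)
    show "continuous_on {0..1} (\<lambda>t. integral {0..1} (h p q t))"
      using integral_continuous_on_param[of "{0..1}" 0 1 "h p q"] c by (simp add: split_def)
    have "continuous_on ({0..1} \<times> {0..1}) (\<lambda>x. h p q (snd x) (fst x))"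
    proof -
      have "continuous_on ({0..1} \<times> {0..1}) (\<lambda>x::real \<times> real. (snd x, fst x))" by (intro continuous_intros)
      moreover have "(\<lambda>x::real \<times> real. (snd x, fst x)) ` ({0..1} \<times> {0..1}) \<subseteq> {0..1} \<times> {0..1}" by auto
      ultimately show ?thesis using continuous_on_compose2[OF c] by fastforce
    qed
    then show "continuous_on {0..1} (\<lambda>u. integral {0..1} (\<lambda>t. h p q t u))"
      using integral_continuous_on_param[of "{0..1}" 0 1 "\<lambda>u t. h p q t u"] by (simp add: split_def)
  qed
  have inner1: "wt (b i) n p t *\<^sub>C trunc_integral (b j) n (\<lambda>w. F (upd (upd z i (piece (b i) n p t)) j w))
      = (\<Sum>q<2 * n + 1. integral {0..1} (h p q t))" if t: "t \<in> {0..1}" for p t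
  proof -
    have "z' \<in> curves (insert i \<Lambda>) \<Longrightarrow> continuous_on (stolz_curve (b j)) (\<lambda>w. F (upd z' j w))" for z'
      using section_continuous[of j "insert i \<Lambda>" F z'] F by (simp add: insert_commute)
    from this[OF upd_in_curves[OF z piece_in_stolz_curve[OF b]]] t
    have int: "(\<lambda>u. wt (b j) n q u *\<^sub>C F (upd (upd z i (piece (b i) n p t)) j (piece (b j) n q u))) integrable_on {0..1}" for q
      by (intro trunc_integrable b) auto
    show ?thesis
      unfolding trunc_integral_def scaleC_sum_right h_def
      using integral_linear[OF int bounded_linear_scaleC[of "wt (b i) n p t"]] by (simp add: o_def)
  qed
  have inner2: "wt (b j) n q u *\<^sub>C trunc_integral (b i) n (\<lambda>v. F (upd (upd z i v) j (piece (b j) n q u)))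
      = (\<Sum>p<2 * n + 1. integral {0..1} (\<lambda>t. h p q t u))" if u: "u \<in> {0..1}" for q u
  proof -
    have "continuous_on (stolz_curve (b i)) (\<lambda>v. F (upd (upd z i v) j (piece (b j) n q u)))"
      using u by (intro continuous_on_compose2[OF F] continuous_intros)
        (auto intro!: in_c piece_in_stolz_curve b)
    then have int: "(\<lambda>t. wt (b i) n p t *\<^sub>C F (upd (upd z i (piece (b i) n p t)) j (piece (b j) n q u))) integrable_on {0..1}" for p
      by (rule trunc_integrable[OF b])
    have "wt (b j) n q u *\<^sub>C (wt (b i) n p t *\<^sub>C x) = wt (b i) n p t *\<^sub>C wt (b j) n q u *\<^sub>C x" for p t and x :: 'b
      by (simp add: scaleC_scaleC mult.commute)
    then show ?thesis
      unfolding trunc_integral_def scaleC_sum_right h_def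
      using integral_linear[OF int bounded_linear_scaleC[of "wt (b j) n q u"]] by (simp add: o_def)
  qed
  have "trunc_integral (b i) n (\<lambda>v. trunc_integral (b j) n (\<lambda>w. F (upd (upd z i v) j w)))
      = (\<Sum>p<2 * n + 1. integral {0..1} (\<lambda>t. \<Sum>q<2 * n + 1. integral {0..1} (h p q t)))"
    unfolding trunc_integral_def[of "b i"]
    by (intro sum.cong refl Henstock_Kurzweil_Integration.integral_cong inner1)
  also have "\<dots> = (\<Sum>p<2 * n + 1. \<Sum>q<2 * n + 1. integral {0..1} (\<lambda>t. integral {0..1} (h p q t)))"
    using cont_sec(3)[of 0 0]
    by (intro sum.cong refl Henstock_Kurzweil_Integration.integral_sum integrable_continuous_real) auto
  also have "\<dots> = (\<Sum>p<2 * n + 1. \<Sum>q<2 * n + 1. integral {0..1} (\<lambda>u. integral {0..1} (\<lambda>t. h p q t u)))"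
    using integral_swap_continuous[OF cont2] by simp
  also have "\<dots> = (\<Sum>q<2 * n + 1. \<Sum>p<2 * n + 1. integral {0..1} (\<lambda>u. integral {0..1} (\<lambda>t. h p q t u)))"
    by (rule sum.swap)
  also have "\<dots> = (\<Sum>q<2 * n + 1. integral {0..1} (\<lambda>u. \<Sum>p<2 * n + 1. integral {0..1} (\<lambda>t. h p q t u)))"
    using cont_sec(4)[of 0 0]
    by (intro sum.cong refl Henstock_Kurzweil_Integration.integral_sum[symmetric] integrable_continuous_real) auto
  also have "\<dots> = trunc_integral (b j) n (\<lambda>w. trunc_integral (b i) n (\<lambda>v. F (upd (upd z i v) j w)))"
    unfolding trunc_integral_def[of "b j"]
    by (intro sum.cong refl Henstock_Kurzweil_Integration.integral_cong inner2[symmetric])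
  finally show ?thesis .
qed

text \<open>As the truncated integrals can be interchanged, any of them can be carried out first. The Cauchy theorem will be
  applied in a single variable, with the others fixed.\<close>

lemma trunc_iterated_inner:
  "i \<notin> set is \<Longrightarrow> z \<in> curves \<Lambda> \<Longrightarrow> continuous_on (curves (insert i (set is \<union> \<Lambda>))) F
    \<Longrightarrow> trunc_iterated b (i # is) n F z = trunc_iterated b is n (\<lambda>z. trunc_integral (b i) n (\<lambda>w. F (upd z i w))) z"
proof (induction "is" arbitrary: z \<Lambda>)
  case (Cons j js)
  have ij: "i \<noteq> j" using Cons.prems by auto
  have F: "continuous_on (curves (set js \<union> insert i (insert j \<Lambda>))) F"
    using Cons.prems(3) by (simp add: insert_commute)
  let ?G = "trunc_iterated b js n F"
  have "trunc_iterated b (i # j # js) n F z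
      = trunc_integral (b i) n (\<lambda>v. trunc_integral (b j) n (\<lambda>w. ?G (upd (upd z i v) j w)))" by simp
  also have "\<dots> = trunc_integral (b j) n (\<lambda>w. trunc_integral (b i) n (\<lambda>v. ?G (upd (upd z i v) j w)))"
    by (rule trunc_integral_swap[OF ij Cons.prems(2) continuous_on_trunc_iterated[OF F]])
  also have "\<dots> = trunc_integral (b j) n (\<lambda>w. trunc_iterated b (i # js) n F (upd z j w))"
    by (simp add: upd_twist[OF ij])
  also have "\<dots> = trunc_integral (b j) n (\<lambda>w. trunc_iterated b js n (\<lambda>z. trunc_integral (b i) n (\<lambda>w. F (upd z i w))) (upd z j w))"
  proof (rule trunc_integral_cong[OF b])
    fix w assume w: "w \<in> stolz_curve (b j)"
    show "trunc_iterated b (i # js) n F (upd z j w)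
      = trunc_iterated b js n (\<lambda>z. trunc_integral (b i) n (\<lambda>w. F (upd z i w))) (upd z j w)"
      using Cons.prems by (intro Cons.IH[OF _ upd_in_curves[OF Cons.prems(2) w]]) (auto simp: insert_commute)
  qed
  finally show ?case by simp
qed simp

lemma trunc_iterated_pick:
  assumes "i \<notin> set ys" "z \<in> curves \<Lambda>" "continuous_on (curves (insert i (set xs \<union> set ys \<union> \<Lambda>))) F"
  shows "trunc_iterated b (xs @ i # ys) n F z
    = trunc_iterated b (xs @ ys) n (\<lambda>z. trunc_integral (b i) n (\<lambda>w. F (upd z i w))) z"
  unfolding trunc_iterated_append
proof (rule trunc_iterated_cong[OF assms(2)])
  fix z assume z: "z \<in> curves (set xs \<union> \<Lambda>)"
  show "trunc_iterated b (i # ys) n F z = trunc_iterated b ys n (\<lambda>z. trunc_integral (b i) n (\<lambda>w. F (upd z i w))) z"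
    using assms(3) by (intro trunc_iterated_inner[OF assms(1) z]) (simp add: Un_ac)
qed

text \<open>The iterated integral is an average, over the positions \<open>t\<close> inside the pieces, of nested sums over
  the pieces.\<close>

lemma trunc_iterated_upd:
  "i \<notin> set is \<Longrightarrow> trunc_iterated b is n F (upd z i w) = trunc_iterated b is n (\<lambda>z. F (upd z i w)) z"
proof (induction "is" arbitrary: z)
  case (Cons j "is")
  then have ij: "i \<noteq> j" and i: "i \<notin> set is" by auto
  have "trunc_iterated b is n F (upd (upd z i w) j v) = trunc_iterated b is n (\<lambda>z. F (upd z i w)) (upd z j v)" for v
    unfolding upd_twist[OF ij] by (rule Cons.IH[OF i])
  then show ?case by simp
qed simp

lemma trunc_iterated_norm_le:
  assumes "distinct is" "z \<in> curves \<Lambda>" "continuous_on (curves (set is \<union> \<Lambda>)) F"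
    and "\<And>t. (\<And>i. t i \<in> {0..1}) \<Longrightarrow> norm (nsum is (2 * n + 1) (\<lambda>P. prod_list (map (\<lambda>i. wt (b i) n (P i) (t i)) is) *\<^sub>C
      F (\<chi> j. if j \<in> set is then piece (b j) n (P j) (t j) else z $ j)) P) \<le> B"
  shows "norm (trunc_iterated b is n F z) \<le> B"
  using assms
proof (induction "is" arbitrary: F \<Lambda>)
  case Nil
  from Nil.prems(4)[of "\<lambda>_. 0"] show ?case by (simp add: vec_lambda_eta)
next
  case (Cons i "is")
  let ?N = "2 * n + 1"
  have i: "i \<notin> set is" and d: "distinct is" using Cons.prems(1) by auto
  have F: "continuous_on (curves (set is \<union> insert i \<Lambda>)) F" using Cons.prems(3) by simp
  have F': "continuous_on (curves (insert i (set is \<union> \<Lambda>))) F" using Cons.prems(3) by simp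
  have G: "continuous_on (stolz_curve (b i)) (\<lambda>w. trunc_iterated b is n F (upd z i w))"
    by (rule section_continuous[OF continuous_on_trunc_iterated[OF F] Cons.prems(2)])
  have int: "(\<lambda>t. wt (b i) n p t *\<^sub>C trunc_iterated b is n F (upd z i (piece (b i) n p t))) integrable_on {0..1}" for p
    by (rule trunc_integrable[OF b G])
  have "trunc_iterated b (i # is) n F z
      = integral {0..1} (\<lambda>t. \<Sum>p<?N. wt (b i) n p t *\<^sub>C trunc_iterated b is n F (upd z i (piece (b i) n p t)))"
    unfolding trunc_iterated.simps trunc_integral_def
    by (rule Henstock_Kurzweil_Integration.integral_sum[symmetric]) (use int in auto)
  also have "norm \<dots> \<le> integral {0..1} (\<lambda>t::real. B)"
  proof (rule Henstock_Kurzweil_Integration.integral_norm_bound_integral)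
    show "(\<lambda>t. \<Sum>p<?N. wt (b i) n p t *\<^sub>C trunc_iterated b is n F (upd z i (piece (b i) n p t))) integrable_on {0..1}"
      by (intro integrable_sum int) simp
    fix t0 :: real assume t0: "t0 \<in> {0..1}"
    define F2 where "F2 z' = (\<Sum>p<?N. wt (b i) n p t0 *\<^sub>C F (upd z' i (piece (b i) n p t0)))" for z'
    have sec: "continuous_on (curves (set is \<union> \<Lambda>)) (\<lambda>z'. F (upd z' i (piece (b i) n p t0)))" for p
      using t0 by (intro continuous_on_compose2[OF F'] continuous_intros)
        (auto intro!: upd_in_curves piece_in_stolz_curve b)
    have F2: "continuous_on (curves (set is \<union> \<Lambda>)) F2"
      unfolding F2_def by (intro continuous_intros sec)
    have "(\<Sum>p<?N. wt (b i) n p t0 *\<^sub>C trunc_iterated b is n F (upd z i (piece (b i) n p t0)))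
        = (\<Sum>p<?N. trunc_iterated b is n (\<lambda>z'. wt (b i) n p t0 *\<^sub>C F (upd z' i (piece (b i) n p t0))) z)"
    proof (intro sum.cong refl)
      fix p
      have "trunc_iterated b is n (\<lambda>z'. wt (b i) n p t0 *\<^sub>C F (upd z' i (piece (b i) n p t0))) z
          = wt (b i) n p t0 *\<^sub>C trunc_iterated b is n (\<lambda>z'. F (upd z' i (piece (b i) n p t0))) z"
        by (rule trunc_iterated_linear[OF bounded_linear_scaleC _ Cons.prems(2) sec])
          (simp add: scaleC_scaleC mult.commute)
      then show "wt (b i) n p t0 *\<^sub>C trunc_iterated b is n F (upd z i (piece (b i) n p t0))
        = trunc_iterated b is n (\<lambda>z'. wt (b i) n p t0 *\<^sub>C F (upd z' i (piece (b i) n p t0))) z"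
        by (simp add: trunc_iterated_upd[OF i])
    qed
    also have "\<dots> = trunc_iterated b is n F2 z"
      unfolding F2_def[abs_def]
      by (rule trunc_iterated_sum[OF _ Cons.prems(2), symmetric]) (intro continuous_intros sec)
    also have "norm \<dots> \<le> B"
    proof (rule Cons.IH[OF d Cons.prems(2) F2])
      fix t :: "'d \<Rightarrow> real" assume t: "\<And>i. t i \<in> {0..1}"
      let ?t = "t(i := t0)"
      define H where "H P = prod_list (map (\<lambda>i. wt (b i) n (P i) (?t i)) (i # is)) *\<^sub>C
          F (\<chi> j. if j \<in> set (i # is) then piece (b j) n (P j) (?t j) else z $ j)" for P
      have "nsum (i # is) ?N H P = nsum is ?N (\<lambda>P. \<Sum>p<?N. H (P(i := p))) P"
        by (simp only: nsum.simps nsum_upd[OF i] nsum_sum)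
      also have "\<dots> = nsum is ?N (\<lambda>P. prod_list (map (\<lambda>i. wt (b i) n (P i) (t i)) is) *\<^sub>C
          F2 (\<chi> j. if j \<in> set is then piece (b j) n (P j) (t j) else z $ j)) P"
      proof -
        have "H (P(i := p)) = prod_list (map (\<lambda>i. wt (b i) n (P i) (t i)) is) *\<^sub>C wt (b i) n p t0 *\<^sub>C
            F (upd (\<chi> j. if j \<in> set is then piece (b j) n (P j) (t j) else z $ j) i (piece (b i) n p t0))" for P p
        proof -
          have 1: "map (\<lambda>j. wt (b j) n ((P(i := p)) j) (?t j)) is = map (\<lambda>i. wt (b i) n (P i) (t i)) is"
            using i by (intro map_cong) auto
          have 2: "(\<chi> j. if j \<in> set (i # is) then piece (b j) n ((P(i := p)) j) (?t j) else z $ j)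
              = upd (\<chi> j. if j \<in> set is then piece (b j) n (P j) (t j) else z $ j) i (piece (b i) n p t0)"
            using i by (auto simp: vec_eq_iff)
          show ?thesis
            unfolding H_def list.map prod_list.Cons 1 2 fun_upd_same scaleC_scaleC by (simp only: mult.commute)
        qed
        then show ?thesis by (simp only: F2_def scaleC_sum_right)
      qed
      finally have "nsum is ?N (\<lambda>P. prod_list (map (\<lambda>i. wt (b i) n (P i) (t i)) is) *\<^sub>C
          F2 (\<chi> j. if j \<in> set is then piece (b j) n (P j) (t j) else z $ j)) P = nsum (i # is) ?N H P" ..
      moreover have "norm (nsum (i # is) ?N H P) \<le> B"
        unfolding H_def[abs_def] by (rule Cons.prems(4)) (use t t0 in auto)
      ultimately show "norm (nsum is ?N (\<lambda>P. prod_list (map (\<lambda>i. wt (b i) n (P i) (t i)) is) *\<^sub>C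
          F2 (\<chi> j. if j \<in> set is then piece (b j) n (P j) (t j) else z $ j)) P) \<le> B" by simp
    qed
    finally show "norm (\<Sum>p<?N. wt (b i) n p t0 *\<^sub>C trunc_iterated b is n F (upd z i (piece (b i) n p t0))) \<le> B" .
  qed (rule integrable_const_ivl)
  finally show ?case by simp
qed

end

section \<open>The functional calculus estimate for one component\<close>

lemma res_commute_res:
  assumes "is_res w S (res w S)" "is_res z T (res z T)" "S * T = T * S"
  shows "res w S * res z T = res z T * res w S"
proof -
  have "res z T * S = S * res z T"
    using res_commute[OF assms(2), of S] assms(3) by simp
  then show ?thesis using res_commute[OF assms(1), of "res z T"] by simp
qed

lemma op_kern_commute:
  assumes "X * res (1 + v) T = res (1 + v) T * X"
  shows "X * op_kern v T = op_kern v T * X"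
proof -
  have 1: "X * op_rho v T = op_rho v T * X" using assms by (simp add: op_rho_def)
  have "X * (1 - op_rho v T) = (1 - op_rho v T) * X"
    by (simp add: right_diff_distrib left_diff_distrib 1)
  then have "X * (op_rho v T * (1 - op_rho v T)) = op_rho v T * (1 - op_rho v T) * X"
    by (metis 1 mult.assoc)
  then show ?thesis by (simp add: op_kern_def)
qed

lemma norm_prod_list_op_le:
  fixes B :: "'i \<Rightarrow> 'x::complex_normed_vector op"
  assumes "\<And>i. i \<in> set is \<Longrightarrow> norm (B i) \<le> \<beta> i"
  shows "norm (prod_list (map B is)) \<le> prod_list (map \<beta> is)"
  using assms
proof (induction "is")
  case (Cons i "is")
  have "0 \<le> \<beta> i" by (rule order_trans[OF norm_ge_zero Cons.prems]) simp
  then show ?case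
    using Cons by (auto intro!: order_trans[OF norm_mult_ineq] mult_mono)
qed (simp add: norm_one_op_le)

lemma prod_list_scaleC:
  fixes B :: "'i \<Rightarrow> 'x::complex_normed_vector op"
  shows "prod_list (map (\<lambda>i. c i *\<^sub>C B i) is) = prod_list (map c is) *\<^sub>C prod_list (map B is)"
  by (induction "is") (auto simp: scaleC_scaleC mult.commute)

lemma continuous_on_prod_list_op:
  fixes B :: "'i \<Rightarrow> 'a::topological_space \<Rightarrow> 'x::complex_normed_vector op"
  shows "(\<And>i. i \<in> set is \<Longrightarrow> continuous_on S (B i)) \<Longrightarrow> continuous_on S (\<lambda>z. prod_list (map (\<lambda>i. B i z) is))"
  by (induction "is") (auto intro: continuous_intros)

lemma (in commuting_operators) disc_pair_kern:
  assumes T: "\<And>n. norm (A k ^ n) \<le> C" and v: "0 < Re v"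
  shows "disc_pair (\<lambda>z. kern v (z k)) (op_kern v (A k))"
proof -
  have rho: "disc_pair (\<lambda>z. v * (1 / (1 + v - z k))) (op_rho v (A k))"
    unfolding op_rho_def by (rule disc_pair_scale[OF disc_pair_resolvent[OF T cmod_1_plus[OF v]]])
  have "disc_pair (\<lambda>z. 1 + (- 1) * (v * (1 / (1 + v - z k)))) (1 *\<^sub>C 1 + (- 1) *\<^sub>C op_rho v (A k))"
    by (rule disc_pair_add[OF disc_pair_const disc_pair_scale[OF rho]])
  then have "disc_pair (\<lambda>z. 1 - v * (1 / (1 + v - z k))) (1 - op_rho v (A k))"
    by (simp add: scaleC_minus_left)
  from disc_pair_scale[OF disc_pair_mult[OF rho this], of 4] show ?thesis
    by (simp add: kern_def op_kern_def mult.assoc)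
qed

text \<open>The data left after the dilation and the \<open>R\<close>-Ritt property have been used: the polynomial inequality for the
  tuple, and \<open>R\<close>-bounded resolvents outside Stolz domains, with constants common to all operators.\<close>

locale ritt_tuple = polynomially_bounded A C
  for A :: "'d::{finite,linorder} \<Rightarrow> 'x::complex_banach op" and C +
  fixes a g :: "'d \<Rightarrow> real" and K Cp :: real
  assumes ag: "\<And>i. 0 < a i" "\<And>i. a i < g i" "\<And>i. g i < pi / 2"
    and K1: "1 \<le> K"
    and powers: "\<And>i n. norm (A i ^ n) \<le> Cp"
    and exterior: "\<And>i l. l \<notin> closure (stolz_domain (a i)) \<Longrightarrow> is_res l (A i) (res l (A i))"
    and R_resolvent: "\<And>i. R_bdd K {(l - 1) *\<^sub>C res l (A i) | l. l \<notin> closure (stolz_domain (a i))}"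
    and disc_resolvent: "\<And>i w. cmod w > 1 \<Longrightarrow> norm ((w - 1) *\<^sub>C res w (A i)) \<le> K"
begin

text \<open>Uniform bounds for \<open>|1 - \<lambda>|\<close> times a resolvent with or without kernels, for the measures of the pieces, and for
  the sums of the scalar kernels.\<close>

definition K3 :: real where "K3 = K * (1 + 4 * (K * (1 + K)) * (4 * (K * (1 + K))))"

definition W :: real where "W = (\<Sum>i\<in>UNIV. 2 * pi / (1 - sin (g i)))"

definition H :: real where "H = (\<Sum>i\<in>UNIV. 32 / (1 - sin (g i)) + 16 / (1 - sin (g i))\<^sup>2)"

lemma g: "0 < g i" "0 < 1 - sin (g i)"
  using ag(1,2)[of i] sin_bounds[of "g i"] ag(3)[of i] by auto

lemma W_ge: "2 * pi / (1 - sin (g i)) \<le> W"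
  unfolding W_def using g by (intro member_le_sum) (auto intro: less_imp_le)

lemma H_ge: "32 / (1 - sin (g i)) + 16 / (1 - sin (g i))\<^sup>2 \<le> H"
  unfolding H_def using g(2) by (intro member_le_sum) (auto intro!: add_nonneg_nonneg divide_nonneg_pos)

lemma W_nonneg: "0 \<le> W" and H_nonneg: "0 \<le> H"
proof -
  have "0 \<le> 2 * pi / (1 - sin (g undefined))" using g(2)[of undefined] by simp
  then show "0 \<le> W" using W_ge[of undefined] by linarith
  have "0 \<le> 32 / (1 - sin (g undefined)) + 16 / (1 - sin (g undefined))\<^sup>2" using g(2)[of undefined] by simp
  then show "0 \<le> H" using H_ge[of undefined] by linarith
qed

text \<open>The constants above depend on \<open>g\<close> but not on the contours \<open>\<partial>B\<^sub>b\<close>, as the final estimate has to be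
  uniform in \<open>b\<close>.\<close>

context
  fixes b s :: "'d \<Rightarrow> real" and \<Lambda> :: "'d set" and f :: "(complex, 'd) vec \<Rightarrow> complex" and c :: real
  assumes ab: "\<And>i. a i < b i" "\<And>i. b i < g i"
    and s: "\<And>i. 0 < s i" and c: "0 < c"
    and hol: "holomorphic_several f (stolz_polydomain g)"
    and dec: "\<And>z. z \<in> stolz_polydomain g \<Longrightarrow> cmod (f z) \<le> c * (\<Prod>i\<in>\<Lambda>. cmod (1 - z $ i) powr s i)"
begin

interpretation contours b s
proof
  show "0 < b i" for i using ag(1)[of i] ab(1)[of i] by simp
  show "b i < pi / 2" for i using ag(3)[of i] ab(2)[of i] by simp
qed (rule s)

lemma curve_exterior: "l \<in> stolz_curve (b i) \<Longrightarrow> l \<notin> closure (stolz_domain (a i))"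
  by (rule stolz_curve_exterior[OF _ ag(1) ab(1) b(2)])

lemma curve_domain: "l \<in> stolz_curve (b i) \<Longrightarrow> l \<in> stolz_domain (g i)"
  by (rule stolz_curve_subset[OF _ b(1) ab(2) ag(3)])

lemma curve_re: "l \<in> stolz_curve (b i) \<Longrightarrow> 0 < Re (1 - l)"
  by (rule stolz_curve_re(1)[OF _ b])

lemma disc_res: "cmod w > 1 \<Longrightarrow> is_res w (A i) (res w (A i))"
  by (rule is_res_power_series(1)[OF powers])

lemma curves_polydomain: "curves \<Lambda>' \<subseteq> stolz_polydomain g"
proof
  fix z assume z: "z \<in> curves \<Lambda>'"
  have "z $ i \<in> stolz_domain (g i)" for i
    using z curve_domain[of "z $ i" i] zero_in_stolz_domain[of "g i"] sin_bounds[OF g(1) ag(3), of i]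
    by (cases "i \<in> \<Lambda>'") (auto simp: curves_def)
  then show "z \<in> stolz_polydomain g" by (simp add: stolz_polydomain_def)
qed

lemma continuous_on_f: "continuous_on (stolz_polydomain g) f"
proof (rule continuous_at_imp_continuous_on, rule ballI)
  fix z assume "z \<in> stolz_polydomain g"
  then obtain f' where "(f has_derivative f') (at z)"
    using hol unfolding holomorphic_several_def by blast
  then show "isCont f z" by (rule has_derivative_continuous)
qed

text \<open>A complex linear total derivative restricts to a complex derivative along a coordinate axis.\<close>

lemma section_holomorphic:
  assumes z: "z \<in> stolz_polydomain g"
  shows "(\<lambda>w. f (upd z i w)) holomorphic_on stolz_domain (g i)"
  unfolding holomorphic_on_def
proof
  fix w assume w: "w \<in> stolz_domain (g i)"
  have u: "upd z i w \<in> stolz_polydomain g" using z w by (simp add: stolz_polydomain_def)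
  then obtain f' where f': "(f has_derivative f') (at (upd z i w))" and lin: "\<And>c v. f' (c *s v) = c * f' v"
    using hol unfolding holomorphic_several_def by blast
  have upd_eq: "upd z i w = upd z i 0 + axis i w" for w
    by (simp add: vec_eq_iff axis_def)
  have "bounded_linear (axis i :: complex \<Rightarrow> (complex, 'd) vec)"
    by (simp add: linear_conv_bounded_linear[symmetric] linear_iff vec_eq_iff axis_def)
  then have "((\<lambda>w. upd z i 0 + axis i w) has_derivative axis i) (at w)"
    by (auto intro!: derivative_eq_intros bounded_linear_imp_has_derivative)
  moreover have E: "(\<lambda>w. upd z i 0 + axis i w) = upd z i" by (rule ext) (rule upd_eq[symmetric])
  ultimately have "(upd z i has_derivative axis i) (at w)" by (simp only: E)
  from has_derivative_compose[OF this f'] have "((\<lambda>w. f (upd z i w)) has_derivative (\<lambda>h. f' (axis i h))) (at w)" .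
  moreover have "(\<lambda>h. f' (axis i h)) = (*) (f' (axis i 1))"
  proof
    fix h
    have "axis i h = h *s axis i (1 :: complex)" by (simp add: vec_eq_iff axis_def)
    then have "f' (axis i h) = h * f' (axis i 1)" by (simp only: lin)
    then show "f' (axis i h) = f' (axis i 1) * h" by (simp only: mult.commute)
  qed
  ultimately have "((\<lambda>w. f (upd z i w)) has_field_derivative f' (axis i 1)) (at w)"
    by (simp only: has_field_derivative_def)
  then show "(\<lambda>w. f (upd z i w)) field_differentiable at w within stolz_domain (g i)"
    using field_differentiable_at_within field_differentiable_def by blast
qed

text \<open>Operator functions with the size of a resolvent; the integrands are \<open>f\<close> times an ordered product
  of them.\<close>

definition res_like :: "('d \<Rightarrow> complex \<Rightarrow> 'x op) \<Rightarrow> bool"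
  where "res_like X \<longleftrightarrow> (\<forall>i. continuous_on (stolz_curve (b i)) (X i) \<and>
    (\<forall>l\<in>stolz_curve (b i). norm (X i l) \<le> K3 / cmod (1 - l)))"

definition int_fun :: "('d \<Rightarrow> complex \<Rightarrow> 'x op) \<Rightarrow> (complex, 'd) vec \<Rightarrow> 'x op"
  where "int_fun X z = f z *\<^sub>C prod_list (map (\<lambda>i. X i (z $ i)) (sorted_list_of_set \<Lambda>))"

definition Rf :: "'d \<Rightarrow> complex \<Rightarrow> 'x op" where "Rf i l = res l (A i)"

definition Kf :: "'d \<Rightarrow> complex \<Rightarrow> 'x op"
  where "Kf i l = op_kern (1 - l) (A i) * op_kern (1 - l) (A i) * res l (A i)"

lemma K3_ge: "K \<le> K3" "4 * (K * (1 + K)) * (4 * (K * (1 + K))) * K \<le> K3"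
  using K1 by (auto simp: K3_def distrib_left mult.commute)

lemma K3_pos: "0 < K3" using K3_ge(1) K1 by simp

lemma norm_res_le:
  assumes "l \<notin> closure (stolz_domain (a i))" "l \<noteq> 1"
  shows "norm (res l (A i)) \<le> K / cmod (1 - l)"
proof -
  have "norm ((l - 1) *\<^sub>C res l (A i)) \<le> K"
    by (rule R_bdd_norm[OF R_resolvent[of i]]) (use assms in auto)
  then show ?thesis using assms(2) by (simp add: norm_scaleC norm_minus_commute field_simps)
qed

lemma continuous_on_Rf: "continuous_on (stolz_curve (b i)) (Rf i)"
  unfolding Rf_def[abs_def]
proof (rule continuous_on_res)
  fix l assume l: "l \<in> stolz_curve (b i)"
  show "is_res l (A i) (res l (A i))" by (rule exterior[OF curve_exterior[OF l]])
  show "norm ((l - 1) *\<^sub>C res l (A i)) \<le> K"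
    by (rule R_bdd_norm[OF R_resolvent[of i]]) (use curve_exterior[OF l] in auto)
qed (rule one_not_in_stolz_curve)

lemma continuous_on_op_kern: "continuous_on (stolz_curve (b i)) (\<lambda>l. op_kern (1 - l) (A i))"
proof -
  have "continuous_on {w. cmod w > 1} (\<lambda>w. res w (A i))"
    by (rule continuous_on_res[OF disc_res disc_resolvent]) auto
  then have "continuous_on (stolz_curve (b i)) (\<lambda>l. res (1 + (1 - l)) (A i))"
    by (rule continuous_on_compose2) (use cmod_1_plus[OF curve_re] in \<open>auto intro!: continuous_intros\<close>)
  then show ?thesis
    unfolding op_kern_def op_rho_def by (intro continuous_intros)
qed

lemma res_like_Rf_Kf:
  assumes "\<And>i. X i = Rf i \<or> X i = Kf i" shows "res_like X"
proof -
  have R: "norm (Rf i l) \<le> K3 / cmod (1 - l)" if l: "l \<in> stolz_curve (b i)" for i l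
  proof -
    have "l \<noteq> 1" using l one_not_in_stolz_curve by auto
    from norm_res_le[OF curve_exterior[OF l] this] show ?thesis
      unfolding Rf_def by (rule order_trans) (intro divide_right_mono K3_ge(1) norm_ge_zero)
  qed
  have "norm (Kf i l) \<le> K3 / cmod (1 - l)" if l: "l \<in> stolz_curve (b i)" for i l
  proof -
    have "l \<noteq> 1" using l one_not_in_stolz_curve by auto
    note r = norm_res_le[OF curve_exterior[OF l] this]
    have k: "norm (op_kern (1 - l) (A i)) \<le> 4 * (K * (1 + K))"
      by (rule norm_op_kern_le(2)[OF b(1) ab(2) ag(3) disc_resolvent curve_re[OF l]])
    have "norm (Kf i l) \<le> (4 * (K * (1 + K)) * (4 * (K * (1 + K)))) * (K / cmod (1 - l))"
      unfolding Kf_def using k r K1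
      by (intro order_trans[OF norm_mult_ineq] mult_mono order_trans[OF norm_mult_ineq]) auto
    also have "\<dots> \<le> K3 / cmod (1 - l)"
      using divide_right_mono[OF K3_ge(2), of "cmod (1 - l)"] by simp
    finally show ?thesis .
  qed
  moreover have "continuous_on (stolz_curve (b i)) (Kf i)" for i
    unfolding Kf_def[abs_def]
    by (intro continuous_intros continuous_on_op_kern continuous_on_Rf[unfolded Rf_def[abs_def]])
  ultimately show ?thesis
    unfolding res_like_def using assms R continuous_on_Rf by metis
qed

lemma Rf_minus_Kf:
  assumes "l \<in> stolz_curve (b i)" shows "Rf i l = Kf i l + kern_defect (A i) l"
proof -
  have "cmod (2 - l) > 1" using cmod_1_plus[OF curve_re[OF assms]] by simp
  from resolvent_minus_kern[OF exterior[OF curve_exterior[OF assms]] disc_res[OF this]]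
  show ?thesis by (simp add: Rf_def Kf_def algebra_simps)
qed

lemma set_is [simp]: "set (sorted_list_of_set \<Lambda>) = \<Lambda>"
  by simp

lemma continuous_on_int_fun:
  assumes "\<And>i. i \<in> \<Lambda> \<Longrightarrow> continuous_on (stolz_curve (b i)) (X i)"
  shows "continuous_on (curves \<Lambda>) (int_fun X)"
  unfolding int_fun_def[abs_def]
proof (intro continuous_intros continuous_on_prod_list_op)
  show "continuous_on (curves \<Lambda>) f"
    by (rule continuous_on_subset[OF continuous_on_f curves_polydomain])
  fix i assume "i \<in> set (sorted_list_of_set \<Lambda>)"
  then have i: "i \<in> \<Lambda>" by simp
  show "continuous_on (curves \<Lambda>) (\<lambda>z. X i (z $ i))"
    by (rule continuous_on_compose2[OF assms[OF i]])
      (use i in \<open>auto simp: curves_def intro!: continuous_intros\<close>)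
qed

lemma prod_list_is: "prod_list (map h (sorted_list_of_set \<Lambda>)) = (\<Prod>i\<in>\<Lambda>. h i)"
  for h :: "'d \<Rightarrow> 'm::comm_monoid_mult"
  using prod.distinct_set_conv_list[of "sorted_list_of_set \<Lambda>" h] by simp

lemma weight_eq:
  fixes z :: "(complex, 'd) vec"
  assumes "\<And>i. i \<in> \<Lambda>' \<Longrightarrow> z $ i \<noteq> 1"
  shows "(\<Prod>i\<in>\<Lambda>'. cmod (1 - z $ i) powr s i) * (\<Prod>i\<in>\<Lambda>'. K3 / cmod (1 - z $ i)) = K3 ^ card \<Lambda>' * wd \<Lambda>' z"
proof -
  have "cmod (1 - z $ i) powr s i * (K3 / cmod (1 - z $ i)) = K3 * cmod (1 - z $ i) powr (s i - 1)"
    if "i \<in> \<Lambda>'" for i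
    using assms[OF that] by (simp add: powr_diff)
  then show ?thesis
    unfolding wd_def prod.distrib[symmetric] prod_constant[symmetric] by (intro prod.cong) auto
qed

lemma dominated_int_fun:
  assumes X: "res_like X" shows "dominated \<Lambda> (c * K3 ^ card \<Lambda>) (int_fun X)"
  unfolding dominated_def
proof (intro conjI ballI)
  show "continuous_on (curves \<Lambda>) (int_fun X)"
    by (rule continuous_on_int_fun) (use X in \<open>simp add: res_like_def\<close>)
  fix z assume z: "z \<in> curves \<Lambda>"
  have z1: "z $ i \<noteq> 1" if "i \<in> \<Lambda>" for i
    using z that one_not_in_stolz_curve[of i] by (auto simp: curves_def)
  have "norm (prod_list (map (\<lambda>i. X i (z $ i)) (sorted_list_of_set \<Lambda>))) \<le> (\<Prod>i\<in>\<Lambda>. K3 / cmod (1 - z $ i))"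
    unfolding prod_list_is[symmetric]
    by (rule norm_prod_list_op_le) (use X z in \<open>auto simp: res_like_def curves_def\<close>)
  then have "norm (int_fun X z) \<le> (c * (\<Prod>i\<in>\<Lambda>. cmod (1 - z $ i) powr s i)) * (\<Prod>i\<in>\<Lambda>. K3 / cmod (1 - z $ i))"
    unfolding int_fun_def norm_scaleC using dec[of z] z curves_polydomain c
    by (intro mult_mono) (auto intro!: prod_nonneg mult_nonneg_nonneg)
  also have "\<dots> = c * K3 ^ card \<Lambda> * wd \<Lambda> z"
    by (simp only: mult.assoc weight_eq[OF z1])
  finally show "norm (int_fun X z) \<le> c * K3 ^ card \<Lambda> * wd \<Lambda> z" .
qed

lemma zero_in_curves: "0 \<in> curves {}"
  by (simp add: curves_def)

text \<open>One resolvent is replaced by its kernel: the integral in its variable, carried out first, becomes an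
  integral over the chord.\<close>

lemma replace_one:
  assumes X: "res_like X" and i: "i \<in> \<Lambda>"
  shows "(\<lambda>n. trunc_iterated b (sorted_list_of_set \<Lambda>) n (int_fun (X(i := Rf i))) 0
    - trunc_iterated b (sorted_list_of_set \<Lambda>) n (int_fun (X(i := Kf i))) 0) \<longlonglongrightarrow> 0"
proof -
  let ?is = "sorted_list_of_set \<Lambda>"
  let ?G = "X(i := kern_defect (A i))"
  obtain xs ys where split: "?is = xs @ i # ys" using i split_list[of i ?is] by auto
  have dist: "distinct (xs @ i # ys)" using distinct_sorted_list_of_set[of \<Lambda>] by (simp only: split)
  have \<Lambda>: "\<Lambda> = insert i (set (xs @ ys))" using set_is split by auto
  have ni: "i \<notin> set (xs @ ys)" using dist by auto
  define \<Lambda>' where "\<Lambda>' = set (xs @ ys)"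
  have cX: "continuous_on (stolz_curve (b j)) (X j)" for j using X by (simp add: res_like_def)
  have cRK: "continuous_on (stolz_curve (b i)) (Rf i)" "continuous_on (stolz_curve (b i)) (Kf i)"
    using res_like_Rf_Kf[of Rf] res_like_Rf_Kf[of Kf] by (auto simp: res_like_def)
  have "continuous_on (stolz_curve (b i)) (\<lambda>l. Rf i l - Kf i l)" by (intro continuous_intros cRK)
  then have cG: "continuous_on (stolz_curve (b i)) (kern_defect (A i))"
    by (rule continuous_on_eq) (simp add: Rf_minus_Kf)
  have cont: "continuous_on (curves \<Lambda>) (int_fun (X(i := Y)))" if "continuous_on (stolz_curve (b i)) Y" for Y
    by (rule continuous_on_int_fun) (use that cX in auto)
  have prod_upd: "prod_list (map (\<lambda>j. (X(i := Y)) j (z $ j)) ?is)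
      = prod_list (map (\<lambda>j. X j (z $ j)) xs) * Y (z $ i) * prod_list (map (\<lambda>j. X j (z $ j)) ys)" for Y z
  proof -
    have "map (\<lambda>j. (X(i := Y)) j (z $ j)) xs = map (\<lambda>j. X j (z $ j)) xs"
      "map (\<lambda>j. (X(i := Y)) j (z $ j)) ys = map (\<lambda>j. X j (z $ j)) ys"
      using ni by (auto intro!: map_cong)
    then show ?thesis
      by (simp only: split map_append list.map prod_list.append prod_list.Cons fun_upd_same mult.assoc)
  qed
  have add: "int_fun (X(i := Rf i)) z = int_fun (X(i := Kf i)) z + int_fun ?G z" if z: "z \<in> curves \<Lambda>" for z
  proof -
    have "z $ i \<in> stolz_curve (b i)" using z i by (auto simp: curves_def)
    from Rf_minus_Kf[OF this] show ?thesis
      unfolding int_fun_def prod_upd by (simp add: distrib_left distrib_right scaleC_add_right)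
  qed
  have diff: "trunc_iterated b ?is n (int_fun (X(i := Rf i))) 0 - trunc_iterated b ?is n (int_fun (X(i := Kf i))) 0
      = trunc_iterated b ?is n (int_fun ?G) 0" for n
  proof -
    let ?F = "\<lambda>j. if j then int_fun (X(i := Kf i)) else int_fun ?G"
    have cF: "continuous_on (curves (set ?is \<union> {})) (?F j)" for j
      using cont[OF cRK(2)] cont[OF cG] by simp
    have "trunc_iterated b ?is n (int_fun (X(i := Rf i))) 0 = trunc_iterated b ?is n (\<lambda>z. \<Sum>j\<in>{True, False}. ?F j z) 0"
      by (rule trunc_iterated_cong[OF zero_in_curves]) (simp add: add)
    also have "\<dots> = (\<Sum>j\<in>{True, False}. trunc_iterated b ?is n (?F j) 0)"
      by (rule trunc_iterated_sum[OF cF zero_in_curves])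
    finally show ?thesis by simp
  qed
  define KG where "KG = (1 + 2 * K) * (1 + 4 * (K * (1 + K))) * (2 * K / (cos (b i))\<^sup>2)"
  define c' where "c' = c * K3 ^ card \<Lambda>' * KG"
  define Hn where "Hn n z = trunc_integral (b i) n (\<lambda>w. int_fun ?G (upd z i w))" for n z
  have dom: "dominated \<Lambda>' (c' * (1 / 2 ^ n) powr s i) (Hn n)" for n
    unfolding dominated_def
  proof (intro conjI ballI)
    show "continuous_on (curves \<Lambda>') (Hn n)"
      unfolding Hn_def[abs_def] using cont[OF cG] by (intro continuous_on_trunc) (simp only: \<Lambda>[folded \<Lambda>'_def, symmetric])
    fix z assume z: "z \<in> curves \<Lambda>'"
    let ?P = "\<lambda>zs. prod_list (map (\<lambda>j. X j (z $ j)) zs)"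
    have eq: "int_fun ?G (upd z i w) = f (upd z i w) *\<^sub>C (?P xs * kern_defect (A i) w * ?P ys)" for w
    proof -
      have m: "map (\<lambda>j. X j (upd z i w $ j)) xs = map (\<lambda>j. X j (z $ j)) xs"
        "map (\<lambda>j. X j (upd z i w $ j)) ys = map (\<lambda>j. X j (z $ j)) ys"
        using ni by (auto intro!: map_cong)
      show ?thesis unfolding int_fun_def prod_upd m by simp
    qed
    have zp: "z \<in> stolz_polydomain g" using z curves_polydomain by blast
    have fl: "cmod (f (upd z i l)) \<le> c * (\<Prod>j\<in>\<Lambda>'. cmod (1 - z $ j) powr s j) * cmod (1 - l) powr s i"
      if l: "l \<in> stolz_domain (g i)" for l
    proof -
      have "upd z i l \<in> stolz_polydomain g" using zp l by (simp add: stolz_polydomain_def)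
      from dec[OF this] have "cmod (f (upd z i l)) \<le> c * (\<Prod>j\<in>\<Lambda>. cmod (1 - upd z i l $ j) powr s j)" .
      also have "(\<Prod>j\<in>\<Lambda>. cmod (1 - upd z i l $ j) powr s j)
          = cmod (1 - l) powr s i * (\<Prod>j\<in>\<Lambda>'. cmod (1 - upd z i l $ j) powr s j)"
        using ni by (simp add: \<Lambda>[folded \<Lambda>'_def] \<Lambda>'_def)
      also have "(\<Prod>j\<in>\<Lambda>'. cmod (1 - upd z i l $ j) powr s j) = (\<Prod>j\<in>\<Lambda>'. cmod (1 - z $ j) powr s j)"
        using ni by (intro prod.cong) (auto simp: \<Lambda>'_def)
      finally show ?thesis by (simp add: mult_ac)
    qed
    have P: "norm (?P xs) * norm (?P ys) \<le> (\<Prod>j\<in>\<Lambda>'. K3 / cmod (1 - z $ j))"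
    proof -
      have "norm (?P zs) \<le> prod_list (map (\<lambda>j. K3 / cmod (1 - z $ j)) zs)" if "set zs \<subseteq> \<Lambda>'" for zs
        by (rule norm_prod_list_op_le) (use X z that in \<open>auto simp: res_like_def curves_def\<close>)
      then have "norm (?P xs) * norm (?P ys) \<le> prod_list (map (\<lambda>j. K3 / cmod (1 - z $ j)) xs)
          * prod_list (map (\<lambda>j. K3 / cmod (1 - z $ j)) ys)"
        using K3_pos by (intro mult_mono prod_list_nonneg) (auto simp: \<Lambda>'_def)
      also have "\<dots> = (\<Prod>j\<in>\<Lambda>'. K3 / cmod (1 - z $ j))"
        using prod.distinct_set_conv_list[of "xs @ ys" "\<lambda>j. K3 / cmod (1 - z $ j)"] dist by (simp add: \<Lambda>'_def)
      finally show ?thesis .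
    qed
    have z1: "z $ j \<noteq> 1" if "j \<in> \<Lambda>'" for j
      using z that one_not_in_stolz_curve[of j] by (auto simp: curves_def)
    have KG: "0 \<le> KG" using K1 by (simp add: KG_def)
    have "norm (Hn n z) \<le> c * (\<Prod>j\<in>\<Lambda>'. cmod (1 - z $ j) powr s j) * (norm (?P xs) * norm (?P ys)) * (KG * (1 / 2 ^ n) powr s i)"
      unfolding Hn_def eq KG_def
      by (rule trunc_integral_kern_defect[OF b(1) ab(2) ag(3) powers disc_resolvent section_holomorphic[OF zp] s fl])
    also have "\<dots> \<le> c * (\<Prod>j\<in>\<Lambda>'. cmod (1 - z $ j) powr s j) * (\<Prod>j\<in>\<Lambda>'. K3 / cmod (1 - z $ j)) * (KG * (1 / 2 ^ n) powr s i)"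
      using P c KG by (intro mult_right_mono mult_left_mono mult_nonneg_nonneg prod_nonneg) auto
    also have "\<dots> = c * ((\<Prod>j\<in>\<Lambda>'. cmod (1 - z $ j) powr s j) * (\<Prod>j\<in>\<Lambda>'. K3 / cmod (1 - z $ j))) * (KG * (1 / 2 ^ n) powr s i)"
      by (simp only: mult.assoc)
    also have "\<dots> = c * (K3 ^ card \<Lambda>' * wd \<Lambda>' z) * (KG * (1 / 2 ^ n) powr s i)"
      by (rule arg_cong[where f = "\<lambda>x. c * x * (KG * (1 / 2 ^ n) powr s i)"]) (rule weight_eq, rule z1)
    also have "\<dots> = c' * (1 / 2 ^ n) powr s i * wd \<Lambda>' z"
      unfolding c'_def by (simp only: mult_ac)
    finally show "norm (Hn n z) \<le> c' * (1 / 2 ^ n) powr s i * wd \<Lambda>' z" .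
  qed
  have bound: "norm (trunc_iterated b ?is n (int_fun ?G) 0) \<le> c' * (1 / 2 ^ n) powr s i * prod_list (map \<kappa> (xs @ ys))" for n
  proof -
    have "trunc_iterated b ?is n (int_fun ?G) 0 = trunc_iterated b (xs @ ys) n (Hn n) 0"
      unfolding split Hn_def[abs_def]
      by (rule trunc_iterated_pick[OF _ zero_in_curves]) (use ni cont[OF cG] \<Lambda> in auto)
    moreover have "dominated {} (c' * (1 / 2 ^ n) powr s i * prod_list (map \<kappa> (xs @ ys))) (trunc_iterated b (xs @ ys) n (Hn n))"
      by (rule dominated_trunc_iterated) (use dist dom \<Lambda>'_def in auto)
    ultimately show ?thesis using zero_in_curves by (auto simp: dominated_def wd_def)
  qed
  have "(\<lambda>n. c' * (1 / 2 ^ n) powr s i * prod_list (map \<kappa> (xs @ ys))) \<longlonglongrightarrow> c' * 0 * prod_list (map \<kappa> (xs @ ys))"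
    by (intro tendsto_intros half_power_tendsto s)
  then have lim: "(\<lambda>n. c' * (1 / 2 ^ n) powr s i * prod_list (map \<kappa> (xs @ ys))) \<longlonglongrightarrow> 0" by simp
  show ?thesis
    unfolding diff by (rule Lim_null_comparison[OF always_eventually lim]) (intro allI bound)
qed

text \<open>The resolvents are replaced one variable at a time; the products are mixed in between.\<close>

lemma replace_all:
  "(\<lambda>n. trunc_iterated b (sorted_list_of_set \<Lambda>) n (int_fun Rf) 0
    - trunc_iterated b (sorted_list_of_set \<Lambda>) n (int_fun Kf) 0) \<longlonglongrightarrow> 0"
proof -
  let ?T = "\<lambda>X n. trunc_iterated b (sorted_list_of_set \<Lambda>) n (int_fun X) 0"
  have "(\<lambda>n. ?T Rf n - ?T (\<lambda>i. if i \<in> L then Kf i else Rf i) n) \<longlonglongrightarrow> 0" if "finite L" "L \<subseteq> \<Lambda>" for L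
    using that
  proof (induction L rule: finite_induct)
    case (insert i L)
    define X where "X = (\<lambda>i. if i \<in> L then Kf i else Rf i)"
    have X: "res_like X" by (rule res_like_Rf_Kf) (auto simp: X_def)
    have "X(i := Rf i) = X" using insert by (auto simp: X_def)
    then have "(\<lambda>n. (?T Rf n - ?T X n) + (?T X n - ?T (X(i := Kf i)) n)) \<longlonglongrightarrow> 0 + 0"
      using replace_one[OF X, of i] insert by (intro tendsto_add) (auto simp: X_def)
    moreover have "X(i := Kf i) = (\<lambda>j. if j \<in> insert i L then Kf j else Rf j)" by (auto simp: X_def)
    ultimately show ?case by simp
  qed simp
  from this[of \<Lambda>] have "(\<lambda>n. ?T Rf n - ?T (\<lambda>i. if i \<in> \<Lambda> then Kf i else Rf i) n) \<longlonglongrightarrow> 0" by simp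
  moreover have "int_fun (\<lambda>i. if i \<in> \<Lambda> then Kf i else Rf i) = int_fun Kf"
  proof
    fix z
    show "int_fun (\<lambda>i. if i \<in> \<Lambda> then Kf i else Rf i) z = int_fun Kf z"
      unfolding int_fun_def by (intro arg_cong2[of _ _ _ _ scaleC] arg_cong[of _ _ prod_list] map_cong) auto
  qed
  ultimately show ?thesis by simp
qed

text \<open>At fixed positions inside the pieces, the integrand is a nested sum to which \<open>norm_kernel_sum_le\<close> applies. The factor
  \<open>\<lambda> - 1\<close> that makes the resolvent \<open>R\<close>-bounded is taken from the weights, leaving coefficients of the size of
  \<open>f\<close>.\<close>

lemma kernel_integral_bound:
  assumes M: "\<And>z. z \<in> stolz_polydomain g \<Longrightarrow> cmod (f z) \<le> M"
  shows "norm (trunc_iterated b (sorted_list_of_set \<Lambda>) n (int_fun Kf) 0)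
    \<le> (C * H * K) ^ card \<Lambda> * (C * (M * W ^ card \<Lambda> * H ^ card \<Lambda>))"
proof -
  let ?is = "sorted_list_of_set \<Lambda>"
  let ?N = "2 * n + 1"
  have M0: "0 \<le> M"
    using M[of 0] curves_polydomain zero_in_curves norm_ge_zero order_trans by blast
  have cont: "continuous_on (curves (set ?is \<union> {})) (int_fun Kf)"
    using dominated_int_fun[OF res_like_Rf_Kf[of Kf]] by (simp add: dominated_def)
  show ?thesis
  proof (rule trunc_iterated_norm_le[OF _ zero_in_curves cont])
    fix t :: "'d \<Rightarrow> real" assume t: "\<And>i. t i \<in> {0..1}"
    define pt where "pt i p = piece (b i) n p (t i)" for i p
    have pt: "pt i p \<in> stolz_curve (b i)" for i p
      unfolding pt_def using t[of i] by (intro piece_in_stolz_curve b) auto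
    define \<Phi> where "\<Phi> i p = op_kern (1 - pt i p) (A i)" for i p
    define S where "S i p = (pt i p - 1) *\<^sub>C res (pt i p) (A i)" for i p
    define zP where "zP P = (\<chi> j. if j \<in> set ?is then piece (b j) n (P j) (t j) else (0 :: (complex, 'd) vec) $ j)" for P
    define cP where "cP P = f (zP P) * prod_list (map (\<lambda>i. wt (b i) n (P i) (t i) / (pt i (P i) - 1)) ?is)" for P
    have term_eq: "prod_list (map (\<lambda>i. wt (b i) n (P i) (t i)) ?is) *\<^sub>C int_fun Kf (zP P)
        = cP P *\<^sub>C prod_list (map (\<lambda>i. \<Phi> i (P i) * \<Phi> i (P i) * S i (P i)) ?is)" for P
    proof -
      have "Kf i (zP P $ i) = (1 / (pt i (P i) - 1)) *\<^sub>C (\<Phi> i (P i) * \<Phi> i (P i) * S i (P i))" if "i \<in> \<Lambda>" for i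
      proof -
        have "pt i (P i) \<noteq> 1" using pt[of i "P i"] one_not_in_stolz_curve[of i] by auto
        then show ?thesis using that by (simp add: Kf_def zP_def \<Phi>_def S_def pt_def scaleC_scaleC)
      qed
      then have "map (\<lambda>i. Kf i (zP P $ i)) ?is
          = map (\<lambda>i. (1 / (pt i (P i) - 1)) *\<^sub>C (\<Phi> i (P i) * \<Phi> i (P i) * S i (P i))) ?is"
        by (intro map_cong) auto
      moreover have "prod_list (map (\<lambda>i. wt (b i) n (P i) (t i)) ?is) * prod_list (map (\<lambda>i. 1 / (pt i (P i) - 1)) ?is)
          = prod_list (map (\<lambda>i. wt (b i) n (P i) (t i) / (pt i (P i) - 1)) ?is)"
        by (simp add: prod_list_is prod.distrib[symmetric])
      ultimately show ?thesis
        unfolding int_fun_def cP_def prod_list_scaleC scaleC_scaleC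
        by (simp only: prod_list_scaleC scaleC_scaleC mult_ac)
    qed
    have "norm (nsum ?is ?N (\<lambda>P. cP P *\<^sub>C prod_list (map (\<lambda>i. \<Phi> i (P i) * \<Phi> i (P i) * S i (P i)) ?is)) P)
        \<le> (C * H * K) ^ length ?is * (C * (M * W ^ card \<Lambda> * H ^ length ?is))" for P
    proof (rule norm_kernel_sum_le[where h = "\<lambda>i p. kern (1 - pt i p)"])
      show "disc_pair (\<lambda>z. kern (1 - pt i p) (z i)) (\<Phi> i p)" for i p
        unfolding \<Phi>_def by (rule disc_pair_kern[OF powers curve_re[OF pt]])
      show "(\<Sum>p<?N. cmod (kern (1 - pt i p) \<zeta>)) \<le> H" if "cmod \<zeta> \<le> 1" for i \<zeta>
        using kern_sum_le[OF b(1)[of i] _ ag(3), of i "t i" \<zeta> n] ab(2)[of i] t[of i] that H_ge[of i]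
        unfolding pt_def by auto
      show "R_bdd K (S i ` {..<?N})" for i
        by (rule R_bdd_subset[OF R_resolvent[of i]]) (use curve_exterior[OF pt] in \<open>auto simp: S_def\<close>)
      have ct: "cmod (1 + (1 - pt i p)) > 1" for i p by (rule cmod_1_plus[OF curve_re[OF pt]])
      have rr: "res w (A i) * res z (A j) = res z (A j) * res w (A i)"
        if "is_res w (A i) (res w (A i))" "is_res z (A j) (res z (A j))" for w z i j
        by (rule res_commute_res[OF that A_commute])
      have \<Phi>_comm: "X * \<Phi> j q = \<Phi> j q * X"
        if "X * res (1 + (1 - pt j q)) (A j) = res (1 + (1 - pt j q)) (A j) * X" for X j q
        unfolding \<Phi>_def by (rule op_kern_commute[OF that])
      show "\<Phi> i p * \<Phi> j q = \<Phi> j q * \<Phi> i p" for i j p q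
      proof (rule \<Phi>_comm, rule \<Phi>_comm[symmetric])
        show "res (1 + (1 - pt j q)) (A j) * res (1 + (1 - pt i p)) (A i)
          = res (1 + (1 - pt i p)) (A i) * res (1 + (1 - pt j q)) (A j)"
          by (rule rr[OF disc_res[OF ct] disc_res[OF ct]])
      qed
      show "\<Phi> i p * S j q = S j q * \<Phi> i p" for i j p q
      proof (rule \<Phi>_comm[symmetric])
        show "S j q * res (1 + (1 - pt i p)) (A i) = res (1 + (1 - pt i p)) (A i) * S j q"
          unfolding S_def mult_scaleC_left mult_scaleC_right
          by (simp only: rr[OF exterior[OF curve_exterior[OF pt]] disc_res[OF ct]])
      qed
      show "cmod (cP P) \<le> M * W ^ card \<Lambda>" for P
      proof -
        have "zP P \<in> curves \<Lambda>" using pt by (auto simp: zP_def curves_def pt_def)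
        then have "cmod (f (zP P)) \<le> M" using M curves_polydomain by blast
        moreover have "cmod (wt (b i) n (P i) (t i) / (pt i (P i) - 1)) \<le> W" for i
        proof -
          have "pt i (P i) \<noteq> 1" using pt[of i "P i"] one_not_in_stolz_curve[of i] by auto
          then have "cmod (wt (b i) n (P i) (t i) / (pt i (P i) - 1)) \<le> 2 * pi / (1 - sin (g i))"
            using wt_le[OF b(1)[of i] _ ag(3), of i "t i" n "P i"] ab(2)[of i] t[of i]
            by (simp add: norm_divide pt_def norm_minus_commute divide_le_eq)
          then show ?thesis using W_ge[of i] by linarith
        qed
        then have "(\<Prod>i\<in>\<Lambda>. cmod (wt (b i) n (P i) (t i) / (pt i (P i) - 1))) \<le> (\<Prod>i\<in>\<Lambda>. W)"
          by (intro prod_mono) auto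
        ultimately show ?thesis
          unfolding cP_def norm_mult prod_list_is prod_norm[symmetric]
          using M0 by (intro mult_mono) (auto intro: prod_nonneg)
      qed
    qed (use M0 W_nonneg H_nonneg in auto)
    then show "norm (nsum ?is ?N (\<lambda>P. prod_list (map (\<lambda>i. wt (b i) n (P i) (t i)) ?is) *\<^sub>C
      int_fun Kf (\<chi> j. if j \<in> set ?is then piece (b j) n (P j) (t j) else 0 $ j)) P)
      \<le> (C * H * K) ^ card \<Lambda> * (C * (M * W ^ card \<Lambda> * H ^ card \<Lambda>))" for P
      unfolding term_eq[unfolded zP_def] by simp
  qed simp
qed

text \<open>In the limit of the truncations, the integrals with and without kernels agree, and the bound for the kernel
  integrals does not depend on the truncation.\<close>

lemma H0_calculus_bound:
  assumes M: "\<And>z. z \<in> stolz_polydomain g \<Longrightarrow> cmod (f z) \<le> M"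
  shows "norm (H0_calculus b (\<lambda>i. op_map (A i)) \<Lambda> f)
    \<le> (C * H * K) ^ card \<Lambda> * (C * (M * W ^ card \<Lambda> * H ^ card \<Lambda>))" (is "_ \<le> ?B")
proof -
  let ?is = "sorted_list_of_set \<Lambda>"
  define F where "F z = f z *\<^sub>C op_prod \<Lambda> (\<lambda>i. resolvent (z $ i) (op_map (A i)))" for z
  have F: "F z = op_map (int_fun Rf z)" if z: "z \<in> curves \<Lambda>" for z
  proof -
    have "resolvent (z $ i) (op_map (A i)) = op_map (Rf i (z $ i))" if "i \<in> \<Lambda>" for i
      unfolding Rf_def using z that
      by (intro resolvent_op_map exterior curve_exterior) (auto simp: curves_def)
    then have "op_prod \<Lambda> (\<lambda>i. resolvent (z $ i) (op_map (A i))) = op_prod \<Lambda> (\<lambda>i. op_map (Rf i (z $ i)))"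
      unfolding op_prod_def by (intro foldr_cong) auto
    then show ?thesis by (simp add: F_def op_prod_op_map int_fun_def scaleC_op.rep_eq)
  qed
  have bl: "bounded_linear (op_map :: 'x op \<Rightarrow> _)"
    by (rule bounded_linear_intro[of _ 1]) (simp_all add: plus_op.rep_eq scaleR_op.rep_eq)
  have dR: "dominated \<Lambda> (c * K3 ^ card \<Lambda>) (int_fun Rf)" by (rule dominated_int_fun[OF res_like_Rf_Kf]) simp
  then have cR: "continuous_on (curves \<Lambda>) (int_fun Rf)" by (simp add: dominated_def)
  have "continuous_on (curves \<Lambda>) (\<lambda>z. op_map (int_fun Rf z))"
    by (rule bounded_linear.continuous_on[OF bl cR])
  then have "continuous_on (curves \<Lambda>) F" by (rule continuous_on_eq) (simp add: F)
  then have "dominated (set ?is \<union> {}) (c * K3 ^ card \<Lambda>) F"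
    using dR by (simp add: dominated_def F)
  from iterated_vs_trunc[OF _ _ this] obtain e where e: "e \<longlonglongrightarrow> 0" and
    le: "\<And>n z. z \<in> curves {} \<Longrightarrow> norm (iterated_contour_integral ?is (\<lambda>i. stolz_boundary (b i)) F z
      - trunc_iterated b ?is n F z) \<le> e n * wd {} z" by auto
  let ?I = "iterated_contour_integral ?is (\<lambda>i. stolz_boundary (b i)) F 0"
  let ?T = "\<lambda>X n. trunc_iterated b ?is n (int_fun X) 0"
  have T: "trunc_iterated b ?is n F 0 = op_map (?T Rf n)" for n
  proof -
    have "trunc_iterated b ?is n F 0 = trunc_iterated b ?is n (\<lambda>z. op_map (int_fun Rf z)) 0"
      by (rule trunc_iterated_cong[OF zero_in_curves]) (simp add: F)
    also have "\<dots> = op_map (?T Rf n)"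
      by (rule trunc_iterated_linear[OF bl _ zero_in_curves]) (use cR in \<open>simp_all add: scaleC_op.rep_eq\<close>)
    finally show ?thesis .
  qed
  have "norm ?I \<le> ?B"
  proof (rule LIMSEQ_le_const)
    have "(\<lambda>n. e n + norm (?T Rf n - ?T Kf n) + ?B) \<longlonglongrightarrow> 0 + norm (0 :: 'x op) + ?B"
      by (intro tendsto_intros e replace_all)
    then show "(\<lambda>n. e n + norm (?T Rf n - ?T Kf n) + ?B) \<longlonglongrightarrow> ?B" by simp
    have "norm ?I \<le> e n + norm (?T Rf n - ?T Kf n) + ?B" for n
    proof -
      have "norm ?I \<le> norm (?I - trunc_iterated b ?is n F 0) + norm (?T Rf n)"
        using norm_triangle_ineq[of "?I - trunc_iterated b ?is n F 0" "trunc_iterated b ?is n F 0"] by (simp add: T)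
      moreover have "norm (?T Rf n) \<le> norm (?T Rf n - ?T Kf n) + norm (?T Kf n)"
        using norm_triangle_ineq[of "?T Rf n - ?T Kf n" "?T Kf n"] by simp
      ultimately show ?thesis
        using le[OF zero_in_curves, of n] kernel_integral_bound[OF M, of n] by (simp add: wd_def)
    qed
    then show "\<exists>N. \<forall>n\<ge>N. norm ?I \<le> e n + norm (?T Rf n - ?T Kf n) + ?B" by blast
  qed
  moreover have "norm (H0_calculus b (\<lambda>i. op_map (A i)) \<Lambda> f) \<le> norm ?I"
  proof -
    have "cmod (1 / (2 * of_real pi * \<i>)) \<le> 1"
      using pi_gt3 by (simp add: norm_divide norm_mult)
    then have "cmod ((1 / (2 * of_real pi * \<i>)) ^ card \<Lambda>) \<le> 1"
      unfolding norm_power by (rule power_le_one[rotated]) simp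
    then have "cmod ((1 / (2 * of_real pi * \<i>)) ^ card \<Lambda>) * norm ?I \<le> 1 * norm ?I"
      by (rule mult_right_mono) simp
    then show ?thesis unfolding H0_calculus_def norm_scaleC F_def[abs_def] by simp
  qed
  ultimately show ?thesis by linarith
qed

end

end

section \<open>The components of a function in the direct sum\<close>

lemma H0_inftyE:
  assumes "f \<in> H0_infty \<gamma> \<Lambda>"
  obtains c s where "0 < c" "\<And>i. i \<in> \<Lambda> \<Longrightarrow> 0 < s i"
    "\<And>z. z \<in> stolz_polydomain \<gamma> \<Longrightarrow> cmod (f z) \<le> c * (\<Prod>i\<in>\<Lambda>. cmod (1 - z $ i) powr s i)"
  using assms unfolding H0_infty_def by blast

lemma H0_inftyD:
  assumes f: "f \<in> H0_infty \<gamma> \<Lambda>"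
  shows "holomorphic_several f (stolz_polydomain \<gamma>)"
    and "\<exists>B. \<forall>z\<in>stolz_polydomain \<gamma>. cmod (f z) \<le> B"
    and "\<And>z w. z \<in> stolz_polydomain \<gamma> \<Longrightarrow> w \<in> stolz_polydomain \<gamma> \<Longrightarrow> (\<And>i. i \<in> \<Lambda> \<Longrightarrow> z $ i = w $ i) \<Longrightarrow> f z = f w"
proof -
  show "holomorphic_several f (stolz_polydomain \<gamma>)"
    using f unfolding H0_infty_def mem_Collect_eq by (elim conjE)
  have "bounded (f ` stolz_polydomain \<gamma>)"
    using f unfolding H0_infty_def mem_Collect_eq by (elim conjE)
  then show "\<exists>B. \<forall>z\<in>stolz_polydomain \<gamma>. cmod (f z) \<le> B" unfolding bounded_iff by blast
  have "\<forall>z\<in>stolz_polydomain \<gamma>. \<forall>w\<in>stolz_polydomain \<gamma>. (\<forall>i\<in>\<Lambda>. z $ i = w $ i) \<longrightarrow> f z = f w"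
    using f unfolding H0_infty_def mem_Collect_eq by (elim conjE)
  note dep = this[rule_format]
  show "f z = f w" if "z \<in> stolz_polydomain \<gamma>" "w \<in> stolz_polydomain \<gamma>" "\<And>i. i \<in> \<Lambda> \<Longrightarrow> z $ i = w $ i" for z w
    by (rule dep[OF that])
qed

text \<open>The components of \<open>\<Sum>\<Lambda>. f \<Lambda>\<close> are controlled by the sum: if the variables outside \<open>\<Lambda>\<close> tend to \<open>1\<close>, all
  components vanish except those \<open>f \<Lambda>'\<close> with \<open>\<Lambda>' \<subseteq> \<Lambda>\<close>, so the partial sums over the subsets of \<open>\<Lambda>\<close> obey
  the bound of the full sum. Subtracting the components of the proper subsets, bounded by induction, leaves
  \<open>f \<Lambda>\<close>.\<close>

lemma sum_subsets_le:
  fixes \<gamma> :: "'d::finite \<Rightarrow> real"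
  assumes \<gamma>: "\<And>i. 0 < sin (\<gamma> i)" and f: "\<And>\<Lambda>. f \<Lambda> \<in> H0_infty \<gamma> \<Lambda>"
    and M: "\<And>z. z \<in> stolz_polydomain \<gamma> \<Longrightarrow> cmod (\<Sum>\<Lambda>\<in>UNIV. f \<Lambda> z) \<le> M"
    and z: "z \<in> stolz_polydomain \<gamma>"
  shows "cmod (\<Sum>\<Lambda>'\<in>Pow \<Lambda>. f \<Lambda>' z) \<le> M"
proof -
  define \<rho> where "\<rho> n = 1 / real (Suc n)" for n
  define y where "y n = (\<chi> i. if i \<in> \<Lambda> then z $ i else 1 - of_real (\<rho> n))" for n
  have \<rho>: "0 < \<rho> n" "\<rho> n \<le> 1" for n by (auto simp: \<rho>_def)
  have \<rho>0: "\<rho> \<longlonglongrightarrow> 0" unfolding \<rho>_def[abs_def] by (rule lim_1_over_n[THEN LIMSEQ_Suc])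
  have y: "y n \<in> stolz_polydomain \<gamma>" for n
    using z one_minus_in_stolz_domain[OF \<gamma> \<rho>] by (simp add: y_def stolz_polydomain_def)
  have "(\<lambda>n. f \<Lambda>' (y n)) \<longlonglongrightarrow> (if \<Lambda>' \<subseteq> \<Lambda> then f \<Lambda>' z else 0)" for \<Lambda>'
  proof (cases "\<Lambda>' \<subseteq> \<Lambda>")
    case True
    have "f \<Lambda>' (y n) = f \<Lambda>' z" for n
      by (rule H0_inftyD(3)[OF f y z]) (use True in \<open>auto simp: y_def\<close>)
    with True show ?thesis by simp
  next
    case False
    then obtain j where j: "j \<in> \<Lambda>'" "j \<notin> \<Lambda>" by blast
    obtain c s where "0 < c" and s: "\<And>i. i \<in> \<Lambda>' \<Longrightarrow> 0 < s i" and
      le: "\<And>z. z \<in> stolz_polydomain \<gamma> \<Longrightarrow> cmod (f \<Lambda>' z) \<le> c * (\<Prod>i\<in>\<Lambda>'. cmod (1 - z $ i) powr s i)"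
      by (rule H0_inftyE[OF f[of \<Lambda>']]) (rule that)
    have "(\<lambda>n. cmod (1 - y n $ i) powr s i) \<longlonglongrightarrow> (if i \<in> \<Lambda> then cmod (1 - z $ i) powr s i else 0)"
      if i: "i \<in> \<Lambda>'" for i
    proof (cases "i \<in> \<Lambda>")
      case False
      have "(\<lambda>n. \<rho> n powr s i) \<longlonglongrightarrow> 0"
        by (rule tendsto_zero_powrI[OF \<rho>0 tendsto_const _ s[OF i]]) (use \<rho>(1) in \<open>simp add: less_imp_le\<close>)
      moreover have "cmod (1 - y n $ i) = \<rho> n" for n using False \<rho>(1)[of n] by (simp add: y_def)
      ultimately show ?thesis using False by simp
    qed (simp add: y_def)
    then have "(\<lambda>n. c * (\<Prod>i\<in>\<Lambda>'. cmod (1 - y n $ i) powr s i))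
        \<longlonglongrightarrow> c * (\<Prod>i\<in>\<Lambda>'. if i \<in> \<Lambda> then cmod (1 - z $ i) powr s i else 0)"
      by (intro tendsto_mult tendsto_const tendsto_prod)
    moreover have "(\<Prod>i\<in>\<Lambda>'. if i \<in> \<Lambda> then cmod (1 - z $ i) powr s i else 0) = 0"
      by (rule prod_zero) (use j in auto)
    ultimately have lim: "(\<lambda>n. c * (\<Prod>i\<in>\<Lambda>'. cmod (1 - y n $ i) powr s i)) \<longlonglongrightarrow> 0" by simp
    have "(\<lambda>n. f \<Lambda>' (y n)) \<longlonglongrightarrow> 0"
      by (rule Lim_null_comparison[OF always_eventually lim]) (intro allI le y)
    with False show ?thesis by simp
  qed
  then have "(\<lambda>n. cmod (\<Sum>\<Lambda>'\<in>UNIV. f \<Lambda>' (y n))) \<longlonglongrightarrow> cmod (\<Sum>\<Lambda>'\<in>UNIV. if \<Lambda>' \<subseteq> \<Lambda> then f \<Lambda>' z else 0)"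
    by (intro tendsto_norm tendsto_sum)
  moreover have "(\<Sum>\<Lambda>'\<in>UNIV. if \<Lambda>' \<subseteq> \<Lambda> then f \<Lambda>' z else 0) = (\<Sum>\<Lambda>'\<in>Pow \<Lambda>. f \<Lambda>' z)"
    by (rule sum.mono_neutral_cong_right) auto
  ultimately have "(\<lambda>n. cmod (\<Sum>\<Lambda>'\<in>UNIV. f \<Lambda>' (y n))) \<longlonglongrightarrow> cmod (\<Sum>\<Lambda>'\<in>Pow \<Lambda>. f \<Lambda>' z)" by simp
  then show ?thesis by (rule LIMSEQ_le_const2) (use M[OF y] in blast)
qed

lemma component_bound:
  fixes \<gamma> :: "'d::finite \<Rightarrow> real"
  assumes \<gamma>: "\<And>i. 0 < sin (\<gamma> i)"
  shows "\<exists>K\<ge>0. \<forall>f M. (\<forall>\<Lambda>. f \<Lambda> \<in> H0_infty \<gamma> \<Lambda>) \<longrightarrow>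
    (\<forall>z\<in>stolz_polydomain \<gamma>. cmod (\<Sum>\<Lambda>\<in>UNIV. f \<Lambda> z) \<le> M) \<longrightarrow>
    (\<forall>z\<in>stolz_polydomain \<gamma>. cmod (f \<Lambda> z) \<le> K * M)"
  using finite[of \<Lambda>]
proof (induction \<Lambda> rule: finite_psubset_induct)
  case (psubset \<Lambda>)
  define P where "P \<Lambda> K \<longleftrightarrow> (\<forall>f M. (\<forall>\<Lambda>. f \<Lambda> \<in> H0_infty \<gamma> \<Lambda>) \<longrightarrow>
    (\<forall>z\<in>stolz_polydomain \<gamma>. cmod (\<Sum>\<Lambda>\<in>UNIV. f \<Lambda> z) \<le> M) \<longrightarrow>
    (\<forall>z\<in>stolz_polydomain \<gamma>. cmod (f \<Lambda> z) \<le> K * M))" for \<Lambda> and K :: real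
  have "\<exists>K\<ge>0. P \<Lambda>' K" if "\<Lambda>' \<subset> \<Lambda>" for \<Lambda>' using psubset.IH[OF that] unfolding P_def by blast
  then obtain K where K: "\<And>\<Lambda>'. \<Lambda>' \<subset> \<Lambda> \<Longrightarrow> 0 \<le> K \<Lambda>'" "\<And>\<Lambda>'. \<Lambda>' \<subset> \<Lambda> \<Longrightarrow> P \<Lambda>' (K \<Lambda>')" by metis
  have "cmod (f \<Lambda> z) \<le> (1 + (\<Sum>\<Lambda>'\<in>{\<Lambda>'. \<Lambda>' \<subset> \<Lambda>}. K \<Lambda>')) * M"
    if f: "\<forall>\<Lambda>. f \<Lambda> \<in> H0_infty \<gamma> \<Lambda>" and M: "\<forall>z\<in>stolz_polydomain \<gamma>. cmod (\<Sum>\<Lambda>\<in>UNIV. f \<Lambda> z) \<le> M"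
      and z: "z \<in> stolz_polydomain \<gamma>" for f M z
  proof -
    have "Pow \<Lambda> = insert \<Lambda> {\<Lambda>'. \<Lambda>' \<subset> \<Lambda>}" by auto
    then have "f \<Lambda> z = (\<Sum>\<Lambda>'\<in>Pow \<Lambda>. f \<Lambda>' z) - (\<Sum>\<Lambda>'\<in>{\<Lambda>'. \<Lambda>' \<subset> \<Lambda>}. f \<Lambda>' z)" by simp
    also have "cmod \<dots> \<le> M + (\<Sum>\<Lambda>'\<in>{\<Lambda>'. \<Lambda>' \<subset> \<Lambda>}. K \<Lambda>' * M)"
    proof (rule order_trans[OF norm_triangle_ineq4 add_mono[OF sum_subsets_le sum_norm_le]])
      show "cmod (f \<Lambda>' z) \<le> K \<Lambda>' * M" if "\<Lambda>' \<in> {\<Lambda>'. \<Lambda>' \<subset> \<Lambda>}" for \<Lambda>'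
        using K(2)[of \<Lambda>'] that f M z unfolding P_def by blast
    qed (use \<gamma> f M z in auto)
    also have "\<dots> = (1 + (\<Sum>\<Lambda>'\<in>{\<Lambda>'. \<Lambda>' \<subset> \<Lambda>}. K \<Lambda>')) * M" by (simp add: distrib_right sum_distrib_right)
    finally show ?thesis .
  qed
  moreover have "0 \<le> 1 + (\<Sum>\<Lambda>'\<in>{\<Lambda>'. \<Lambda>' \<subset> \<Lambda>}. K \<Lambda>')" by (intro add_nonneg_nonneg sum_nonneg) (auto intro: K(1))
  ultimately show ?case by blast
qed

section \<open>The joint functional calculus\<close>

text \<open>This is where the \<open>R\<close>-Ritt property enters: \<open>R\<close>-boundedness of the resolvents in the exterior of the disc is spread
  by Neumann series to the exterior of a Stolz domain.\<close>

lemma R_ritt_stolz_resolvent: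
  fixes B :: "'x::complex_banach op"
  assumes r: "rademacher_sequence \<Omega> r" and B: "R_ritt_operator \<Omega> r (op_map B)"
  shows "\<exists>a K Cp. 0 < a \<and> a < pi / 2 \<and> 1 \<le> K \<and> (\<forall>n. norm (B ^ n) \<le> Cp)
    \<and> (\<forall>l. l \<notin> closure (stolz_domain a) \<longrightarrow> is_res l B (res l B))
    \<and> R_bdd K {(l - 1) *\<^sub>C res l B | l. l \<notin> closure (stolz_domain a)}
    \<and> (\<forall>w. cmod w > 1 \<longrightarrow> norm ((w - 1) *\<^sub>C res w B) \<le> K)"
proof -
  obtain C1 where "R_bdd C1 {A. op_map A \<in> range (op_power (op_map B))}"
    using R_bounded_imp_R_bdd[OF r] B unfolding R_ritt_operator_def by blast
  then have C1: "R_bdd C1 (range ((^) B))" by (rule R_bdd_subset) (auto simp: op_power_op_map)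
  obtain C2 where "R_bdd C2 {A. op_map A \<in> {real n *\<^sub>R (op_power (op_map B) n - op_power (op_map B) (n - 1)) | n. n \<ge> 1}}"
    using R_bounded_imp_R_bdd[OF r] B unfolding R_ritt_operator_def by blast
  then have C2: "R_bdd C2 {real n *\<^sub>R (B ^ n - B ^ (n - 1)) | n. n \<ge> 1}"
    by (rule R_bdd_subset) (auto simp: op_power_op_map scaleR_op.rep_eq minus_op.rep_eq)
  define K0 where "K0 = max 1 (8 * C1 + 2 * C2 + 8 * (C2 * C2))"
  have K0: "1 \<le> K0" by (simp add: K0_def)
  have RK0: "R_bdd K0 {(w - 1) *\<^sub>C res w B | w. cmod w > 1}"
    by (rule R_bdd_mono[OF R_ritt_resolvent_exterior[OF C1 C2]]) (simp add: K0_def)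
  have pow: "norm (B ^ n) \<le> C1" for n by (rule R_bdd_norm[OF C1]) simp
  obtain a where a: "0 < a" "a < pi / 2"
    "\<And>l. l \<notin> closure (stolz_domain a) \<Longrightarrow> \<exists>w. cmod w > 1 \<and> cmod (l - w) \<le> cmod (w - 1) / (4 * K0)"
    using stolz_exterior_near_unit_circle[OF K0] by blast
  note N = R_bdd_resolvent_neumann[OF is_res_power_series(1)[OF pow] RK0 K0]
  obtain K' where K': "R_bdd K' {(l - 1) *\<^sub>C res l B | l. l \<in> {l. \<exists>w. cmod w > 1 \<and> cmod (l - w) \<le> cmod (w - 1) / (4 * K0)}}"
    using N(2) by blast
  have "R_bdd (max K0 K') {(l - 1) *\<^sub>C res l B | l. l \<notin> closure (stolz_domain a)}"
    by (rule R_bdd_mono[OF R_bdd_subset[OF K']]) (use a(3) in auto)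
  moreover have "is_res l B (res l B)" if "l \<notin> closure (stolz_domain a)" for l
    using N(1) a(3)[OF that] by blast
  moreover have "norm ((w - 1) *\<^sub>C res w B) \<le> max K0 K'" if "cmod w > 1" for w
    by (rule order_trans[OF R_bdd_norm[OF RK0]]) (use that in auto)
  moreover have "1 \<le> max K0 K'" using K0 by simp
  ultimately show ?thesis using a(1,2) pow by blast
qed

lemma ritt_operator_of_typeI:
  fixes B :: "'x::complex_banach op"
  assumes B: "ritt_operator (op_map B)" and a: "0 < a" "a < pi / 2"
    and ext: "\<And>l. l \<notin> closure (stolz_domain a) \<Longrightarrow> is_res l B (res l B)"
    and K: "\<And>l. l \<notin> closure (stolz_domain a) \<Longrightarrow> norm ((l - 1) *\<^sub>C res l B) \<le> K" "1 \<le> K"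
  shows "ritt_operator_of_type a (op_map B)"
  unfolding ritt_operator_of_type_def
proof (intro conjI allI impI a B)
  have "\<zeta> \<notin> op_spectrum (op_map B)" if "\<zeta> \<notin> closure (stolz_domain a)" for \<zeta>
    using ext[OF that] unfolding op_spectrum_def is_op_inverse_op_map by blast
  then show "op_spectrum (op_map B) \<subseteq> closure (stolz_domain a)" by blast
  fix b assume b: "a < b \<and> b < pi / 2"
  have "sin a \<le> sin b" using a b by (intro sin_monotone_2pi_le) auto
  then have sub: "closure (stolz_domain a) \<subseteq> closure (stolz_domain b)"
    by (intro closure_mono stolz_domain_mono)
  have "norm ((\<zeta> - 1) *\<^sub>C resolvent \<zeta> (op_map B)) \<le> K" if "\<zeta> \<notin> closure (stolz_domain b)" for \<zeta>
  proof -
    have \<zeta>: "\<zeta> \<notin> closure (stolz_domain a)" using that sub by blast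
    show ?thesis using K(1)[OF \<zeta>] by (simp add: resolvent_op_map[OF ext[OF \<zeta>]] norm_scaleC)
  qed
  with K(2) show "\<exists>K>0. \<forall>\<zeta>. \<zeta> \<notin> closure (stolz_domain b) \<longrightarrow> norm ((\<zeta> - 1) *\<^sub>C resolvent \<zeta> (op_map B)) \<le> K"
    by (intro exI[of _ K]) auto
qed

lemma (in ritt_tuple) joint_calculus_bound:
  assumes ab: "\<And>i. a i < b i" "\<And>i. b i < g i"
    and f: "f \<in> H0_infty g \<Lambda>" and M: "\<And>z. z \<in> stolz_polydomain g \<Longrightarrow> cmod (f z) \<le> M"
  shows "norm (H0_calculus b (\<lambda>i. op_map (A i)) \<Lambda> f)
    \<le> (C * H * K) ^ card \<Lambda> * (C * (M * W ^ card \<Lambda> * H ^ card \<Lambda>))"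
proof -
  obtain c s where c: "0 < c" and s: "\<And>i. i \<in> \<Lambda> \<Longrightarrow> 0 < s i" and
    dec: "\<And>z. z \<in> stolz_polydomain g \<Longrightarrow> cmod (f z) \<le> c * (\<Prod>i\<in>\<Lambda>. cmod (1 - z $ i) powr s i)"
    by (rule H0_inftyE[OF f]) (rule that)
  show ?thesis
  \<comment> \<open>the estimate is stated with a positive exponent for every index\<close>
  proof (rule H0_calculus_bound[OF ab, of "\<lambda>i. if i \<in> \<Lambda> then s i else 1" c])
    show "holomorphic_several f (stolz_polydomain g)" by (rule H0_inftyD(1)[OF f])
    fix z assume z: "z \<in> stolz_polydomain g"
    have eq: "(\<Prod>i\<in>\<Lambda>. cmod (1 - z $ i) powr s i) = (\<Prod>i\<in>\<Lambda>. cmod (1 - z $ i) powr (if i \<in> \<Lambda> then s i else 1))"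
      by (intro prod.cong) auto
    from dec[OF z] show "cmod (f z) \<le> c * (\<Prod>i\<in>\<Lambda>. cmod (1 - z $ i) powr (if i \<in> \<Lambda> then s i else 1))"
      by (simp only: eq)
  qed (use c s M in auto)
qed

text \<open>The bounds of the single components by their own suprema are combined with the bounds of these suprema by
  the supremum of the sum.\<close>

lemma (in ritt_tuple) joint_calculus:
  assumes T: "\<And>k. ritt_operator (op_map (A k))"
  shows "joint_functional_calculus g (\<lambda>k. op_map (A k))"
  unfolding joint_functional_calculus_def
proof (intro exI[of _ a] conjI allI)
  show "a k < g k" for k by (rule ag(2))
  have res_K: "norm ((l - 1) *\<^sub>C res l (A k)) \<le> K" if "l \<notin> closure (stolz_domain (a k))" for k l
    by (rule R_bdd_norm[OF R_resolvent[of k]]) (use that in blast)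
  show "ritt_operator_of_type (a k) (op_map (A k))" for k
    using ag[of k] by (intro ritt_operator_of_typeI[OF T _ _ exterior res_K K1]) auto
  have sg: "0 < sin (g i)" for i using sin_bounds[OF g(1) ag(3)] by simp
  obtain L where L: "\<And>\<Lambda>. 0 \<le> L \<Lambda>" and comp: "\<And>\<Lambda> f M z. (\<forall>\<Lambda>. f \<Lambda> \<in> H0_infty g \<Lambda>) \<Longrightarrow>
      (\<forall>z\<in>stolz_polydomain g. cmod (\<Sum>\<Lambda>\<in>UNIV. f \<Lambda> z) \<le> M) \<Longrightarrow> z \<in> stolz_polydomain g \<Longrightarrow> cmod (f \<Lambda> z) \<le> L \<Lambda> * M"
    using component_bound[of g, OF sg] by metis
  define D where "D \<Lambda> = (C * H * K) ^ card \<Lambda> * (C * (W ^ card \<Lambda> * H ^ card \<Lambda>))" for \<Lambda> :: "'d set"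
  have D: "0 \<le> D \<Lambda>" for \<Lambda>
    using C_nonneg H_nonneg W_nonneg K1 by (simp add: D_def)
  have DL: "0 \<le> (\<Sum>\<Lambda>\<in>UNIV. D \<Lambda> * L \<Lambda>)" using D L by (intro sum_nonneg mult_nonneg_nonneg)
  show "\<exists>K>0. \<forall>b f. (\<forall>k. a k < b k \<and> b k < g k) \<longrightarrow> (\<forall>\<Lambda>. f \<Lambda> \<in> H0_infty g \<Lambda>) \<longrightarrow>
        norm (\<Sum>\<Lambda>\<in>UNIV. H0_calculus b (\<lambda>k. op_map (A k)) \<Lambda> (f \<Lambda>))
          \<le> K * (SUP z\<in>stolz_polydomain g. cmod (\<Sum>\<Lambda>\<in>UNIV. f \<Lambda> z))"
  proof (intro exI[of _ "1 + (\<Sum>\<Lambda>\<in>UNIV. D \<Lambda> * L \<Lambda>)"] conjI allI impI)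
    show "0 < 1 + (\<Sum>\<Lambda>\<in>UNIV. D \<Lambda> * L \<Lambda>)" using DL by simp
    fix b f assume b: "\<forall>k. a k < b k \<and> b k < g k" and f: "\<forall>\<Lambda>. f \<Lambda> \<in> H0_infty g \<Lambda>"
    let ?S = "SUP z\<in>stolz_polydomain g. cmod (\<Sum>\<Lambda>\<in>UNIV. f \<Lambda> z)"
    have "\<exists>B. \<forall>z\<in>stolz_polydomain g. cmod (f \<Lambda> z) \<le> B" for \<Lambda>
      by (rule H0_inftyD(2)[OF f[rule_format]])
    then obtain B where B: "\<And>\<Lambda> z. z \<in> stolz_polydomain g \<Longrightarrow> cmod (f \<Lambda> z) \<le> B \<Lambda>" by metis
    have "bdd_above ((\<lambda>z. cmod (\<Sum>\<Lambda>\<in>UNIV. f \<Lambda> z)) ` stolz_polydomain g)"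
      by (rule bdd_aboveI2[of _ _ "\<Sum>\<Lambda>\<in>UNIV. B \<Lambda>"]) (intro sum_norm_le B)
    then have S: "cmod (\<Sum>\<Lambda>\<in>UNIV. f \<Lambda> z) \<le> ?S" if "z \<in> stolz_polydomain g" for z
      by (rule cSUP_upper[OF that])
    have "0 \<in> stolz_polydomain g" by (simp add: stolz_polydomain_def zero_in_stolz_domain sg)
    from order_trans[OF norm_ge_zero S[OF this]] have S0: "0 \<le> ?S" .
    have "norm (\<Sum>\<Lambda>\<in>UNIV. H0_calculus b (\<lambda>k. op_map (A k)) \<Lambda> (f \<Lambda>)) \<le> (\<Sum>\<Lambda>\<in>UNIV. D \<Lambda> * L \<Lambda> * ?S)"
    proof (rule sum_norm_le)
      fix \<Lambda>
      have "norm (H0_calculus b (\<lambda>k. op_map (A k)) \<Lambda> (f \<Lambda>))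
          \<le> (C * H * K) ^ card \<Lambda> * (C * (L \<Lambda> * ?S * W ^ card \<Lambda> * H ^ card \<Lambda>))"
        by (rule joint_calculus_bound) (use b f S comp in auto)
      also have "\<dots> = D \<Lambda> * L \<Lambda> * ?S" unfolding D_def by (simp only: mult_ac)
      finally show "norm (H0_calculus b (\<lambda>k. op_map (A k)) \<Lambda> (f \<Lambda>)) \<le> D \<Lambda> * L \<Lambda> * ?S" .
    qed
    also have "\<dots> = (\<Sum>\<Lambda>\<in>UNIV. D \<Lambda> * L \<Lambda>) * ?S" by (rule sum_distrib_right[symmetric])
    also have "\<dots> \<le> (1 + (\<Sum>\<Lambda>\<in>UNIV. D \<Lambda> * L \<Lambda>)) * ?S" using S0 by (intro mult_right_mono) auto
    finally show "norm (\<Sum>\<Lambda>\<in>UNIV. H0_calculus b (\<lambda>k. op_map (A k)) \<Lambda> (f \<Lambda>))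
      \<le> (1 + (\<Sum>\<Lambda>\<in>UNIV. D \<Lambda> * L \<Lambda>)) * ?S" .
  qed
qed

theorem theorem1p2:
  fixes T :: "'d::{finite,linorder} \<Rightarrow> ('x::complex_banach \<Rightarrow>\<^sub>L 'x)"
    and p :: real
    and \<Omega> :: "'w measure" and r :: "nat \<Rightarrow> 'w \<Rightarrow> real"
    and M :: "'s measure"
    and U :: "'d \<Rightarrow> ('s \<Rightarrow> 'x) set \<Rightarrow> ('s \<Rightarrow> 'x) set"
    and J :: "'x \<Rightarrow> ('s \<Rightarrow> 'x) set"
    and Q :: "('s \<Rightarrow> 'x) set \<Rightarrow> 'x"
  assumes "1 < p"
    and "rademacher_sequence \<Omega> r"
    and "\<And>j k. T j o\<^sub>L T k = T k o\<^sub>L T j"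
    and "\<And>k. R_ritt_operator \<Omega> r (T k)"
    and "\<And>k. isomorphism_on (Lp_space M p) (U k)"
    and "\<And>j k F. F \<in> ns_carrier (Lp_space M p) \<Longrightarrow> U j (U k F) = U k (U j F)"
    and "torus_bounded_calculus (Lp_space M p) U"
    and "bounded_operator_between type_space (Lp_space M p) J"
    and "bounded_operator_between (Lp_space M p) type_space Q"
    and "\<And>(n :: 'd \<Rightarrow> nat) x.
      blinfun_apply (op_prod UNIV (\<lambda>k. op_power (T k) (n k))) x
        = Q (multi_power_on (Lp_space M p) U (\<lambda>k. int (n k)) (J x))"
  shows "\<exists>\<gamma>. (\<forall>k. 0 < \<gamma> k \<and> \<gamma> k < pi / 2) \<and> joint_functional_calculus \<gamma> T"
proof -
  define A where "A k = Op (T k)" for k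
  have ritt: "ritt_operator (T k)" for k using assms(4)[of k] by (simp add: R_ritt_operator_def)
  then have TA: "T k = op_map (A k)" for k
    by (simp add: A_def Op_inverse ritt_operator_def)
  have comm: "A i * A j = A j * A i" for i j
    using assms(3)[of i j] unfolding TA times_op.rep_eq[symmetric] op_map_inject .
  have "op_monomial A n \<star> x = Q (multi_power_on (Lp_space M p) U (\<lambda>k. int (n k)) (J x))" for n x
    using assms(10)[of n x] unfolding TA op_power_op_map op_prod_op_map op_monomial_def .
  from dilation_polynomial_bound[OF assms(1,5,7,8,9) this]
  obtain C where C: "C \<ge> 0" and poly: "\<And>N a B. finite N \<Longrightarrow> (\<And>z. (\<And>k. cmod (z k) \<le> 1) \<Longrightarrow>
        cmod (\<Sum>n\<in>N. a n * (\<Prod>k\<in>UNIV. z k ^ n k)) \<le> B)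
      \<Longrightarrow> norm (\<Sum>n\<in>N. a n *\<^sub>C op_monomial A n) \<le> C * B" by blast
  have "\<forall>k. \<exists>a K Cp. 0 < a \<and> a < pi / 2 \<and> 1 \<le> K \<and> (\<forall>n. norm (A k ^ n) \<le> Cp)
    \<and> (\<forall>l. l \<notin> closure (stolz_domain a) \<longrightarrow> is_res l (A k) (res l (A k)))
    \<and> R_bdd K {(l - 1) *\<^sub>C res l (A k) | l. l \<notin> closure (stolz_domain a)}
    \<and> (\<forall>w. cmod w > 1 \<longrightarrow> norm ((w - 1) *\<^sub>C res w (A k)) \<le> K)"
    using R_ritt_stolz_resolvent[OF assms(2)] assms(4) unfolding TA by blast
  from choice[OF this] obtain a where "\<forall>k. \<exists>K Cp. 0 < a k \<and> a k < pi / 2 \<and> 1 \<le> K \<and> (\<forall>n. norm (A k ^ n) \<le> Cp)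
    \<and> (\<forall>l. l \<notin> closure (stolz_domain (a k)) \<longrightarrow> is_res l (A k) (res l (A k)))
    \<and> R_bdd K {(l - 1) *\<^sub>C res l (A k) | l. l \<notin> closure (stolz_domain (a k))}
    \<and> (\<forall>w. cmod w > 1 \<longrightarrow> norm ((w - 1) *\<^sub>C res w (A k)) \<le> K)" by blast
  from choice[OF this] obtain K' where "\<forall>k. \<exists>Cp. 0 < a k \<and> a k < pi / 2 \<and> 1 \<le> K' k \<and> (\<forall>n. norm (A k ^ n) \<le> Cp)
    \<and> (\<forall>l. l \<notin> closure (stolz_domain (a k)) \<longrightarrow> is_res l (A k) (res l (A k)))
    \<and> R_bdd (K' k) {(l - 1) *\<^sub>C res l (A k) | l. l \<notin> closure (stolz_domain (a k))}
    \<and> (\<forall>w. cmod w > 1 \<longrightarrow> norm ((w - 1) *\<^sub>C res w (A k)) \<le> K' k)" by blast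
  from choice[OF this] obtain C' where "\<forall>k. 0 < a k \<and> a k < pi / 2 \<and> 1 \<le> K' k \<and> (\<forall>n. norm (A k ^ n) \<le> C' k)
    \<and> (\<forall>l. l \<notin> closure (stolz_domain (a k)) \<longrightarrow> is_res l (A k) (res l (A k)))
    \<and> R_bdd (K' k) {(l - 1) *\<^sub>C res l (A k) | l. l \<notin> closure (stolz_domain (a k))}
    \<and> (\<forall>w. cmod w > 1 \<longrightarrow> norm ((w - 1) *\<^sub>C res w (A k)) \<le> K' k)" by blast
  then have a: "\<And>k. 0 < a k" "\<And>k. a k < pi / 2" and K': "\<And>k. 1 \<le> K' k" and C': "\<And>k n. norm (A k ^ n) \<le> C' k"
    and ext: "\<And>k l. l \<notin> closure (stolz_domain (a k)) \<Longrightarrow> is_res l (A k) (res l (A k))"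
    and R: "\<And>k. R_bdd (K' k) {(l - 1) *\<^sub>C res l (A k) | l. l \<notin> closure (stolz_domain (a k))}"
    and disc: "\<And>k w. cmod w > 1 \<Longrightarrow> norm ((w - 1) *\<^sub>C res w (A k)) \<le> K' k" by blast+
  \<comment> \<open>strictly between \<open>a k\<close> and \<open>\<pi>/2\<close>, which leaves room for contours inside \<open>B\<^sub>\<gamma>\<close> and outside \<open>B\<^sub>a\<close>\<close>
  define \<gamma> where "\<gamma> k = (a k + pi / 2) / 2" for k
  define K where "K = (\<Sum>k\<in>UNIV. K' k)"
  define Cp where "Cp = (\<Sum>k\<in>UNIV. \<bar>C' k\<bar>)"
  have K: "K' k \<le> K" for k
    unfolding K_def using K' by (intro member_le_sum) (auto intro: order_trans[of 0 1])
  have Cp: "C' k \<le> Cp" for k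
    unfolding Cp_def by (rule order_trans[OF abs_ge_self]) (rule member_le_sum, auto)
  interpret ritt_tuple A C a \<gamma> K Cp
  proof unfold_locales
    show "0 < a i" "a i < \<gamma> i" "\<gamma> i < pi / 2" for i using a[of i] by (auto simp: \<gamma>_def)
    show "1 \<le> K" using K' K order_trans by blast
    show "norm (A i ^ n) \<le> Cp" for i n by (rule order_trans[OF C' Cp])
    show "R_bdd K {(l - 1) *\<^sub>C res l (A i) | l. l \<notin> closure (stolz_domain (a i))}" for i
      by (rule R_bdd_mono[OF R K])
    show "norm ((w - 1) *\<^sub>C res w (A i)) \<le> K" if "cmod w > 1" for i w
      by (rule order_trans[OF disc[OF that] K])
  qed (fact comm C poly ext)+
  have "joint_functional_calculus \<gamma> T"
    using joint_calculus ritt unfolding TA[symmetric] by blast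
  moreover have "0 < \<gamma> k \<and> \<gamma> k < pi / 2" for k using a[of k] by (simp add: \<gamma>_def)
  ultimately show ?thesis by blast
qed

end
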